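(* Let $\ell$ be a prime number, let $n\ge 1$, and let $F=F_0\subseteq F_1\subseteq\cdots\subseteq F_n=K$ be number fields such that each $F_i/F_{i-1}$ is Galois. Then $$\mathrm{rk}_\ell\,\mathrm{Cl}(K)\geq \frac{t_\ell(K/F)}{n}-\mathrm{rk}_\ell\,\mathcal{O}_K^*+\mathrm{rk}_\ell\,\mathcal{O}_F^*-e_\ell(K/F).$$
   Context: For an abelian group $A$ (written multiplicatively), $\mathrm{rk}_\ell\,A$ is the dimension of $A/A^\ell$ over $\mathbb{F}_\ell$. $\mathrm{Cl}(K)$ is the ideal class group and $\mathcal{O}_K^*$ the unit group of the ring of integers $\mathcal{O}_K$. $t_\ell(K/F)$ is the number of (nonzero) prime ideals $p$ of $\mathcal{O}_F$ such that at least one prime of $\mathcal{O}_K$ above $p$ has ramification index over $p$ divisible by $\ell$. $e_\ell(K/F)$ is the exponent of $\ell$ in the prime factorization of $[K:F]$. *)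

theory Defs
  imports
    Complex_Main
    "HOL-Algebra.Finite_Extensions"
    "HOL-Algebra.Generated_Fields"
    "HOL-Algebra.Ideal_Product"
    "HOL-Algebra.QuotRing"
    "HOL-Number_Theory.Residues"
    "Jordan_Normal_Form.Missing_VectorSpace"
begin

section \<open>The \<open>\<ell>\<close>-rank of an abelian group\<close>

definition power_subgroup :: "nat \<Rightarrow> ('g, 'm) monoid_scheme \<Rightarrow> 'g set" where
  "power_subgroup l A = (\<lambda>x. x [^]\<^bsub>A\<^esub> l) ` carrier A"

text \<open>
  The group \<open>V\<close>, of exponent dividing \<open>l\<close> and written multiplicatively, seen as a vector space
  over the field with \<open>l\<close> elements: vector addition is the group operation and the scalar \<open>k\<close>
  acts by \<open>v \<mapsto> v\<^sup>k\<close>. The ring multiplication which the record type \<open>module\<close> provides is not used.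
\<close>

definition exponent_module :: "('g, 'm) monoid_scheme \<Rightarrow> (int, 'g) module" where
  "exponent_module V =
     \<lparr> carrier = carrier V, mult = undefined, one = undefined,
       zero = \<one>\<^bsub>V\<^esub>, add = (\<otimes>\<^bsub>V\<^esub>), smult = (\<lambda>k v. v [^]\<^bsub>V\<^esub> k) \<rparr>"

definition group_rank :: "nat \<Rightarrow> ('g, 'm) monoid_scheme \<Rightarrow> nat" where
  "group_rank l A =
     vectorspace.dim (residue_ring (int l)) (exponent_module (A Mod power_subgroup l A))"


section \<open>Number fields\<close>

text \<open>The field generated by the empty set is the prime field, which is a copy of the rationals.\<close>

locale number_field = field K for K (structure) +
  assumes char_zero: "\<And>k::nat. k > 0 \<Longrightarrow> add_pow K k \<one> \<noteq> \<zero>"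
    and finite_over_rationals: "finite_dimension (generate_field K {}) (carrier K)"

definition galois_extension :: "('a, 'b) ring_scheme \<Rightarrow> 'a set \<Rightarrow> bool" where
  "galois_extension K F \<longleftrightarrow>
     field K \<and> subfield F K \<and> ring.finite_dimension K F (carrier K) \<and>
     {x \<in> carrier K. \<forall>\<sigma> \<in> ring_iso K K. (\<forall>a \<in> F. \<sigma> a = a) \<longrightarrow> \<sigma> x = x} = F"

definition rational_integers :: "('a, 'b) ring_scheme \<Rightarrow> 'a set" where
  "rational_integers K = range (\<lambda>k::int. add_pow K k \<one>\<^bsub>K\<^esub>)"

text \<open>Polynomials are lists of coefficients starting with the leading one.\<close>

definition ring_of_integers :: "('a, 'b) ring_scheme \<Rightarrow> ('a, 'b) ring_scheme" where
  "ring_of_integers K =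
     K \<lparr> carrier := {x \<in> carrier K. \<exists>p \<in> carrier (univ_poly K (rational_integers K)).
           p \<noteq> [] \<and> hd p = \<one>\<^bsub>K\<^esub> \<and> ring.eval K p x = \<zero>\<^bsub>K\<^esub>} \<rparr>"


section \<open>The ideal class group\<close>

definition fractional_ideals :: "('a, 'b) ring_scheme \<Rightarrow> 'a set set" where
  "fractional_ideals K =
     {I. additive_subgroup I K \<and> I \<noteq> {\<zero>\<^bsub>K\<^esub>} \<and>
         (\<forall>a \<in> carrier (ring_of_integers K). \<forall>x \<in> I. a \<otimes>\<^bsub>K\<^esub> x \<in> I) \<and>
         (\<exists>d \<in> carrier (ring_of_integers K) - {\<zero>\<^bsub>K\<^esub>}.
            \<forall>x \<in> I. d \<otimes>\<^bsub>K\<^esub> x \<in> carrier (ring_of_integers K))}"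

text \<open>\<open>ideal_prod K I J\<close> is the set of nonempty finite sums of products \<open>i \<otimes> j\<close>; it makes sense
  for arbitrary subsets of \<open>K\<close>, in particular for fractional ideals.\<close>

definition fractional_ideal_group :: "('a, 'b) ring_scheme \<Rightarrow> 'a set monoid" where
  "fractional_ideal_group K =
     \<lparr> carrier = fractional_ideals K, mult = ideal_prod K,
       one = carrier (ring_of_integers K) \<rparr>"

definition principal_fractional_ideals :: "('a, 'b) ring_scheme \<Rightarrow> 'a set set" where
  "principal_fractional_ideals K =
     {(\<lambda>a. a \<otimes>\<^bsub>K\<^esub> x) ` carrier (ring_of_integers K) | x. x \<in> carrier K - {\<zero>\<^bsub>K\<^esub>}}"

definition class_group :: "('a, 'b) ring_scheme \<Rightarrow> 'a set set monoid" where
  "class_group K = fractional_ideal_group K Mod principal_fractional_ideals K"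


section \<open>Ramification\<close>

definition nonzero_primes :: "('a, 'b) ring_scheme \<Rightarrow> 'a set set" where
  "nonzero_primes R = {P. primeideal P R \<and> P \<noteq> {\<zero>\<^bsub>R\<^esub>}}"

text \<open>For a subfield \<open>F\<close> of \<open>K\<close>, a prime \<open>p\<close> of the integers of \<open>F\<close> and a prime \<open>P\<close> of the integers
  of \<open>K\<close> above \<open>p\<close>: the exponent of \<open>P\<close> in the factorization of \<open>p \<O>\<^sub>K\<close> into a product of primes.\<close>

definition ramification_index :: "('a, 'b) ring_scheme \<Rightarrow> 'a set \<Rightarrow> 'a set \<Rightarrow> nat" where
  "ramification_index K p P =
     (THE e. \<exists>Ps. set Ps \<subseteq> nonzero_primes (ring_of_integers K) \<and>
        foldr (ideal_prod (ring_of_integers K)) Ps (carrier (ring_of_integers K)) =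
          genideal (ring_of_integers K) p \<and>
        e = count_list Ps P)"

definition ramified_count :: "nat \<Rightarrow> ('a, 'b) ring_scheme \<Rightarrow> 'a set \<Rightarrow> nat" where
  "ramified_count l K F =
     card {p \<in> nonzero_primes (ring_of_integers (K \<lparr> carrier := F \<rparr>)).
       \<exists>P \<in> nonzero_primes (ring_of_integers K).
         P \<inter> carrier (ring_of_integers (K \<lparr> carrier := F \<rparr>)) = p \<and>
         l dvd ramification_index K p P}"

definition degree_exponent :: "nat \<Rightarrow> ('a, 'b) ring_scheme \<Rightarrow> 'a set \<Rightarrow> nat" where
  "degree_exponent l K F = multiplicity l (ring.dim K F (carrier K))"

end

theory Submission
  imports Defs "HOL-Computational_Algebra.Computational_Algebra" "Jordan_Normal_Form.Char_Poly"
begin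

text \<open>
  Embed \<open>K\<close> into the complex numbers. If a prime of \<open>K\<close> has ramification index divisible by \<open>l\<close>
  over \<open>F\<^sub>0\<close>, then, indices being multiplicative, so has its restriction in some step
  of the tower, and one step \<open>E \<subseteq> M\<close> serves a set \<open>T\<close> of at least \<open>t / n\<close> of the
  primes. As \<open>M\<close> is Galois over \<open>E\<close>, each such prime of \<open>E\<close> becomes an \<open>l\<close>-th power of an ideal in
  \<open>M\<close>, hence in \<open>K\<close>. Modulo \<open>l\<close>-th powers of \<open>E\<close> there are at least
  \<open>l ^ (card T + rk U\<^sub>E)\<close> classes of \<open>T\<close>-units, where \<open>U\<close> denotes the units. A \<open>T\<close>-unit
  \<open>x\<close> generates in \<open>K\<close> the \<open>l\<close>-th power of an ideal \<open>J\<close>; the class of \<open>J\<close>, which is killed by \<open>l\<close>,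
  and then a unit of \<open>K\<close> modulo \<open>l\<close>-th powers determine \<open>x\<close> up to an \<open>l\<close>-th power of \<open>K\<close>. At most
  \<open>l ^ e\<close> classes of \<open>E\<close> become \<open>l\<close>-th powers in \<open>K\<close>, where \<open>e\<close> is the exponent of \<open>l\<close> in
  \<open>[K : E]\<close>. The same argument for units alone bounds \<open>rk U\<close> of \<open>F\<^sub>0\<close> by \<open>rk U\<^sub>E\<close> plus the exponent of
  \<open>l\<close> in \<open>[E : F\<^sub>0]\<close>.
\<close>

section \<open>Algebraic integers\<close>

text \<open>Each rank is the logarithm to base \<open>l\<close> of a cardinal, so the inequality is
  proved between products of finite cardinals, and exponents of \<open>l\<close> are compared only
  at the very end. The counting meets ideal classes killed by \<open>l\<close>, while the rank of
  the class group counts classes modulo \<open>l\<close>-th powers; for a finite abelian group the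
  two numbers agree. The loss \<open>e\<close> comes from elements that become \<open>l\<close>-th
  powers in a larger field. The loss for units below \<open>E\<close> and the loss above
  \<open>E\<close> add up to exactly \<open>e\<close>, because degrees multiply. Finiteness of the
  class number comes before the ideal theory: it makes a power of every ideal principal.
  Invertibility of ideals, hence unique factorization, and the transitivity of the Galois group on
  primes rest on this.\<close>

interpretation zmod: Modules.module "\<lambda>(k::int) (x::complex). of_int k * x"
  by standard (auto simp: algebra_simps)

text \<open>Multiplication by \<open>x\<close> acts on the generators through an integer matrix that
  has the vector of generators as an eigenvector, so \<open>x\<close> is a root of a monic integral
  characteristic polynomial. The element \<open>s0\<close> makes the eigenvector nonzero.\<close>

lemma algebraic_int_stable:
  assumes fin: "finite S" and s0: "s0 \<in> S" "s0 \<noteq> 0"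
    and stable: "\<And>s. s \<in> S \<Longrightarrow> x * s \<in> zmod.span S"
  shows "algebraic_int (x :: complex)"
proof -
  have "\<exists>c. x * s = (\<Sum>t\<in>S. of_int (c t) * t)" if "s \<in> S" for s
    using stable[OF that] unfolding zmod.span_finite[OF fin] by auto
  then obtain c where c: "\<And>s. s \<in> S \<Longrightarrow> x * s = (\<Sum>t\<in>S. of_int (c s t) * t)"
    by metis
  obtain e where e: "bij_betw e {0..<card S} S"
    using ex_bij_betw_nat_finite[OF fin] by auto
  define n where "n = card S"
  define A where "A = Matrix.mat n n (\<lambda>(i,j). c (e i) (e j))"
  define w where "w = Matrix.vec n e"
  have eS: "e i \<in> S" if "i < n" for i
    using e that unfolding n_def by (auto simp: bij_betw_def)
  have A: "A \<in> carrier_mat n n" and w: "w \<in> carrier_vec n"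
    by (auto simp: A_def w_def)
  have A': "map_mat complex_of_int A \<in> carrier_mat n n" using A by auto
  have "map_mat complex_of_int A *\<^sub>v w = x \<cdot>\<^sub>v w"
  proof (rule eq_vecI)
    fix i assume "i < dim_vec (x \<cdot>\<^sub>v w)"
    then have i: "i < n" by (simp add: w_def)
    have "(map_mat complex_of_int A *\<^sub>v w) $ i = (\<Sum>j = 0..<n. of_int (c (e i) (e j)) * e j)"
      using i by (simp add: A_def w_def scalar_prod_def)
    also have "\<dots> = (\<Sum>t\<in>S. of_int (c (e i) t) * t)"
      unfolding n_def by (rule sum.reindex_bij_betw[OF e])
    also have "\<dots> = x * e i" using c[OF eS[OF i]] by simp
    finally show "(map_mat complex_of_int A *\<^sub>v w) $ i = (x \<cdot>\<^sub>v w) $ i"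
      using i by (simp add: w_def)
  qed (auto simp: A_def w_def)
  moreover have "w \<noteq> 0\<^sub>v n"
  proof
    assume "w = 0\<^sub>v n"
    moreover obtain i where "i < n" "e i = s0"
      using e s0(1) unfolding n_def bij_betw_def by (metis atLeastLessThan_iff imageE)
    ultimately show False using s0(2) by (auto simp: w_def vec_eq_iff)
  qed
  ultimately have "eigenvalue (map_mat complex_of_int A) x"
    using A w unfolding eigenvalue_def eigenvector_def by auto
  then have "poly (map_poly complex_of_int (char_poly A)) x = 0"
    using eigenvalue_root_char_poly[OF A'] of_int_hom.char_poly_hom[OF A, where 'a = complex] by auto
  moreover have "lead_coeff (char_poly A) = 1"
    using degree_monic_char_poly[OF A] by auto
  ultimately show ?thesis
    unfolding algebraic_int_altdef_ipoly by blast
qed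

lemma algebraic_int_power_reduce:
  assumes "algebraic_int (x :: complex)"
  obtains n and c :: "nat \<Rightarrow> int" where "n > 0" "x ^ n = (\<Sum>i<n. of_int (c i) * x ^ i)"
proof -
  obtain p where p: "poly (map_poly complex_of_int p) x = 0" "lead_coeff p = 1"
    using assms unfolding algebraic_int_altdef_ipoly by auto
  define n where "n = Polynomial.degree p"
  have "n > 0"
  proof (rule ccontr)
    assume "\<not> n > 0"
    then have "p = [:1:]" using p(2) by (simp add: n_def) (metis degree_eq_zeroE lead_coeff_pCons(2) pCons_0_0 zero_neq_one lead_coeff_pCons(1) degree_0 coeff_pCons_0)
    then show False using p(1) by simp
  qed
  have "0 = (\<Sum>i\<le>n. of_int (Polynomial.coeff p i) * x ^ i)"
    using p(1) by (simp add: poly_altdef n_def degree_map_poly coeff_map_poly)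
  also have "\<dots> = x ^ n + (\<Sum>i<n. of_int (Polynomial.coeff p i) * x ^ i)"
    using p(2) by (simp add: lessThan_Suc_atMost[symmetric] n_def)
  finally have "x ^ n = (\<Sum>i<n. of_int (- Polynomial.coeff p i) * x ^ i)"
    by (simp add: sum_negf eq_neg_iff_add_eq_0)
  with \<open>n > 0\<close> show ?thesis by (rule that)
qed

lemma zspan_mult:
  assumes "\<And>s. s \<in> S \<Longrightarrow> x * s \<in> zmod.span S" and "y \<in> zmod.span S"
  shows "x * y \<in> zmod.span S"
  using assms(2)
proof (induction rule: zmod.span_induct_alt)
  case (step c z y)
  have "x * (of_int c * z + y) = of_int c * (x * z) + x * y" by (simp add: algebra_simps)
  then show ?case
    using step assms(1) zmod.span_add zmod.span_scale by metis
qed (auto intro: zmod.span_zero)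

text \<open>The products \<open>x ^ i * y ^ j\<close> with \<open>i < m\<close> and
  \<open>j < n\<close> generate a group stable under \<open>x\<close> and under \<open>y\<close>,
  since \<open>x ^ m\<close> and \<open>y ^ n\<close> reduce to lower powers. Hence it is stable
  under the sum and the product as well.\<close>

lemma algebraic_int_add_mult:
  assumes "algebraic_int (x :: complex)" "algebraic_int y"
  shows "algebraic_int (x + y)" "algebraic_int (x * y)"
proof -
  obtain m c where m: "m > 0" "x ^ m = (\<Sum>i<m. of_int (c i) * x ^ i)"
    using algebraic_int_power_reduce[OF assms(1)] .
  obtain n d where n: "n > 0" "y ^ n = (\<Sum>i<n. of_int (d i) * y ^ i)"
    using algebraic_int_power_reduce[OF assms(2)] .
  define S where "S = (\<lambda>(i,j). x ^ i * y ^ j) ` ({..<m} \<times> {..<n})"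
  have fin: "finite S" by (simp add: S_def)
  have mem: "x ^ i * y ^ j \<in> zmod.span S" if "i < m" "j < n" for i j
    by (rule zmod.span_base) (use that in \<open>auto simp: S_def\<close>)
  have one: "1 \<in> S" unfolding S_def using m(1) n(1) by (auto intro!: image_eqI[of _ _ "(0,0)"])
  have xS: "x * s \<in> zmod.span S" if "s \<in> S" for s
  proof -
    obtain i j where ij: "i < m" "j < n" "s = x ^ i * y ^ j" using \<open>s \<in> S\<close> by (auto simp: S_def)
    show ?thesis
    proof (cases "Suc i < m")
      case True
      then show ?thesis using mem[of "Suc i" j] ij by (simp add: algebra_simps)
    next
      case False
      then have "Suc i = m" using ij by simp
      then have "x * s = x ^ m * y ^ j" using ij(3) by auto
      also have "\<dots> = (\<Sum>i<m. of_int (c i) * (x ^ i * y ^ j))"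
        unfolding m(2) by (simp add: sum_distrib_right mult.assoc)
      also have "\<dots> \<in> zmod.span S"
        using mem ij by (intro zmod.span_sum zmod.span_scale) auto
      finally show ?thesis .
    qed
  qed
  have yS: "y * s \<in> zmod.span S" if "s \<in> S" for s
  proof -
    obtain i j where ij: "i < m" "j < n" "s = x ^ i * y ^ j" using \<open>s \<in> S\<close> by (auto simp: S_def)
    show ?thesis
    proof (cases "Suc j < n")
      case True
      then show ?thesis using mem[of i "Suc j"] ij by (simp add: algebra_simps)
    next
      case False
      then have "Suc j = n" using ij by simp
      then have "y * s = x ^ i * y ^ n" using ij(3) by auto
      also have "\<dots> = (\<Sum>j<n. of_int (d j) * (x ^ i * y ^ j))"
        unfolding n(2) by (simp add: sum_distrib_left algebra_simps)
      also have "\<dots> \<in> zmod.span S"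
        using mem ij by (intro zmod.span_sum zmod.span_scale) auto
      finally show ?thesis .
    qed
  qed
  show "algebraic_int (x + y)"
    by (rule algebraic_int_stable[OF fin one]) (auto simp: distrib_right intro: zmod.span_add xS yS)
  show "algebraic_int (x * y)"
    by (rule algebraic_int_stable[OF fin one]) (auto simp: mult.assoc intro: zspan_mult xS yS)
qed

lemma algebraic_int_of_int: "algebraic_int (of_int k :: complex)"
  by (rule int_imp_algebraic_int) auto

lemma algebraic_int_diff: "algebraic_int (x :: complex) \<Longrightarrow> algebraic_int y \<Longrightarrow> algebraic_int (x - y)"
  using algebraic_int_add_mult(1)[of x "- y"] by auto

lemma algebraic_int_power: "algebraic_int (x :: complex) \<Longrightarrow> algebraic_int (x ^ n)"
  by (induction n) (auto intro: algebraic_int_add_mult)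

section \<open>Number fields inside the complex numbers\<close>

locale complex_subfield =
  fixes K :: "complex set"
  assumes one_mem: "1 \<in> K"
    and diff_mem: "x \<in> K \<Longrightarrow> y \<in> K \<Longrightarrow> x - y \<in> K"
    and mult_mem: "x \<in> K \<Longrightarrow> y \<in> K \<Longrightarrow> x * y \<in> K"
    and inverse_mem: "x \<in> K \<Longrightarrow> inverse x \<in> K"
begin

lemma zero_mem: "0 \<in> K" using diff_mem[OF one_mem one_mem] by simp

lemma minus_mem: "x \<in> K \<Longrightarrow> - x \<in> K" using diff_mem[OF zero_mem] by simp

lemma add_mem: "x \<in> K \<Longrightarrow> y \<in> K \<Longrightarrow> x + y \<in> K" using diff_mem[of x "- y"] minus_mem by simp

lemma divide_mem: "x \<in> K \<Longrightarrow> y \<in> K \<Longrightarrow> x / y \<in> K"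
  unfolding divide_inverse by (intro mult_mem inverse_mem)

lemma power_mem: "x \<in> K \<Longrightarrow> x ^ n \<in> K"
  by (induction n) (auto intro: one_mem mult_mem)

lemma power_int_mem: "x \<in> K \<Longrightarrow> x powi n \<in> K"
  by (auto simp: power_int_def intro: power_mem inverse_mem)

lemma sum_mem: "(\<And>i. i \<in> A \<Longrightarrow> f i \<in> K) \<Longrightarrow> sum f A \<in> K"
  by (induction A rule: infinite_finite_induct) (auto intro: zero_mem add_mem)

lemma prod_mem: "(\<And>i. i \<in> A \<Longrightarrow> f i \<in> K) \<Longrightarrow> prod f A \<in> K"
  by (induction A rule: infinite_finite_induct) (auto intro: one_mem mult_mem)

lemma of_nat_mem: "of_nat n \<in> K"
  by (induction n) (auto intro: zero_mem add_mem one_mem)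

lemma of_int_mem: "of_int n \<in> K"
  by (cases n rule: int_diff_cases) (auto intro: diff_mem of_nat_mem)

lemma Rats_mem: "x \<in> \<rat> \<Longrightarrow> x \<in> K"
  by (elim Rats_cases') (auto intro: divide_mem of_int_mem)

lemma of_rat_mem: "of_rat q \<in> K"
  by (rule Rats_mem) auto

lemmas mems = zero_mem one_mem add_mem diff_mem minus_mem mult_mem inverse_mem divide_mem
  power_mem power_int_mem sum_mem prod_mem of_nat_mem of_int_mem of_rat_mem

end

definition hom_on :: "complex set \<Rightarrow> (complex \<Rightarrow> complex) \<Rightarrow> bool" where
  "hom_on K \<tau> \<longleftrightarrow> \<tau> 1 = 1 \<and> (\<forall>x\<in>K. \<forall>y\<in>K. \<tau> (x + y) = \<tau> x + \<tau> y \<and> \<tau> (x * y) = \<tau> x * \<tau> y)"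

definition oint :: "complex set \<Rightarrow> complex set" where
  "oint K = {x \<in> K. algebraic_int x}"

interpretation qvs: Vector_Spaces.vector_space "\<lambda>(q::rat) (x::complex). of_rat q * x"
  by standard (auto simp: algebra_simps of_rat_add of_rat_mult)

text \<open>
  The second assumption says that the conjugates of \<open>x\<close> are its images under embeddings of \<open>K\<close>, with
  a degree bound which is uniform in \<open>x\<close>. It stands in for minimal polynomials and separability.
\<close>

locale complex_number_field = complex_subfield +
  assumes finite_dim: "\<exists>B. finite B \<and> K \<subseteq> qvs.span B"
    and conjugates_bounded: "\<exists>D. \<forall>x\<in>K. \<exists>f. lead_coeff f = 1 \<and> Polynomial.degree f \<le> D \<and>
      (\<forall>i. Polynomial.coeff f i \<in> \<rat>) \<and> poly f x = 0 \<and>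
      (\<forall>z. poly f z = 0 \<longrightarrow> (\<exists>\<tau>. hom_on K \<tau> \<and> \<tau> x = z))"
begin

lemma conjugates:
  "x \<in> K \<Longrightarrow> \<exists>f. lead_coeff f = 1 \<and> (\<forall>i. Polynomial.coeff f i \<in> \<rat>) \<and>
      poly f x = 0 \<and> (\<forall>z. poly f z = 0 \<longrightarrow> (\<exists>\<tau>. hom_on K \<tau> \<and> \<tau> x = z))"
  using conjugates_bounded by metis

lemma oint_mem: "x \<in> oint K \<Longrightarrow> x \<in> K" by (simp add: oint_def)

lemma oint_closed:
  "0 \<in> oint K" "1 \<in> oint K" "x \<in> oint K \<Longrightarrow> y \<in> oint K \<Longrightarrow> x + y \<in> oint K"
  "x \<in> oint K \<Longrightarrow> y \<in> oint K \<Longrightarrow> x - y \<in> oint K" "x \<in> oint K \<Longrightarrow> - x \<in> oint K"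
  "x \<in> oint K \<Longrightarrow> y \<in> oint K \<Longrightarrow> x * y \<in> oint K" "of_int k \<in> oint K" "of_nat n \<in> oint K"
  "x \<in> oint K \<Longrightarrow> x ^ n \<in> oint K"
  unfolding oint_def using algebraic_int_of_int[of "int n"]
  by (auto intro: mems algebraic_int_add_mult algebraic_int_diff algebraic_int_of_int algebraic_int_power)

lemma oint_sum: "(\<And>i. i \<in> A \<Longrightarrow> f i \<in> oint K) \<Longrightarrow> sum f A \<in> oint K"
  by (induction A rule: infinite_finite_induct) (auto intro: oint_closed)

lemma Rats_common_denominator:
  assumes "finite A" "\<And>i. i \<in> A \<Longrightarrow> (f i :: 'x :: field_char_0) \<in> \<rat>"
  shows "\<exists>D::int. D > 0 \<and> (\<forall>i\<in>A. of_int D * f i \<in> \<int>)"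
  using assms
proof (induction A)
  case (insert a A)
  then obtain D where D: "D > 0" "\<forall>i\<in>A. of_int D * f i \<in> \<int>" by auto
  obtain p q where pq: "q > 0" "f a = of_int p / of_int q"
    using insert.prems[of a] by (auto elim!: Rats_cases')
  have "of_int (q * D) * f i \<in> \<int>" if "i \<in> insert a A" for i
  proof (cases "i = a")
    case True
    then have "of_int (q * D) * f i = of_int (D * p)" using pq by simp
    then show ?thesis by (metis Ints_of_int)
  next
    case False
    then have "of_int D * f i \<in> \<int>" using that D by auto
    then have "of_int q * (of_int D * f i) \<in> \<int>" using Ints_mult[OF Ints_of_int] by blast
    then show ?thesis by (simp only: of_int_mult mult.assoc)
  qed
  then show ?case using pq(1) D(1) by (intro exI[of _ "q * D"]) auto
qed (auto intro: exI[of _ 1])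

text \<open>Multiplying the equation of \<open>x\<close> by \<open>D ^ n\<close> gives a monic
  equation for \<open>D * x\<close> whose coefficient of index \<open>i\<close> carries the factor
  \<open>D ^ (n - i)\<close>. For \<open>i < n\<close> this contains one factor \<open>D\<close>,
  which clears the denominator.\<close>

lemma ex_integral_multiple:
  assumes "x \<in> K"
  shows "\<exists>D::int. D > 0 \<and> of_int D * x \<in> oint K"
proof -
  obtain f where f: "lead_coeff f = 1" "\<forall>i. Polynomial.coeff f i \<in> \<rat>" "poly f x = 0"
    using conjugates[OF assms] by blast
  define n where "n = Polynomial.degree f"
  obtain D :: int where D: "D > 0" "\<forall>i\<in>{..n}. of_int D * Polynomial.coeff f i \<in> \<int>"
    using Rats_common_denominator[of "{..n}" "Polynomial.coeff f"] f(2) by auto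
  define y where "y = of_int D * x"
  have "n > 0"
  proof (rule ccontr)
    assume "\<not> n > 0"
    then obtain a where "f = [:a:]" using degree_eq_zeroE unfolding n_def by blast
    then show False using f(1,3) by auto
  qed
  have "0 = of_int D ^ n * (\<Sum>i\<le>n. Polynomial.coeff f i * x ^ i)"
    using f(3) by (simp add: poly_altdef n_def)
  also have "\<dots> = (\<Sum>i\<le>n. of_int D ^ (n - i) * Polynomial.coeff f i * y ^ i)"
    unfolding sum_distrib_left
  proof (rule sum.cong)
    fix i assume "i \<in> {..n}"
    then have "of_int D ^ n = (of_int D ^ (n - i) * of_int D ^ i :: complex)" by (simp flip: power_add)
    then show "of_int D ^ n * (Polynomial.coeff f i * x ^ i) =
        of_int D ^ (n - i) * Polynomial.coeff f i * y ^ i"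
      by (simp add: y_def power_mult_distrib)
  qed simp
  also have "\<dots> = y ^ n + (\<Sum>i<n. of_int D ^ (n - i) * Polynomial.coeff f i * y ^ i)"
    using f(1) by (simp add: lessThan_Suc_atMost[symmetric] n_def)
  finally have yn: "y ^ n = (\<Sum>i<n. - (of_int D ^ (n - i) * Polynomial.coeff f i) * y ^ i)"
    by (simp add: sum_negf eq_neg_iff_add_eq_0)
  have int: "- (of_int D ^ (n - i) * Polynomial.coeff f i) \<in> \<int>" if "i < n" for i
  proof -
    have "n - i = Suc (n - Suc i)" using that by simp
    then have "- (of_int D ^ (n - i) * Polynomial.coeff f i) =
      - (of_int D ^ (n - Suc i) * (of_int D * Polynomial.coeff f i))" by simp
    also have "\<dots> \<in> \<int>"
      by (rule Ints_minus[OF Ints_mult[OF Ints_power[OF Ints_of_int]]]) (use D(2) that in auto)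
    finally show ?thesis .
  qed
  have "algebraic_int y"
  proof (rule algebraic_int_stable[of "(\<lambda>i. y ^ i) ` {..<n}"])
    show "1 \<in> (\<lambda>i. y ^ i) ` {..<n}" using \<open>n > 0\<close> by (auto intro!: image_eqI[of _ _ 0])
    fix s assume "s \<in> (\<lambda>i. y ^ i) ` {..<n}"
    then obtain i where i: "i < n" "s = y ^ i" by auto
    show "y * s \<in> zmod.span ((\<lambda>i. y ^ i) ` {..<n})"
    proof (cases "Suc i < n")
      case True
      then show ?thesis using i by (intro zmod.span_base) (auto intro!: image_eqI[of _ _ "Suc i"])
    next
      case False
      then have "Suc i = n" using i by simp
      then have "y * s = y ^ n" using i by auto
      also have "\<dots> \<in> zmod.span ((\<lambda>i. y ^ i) ` {..<n})"
        unfolding yn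
      proof (rule zmod.span_sum)
        fix i assume "i \<in> {..<n}"
        then obtain k where k: "- (of_int D ^ (n - i) * Polynomial.coeff f i) = of_int k"
          using int Ints_cases by blast
        show "- (of_int D ^ (n - i) * Polynomial.coeff f i) * y ^ i \<in> zmod.span ((\<lambda>i. y ^ i) ` {..<n})"
          unfolding k using \<open>i \<in> {..<n}\<close> by (intro zmod.span_scale zmod.span_base) auto
      qed
      finally show ?thesis .
    qed
  qed auto
  then show ?thesis using D(1) assms by (intro exI[of _ D]) (auto simp: oint_def y_def intro: mems)
qed

end

text \<open>A rational basis made of algebraic integers, with its coordinate functions. The lattice
  spanned by \<open>b\<close> may be smaller than \<open>oint K\<close>;
  \<open>oint_bounded_denominator\<close> controls the difference.\<close>

locale number_field_basis = complex_number_field +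
  fixes d :: nat and b :: "nat \<Rightarrow> complex" and c :: "complex \<Rightarrow> nat \<Rightarrow> rat"
  assumes b_oint: "i < d \<Longrightarrow> b i \<in> oint K"
    and expansion: "x \<in> K \<Longrightarrow> x = (\<Sum>i<d. of_rat (c x i) * b i)"
    and c_add: "x \<in> K \<Longrightarrow> y \<in> K \<Longrightarrow> i < d \<Longrightarrow> c (x + y) i = c x i + c y i"
    and c_scale: "x \<in> K \<Longrightarrow> i < d \<Longrightarrow> c (of_rat q * x) i = q * c x i"
    and c_b: "i < d \<Longrightarrow> j < d \<Longrightarrow> c (b j) i = (if i = j then 1 else 0)"

lemma (in complex_number_field) ex_number_field_basis: "\<exists>d b c. number_field_basis K d b c"
proof -
  have sub: "qvs.subspace K"
    by (rule qvs.subspaceI) (auto intro: mems)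
  obtain B0 where B0: "finite B0" "K \<subseteq> qvs.span B0" using finite_dim by auto
  obtain B where B: "B \<subseteq> K" "qvs.independent B" "K \<subseteq> qvs.span B"
    by (rule qvs.maximal_independent_subset)
  have finB: "finite B"
    using qvs.independent_span_bound[OF B0(1) B(2) subset_trans[OF B(1) B0(2)]] ..
  obtain e where e: "bij_betw e {..<card B} B"
    using ex_bij_betw_nat_finite[OF finB] by (auto simp: atLeast0LessThan)
  define d where "d = card B"
  have eB: "i < d \<Longrightarrow> e i \<in> B" for i using bij_betw_apply[OF e] unfolding d_def by simp
  have e_inj: "i < d \<Longrightarrow> j < d \<Longrightarrow> e i = e j \<longleftrightarrow> i = j" for i j
    using inj_on_eq_iff[OF bij_betw_imp_inj_on[OF e]] unfolding d_def by simp
  have "\<forall>i. \<exists>D::int. D > 0 \<and> (i < d \<longrightarrow> of_int D * e i \<in> oint K)"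
  proof
    fix i show "\<exists>D::int. D > 0 \<and> (i < d \<longrightarrow> of_int D * e i \<in> oint K)"
    proof (cases "i < d")
      case True
      then show ?thesis using ex_integral_multiple[OF subsetD[OF B(1) eB[OF True]]] by simp
    next
      case False
      then show ?thesis by (intro exI[of _ 1]) simp
    qed
  qed
  then obtain D :: "nat \<Rightarrow> int" where D: "\<And>i. D i > 0" "\<And>i. i < d \<Longrightarrow> of_int (D i) * e i \<in> oint K"
    by metis
  define b where "b i = of_int (D i) * e i" for i
  define c where "c x i = qvs.representation B x (e i) / of_int (D i)" for x i
  have D0: "D i \<noteq> 0" for i using D(1)[of i] by simp
  have sp: "x \<in> qvs.span B" if "x \<in> K" for x using that B(3) by auto
  have "number_field_basis K d b c"
  proof
    show "b i \<in> oint K" if "i < d" for i using D(2)[OF that] by (simp add: b_def)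
    show "x = (\<Sum>i<d. of_rat (c x i) * b i)" if x: "x \<in> K" for x
    proof -
      have "x = (\<Sum>v\<in>B. of_rat (qvs.representation B x v) * v)"
        using qvs.sum_representation_eq[OF B(2) sp[OF x] finB order_refl] by simp
      also have "\<dots> = (\<Sum>i<d. of_rat (qvs.representation B x (e i)) * e i)"
        unfolding d_def by (rule sum.reindex_bij_betw[OF e, symmetric])
      also have "\<dots> = (\<Sum>i<d. of_rat (c x i) * b i)"
        using D0 by (intro sum.cong) (auto simp: c_def b_def of_rat_divide)
      finally show ?thesis .
    qed
    show "c (x + y) i = c x i + c y i" if "x \<in> K" "y \<in> K" "i < d" for x y i
      unfolding c_def using qvs.representation_add[OF B(2) sp sp] that by (simp add: add_divide_distrib)
    show "c (of_rat q * x) i = q * c x i" if "x \<in> K" "i < d" for x i q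
      unfolding c_def using qvs.representation_scale[OF B(2) sp] that by simp
    show "c (b j) i = (if i = j then 1 else 0)" if "i < d" "j < d" for i j
    proof -
      have "b j = of_rat (of_int (D j)) * e j" by (simp add: b_def)
      then have "c (b j) i = of_int (D j) * qvs.representation B (e j) (e i) / of_int (D i)"
        unfolding c_def
        by (simp only: qvs.representation_scale[OF B(2) qvs.span_base[OF eB[OF that(2)]]])
      then show ?thesis
        using qvs.representation_basis[OF B(2) eB[OF that(2)]] e_inj[OF that] D0 by auto
    qed
  qed
  then show ?thesis by blast
qed

lemma det_Ints:
  fixes A :: "rat mat"
  assumes "A \<in> carrier_mat n n" "\<And>i j. i < n \<Longrightarrow> j < n \<Longrightarrow> A $$ (i,j) \<in> \<int>"
  shows "Determinant.det A \<in> \<int>"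
  unfolding det_def'[OF assms(1)]
proof (rule Ints_sum)
  fix p assume "p \<in> {p. p permutes {0..<n}}"
  then have "p i < n" if "i < n" for i using that permutes_in_image by fastforce
  then show "signof p * (\<Prod>i = 0..<n. A $$ (i, p i)) \<in> \<int>"
    using assms(2) by (intro Ints_mult Ints_prod) (auto simp: sign_def)
qed

lemma det_bound:
  fixes A :: "rat mat"
  assumes "A \<in> carrier_mat n n" "\<And>i j. i < n \<Longrightarrow> j < n \<Longrightarrow> \<bar>A $$ (i,j)\<bar> \<le> e"
  shows "\<bar>Determinant.det A\<bar> \<le> fact n * e ^ n"
proof -
  have "\<bar>Determinant.det A\<bar> \<le> (\<Sum>p\<in>{p. p permutes {0..<n}}. e ^ n)"
    unfolding det_def'[OF assms(1)]
  proof (rule order_trans[OF sum_abs sum_mono])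
    fix p assume "p \<in> {p. p permutes {0..<n}}"
    then have p: "p i < n" if "i < n" for i using that permutes_in_image by fastforce
    have "\<bar>signof p * (\<Prod>i = 0..<n. A $$ (i, p i))\<bar> = (\<Prod>i = 0..<n. \<bar>A $$ (i, p i)\<bar>)"
      by (simp add: abs_mult sign_def abs_prod)
    also have "\<dots> \<le> (\<Prod>i = 0..<n. e)"
      using p assms(2) by (intro prod_mono) auto
    finally show "\<bar>signof p * (\<Prod>i = 0..<n. A $$ (i, p i))\<bar> \<le> e ^ n" by simp
  qed
  also have "\<dots> = fact n * e ^ n"
    by (simp add: card_permutations)
  finally show ?thesis .
qed

text \<open>If \<open>q\<close> is the reduced denominator of \<open>r\<close>, then
  \<open>q ^ k\<close> is that of \<open>r ^ k\<close> and divides \<open>E\<close> for every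
  \<open>k\<close>, which forces \<open>q = 1\<close>.\<close>

lemma rat_Ints_if_bounded_denominator:
  fixes r :: rat
  assumes "E \<noteq> (0::int)" "\<And>k::nat. of_int E * r ^ k \<in> \<int>"
  shows "r \<in> \<int>"
proof -
  obtain p q where pq: "quotient_of r = (p, q)" by force
  have q: "q > 0" "Rings.coprime p q" "r = of_int p / of_int q"
    using quotient_of_denom_pos[OF pq] quotient_of_coprime[OF pq] quotient_of_div[OF pq] by auto
  have "q ^ k dvd E" for k
  proof -
    obtain m where "of_int E * r ^ k = of_int m" using assms(2)[of k] Ints_cases by blast
    then have "of_int (E * p ^ k) = (of_int (m * q ^ k) :: rat)"
      using q by (simp add: power_divide field_simps)
    then have "E * p ^ k = m * q ^ k" using of_int_eq_iff by blast
    then have "q ^ k dvd E * p ^ k" by simp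
    moreover have "Rings.coprime (q ^ k) (p ^ k)" using q(2) by (simp add: ac_simps)
    ultimately show ?thesis using coprime_dvd_mult_left_iff by blast
  qed
  moreover have "\<exists>k. \<bar>E\<bar> < q ^ k" if "q \<ge> 2"
  proof -
    have "nat \<bar>E\<bar> < 2 ^ nat \<bar>E\<bar>" by (rule less_exp)
    then have "int (nat \<bar>E\<bar>) < int (2 ^ nat \<bar>E\<bar>)" by (simp only: of_nat_less_iff)
    then have "\<bar>E\<bar> < 2 ^ nat \<bar>E\<bar>" by simp
    also have "\<dots> \<le> q ^ nat \<bar>E\<bar>" using that by (intro power_mono) auto
    finally show ?thesis by blast
  qed
  moreover have "q ^ k \<le> \<bar>E\<bar>" if "q ^ k dvd E" for k
    using dvd_imp_le_int[OF assms(1) that] q(1) by simp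
  ultimately have "\<not> q \<ge> 2" by (meson linorder_not_le)
  then have "q = 1" using q(1) by simp
  then show ?thesis using q(3) by simp
qed

section \<open>The norm, approximation by lattice points, and residues of the ring of
  integers\<close>

context number_field_basis
begin

lemma b_mem: "i < d \<Longrightarrow> b i \<in> K" using b_oint oint_mem by blast

lemma c_zero: "i < d \<Longrightarrow> c 0 i = 0"
  using c_scale[OF zero_mem, of i 0] by simp

lemma c_sum:
  "(\<And>k. k \<in> A \<Longrightarrow> f k \<in> K) \<Longrightarrow> i < d \<Longrightarrow> c (\<Sum>k\<in>A. of_rat (q k) * f k) i = (\<Sum>k\<in>A. q k * c (f k) i)"
  by (induction A rule: infinite_finite_induct) (auto simp: c_zero c_add c_scale mems)

lemma c_combination: "i < d \<Longrightarrow> c (\<Sum>j<d. of_rat (q j) * b j) i = q i"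
  by (subst c_sum) (auto intro: b_mem simp: c_b if_distrib cong: if_cong)

lemma c_diff: "x \<in> K \<Longrightarrow> y \<in> K \<Longrightarrow> i < d \<Longrightarrow> c (x - y) i = c x i - c y i"
  using c_add[of "x - y" y i] by (simp add: mems)

lemma c_scale_int: "x \<in> K \<Longrightarrow> i < d \<Longrightarrow> c (of_int q * x) i = of_int q * c x i"
  using c_scale[of x i "of_int q"] by simp

definition mult_mat :: "complex \<Rightarrow> rat mat" where
  "mult_mat x = Matrix.mat d d (\<lambda>(i,j). c (x * b j) i)"

lemma mult_mat_carrier: "mult_mat x \<in> carrier_mat d d"
  by (simp add: mult_mat_def)

lemma mult_mat_mult:
  assumes "x \<in> K" "y \<in> K"
  shows "mult_mat (x * y) = mult_mat x * mult_mat y"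
proof (rule eq_matI)
  fix i j assume "i < dim_row (mult_mat x * mult_mat y)" "j < dim_col (mult_mat x * mult_mat y)"
  then have ij: "i < d" "j < d" by (auto simp: mult_mat_def)
  have "x * y * b j = x * (\<Sum>k<d. of_rat (c (y * b j) k) * b k)"
    using expansion[of "y * b j"] assms ij b_mem by (simp add: mems mult.assoc)
  also have "\<dots> = (\<Sum>k<d. of_rat (c (y * b j) k) * (x * b k))"
    by (simp add: sum_distrib_left algebra_simps)
  finally have "c (x * y * b j) i = (\<Sum>k<d. c (y * b j) k * c (x * b k) i)"
    using c_sum[where A = "{..<d}" and f = "\<lambda>k. x * b k" and q = "c (y * b j)", OF mult_mem[OF assms(1) b_mem] ij(1)]
    by simp
  then show "mult_mat (x * y) $$ (i, j) = (mult_mat x * mult_mat y) $$ (i, j)"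
    using ij by (simp add: mult_mat_def scalar_prod_def atLeast0LessThan mult.commute)
qed (auto simp: mult_mat_def)

lemma mult_mat_one: "mult_mat 1 = 1\<^sub>m d"
  by (rule eq_matI) (auto simp: mult_mat_def c_b)

text \<open>The absolute value of the norm of \<open>x\<close> from \<open>K\<close> to the
  rationals.\<close>

definition fnorm :: "complex \<Rightarrow> rat" where
  "fnorm x = \<bar>Determinant.det (mult_mat x)\<bar>"

lemma fnorm_mult: "x \<in> K \<Longrightarrow> y \<in> K \<Longrightarrow> fnorm (x * y) = fnorm x * fnorm y"
  unfolding fnorm_def by (simp add: mult_mat_mult det_mult[OF mult_mat_carrier mult_mat_carrier] abs_mult)

lemma fnorm_one: "fnorm 1 = 1"
  by (simp add: fnorm_def mult_mat_one)

lemma fnorm_pos: "x \<in> K \<Longrightarrow> x \<noteq> 0 \<Longrightarrow> fnorm x > 0"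
proof -
  assume x: "x \<in> K" "x \<noteq> 0"
  have "fnorm x * fnorm (inverse x) = 1"
    using fnorm_mult[of x "inverse x"] x by (simp add: mems fnorm_one)
  then show "fnorm x > 0" unfolding fnorm_def by (metis abs_ge_zero less_eq_rat_def mult_zero_left zero_neq_one)
qed

lemma d_pos: "d > 0"
  using expansion[OF one_mem] by (intro Nat.gr0I) auto

lemma det_mult_mat_power: "x \<in> K \<Longrightarrow> Determinant.det (mult_mat (x ^ k)) = Determinant.det (mult_mat x) ^ k"
  by (induction k) (simp_all add: mult_mat_one mult_mat_mult mems det_mult[OF mult_mat_carrier mult_mat_carrier])

text \<open>All powers of \<open>x\<close> lie in one finitely generated group, so a single
  \<open>D\<close> is a common denominator for the matrices of all of them. Then
  \<open>D ^ d\<close> bounds the denominators of all powers of the determinant, which must be an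
  integer. The matrix entries themselves may be fractions, because \<open>b\<close> need not span
  the ring of integers.\<close>

lemma fnorm_Ints:
  assumes x: "x \<in> oint K"
  shows "fnorm x \<in> \<int>"
proof -
  have xK: "x \<in> K" and "algebraic_int x" using x by (auto simp: oint_def)
  then obtain n a where n: "n > 0" "x ^ n = (\<Sum>i<n. of_int (a i) * x ^ i)"
    using algebraic_int_power_reduce by blast
  obtain D :: int where D: "D > 0"
    "\<forall>t\<in>{..<n} \<times> {..<d} \<times> {..<d}. of_int D * (case t of (k,i,j) \<Rightarrow> c (x ^ k * b j) i) \<in> \<int>"
    using Rats_common_denominator[of "{..<n} \<times> {..<d} \<times> {..<d}" "\<lambda>(k,i,j). c (x ^ k * b j) i"]
    by (auto simp: Rats_def)
  let ?S = "(\<lambda>i. x ^ i) ` {..<n}"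
  have x_span: "x * s \<in> zmod.span ?S" if s: "s \<in> ?S" for s
  proof -
    obtain i where i: "i < n" "s = x ^ i" using s by auto
    show ?thesis
    proof (cases "Suc i < n")
      case True
      then show ?thesis using i by (intro zmod.span_base) (auto intro!: image_eqI[of _ _ "Suc i"])
    next
      case False
      then have "Suc i = n" using i by simp
      then have "x * s = x ^ n" using i by auto
      also have "\<dots> \<in> zmod.span ?S"
        unfolding n(2) by (intro zmod.span_sum zmod.span_scale zmod.span_base) auto
      finally show ?thesis .
    qed
  qed
  have pow: "x ^ k \<in> zmod.span ?S" for k
  proof (induction k)
    case 0 show ?case using n(1) by (intro zmod.span_base) (auto intro!: image_eqI[of _ _ 0])
  next
    case (Suc k) then show ?case using zspan_mult[OF x_span] by simp
  qed
  have int: "z \<in> K \<and> (\<forall>i<d. \<forall>j<d. of_int D * c (z * b j) i \<in> \<int>)" if "z \<in> zmod.span ?S" for z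
    using that
  proof (induction rule: zmod.span_induct_alt)
    case base then show ?case by (auto simp: c_zero mems)
  next
    case (step k s z)
    have s: "s \<in> K" "\<forall>i<d. \<forall>j<d. of_int D * c (s * b j) i \<in> \<int>" using step(1) D(2) xK by (auto intro: mems)
    have "of_int D * c ((of_int k * s + z) * b j) i =
        of_int k * (of_int D * c (s * b j) i) + of_int D * c (z * b j) i" if "i < d" "j < d" for i j
    proof -
      have "(of_int k * s + z) * b j = of_int k * (s * b j) + z * b j" by (simp add: algebra_simps)
      then have "c ((of_int k * s + z) * b j) i = of_int k * c (s * b j) i + c (z * b j) i"
        using that s step b_mem by (simp only: c_add c_scale_int mems)
      then show ?thesis by (simp add: algebra_simps)
    qed
    then show ?case using s step by (auto intro!: mems Ints_add Ints_mult[OF Ints_of_int])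
  qed
  have "of_int (D ^ d) * Determinant.det (mult_mat x) ^ k \<in> \<int>" for k
  proof -
    have "of_int (D ^ d) * Determinant.det (mult_mat x) ^ k = Determinant.det (of_int D \<cdot>\<^sub>m mult_mat (x ^ k))"
      using det_mult_mat_power[OF xK, of k] mult_mat_carrier[of "x ^ k"] by (simp add: carrier_matD)
    also have "\<dots> \<in> \<int>"
      by (rule det_Ints[of _ d]) (use int[OF pow[of k]] in \<open>auto simp: mult_mat_def\<close>)
    finally show ?thesis .
  qed
  moreover have "D ^ d \<noteq> 0" using D(1) by simp
  ultimately have "Determinant.det (mult_mat x) \<in> \<int>"
    by (metis rat_Ints_if_bounded_denominator)
  then show ?thesis unfolding fnorm_def by simp
qed

lemma fnorm_ge_one: "x \<in> oint K \<Longrightarrow> x \<noteq> 0 \<Longrightarrow> fnorm x \<ge> 1"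
proof -
  assume x: "x \<in> oint K" "x \<noteq> 0"
  obtain k where "fnorm x = of_int k" using fnorm_Ints[OF x(1)] Ints_cases by blast
  then show ?thesis using fnorm_pos[of x] x oint_mem by auto
qed

text \<open>The entries of \<open>mult_mat x\<close> are linear in the coordinates of
  \<open>x\<close>, so the determinant grows like the \<open>d\<close>-th power of a bound for
  them.\<close>

lemma ex_fnorm_bound:
  "\<exists>C. C > 0 \<and> (\<forall>x\<in>K. \<forall>e\<ge>0. (\<forall>i<d. \<bar>c x i\<bar> \<le> e) \<longrightarrow> fnorm x \<le> C * e ^ d)"
proof -
  \<comment> \<open>\<open>M\<close> bounds all structure constants of the multiplication; using
    \<open>M + 1\<close> below keeps the final constant positive.\<close>
  define M where "M = (\<Sum>k<d. \<Sum>i<d. \<Sum>j<d. \<bar>c (b k * b j) i\<bar>)"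
  have M0: "M \<ge> 0" unfolding M_def by (intro sum_nonneg) auto
  have "fnorm x \<le> fact d * (M + 1) ^ d * e ^ d" if x: "x \<in> K" "e \<ge> 0" "\<forall>i<d. \<bar>c x i\<bar> \<le> e" for x e
  proof -
    have "\<bar>c (x * b j) i\<bar> \<le> (M + 1) * e" if ij: "i < d" "j < d" for i j
    proof -
      have "x * b j = (\<Sum>k<d. of_rat (c x k) * (b k * b j))"
        by (subst expansion[OF x(1)]) (simp add: sum_distrib_right mult.assoc)
      then have "c (x * b j) i = (\<Sum>k<d. c x k * c (b k * b j) i)"
        using c_sum[where A = "{..<d}" and f = "\<lambda>k. b k * b j" and q = "c x", OF mult_mem[OF b_mem b_mem] ij(1)] ij(2)
        by simp
      then have "\<bar>c (x * b j) i\<bar> \<le> (\<Sum>k<d. \<bar>c x k * c (b k * b j) i\<bar>)" by simp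
      also have "\<dots> \<le> (\<Sum>k<d. e * \<bar>c (b k * b j) i\<bar>)"
        using x(3) by (intro sum_mono) (auto simp: abs_mult intro!: mult_right_mono)
      also have "\<dots> = e * (\<Sum>k<d. \<bar>c (b k * b j) i\<bar>)" by (simp add: sum_distrib_left)
      also have "\<dots> \<le> e * M"
      proof -
        have "\<bar>c (b k * b j) i\<bar> \<le> (\<Sum>i<d. \<Sum>j<d. \<bar>c (b k * b j) i\<bar>)" for k
          using ij member_le_sum[of j "{..<d}" "\<lambda>j. \<bar>c (b k * b j) i\<bar>"]
            member_le_sum[of i "{..<d}" "\<lambda>i. \<Sum>j<d. \<bar>c (b k * b j) i\<bar>"]
          by (force simp: sum_nonneg)
        then show ?thesis unfolding M_def using x(2) by (intro mult_left_mono sum_mono) auto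
      qed
      also have "\<dots> \<le> (M + 1) * e" using x(2) M0 by (simp add: algebra_simps)
      finally show ?thesis .
    qed
    then have "fnorm x \<le> fact d * ((M + 1) * e) ^ d"
      unfolding fnorm_def by (intro det_bound[OF mult_mat_carrier]) (simp add: mult_mat_def)
    then show ?thesis by (simp add: power_mult_distrib mult.assoc)
  qed
  then show ?thesis using M0 by (intro exI[of _ "fact d * (M + 1) ^ d"]) auto
qed

text \<open>Dirichlet's pigeonhole argument: among the \<open>Q ^ d + 1\<close> multiples of
  \<open>x\<close> by numbers up to \<open>Q ^ d\<close>, two have coordinates whose fractional
  parts fall into the same of \<open>Q ^ d\<close> boxes of side \<open>1 / Q\<close>, and
  \<open>t\<close> is the difference of the two multipliers.\<close>

lemma simultaneous_approximation:
  assumes "x \<in> K" "Q > 0"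
  shows "\<exists>t::nat. t > 0 \<and> t \<le> Q ^ d \<and>
    (\<exists>a. \<forall>i<d. \<bar>c (of_nat t * x - (\<Sum>j<d. of_int (a j) * b j)) i\<bar> \<le> 1 / of_nat Q)"
proof -
  \<comment> \<open>The box that contains the fractional parts for \<open>t * x\<close>. The
    restriction makes these functions extensional, so that there are only finitely many of
    them.\<close>
  define g where "g t = restrict (\<lambda>i. nat \<lfloor>of_nat Q * frac (of_nat t * c x i)\<rfloor>) {..<d}" for t :: nat
  have "g ` {..Q ^ d} \<subseteq> {..<d} \<rightarrow>\<^sub>E {..<Q}"
  proof -
    have "nat \<lfloor>of_nat Q * frac z\<rfloor> < Q" for z :: rat
    proof -
      have "of_nat Q * frac z < of_nat Q * 1" using assms(2) frac_lt_1[of z] by (intro mult_strict_left_mono) auto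
      then have "\<lfloor>of_nat Q * frac z\<rfloor> < int Q" by (simp add: floor_less_iff)
      then show ?thesis using assms(2) by simp
    qed
    then show ?thesis unfolding g_def by (intro image_subsetI) (simp add: restrict_PiE_iff)
  qed
  then have "card (g ` {..Q ^ d}) \<le> Q ^ d"
    using card_mono[of "{..<d} \<rightarrow>\<^sub>E {..<Q}" "g ` {..Q ^ d}"] by (simp add: card_PiE finite_PiE)
  then have "\<not> inj_on g {..Q ^ d}" using card_image[of g "{..Q ^ d}"] by auto
  then obtain s t where st: "s < t" "t \<le> Q ^ d" "g s = g t"
    unfolding inj_on_def by (metis atMost_iff linorder_neqE_nat)
  define a where "a i = \<lfloor>of_nat t * c x i\<rfloor> - \<lfloor>of_nat s * c x i\<rfloor>" for i
  have "\<bar>c (of_nat (t - s) * x - (\<Sum>j<d. of_int (a j) * b j)) i\<bar> \<le> 1 / of_nat Q" if i: "i < d" for i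
  proof -
    have sK: "(\<Sum>j<d. of_int (a j) * b j) \<in> K" using b_mem by (intro mems) auto
    have "c (\<Sum>j<d. of_int (a j) * b j) i = of_int (a i)"
      using c_combination[OF i, of "\<lambda>j. of_int (a j)"] by simp
    moreover have "c (of_nat (t - s) * x) i = of_nat (t - s) * c x i"
      using c_scale[OF assms(1) i, of "of_nat (t - s)"] by simp
    ultimately have "c (of_nat (t - s) * x - (\<Sum>j<d. of_int (a j) * b j)) i = of_nat (t - s) * c x i - of_int (a i)"
      using c_diff[OF _ sK i, of "of_nat (t - s) * x"] assms(1) by (simp add: mems)
    also have "\<dots> = frac (of_nat t * c x i) - frac (of_nat s * c x i)"
      using st(1) by (simp add: a_def frac_def algebra_simps of_nat_diff)
    finally have eq: "c (of_nat (t - s) * x - (\<Sum>j<d. of_int (a j) * b j)) i =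
      frac (of_nat t * c x i) - frac (of_nat s * c x i)" .
    have "g s i = g t i" using st(3) by simp
    then have "nat \<lfloor>of_nat Q * frac (of_nat s * c x i)\<rfloor> = nat \<lfloor>of_nat Q * frac (of_nat t * c x i)\<rfloor>"
      using i by (simp add: g_def)
    moreover have "0 \<le> \<lfloor>of_nat Q * frac (of_nat u * c x i)\<rfloor>" for u by simp
    ultimately have "\<lfloor>of_nat Q * frac (of_nat s * c x i)\<rfloor> = \<lfloor>of_nat Q * frac (of_nat t * c x i)\<rfloor>"
      using eq_nat_nat_iff by blast
    then have "\<bar>of_nat Q * frac (of_nat t * c x i) - of_nat Q * frac (of_nat s * c x i)\<bar> \<le> 1"
      using floor_correct[of "of_nat Q * frac (of_nat t * c x i)"]
        floor_correct[of "of_nat Q * frac (of_nat s * c x i)"] by linarith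
    then have "of_nat Q * \<bar>frac (of_nat t * c x i) - frac (of_nat s * c x i)\<bar> \<le> 1"
      using assms(2) by (metis abs_mult abs_of_nat right_diff_distrib)
    then show ?thesis using assms(2) unfolding eq by (simp add: field_simps)
  qed
  moreover have "t - s > 0" "t - s \<le> Q ^ d" using st by auto
  ultimately show ?thesis by blast
qed

lemma lattice_oint: "(\<Sum>j<d. of_int (a j) * b j) \<in> oint K"
  by (intro oint_sum oint_closed b_oint) auto

text \<open>The error has coordinates at most \<open>1 / Q\<close>, hence norm at most
  \<open>C / Q ^ d\<close>, and \<open>Q ^ d\<close> serves as \<open>M\<close>. The bound is 1/2
  rather than 1 because the class number argument minimises norms only up to a factor of 2.\<close>

lemma oint_approximation:
  "\<exists>M::nat. M > 0 \<and> (\<forall>x\<in>K. \<exists>t a. 0 < t \<and> t \<le> M \<and>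
     fnorm (of_nat t * x - (\<Sum>j<d. of_int (a j) * b j)) < 1 / 2)"
proof -
  obtain C where C: "C > 0" "\<And>x e. x \<in> K \<Longrightarrow> e \<ge> 0 \<Longrightarrow> (\<forall>i<d. \<bar>c x i\<bar> \<le> e) \<Longrightarrow> fnorm x \<le> C * e ^ d"
    using ex_fnorm_bound by blast
  obtain Q :: nat where Q: "2 * C < of_nat Q"
    using reals_Archimedean2 by blast
  then have Q0: "Q > 0" using C(1) by (intro Nat.gr0I) auto
  have le: "C * (1 / of_nat Q) ^ d < 1 / 2"
  proof -
    have "(1 / of_nat Q :: rat) ^ d \<le> (1 / of_nat Q) ^ 1"
      using d_pos Q0 by (intro power_decreasing) auto
    then have "C * (1 / of_nat Q) ^ d \<le> C * (1 / of_nat Q)" using C(1) by (intro mult_left_mono) auto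
    also have "\<dots> < 1 / 2" using Q Q0 by (simp add: field_simps)
    finally show ?thesis .
  qed
  show ?thesis
  proof (rule exI[of _ "Q ^ d"], intro conjI ballI)
    fix x assume x: "x \<in> K"
    obtain t a where t: "t > 0" "t \<le> Q ^ d"
      "\<forall>i<d. \<bar>c (of_nat t * x - (\<Sum>j<d. of_int (a j) * b j)) i\<bar> \<le> 1 / of_nat Q"
      using simultaneous_approximation[OF x Q0] by blast
    have "of_nat t * x - (\<Sum>j<d. of_int (a j) * b j) \<in> K"
      using x b_mem by (intro mems) auto
    then have "fnorm (of_nat t * x - (\<Sum>j<d. of_int (a j) * b j)) \<le> C * (1 / of_nat Q) ^ d"
      using C(2) t(3) by simp
    then show "\<exists>t a. 0 < t \<and> t \<le> Q ^ d \<and> fnorm (of_nat t * x - (\<Sum>j<d. of_int (a j) * b j)) < 1 / 2"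
      using t le by (meson le_less_trans)
  qed (use Q0 in auto)
qed

text \<open>For an algebraic integer \<open>x\<close> the approximation error is an algebraic
  integer of norm below 1, hence zero. So a multiple \<open>t * x\<close> with
  \<open>0 < t \<le> M\<close> lies in the lattice, and every such \<open>t\<close> divides
  \<open>fact M\<close>.\<close>

lemma oint_bounded_denominator:
  "\<exists>D::int. D > 0 \<and> (\<forall>x\<in>oint K. \<exists>a. of_int D * x = (\<Sum>j<d. of_int (a j) * b j))"
proof -
  obtain M :: nat where M: "M > 0" "\<And>x. x \<in> K \<Longrightarrow> \<exists>t a. 0 < t \<and> t \<le> M \<and>
     fnorm (of_nat t * x - (\<Sum>j<d. of_int (a j) * b j)) < 1 / 2"
    using oint_approximation by blast
  have "\<exists>a. of_int (fact M) * x = (\<Sum>j<d. of_int (a j) * b j)" if x: "x \<in> oint K" for x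
  proof -
    obtain t a where t: "0 < t" "t \<le> M" "fnorm (of_nat t * x - (\<Sum>j<d. of_int (a j) * b j)) < 1 / 2"
      using M(2)[OF oint_mem[OF x]] by blast
    have "of_nat t * x - (\<Sum>j<d. of_int (a j) * b j) \<in> oint K"
      using x lattice_oint by (intro oint_closed) auto
    then have eq: "of_nat t * x = (\<Sum>j<d. of_int (a j) * b j)"
      using fnorm_ge_one t(3) by force
    have "t dvd fact M" using t by (intro dvd_fact) auto
    then obtain k :: nat where "fact M = t * k" by blast
    then have "of_int (fact M) * x = of_nat k * (of_nat t * x)"
    proof -
      have "of_int (fact M) = (of_nat (fact M) :: complex)" by simp
      then show ?thesis unfolding \<open>fact M = t * k\<close> by simp
    qed
    also have "\<dots> = (\<Sum>j<d. of_int (int k * a j) * b j)"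
      unfolding eq by (simp add: sum_distrib_left mult.assoc)
    finally show ?thesis by (intro exI[of _ "\<lambda>j. int k * a j"])
  qed
  then show ?thesis by (intro exI[of _ "fact M"]) auto
qed

text \<open>The coordinates of \<open>D * x\<close> are integers, and reducing them modulo
  \<open>D * m\<close> leaves finitely many classes. Two integers in one class differ by
  \<open>m\<close> times a lattice point.\<close>

lemma oint_finite_quotient:
  assumes m: "m \<noteq> (0::int)"
  shows "\<exists>R. finite R \<and> R \<subseteq> oint K \<and> (\<forall>x\<in>oint K. \<exists>r\<in>R. \<exists>y\<in>oint K. x = r + of_int m * y)"
proof -
  obtain D :: int and a where D: "D > 0"
    "\<And>x. x \<in> oint K \<Longrightarrow> of_int D * x = (\<Sum>j<d. of_int (a x j) * b j)"
    using oint_bounded_denominator by metis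
  define g where "g x = restrict (\<lambda>j. a x j mod (D * m)) {..<d}" for x
  have img: "finite (g ` oint K)"
  proof (rule finite_subset)
    show "g ` oint K \<subseteq> {..<d} \<rightarrow>\<^sub>E {- \<bar>D * m\<bar>..\<bar>D * m\<bar>}"
    proof -
      have "u mod (D * m) \<in> {- \<bar>D * m\<bar>..\<bar>D * m\<bar>}" for u
        using abs_mod_less[of "D * m" u] D(1) m by auto
      then show ?thesis unfolding g_def by (intro image_subsetI) (simp add: restrict_PiE_iff)
    qed
  qed (auto intro: finite_PiE)
  define R where "R = inv_into (oint K) g ` (g ` oint K)"
  have "\<exists>r\<in>R. \<exists>y\<in>oint K. x = r + of_int m * y" if x: "x \<in> oint K" for x
  proof -
    define r where "r = inv_into (oint K) g (g x)"
    have r: "r \<in> oint K" "g r = g x" "r \<in> R"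
      unfolding r_def R_def using x by (auto simp: inv_into_into f_inv_into_f)
    have "\<exists>k. a x j = a r j + D * m * k" if "j < d" for j
    proof -
      have "a x j mod (D * m) = a r j mod (D * m)"
        using fun_cong[OF r(2), of j] that by (simp add: g_def)
      then have "D * m dvd a x j - a r j" by (simp add: mod_eq_dvd_iff)
      then show ?thesis by (auto simp: dvd_def algebra_simps)
    qed
    then obtain k where k: "\<And>j. j < d \<Longrightarrow> a x j = a r j + D * m * k j" by metis
    define y where "y = (\<Sum>j<d. of_int (k j) * b j)"
    have "of_int D * x = (\<Sum>j<d. of_int (a x j) * b j)" by (rule D(2)[OF x])
    also have "\<dots> = (\<Sum>j<d. of_int (a r j) * b j + of_int (D * m) * (of_int (k j) * b j))"
      by (rule sum.cong[OF refl]) (simp only: lessThan_iff k of_int_add of_int_mult distrib_right mult.assoc)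
    also have "\<dots> = of_int D * r + of_int (D * m) * y"
      by (simp only: D(2)[OF r(1)] y_def sum.distrib sum_distrib_left)
    finally have "of_int D * x = of_int D * r + of_int (D * m) * y" .
    then have "of_int D * x = of_int D * (r + of_int m * y)" by (simp add: algebra_simps)
    then have "x = r + of_int m * y" using D(1) by simp
    then show ?thesis using r y_def lattice_oint by blast
  qed
  moreover have "finite R" "R \<subseteq> oint K" using img by (auto simp: R_def inv_into_into)
  ultimately show ?thesis by blast
qed

text \<open>The remainders modulo \<open>D\<close> together with the basis generate, because
  \<open>D * y\<close> lies in the lattice for every integer \<open>y\<close> of
  \<open>K\<close>.\<close>

lemma oint_finitely_generated: "\<exists>S. finite S \<and> S \<subseteq> oint K \<and> oint K \<subseteq> zmod.span S"
proof -
  obtain D :: int where D: "D > 0" "\<And>x. x \<in> oint K \<Longrightarrow> \<exists>a. of_int D * x = (\<Sum>j<d. of_int (a j) * b j)"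
    using oint_bounded_denominator by metis
  then obtain R where R: "finite R" "R \<subseteq> oint K" "\<And>x. x \<in> oint K \<Longrightarrow> \<exists>r\<in>R. \<exists>y\<in>oint K. x = r + of_int D * y"
    using oint_finite_quotient[of D] by auto
  have "x \<in> zmod.span (R \<union> b ` {..<d})" if x: "x \<in> oint K" for x
  proof -
    obtain r y where ry: "r \<in> R" "y \<in> oint K" "x = r + of_int D * y" using R(3)[OF x] by blast
    obtain a where "of_int D * y = (\<Sum>j<d. of_int (a j) * b j)" using D(2)[OF ry(2)] by blast
    then show ?thesis unfolding ry(3) using ry(1)
      by (auto intro!: zmod.span_add zmod.span_sum zmod.span_scale intro: zmod.span_base)
  qed
  then show ?thesis using R b_oint by (intro exI[of _ "R \<union> b ` {..<d}"]) auto
qed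

end

section \<open>Fractional ideals and the finiteness of the class group\<close>

text \<open>The two rules copy those of \<open>ideal_prod\<close>, so that products of ideals can be
  carried along an embedding by induction.\<close>

inductive_set imul :: "complex set \<Rightarrow> complex set \<Rightarrow> complex set" for I J where
  prod: "i \<in> I \<Longrightarrow> j \<in> J \<Longrightarrow> i * j \<in> imul I J"
| sum: "x \<in> imul I J \<Longrightarrow> y \<in> imul I J \<Longrightarrow> x + y \<in> imul I J"

lemma imul_least:
  assumes "\<And>i j. i \<in> I \<Longrightarrow> j \<in> J \<Longrightarrow> i * j \<in> M" "\<And>x y. x \<in> M \<Longrightarrow> y \<in> M \<Longrightarrow> x + y \<in> M"
  shows "imul I J \<subseteq> M"
proof
  fix x assume "x \<in> imul I J" then show "x \<in> M" by induction (auto intro: assms)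
qed

lemma imul_mono: "I \<subseteq> I' \<Longrightarrow> J \<subseteq> J' \<Longrightarrow> imul I J \<subseteq> imul I' J'"
  by (rule imul_least) (auto intro: imul.intros)

lemma imul_commute: "imul I J = imul J I"
proof -
  have "imul I J \<subseteq> imul J I" for I J
    by (rule imul_least) (metis imul.prod mult.commute, rule imul.sum)
  then show ?thesis by blast
qed

lemma imul_assoc: "imul (imul I J) L = imul I (imul J L)"
proof (rule antisym)
  show "imul (imul I J) L \<subseteq> imul I (imul J L)"
  proof (rule imul_least)
    fix x l assume "x \<in> imul I J" "l \<in> L"
    then show "x * l \<in> imul I (imul J L)"
      by (induction) (auto simp: mult.assoc distrib_right intro: imul.intros)
  qed (rule imul.sum)
  show "imul I (imul J L) \<subseteq> imul (imul I J) L"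
  proof (rule imul_least)
    fix i x assume "i \<in> I" "x \<in> imul J L"
    from this(2,1) show "i * x \<in> imul (imul I J) L"
      by (induction) (auto simp: mult.assoc[symmetric] distrib_left intro: imul.intros)
  qed (rule imul.sum)
qed

abbreviation smul :: "complex \<Rightarrow> complex set \<Rightarrow> complex set" where
  "smul x I \<equiv> (\<lambda>y. x * y) ` I"

lemma smul_smul: "smul x (smul y I) = smul (x * y) I"
  by (auto simp: image_image mult.assoc)

lemma smul_imul: "imul (smul x I) J = smul x (imul I J)"
proof (rule antisym)
  show "imul (smul x I) J \<subseteq> smul x (imul I J)"
    by (rule imul_least) (auto simp: mult.assoc distrib_left[symmetric] intro: imul.intros)
  show "smul x (imul I J) \<subseteq> imul (smul x I) J"
  proof clarify
    fix y assume "y \<in> imul I J"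
    then show "x * y \<in> imul (smul x I) J"
    proof induction
      case (prod i j)
      then show ?case using imul.prod[of "x * i" "smul x I" j J] by (metis imageI mult.assoc)
    qed (auto simp: distrib_left intro: imul.sum)
  qed
qed

lemma smul_inverse: "x \<noteq> 0 \<Longrightarrow> smul x I = J \<longleftrightarrow> I = smul (inverse x) J"
  by (auto simp: image_image mult.assoc[symmetric])

definition omodule :: "complex set \<Rightarrow> complex set \<Rightarrow> bool" where
  "omodule K I \<longleftrightarrow> 0 \<in> I \<and> (\<forall>x\<in>I. \<forall>y\<in>I. x + y \<in> I) \<and> (\<forall>a\<in>oint K. \<forall>x\<in>I. a * x \<in> I)"

definition fideals :: "complex set \<Rightarrow> complex set set" where
  "fideals K = {I. omodule K I \<and> I \<subseteq> K \<and> I \<noteq> {0} \<and> (\<exists>d\<in>oint K - {0}. \<forall>x\<in>I. d * x \<in> oint K)}"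

definition ideal_group :: "complex set \<Rightarrow> complex set monoid" where
  "ideal_group K = \<lparr>carrier = fideals K, mult = imul, one = oint K\<rparr>"

definition prime_ideals :: "complex set \<Rightarrow> complex set set" where
  "prime_ideals K = {P \<in> fideals K. P \<subseteq> oint K \<and> 1 \<notin> P \<and>
     (\<forall>x\<in>oint K. \<forall>y\<in>oint K. x * y \<in> P \<longrightarrow> x \<in> P \<or> y \<in> P)}"

section \<open>Finiteness of the class number and finite generation of ideals\<close>

context complex_number_field
begin

text \<open>Collects what the class number argument uses of the norm, so that the chosen basis
  disappears.\<close>

lemma ex_multiplicative_norm:
  obtains N :: "complex \<Rightarrow> rat" and M :: nat where
    "\<And>x y. x \<in> K \<Longrightarrow> y \<in> K \<Longrightarrow> N (x * y) = N x * N y"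
    "\<And>x. x \<in> K \<Longrightarrow> x \<noteq> 0 \<Longrightarrow> N x > 0"
    "\<And>x. x \<in> oint K \<Longrightarrow> x \<noteq> 0 \<Longrightarrow> N x \<ge> 1" "M > 0"
    "\<And>x. x \<in> K \<Longrightarrow> \<exists>t w. 0 < t \<and> t \<le> M \<and> w \<in> oint K \<and> N (of_nat t * x - w) < 1 / 2"
proof -
  obtain d b c where "number_field_basis K d b c" using ex_number_field_basis by blast
  then interpret number_field_basis K d b c .
  obtain M :: nat where M: "M > 0" "\<And>x. x \<in> K \<Longrightarrow> \<exists>t a. 0 < t \<and> t \<le> M \<and>
     fnorm (of_nat t * x - (\<Sum>j<d. of_int (a j) * b j)) < 1 / 2"
    using oint_approximation by blast
  show ?thesis
  proof (rule that[of fnorm M])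
    fix x assume "x \<in> K"
    then obtain t a where "0 < t" "t \<le> M" "fnorm (of_nat t * x - (\<Sum>j<d. of_int (a j) * b j)) < 1 / 2"
      using M(2) by blast
    then show "\<exists>t w. 0 < t \<and> t \<le> M \<and> w \<in> oint K \<and> fnorm (of_nat t * x - w) < 1 / 2"
      using lattice_oint[of a] by (intro exI[of _ t] exI[of _ "\<Sum>j<d. of_int (a j) * b j"]) auto
  qed (auto intro: fnorm_mult fnorm_pos fnorm_ge_one M)
qed

lemma ex_finite_quotient:
  "m \<noteq> (0::int) \<Longrightarrow> \<exists>R. finite R \<and> R \<subseteq> oint K \<and> (\<forall>x\<in>oint K. \<exists>r\<in>R. \<exists>y\<in>oint K. x = r + of_int m * y)"
  using ex_number_field_basis number_field_basis.oint_finite_quotient[of K] by metis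

lemma ex_finite_generators: "\<exists>S. finite S \<and> S \<subseteq> oint K \<and> oint K \<subseteq> zmod.span S"
  using ex_number_field_basis number_field_basis.oint_finitely_generated by blast

lemma omoduleD:
  assumes "omodule K I"
  shows "0 \<in> I" "x \<in> I \<Longrightarrow> y \<in> I \<Longrightarrow> x + y \<in> I" "a \<in> oint K \<Longrightarrow> x \<in> I \<Longrightarrow> a * x \<in> I"
    "x \<in> I \<Longrightarrow> - x \<in> I" "x \<in> I \<Longrightarrow> y \<in> I \<Longrightarrow> x - y \<in> I" "x \<in> I \<Longrightarrow> of_int k * x \<in> I"
proof -
  show *: "0 \<in> I" "\<And>x y. x \<in> I \<Longrightarrow> y \<in> I \<Longrightarrow> x + y \<in> I" "\<And>a x. a \<in> oint K \<Longrightarrow> x \<in> I \<Longrightarrow> a * x \<in> I"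
    using assms unfolding omodule_def by auto
  show **: "- x \<in> I" if "x \<in> I" for x
    using *(3)[of "- 1" x] that oint_closed(7)[of "- 1"] by simp
  show "x - y \<in> I" if "x \<in> I" "y \<in> I" for x y using *(2)[OF that(1) **[OF that(2)]] by simp
  show "of_int k * x \<in> I" if "x \<in> I" for k x by (rule *(3)[OF oint_closed(7) that])
qed

lemma omodule_oint: "omodule K (oint K)"
  unfolding omodule_def by (auto intro: oint_closed)

lemma omodule_imul: "omodule K I \<Longrightarrow> omodule K J \<Longrightarrow> omodule K (imul I J)"
  unfolding omodule_def
proof (intro conjI ballI)
  assume I: "0 \<in> I \<and> (\<forall>x\<in>I. \<forall>y\<in>I. x + y \<in> I) \<and> (\<forall>a\<in>oint K. \<forall>x\<in>I. a * x \<in> I)"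
    and J: "0 \<in> J \<and> (\<forall>x\<in>J. \<forall>y\<in>J. x + y \<in> J) \<and> (\<forall>a\<in>oint K. \<forall>x\<in>J. a * x \<in> J)"
  show "0 \<in> imul I J" using imul.prod[of 0 I 0 J] I J by simp
  fix a x assume a: "a \<in> oint K" and "x \<in> imul I J"
  from this(2) show "a * x \<in> imul I J"
  proof induction
    case (prod i j)
    then show ?case using imul.prod[of "a * i" I j J] a I by (simp add: mult.assoc)
  qed (auto simp: distrib_left intro: imul.sum)
qed (auto intro: imul.sum)

lemma imul_oint: "omodule K I \<Longrightarrow> imul I (oint K) = I"
proof (rule antisym)
  assume I: "omodule K I"
  then show "imul I (oint K) \<subseteq> I"
    by (intro imul_least) (metis mult.commute omoduleD(3), metis omoduleD(2))
  show "I \<subseteq> imul I (oint K)"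
    using imul.prod[of _ I 1 "oint K"] oint_closed(2) by auto
qed

lemma fidealsD:
  assumes "I \<in> fideals K"
  shows "omodule K I" "I \<subseteq> K" "\<exists>x\<in>I. x \<noteq> 0" "\<exists>d\<in>oint K - {0}. \<forall>x\<in>I. d * x \<in> oint K"
  using assms omoduleD(1)[of I] unfolding fideals_def by auto

lemma oint_fideal: "oint K \<in> fideals K"
  unfolding fideals_def using omodule_oint oint_closed
  by (auto simp: oint_mem intro!: bexI[of _ 1])

lemma integral_fideal: "omodule K I \<Longrightarrow> I \<subseteq> oint K \<Longrightarrow> x \<in> I \<Longrightarrow> x \<noteq> 0 \<Longrightarrow> I \<in> fideals K"
  unfolding fideals_def using oint_closed oint_mem by (auto intro!: bexI[of _ 1])

lemma imul_fideal:
  assumes "I \<in> fideals K" "J \<in> fideals K"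
  shows "imul I J \<in> fideals K"
proof -
  obtain d e where d: "d \<in> oint K" "d \<noteq> 0" "\<forall>x\<in>I. d * x \<in> oint K"
    and e: "e \<in> oint K" "e \<noteq> 0" "\<forall>x\<in>J. e * x \<in> oint K"
    using fidealsD(4)[OF assms(1)] fidealsD(4)[OF assms(2)] by auto
  obtain x y where xy: "x \<in> I" "x \<noteq> 0" "y \<in> J" "y \<noteq> 0" using fidealsD(3)[OF assms(1)] fidealsD(3)[OF assms(2)] by auto
  have "imul I J \<subseteq> K"
    using fidealsD(2)[OF assms(1)] fidealsD(2)[OF assms(2)] by (intro imul_least) (auto intro: mems)
  moreover have "imul I J \<noteq> {0}" using imul.prod[OF xy(1,3)] xy no_zero_divisors by blast
  moreover have "\<forall>x\<in>imul I J. (d * e) * x \<in> oint K"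
  proof
    fix x assume "x \<in> imul I J"
    then show "(d * e) * x \<in> oint K"
    proof induction
      case (prod i j)
      then have "(d * i) * (e * j) \<in> oint K" using d e oint_closed(6) by blast
      then show ?case by (simp add: algebra_simps)
    qed (auto simp: distrib_left intro: oint_closed)
  qed
  ultimately show ?thesis
    unfolding fideals_def using omodule_imul[OF fidealsD(1) fidealsD(1)] assms d e
    by (auto intro!: bexI[of _ "d * e"] oint_closed)
qed

lemma smul_omodule: "omodule K I \<Longrightarrow> omodule K (smul x I)"
  unfolding omodule_def by (auto simp: distrib_left[symmetric] mult.left_commute intro: imageI)

lemma ex_denominator:
  assumes "x \<in> K"
  shows "\<exists>d\<in>oint K. d \<noteq> 0 \<and> d * x \<in> oint K"
proof -
  obtain D :: int where "D > 0" "of_int D * x \<in> oint K" using ex_integral_multiple[OF assms] by blast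
  then show ?thesis by (intro bexI[of _ "of_int D"]) (auto intro: oint_closed)
qed

lemma smul_fideal:
  assumes "I \<in> fideals K" "x \<in> K" "x \<noteq> 0"
  shows "smul x I \<in> fideals K"
proof -
  obtain d where d: "d \<in> oint K" "d \<noteq> 0" "\<forall>y\<in>I. d * y \<in> oint K"
    using fidealsD(4)[OF assms(1)] by auto
  obtain e where e: "e \<in> oint K" "e \<noteq> 0" "e * x \<in> oint K"
    using ex_denominator[OF assms(2)] by blast
  obtain y where y: "y \<in> I" "y \<noteq> 0" using fidealsD(3)[OF assms(1)] by auto
  have "\<forall>z\<in>smul x I. (d * e) * z \<in> oint K"
  proof clarify
    fix y assume "y \<in> I"
    then have "(d * y) * (e * x) \<in> oint K" using d e oint_closed(6) by blast
    then show "(d * e) * (x * y) \<in> oint K" by (simp add: algebra_simps)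
  qed
  moreover have "d * e \<in> oint K - {0}" using d e by (auto intro: oint_closed)
  moreover have "x * y \<noteq> 0" "x * y \<in> smul x I" using y assms(3) by auto
  then have "smul x I \<noteq> {0}" by blast
  moreover have "smul x I \<subseteq> K" using fidealsD(2)[OF assms(1)] assms(2) by (auto intro: mems)
  ultimately show ?thesis
    unfolding fideals_def using smul_omodule[OF fidealsD(1)[OF assms(1)]] by blast
qed

text \<open>Some positive multiple \<open>D * inverse x\<close> is integral, and multiplying it by
  \<open>x\<close> gives \<open>D\<close>, an element of \<open>I\<close>.\<close>

lemma nonzero_int_in_ideal:
  assumes "omodule K I" "I \<subseteq> oint K" "x \<in> I" "x \<noteq> 0"
  obtains m :: int where "m > 0" "of_int m \<in> I"
proof -
  obtain D :: int where D: "D > 0" "of_int D * inverse x \<in> oint K"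
    using ex_integral_multiple[of "inverse x"] assms(2,3) oint_mem by (auto intro: mems)
  then have "of_int D * inverse x * x \<in> I" using omoduleD(3)[OF assms(1)] assms(3) by blast
  moreover have "of_int D * inverse x * x = of_int D" using assms(4) by simp
  ultimately have "of_int D \<in> I" by metis
  with D(1) show ?thesis by (rule that)
qed

text \<open>An ideal that contains \<open>m\<close> is a union of cosets modulo \<open>m\<close>, so
  it is determined by the members of the finite system \<open>R\<close> that it contains.\<close>

lemma finite_ideals_containing:
  assumes "m \<noteq> (0::int)"
  shows "finite {J. omodule K J \<and> J \<subseteq> oint K \<and> of_int m \<in> J}"
proof -
  obtain R where R: "finite R" "R \<subseteq> oint K" "\<And>x. x \<in> oint K \<Longrightarrow> \<exists>r\<in>R. \<exists>y\<in>oint K. x = r + of_int m * y"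
    using ex_finite_quotient[OF assms] by auto
  have "J = (\<lambda>(r,y). r + of_int m * y) ` ((J \<inter> R) \<times> oint K)"
    if J: "omodule K J" "J \<subseteq> oint K" "of_int m \<in> J" for J
  proof (rule antisym)
    have m: "of_int m * y \<in> J" if "y \<in> oint K" for y
      using omoduleD(3)[OF J(1) that J(3)] by (simp add: mult.commute)
    show "J \<subseteq> (\<lambda>(r,y). r + of_int m * y) ` ((J \<inter> R) \<times> oint K)"
    proof
      fix x assume x: "x \<in> J"
      then obtain r y where ry: "r \<in> R" "y \<in> oint K" "x = r + of_int m * y" using R(3) J(2) by blast
      then have "r = x - of_int m * y" by simp
      then have "r \<in> J" using omoduleD(5)[OF J(1) x m[OF ry(2)]] by simp
      then show "x \<in> (\<lambda>(r,y). r + of_int m * y) ` ((J \<inter> R) \<times> oint K)"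
        using ry by (intro image_eqI[of _ _ "(r, y)"]) auto
    qed
    show "(\<lambda>(r,y). r + of_int m * y) ` ((J \<inter> R) \<times> oint K) \<subseteq> J"
    proof (clarsimp)
      fix r y assume "r \<in> J" "y \<in> oint K"
      then show "r + of_int m * y \<in> J" using m omoduleD(2)[OF J(1)] by blast
    qed
  qed
  then have "{J. omodule K J \<and> J \<subseteq> oint K \<and> of_int m \<in> J} \<subseteq>
    (\<lambda>A. (\<lambda>(r,y). r + of_int m * y) ` (A \<times> oint K)) ` Pow R"
    by blast
  then show ?thesis using R(1) by (auto intro: finite_subset)
qed

text \<open>
  Hurwitz's argument: scale \<open>I\<close> by an element of nearly minimal norm so that it contains \<open>fact M\<close>;
  only finitely many integral ideals do.
\<close>

lemma finite_class_representatives: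
  "\<exists>C. finite C \<and> C \<subseteq> fideals K \<and> (\<forall>I\<in>fideals K. \<exists>x\<in>K - {0}. \<exists>J\<in>C. I = smul x J)"
proof -
  obtain N :: "complex \<Rightarrow> rat" and M :: nat where N:
    "\<And>x y. x \<in> K \<Longrightarrow> y \<in> K \<Longrightarrow> N (x * y) = N x * N y"
    "\<And>x. x \<in> K \<Longrightarrow> x \<noteq> 0 \<Longrightarrow> N x > 0"
    "\<And>x. x \<in> oint K \<Longrightarrow> x \<noteq> 0 \<Longrightarrow> N x \<ge> 1" "M > 0"
    "\<And>x. x \<in> K \<Longrightarrow> \<exists>t w. 0 < t \<and> t \<le> M \<and> w \<in> oint K \<and> N (of_nat t * x - w) < 1 / 2"
    using ex_multiplicative_norm by metis
  define C where "C = {J \<in> fideals K. J \<subseteq> oint K \<and> of_int (fact M) \<in> J}"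
  have "finite C"
    by (rule finite_subset[OF _ finite_ideals_containing[of "fact M"]]) (auto simp: C_def fidealsD)
  moreover have "\<exists>x\<in>K - {0}. \<exists>J\<in>C. I = smul x J" if I: "I \<in> fideals K" for I
  proof -
    obtain d where d: "d \<in> oint K" "d \<noteq> 0" "\<forall>y\<in>I. d * y \<in> oint K"
      using fidealsD(4)[OF I] by auto
    have dK: "d \<in> K" using d oint_mem by auto
    obtain z where z: "z \<in> I" "z \<noteq> 0" using fidealsD(3)[OF I] by auto
    \<comment> \<open>The values \<open>N (d * y)\<close> are rationals not smaller than 1 and need
      not attain a minimum at sight. The least power of 2 that exceeds one of them yields a
      \<open>y\<close> whose norm is minimal up to a factor of 2.\<close>
    define P where "P = (\<lambda>n::nat. \<exists>y\<in>I. y \<noteq> 0 \<and> N (d * y) < 2 ^ n)"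
    have "\<exists>n. P n"
    proof -
      obtain k :: nat where "N (d * z) < of_nat k" using reals_Archimedean2 by blast
      also have "of_nat k < (2 ^ k :: rat)" using less_exp[of k]
        by (metis of_nat_less_iff of_nat_numeral of_nat_power)
      finally show ?thesis using z P_def by blast
    qed
    define n where "n = (LEAST n. P n)"
    have PL: "P n" unfolding n_def using \<open>\<exists>n. P n\<close> by (rule LeastI_ex)
    have "n > 0"
    proof (rule ccontr)
      assume "\<not> n > 0"
      then obtain y where "y \<in> I" "y \<noteq> 0" "N (d * y) < 1" using PL unfolding P_def by auto
      then show False using N(3)[of "d * y"] d by auto
    qed
    obtain y where y: "y \<in> I" "y \<noteq> 0" "N (d * y) < 2 ^ n" using PL unfolding P_def by auto
    have min: "N (d * v) \<ge> N (d * y) / 2" if "v \<in> I" "v \<noteq> 0" for v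
    proof -
      have "\<not> P (n - 1)" using not_less_Least[of "n - 1" P] \<open>n > 0\<close> unfolding n_def by simp
      then have "N (d * v) \<ge> 2 ^ (n - 1)" using that unfolding P_def by force
      moreover have "(2::rat) ^ n = 2 * 2 ^ (n - 1)" using \<open>n > 0\<close> by (cases n) auto
      ultimately show ?thesis using y(3) by simp
    qed
    have yK: "y \<in> K" using y fidealsD(2)[OF I] by auto
    have key: "\<exists>w\<in>oint K. of_int (fact M) * x = w * y" if x: "x \<in> I" for x
    proof -
      have xK: "x \<in> K" using x fidealsD(2)[OF I] by auto
      obtain t w where tw: "0 < t" "t \<le> M" "w \<in> oint K" "N (of_nat t * (x / y) - w) < 1 / 2"
        using N(5)[of "x / y"] xK yK by (auto intro: mems)
      \<comment> \<open>After multiplication by \<open>d\<close>, this element of \<open>I\<close>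
        has less than half the norm of \<open>y\<close>, which contradicts the choice of
        \<open>y\<close> unless it is zero.\<close>
      define v where "v = of_nat t * x - w * y"
      have vI: "v \<in> I" unfolding v_def
        using x y tw fidealsD(1)[OF I] by (intro omoduleD(5) omoduleD(3)) (auto intro: oint_closed)
      have "v = 0"
      proof (rule ccontr)
        assume "v \<noteq> 0"
        have "d * v = (of_nat t * (x / y) - w) * (d * y)" using y(2) by (simp add: v_def field_simps)
        then have "N (d * v) = N (of_nat t * (x / y) - w) * N (d * y)"
          using N(1)[of "of_nat t * (x / y) - w" "d * y"] xK yK dK oint_mem[OF tw(3)]
          by (metis mult_mem diff_mem divide_mem of_nat_mem)
        also have "\<dots> < 1 / 2 * N (d * y)"
          using tw(4) N(2)[of "d * y"] y(2) yK dK d(2) by (intro mult_strict_right_mono) (auto intro: mems)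
        finally show False using min[OF vI \<open>v \<noteq> 0\<close>] by simp
      qed
      then have eq: "of_nat t * x = w * y" by (simp add: v_def)
      have "t dvd fact M" using tw by (intro dvd_fact) auto
      then obtain k :: nat where k: "fact M = t * k" by blast
      have "of_int (fact M) = (of_nat (fact M) :: complex)" by simp
      then have "of_int (fact M) * x = of_nat k * w * y" unfolding k using eq by (simp add: algebra_simps)
      then show ?thesis using tw(3) by (intro bexI[of _ "of_nat k * w"]) (auto intro: oint_closed)
    qed
    define s where "s = of_int (fact M) / y"
    have s: "s \<in> K" "s \<noteq> 0" using yK y(2) by (auto simp: s_def intro!: mems simp del: of_int_fact)
    have "smul s I \<subseteq> oint K"
    proof clarify
      fix x assume "x \<in> I"
      then obtain w where "w \<in> oint K" "of_int (fact M) * x = w * y" using key by blast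
      then show "s * x \<in> oint K" using y(2) by (simp add: s_def)
    qed
    moreover have "of_int (fact M) \<in> smul s I" using y by (auto simp: s_def intro!: image_eqI[of _ _ y])
    ultimately have "smul s I \<in> C" unfolding C_def using smul_fideal[OF I s] by auto
    moreover have "I = smul (inverse s) (smul s I)" using s by (simp add: smul_smul)
    ultimately show ?thesis using s by (intro bexI[of _ "inverse s"]) (auto intro: mems)
  qed
  ultimately show ?thesis by (intro exI[of _ C]) (auto simp: C_def)
qed

text \<open>If \<open>m\<close> lies in \<open>I\<close>, then \<open>I\<close> is generated by the
  remainders modulo \<open>m\<close> that belong to \<open>I\<close> and by \<open>m\<close> times
  generators of the ring of integers.\<close>

lemma integral_ideal_finitely_generated:
  assumes "omodule K I" "I \<subseteq> oint K"
  shows "\<exists>S. finite S \<and> S \<subseteq> I \<and> I \<subseteq> zmod.span S"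
proof (cases "I = {0}")
  case False
  then obtain x where "x \<in> I" "x \<noteq> 0" using omoduleD(1)[OF assms(1)] by auto
  then obtain m :: int where m: "m > 0" "of_int m \<in> I" using nonzero_int_in_ideal[OF assms] by blast
  obtain R where R: "finite R" "R \<subseteq> oint K" "\<And>x. x \<in> oint K \<Longrightarrow> \<exists>r\<in>R. \<exists>y\<in>oint K. x = r + of_int m * y"
    using ex_finite_quotient[of m] m(1) by auto
  obtain S where S: "finite S" "S \<subseteq> oint K" "oint K \<subseteq> zmod.span S" using ex_finite_generators by blast
  have mI: "of_int m * y \<in> I" if "y \<in> oint K" for y
    using omoduleD(3)[OF assms(1) that m(2)] by (simp add: mult.commute)
  let ?T = "(I \<inter> R) \<union> smul (of_int m) S"
  have "x \<in> zmod.span ?T" if x: "x \<in> I" for x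
  proof -
    obtain r y where ry: "r \<in> R" "y \<in> oint K" "x = r + of_int m * y" using R(3) x assms(2) by blast
    have "r \<in> I" using omoduleD(5)[OF assms(1) x mI[OF ry(2)]] ry(3) by simp
    moreover have "of_int m * y \<in> zmod.span (smul (of_int m) S)"
    proof -
      have "y \<in> zmod.span S" using S(3) ry(2) by blast
      then show ?thesis
      proof (induction rule: zmod.span_induct_alt)
        case (step k s z)
        have "of_int m * (of_int k * s + z) = of_int k * (of_int m * s) + of_int m * z" by (simp add: algebra_simps)
        then show ?case
          using step zmod.span_add zmod.span_scale zmod.span_base[OF imageI[OF step(1)]] by metis
      qed (simp add: zmod.span_zero)
    qed
    ultimately show ?thesis unfolding ry(3) using ry(1)
      by (intro zmod.span_add) (auto intro: zmod.span_base subsetD[OF zmod.span_mono, rotated])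
  qed
  moreover have "?T \<subseteq> I" using mI S(2) by auto
  ultimately show ?thesis using R(1) S(1) by (intro exI[of _ ?T]) auto
qed (auto intro: exI[of _ "{}"])

lemma fideal_finitely_generated:
  assumes "I \<in> fideals K"
  shows "\<exists>S. finite S \<and> S \<subseteq> I \<and> I \<subseteq> zmod.span S"
proof -
  obtain d where d: "d \<in> oint K" "d \<noteq> 0" "\<forall>y\<in>I. d * y \<in> oint K"
    using fidealsD(4)[OF assms] by auto
  obtain S where S: "finite S" "S \<subseteq> smul d I" "smul d I \<subseteq> zmod.span S"
    using integral_ideal_finitely_generated[OF smul_omodule[OF fidealsD(1)[OF assms]]] d by (metis image_subsetI)
  have "x \<in> zmod.span (smul (inverse d) S)" if "x \<in> I" for x
  proof -
    have "inverse d * y \<in> zmod.span (smul (inverse d) S)" if "y \<in> zmod.span S" for y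
      using that
    proof (induction rule: zmod.span_induct_alt)
      case (step k s z)
      have "inverse d * (of_int k * s + z) = of_int k * (inverse d * s) + inverse d * z" by (simp add: algebra_simps)
      then show ?case
        using step zmod.span_add zmod.span_scale zmod.span_base[OF imageI[OF step(1)]] by metis
    qed (simp add: zmod.span_zero)
    then have "inverse d * (d * x) \<in> zmod.span (smul (inverse d) S)" using S(3) that by blast
    moreover have "inverse d * (d * x) = x" using d(2) by simp
    ultimately show ?thesis by metis
  qed
  moreover have "smul (inverse d) S \<subseteq> I"
  proof -
    have "smul (inverse d) S \<subseteq> smul (inverse d) (smul d I)" using S(2) by blast
    then show ?thesis using d(2) by (simp add: smul_smul)
  qed
  ultimately show ?thesis using S(1) by (intro exI[of _ "smul (inverse d) S"]) auto
qed

text \<open>A finite generating set of \<open>I\<close> feeds the determinant argument of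
  \<open>algebraic_int_stable\<close>.\<close>

lemma stable_imp_integral:
  assumes "I \<in> fideals K" "x \<in> K" "\<And>y. y \<in> I \<Longrightarrow> x * y \<in> I"
  shows "x \<in> oint K"
proof -
  obtain S where S: "finite S" "S \<subseteq> I" "I \<subseteq> zmod.span S" using fideal_finitely_generated[OF assms(1)] by blast
  have "\<exists>s\<in>S. s \<noteq> 0"
  proof (rule ccontr)
    assume "\<not> (\<exists>s\<in>S. s \<noteq> 0)"
    then have "zmod.span S \<subseteq> {0}" by (intro zmod.span_minimal) (auto simp: zmod.subspace_def)
    then show False using fidealsD(3)[OF assms(1)] S(3) by auto
  qed
  then obtain s where "s \<in> S" "s \<noteq> 0" by blast
  then show ?thesis unfolding oint_def using assms S by (auto intro!: algebraic_int_stable[of S s x])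
qed

end

section \<open>Invertibility of ideals and unique factorization\<close>

context complex_number_field
begin

text \<open>Nakayama's lemma by elimination: \<open>a\<close> stays congruent to 1 modulo
  \<open>D\<close>, and multiplication by \<open>a - f v v\<close> expresses the generator
  \<open>v\<close> through the others, so that the number of generators drops by one.\<close>

lemma nakayama_aux:
  assumes D: "omodule K D" "D \<subseteq> oint K" and "finite S"
    and "a \<in> oint K" "1 - a \<in> D"
    and "\<forall>s\<in>S. \<exists>e. (\<forall>t. e t \<in> D) \<and> a * s = (\<Sum>t\<in>S. e t * t)"
  shows "\<exists>a'\<in>oint K. 1 - a' \<in> D \<and> (\<forall>s\<in>S. a' * s = 0)"
  using assms(3-6)
proof (induction S arbitrary: a)
  case (insert v S)
  obtain f where f: "\<And>s t. s \<in> insert v S \<Longrightarrow> f s t \<in> D"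
    "\<And>s. s \<in> insert v S \<Longrightarrow> a * s = f s v * v + (\<Sum>t\<in>S. f s t * t)"
  proof -
    have "\<forall>s. \<exists>e. s \<in> insert v S \<longrightarrow> (\<forall>t. e t \<in> D) \<and> a * s = e v * v + (\<Sum>t\<in>S. e t * t)"
      using insert.prems(3) unfolding sum.insert[OF insert.hyps] by blast
    from choice[OF this] show ?thesis using that by blast
  qed
  define a1 where "a1 = a - f v v"
  have a1: "a1 \<in> oint K" using insert.prems(1) f(1)[of v v] D(2) by (auto simp: a1_def intro: oint_closed)
  have a1v: "a1 * v = (\<Sum>t\<in>S. f v t * t)"
    using f(2)[of v] by (simp add: a1_def algebra_simps)
  have one: "1 - a1 * b \<in> D" if "1 - a1 \<in> D" "1 - b \<in> D" "b \<in> oint K" for a1 b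
  proof -
    have "1 - a1 * b = b * (1 - a1) + (1 - b)" by (simp add: algebra_simps)
    then show ?thesis using that D(1) omoduleD(2,3) by metis
  qed
  have "(1 - a) + f v v \<in> D" by (rule omoduleD(2)[OF D(1) insert.prems(2) f(1)[OF insertI1]])
  then have a1D: "1 - a1 \<in> D" by (simp add: a1_def algebra_simps)
  have "\<forall>s\<in>S. \<exists>e. (\<forall>t. e t \<in> D) \<and> (a1 * a) * s = (\<Sum>t\<in>S. e t * t)"
  proof
    fix s assume s: "s \<in> S"
    define e where "e t = (if t \<in> S then f s v * f v t + a1 * f s t else 0)" for t
    have "e t \<in> D" for t
    proof (cases "t \<in> S")
      case True
      have "f s v \<in> oint K" using f(1)[of s v] s D(2) by auto
      then show ?thesis using True f(1)[of v t] f(1)[of s t] s a1 omoduleD(2,3)[OF D(1)] by (simp add: e_def)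
    qed (simp add: e_def omoduleD(1)[OF D(1)])
    moreover have "(a1 * a) * s = (\<Sum>t\<in>S. e t * t)"
    proof -
      have "(a1 * a) * s = f s v * (a1 * v) + a1 * (\<Sum>t\<in>S. f s t * t)"
        using f(2)[of s] s by (simp add: algebra_simps)
      also have "\<dots> = (\<Sum>t\<in>S. e t * t)"
        unfolding a1v sum_distrib_left sum.distrib[symmetric]
        by (intro sum.cong) (auto simp: e_def algebra_simps)
      finally show ?thesis .
    qed
    ultimately show "\<exists>e. (\<forall>t. e t \<in> D) \<and> (a1 * a) * s = (\<Sum>t\<in>S. e t * t)" by blast
  qed
  then obtain b where b: "b \<in> oint K" "1 - b \<in> D" "\<forall>s\<in>S. b * s = 0"
    using insert.IH[of "a1 * a"] one[OF a1D insert.prems(2,1)] oint_closed(6)[OF a1 insert.prems(1)] by auto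
  have "a1 * b * v = (\<Sum>t\<in>S. f v t * (b * t))"
    using arg_cong[OF a1v, of "\<lambda>x. b * x"] by (simp add: sum_distrib_left algebra_simps)
  also have "\<dots> = 0" using b(3) by (intro sum.neutral) auto
  finally have "a1 * b * v = 0" .
  moreover have "\<forall>s\<in>S. a1 * b * s = 0" using b(3) by (simp add: mult.assoc)
  ultimately have "\<forall>s\<in>insert v S. a1 * b * s = 0" by blast
  then show ?case using one[OF a1D b(2,1)] oint_closed(6)[OF a1 b(1)] by blast
qed (auto intro: oint_closed)

lemma imul_span_coefficients:
  assumes "omodule K D" "D \<subseteq> oint K" "finite S" "x \<in> imul D (zmod.span S)"
  shows "\<exists>e. (\<forall>t. e t \<in> D) \<and> x = (\<Sum>t\<in>S. e t * t)"
  using assms(4)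
proof induction
  case (prod i j)
  then obtain u where "j = (\<Sum>t\<in>S. of_int (u t) * t)"
    unfolding zmod.span_finite[OF assms(3)] by auto
  then have "i * j = (\<Sum>t\<in>S. (of_int (u t) * i) * t)"
    by (simp add: sum_distrib_left algebra_simps)
  then show ?case using omoduleD(6)[OF assms(1) prod(1)]
    by (intro exI[of _ "\<lambda>t. of_int (u t) * i"]) auto
next
  case (sum x y)
  then obtain e f where "\<forall>t. e t \<in> D" "x = (\<Sum>t\<in>S. e t * t)" "\<forall>t. f t \<in> D" "y = (\<Sum>t\<in>S. f t * t)" by blast
  then show ?case using omoduleD(2)[OF assms(1)]
    by (intro exI[of _ "\<lambda>t. e t + f t"]) (auto simp: sum.distrib distrib_right)
qed

text \<open>Serves in \<open>ex_principal_power\<close>, at a stage where ideals cannot be cancelled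
  yet.\<close>

lemma nakayama:
  assumes "omodule K D" "D \<subseteq> oint K" "J \<in> fideals K" "J \<subseteq> imul D J"
  shows "1 \<in> D"
proof -
  obtain S where S: "finite S" "S \<subseteq> J" "J \<subseteq> zmod.span S" using fideal_finitely_generated[OF assms(3)] by blast
  have "\<forall>s\<in>S. \<exists>e. (\<forall>t. e t \<in> D) \<and> 1 * s = (\<Sum>t\<in>S. e t * t)"
  proof
    fix s assume "s \<in> S"
    then have "s \<in> imul D (zmod.span S)" using S(2,3) assms(4) imul_mono[OF order_refl S(3)] by blast
    then show "\<exists>e. (\<forall>t. e t \<in> D) \<and> 1 * s = (\<Sum>t\<in>S. e t * t)"
      using imul_span_coefficients[OF assms(1,2) S(1)] by simp
  qed
  then obtain a where a: "a \<in> oint K" "1 - a \<in> D" "\<forall>s\<in>S. a * s = 0"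
    using nakayama_aux[OF assms(1,2) S(1) oint_closed(2)] omoduleD(1)[OF assms(1)] by auto
  obtain x where x: "x \<in> J" "x \<noteq> 0" using fidealsD(3)[OF assms(3)] by blast
  have "a = 0"
  proof (rule ccontr)
    assume "a \<noteq> 0"
    then have "S \<subseteq> {0}" using a(3) by auto
    then have "zmod.span S \<subseteq> {0}" by (intro zmod.span_minimal) (auto simp: zmod.subspace_def)
    then show False using x S(3) by auto
  qed
  then show ?thesis using a(2) by simp
qed

primrec ipow :: "complex set \<Rightarrow> nat \<Rightarrow> complex set" where
  "ipow I 0 = oint K"
| "ipow I (Suc n) = imul I (ipow I n)"

lemma ipow_fideal: "I \<in> fideals K \<Longrightarrow> ipow I n \<in> fideals K"
  by (induction n) (auto intro: oint_fideal imul_fideal)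

lemma ipow_add: "I \<in> fideals K \<Longrightarrow> ipow I (m + n) = imul (ipow I m) (ipow I n)"
proof (induction m)
  case 0
  then show ?case using imul_oint[OF fidealsD(1)[OF ipow_fideal]] by (simp add: imul_commute[of "oint K"])
qed (simp add: imul_assoc)

lemma oint_ideal_eqI: "omodule K I \<Longrightarrow> I \<subseteq> oint K \<Longrightarrow> 1 \<in> I \<Longrightarrow> I = oint K"
  using omoduleD(3)[of I _ 1] by auto

text \<open>As there are finitely many classes, two powers of \<open>I\<close> are proportional, say
  \<open>I ^ n = y * I ^ m\<close> with \<open>m < n\<close>. For \<open>B = I ^ (n - m) / y\<close>
  this says \<open>B * I ^ m = I ^ m\<close>. Cancellation is replaced by two facts: elements that
  stabilise \<open>I ^ m\<close> are integral, so \<open>B \<subseteq> oint K\<close>, and then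
  Nakayama's lemma gives \<open>1 \<in> B\<close>.\<close>

lemma ex_principal_power:
  assumes I: "I \<in> fideals K"
  shows "\<exists>k>0. \<exists>x\<in>K - {0}. ipow I k = smul x (oint K)"
proof -
  obtain C where C: "finite C" "\<And>I. I \<in> fideals K \<Longrightarrow> \<exists>x\<in>K - {0}. \<exists>J\<in>C. I = smul x J"
    using finite_class_representatives by metis
  have "\<forall>n. \<exists>x J. x \<in> K - {0} \<and> J \<in> C \<and> ipow I n = smul x J" 
  proof
    fix n
    obtain x J where "x \<in> K - {0}" "J \<in> C" "ipow I n = smul x J" using C(2)[OF ipow_fideal[OF I, of n]] by blast
    then have "x \<in> K - {0} \<and> J \<in> C \<and> ipow I n = smul x J" by (intro conjI)
    then show "\<exists>x J. x \<in> K - {0} \<and> J \<in> C \<and> ipow I n = smul x J" by (intro exI)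
  qed
  then obtain x J where xJ: "\<And>n. x n \<in> K - {0}" "\<And>n. J n \<in> C" "\<And>n. ipow I n = smul (x n) (J n)" by metis
  have "\<not> inj J"
  proof
    assume "inj J"
    moreover have "finite (range J)" using C(1) xJ(2) by (intro finite_subset[of "range J" C]) auto
    ultimately show False using finite_imageD[of J UNIV] by simp
  qed
  then obtain m n where mn: "m < n" "J m = J n"
    unfolding inj_on_def by (metis linorder_neqE_nat)
  define y where "y = x n / x m"
  have y: "y \<in> K" "y \<noteq> 0" using xJ(1)[of m] xJ(1)[of n] by (auto simp: y_def intro: mems)
  have eq: "ipow I n = smul y (ipow I m)"
    unfolding xJ(3) smul_smul mn(2) using xJ(1)[of m] by (simp add: y_def)
  define B where "B = smul (inverse y) (ipow I (n - m))"
  have B: "B \<in> fideals K" unfolding B_def using y by (intro smul_fideal ipow_fideal I) (auto intro: mems)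
  have "imul B (ipow I m) = smul (inverse y) (ipow I (n - m + m))"
    unfolding B_def smul_imul ipow_add[OF I] ..
  also have "\<dots> = ipow I m" using mn(1) y(2) by (simp add: eq smul_smul)
  finally have Bm: "imul B (ipow I m) = ipow I m" .
  have "B \<subseteq> oint K"
  proof
    fix b assume "b \<in> B"
    moreover have "b * z \<in> ipow I m" if "z \<in> ipow I m" for z
      using imul.prod[OF \<open>b \<in> B\<close> that] Bm by simp
    ultimately show "b \<in> oint K"
      using stable_imp_integral[OF ipow_fideal[OF I]] fidealsD(2)[OF B] by blast
  qed
  then have "B = oint K"
    using nakayama[OF fidealsD(1)[OF B] _ ipow_fideal[OF I]] Bm oint_ideal_eqI[OF fidealsD(1)[OF B]] by blast
  then have "ipow I (n - m) = smul y (oint K)"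
    using y(2) unfolding B_def by (metis smul_inverse)
  then show ?thesis using mn(1) y by (intro exI[of _ "n - m"]) auto
qed

text \<open>If \<open>I ^ k\<close> is generated by \<open>x\<close>, then
  \<open>I ^ (k - 1) / x\<close> is an inverse of \<open>I\<close>.\<close>

lemma ex_inverse_ideal:
  assumes I: "I \<in> fideals K"
  shows "\<exists>J\<in>fideals K. imul J I = oint K"
proof -
  obtain k x where k: "k > 0" "x \<in> K - {0}" "ipow I k = smul x (oint K)" using ex_principal_power[OF I] by blast
  then obtain j where j: "k = Suc j" by (cases k) auto
  have "imul (smul (inverse x) (ipow I j)) I = smul (inverse x) (ipow I k)"
    by (simp add: smul_imul j imul_commute[of I])
  also have "\<dots> = oint K" using k by (simp add: smul_smul)
  finally show ?thesis
    using k by (intro bexI[of _ "smul (inverse x) (ipow I j)"] smul_fideal ipow_fideal I) (auto intro: mems)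
qed

sublocale ideals: comm_group "ideal_group K"
proof (rule comm_groupI)
  show "\<exists>y\<in>carrier (ideal_group K). y \<otimes>\<^bsub>ideal_group K\<^esub> x = \<one>\<^bsub>ideal_group K\<^esub>"
    if "x \<in> carrier (ideal_group K)" for x
    using ex_inverse_ideal that by (simp add: ideal_group_def)
  show "x \<otimes>\<^bsub>ideal_group K\<^esub> y = y \<otimes>\<^bsub>ideal_group K\<^esub> x" for x y
    by (simp add: ideal_group_def imul_commute)
qed (auto simp: ideal_group_def imul_assoc imul_commute[of "oint K"] imul_oint fidealsD
    intro: imul_fideal oint_fideal)

lemma ideals_simps:
  "carrier (ideal_group K) = fideals K" "x \<otimes>\<^bsub>ideal_group K\<^esub> y = imul x y" "\<one>\<^bsub>ideal_group K\<^esub> = oint K"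
  by (auto simp: ideal_group_def)

lemma ideals_pow: "I [^]\<^bsub>ideal_group K\<^esub> (n::nat) = ipow I n"
  by (induction n) (simp_all add: ideals_simps imul_commute ideals.nat_pow_Suc)

lemma imul_oint_left: "I \<in> fideals K \<Longrightarrow> imul (oint K) I = I"
  using imul_oint[OF fidealsD(1)] imul_commute by metis

lemma imul_cancel:
  assumes "I \<in> fideals K" "J \<in> fideals K" "L \<in> fideals K" "imul I J = imul I L" shows "J = L"
  using ideals.l_cancel[of I J L] assms by (simp add: ideals_simps)

lemma imul_integral_subset: "omodule K J \<Longrightarrow> I \<subseteq> oint K \<Longrightarrow> imul I J \<subseteq> J"
  by (intro imul_least) (auto intro: omoduleD)

lemma to_contain_is_to_divide:
  assumes "I \<in> fideals K" "J \<in> fideals K" "I \<subseteq> J"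
  shows "\<exists>L\<in>fideals K. L \<subseteq> oint K \<and> I = imul J L"
proof -
  obtain J' where J': "J' \<in> fideals K" "imul J' J = oint K" using ex_inverse_ideal[OF assms(2)] by blast
  have "imul J' I \<subseteq> oint K" using imul_mono[OF order_refl assms(3)] J'(2) by blast
  moreover have "imul J (imul J' I) = I"
    using J'(2) by (metis imul_assoc imul_commute imul_oint_left[OF assms(1)])
  ultimately show ?thesis using imul_fideal[OF J'(1) assms(1)] by metis
qed

lemma finite_over_ideals:
  assumes "I \<in> fideals K" "I \<subseteq> oint K"
  shows "finite {J. omodule K J \<and> J \<subseteq> oint K \<and> I \<subseteq> J}"
proof -
  obtain x where "x \<in> I" "x \<noteq> 0" using fidealsD(3)[OF assms(1)] by blast
  then obtain m :: int where "m > 0" "of_int m \<in> I" using nonzero_int_in_ideal[OF fidealsD(1)[OF assms(1)] assms(2)] by blast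
  then show ?thesis by (intro finite_subset[OF _ finite_ideals_containing[of m]]) auto
qed

lemma primeD:
  assumes "P \<in> prime_ideals K"
  shows "P \<in> fideals K" "P \<subseteq> oint K" "1 \<notin> P" "omodule K P"
    "x \<in> oint K \<Longrightarrow> y \<in> oint K \<Longrightarrow> x * y \<in> P \<Longrightarrow> x \<in> P \<or> y \<in> P"
  using assms fidealsD(1) unfolding prime_ideals_def by blast+

lemma prime_contains_imul:
  assumes P: "P \<in> prime_ideals K" and "A \<subseteq> oint K" "B \<subseteq> oint K" "imul A B \<subseteq> P"
  shows "A \<subseteq> P \<or> B \<subseteq> P"
proof (rule ccontr)
  assume "\<not> (A \<subseteq> P \<or> B \<subseteq> P)"
  then obtain a b where "a \<in> A" "a \<notin> P" "b \<in> B" "b \<notin> P" by blast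
  then show False using primeD(5)[OF P, of a b] imul.prod[of a A b B] assms by blast
qed

text \<open>Take an ideal maximal among those that contain \<open>I\<close> but not 1; it exists
  because only finitely many ideals contain \<open>I\<close>. Maximality makes every integer outside
  it invertible modulo it.\<close>

lemma proper_in_prime:
  assumes "I \<in> fideals K" "I \<subseteq> oint K" "1 \<notin> I"
  shows "\<exists>P\<in>prime_ideals K. I \<subseteq> P"
proof -
  let ?A = "{J. omodule K J \<and> J \<subseteq> oint K \<and> I \<subseteq> J \<and> 1 \<notin> J}"
  have "finite ?A" by (rule finite_subset[OF _ finite_over_ideals[OF assms(1,2)]]) auto
  moreover have "?A \<noteq> {}" using assms fidealsD(1) by blast
  ultimately have "\<exists>P\<in>?A. \<forall>J\<in>?A. P \<subseteq> J \<longrightarrow> P = J"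
    by (rule finite_has_maximal)
  then obtain P where P1: "P \<in> ?A" and P2: "\<forall>J\<in>?A. P \<subseteq> J \<longrightarrow> P = J" ..
  note P = P1 sym[OF mp[OF bspec[OF P2]]]
  obtain z where z: "z \<in> I" "z \<noteq> 0" using fidealsD(3)[OF assms(1)] by blast
  have gen: "\<exists>p\<in>P. \<exists>a\<in>oint K. p + a * x = 1" if x: "x \<in> oint K" "x \<notin> P" for x
  proof -
    define J where "J = {p + a * x | p a. p \<in> P \<and> a \<in> oint K}"
    have "omodule K J"
      unfolding omodule_def
    proof (intro conjI ballI)
      show "0 \<in> J" unfolding J_def using P(1) omoduleD(1) oint_closed(1) by force
      show "u + v \<in> J" if uv: "u \<in> J" "v \<in> J" for u v
      proof -
        obtain p a q b where "p \<in> P" "a \<in> oint K" "u = p + a * x" "q \<in> P" "b \<in> oint K" "v = q + b * x"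
          using uv unfolding J_def by blast
        then have "u + v = (p + q) + (a + b) * x" "p + q \<in> P" "a + b \<in> oint K"
          using P(1) omoduleD(2)[of P] oint_closed(3) by (auto simp: algebra_simps)
        then show ?thesis unfolding J_def by blast
      qed
      show "e * u \<in> J" if eu: "e \<in> oint K" "u \<in> J" for e u
      proof -
        obtain p a where "p \<in> P" "a \<in> oint K" "u = p + a * x" using eu unfolding J_def by blast
        then have "e * u = e * p + (e * a) * x" "e * p \<in> P" "e * a \<in> oint K"
          using P(1) eu(1) omoduleD(3)[of P] oint_closed(6) by (auto simp: algebra_simps)
        then show ?thesis unfolding J_def by blast
      qed
    qed
    moreover have "J \<subseteq> oint K" unfolding J_def using P(1) x(1) oint_closed(3,6) by blast
    moreover have PJ: "P \<subseteq> J" unfolding J_def using oint_closed(1) by force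
    moreover have "x \<in> J"
    proof -
      have "x = 0 + 1 * x" by simp
      then show ?thesis unfolding J_def using P(1) omoduleD(1) oint_closed(2) by blast
    qed
    ultimately have "1 \<in> J" using P(1) P(2)[of J] x(2) by blast
    then show ?thesis unfolding J_def by force
  qed
  have "P \<in> prime_ideals K"
    unfolding prime_ideals_def
  proof (intro CollectI conjI ballI impI)
    show "P \<in> fideals K" using P(1) z integral_fideal by blast
    fix x y assume xy: "x \<in> oint K" "y \<in> oint K" "x * y \<in> P"
    show "x \<in> P \<or> y \<in> P"
    proof (rule ccontr)
      assume "\<not> (x \<in> P \<or> y \<in> P)"
      then obtain p a q b where pq: "p \<in> P" "a \<in> oint K" "p + a * x = 1" "q \<in> P" "b \<in> oint K" "q + b * y = 1"
        using gen xy by metis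
      have mod: "omodule K P" using P(1) by blast
      have "1 = (p + a * x) * (q + b * y)" using pq by simp
      also have "\<dots> = (q + b * y) * p + (a * x) * q + (a * b) * (x * y)" by (simp add: algebra_simps)
      also have "\<dots> = 1 * p + (a * x) * q + (a * b) * (x * y)" using pq(6) by simp
      also have "\<dots> \<in> P"
        using pq(1,2,4,5) xy oint_closed(2,6) omoduleD(2,3)[OF mod] by metis
      finally show False using P(1) by blast
    qed
  qed (use P(1) in auto)
  then show ?thesis using P(1) by blast
qed

text \<open>Containment is divisibility, so \<open>P = Q * L\<close>, and \<open>Q\<close> or
  \<open>L\<close> lies in \<open>P\<close>. In the second case \<open>L = Q * L\<close>, and
  cancelling \<open>L\<close> would give \<open>Q = oint K\<close>.\<close>

lemma prime_subset_eq:
  assumes "P \<in> prime_ideals K" "Q \<in> prime_ideals K" "P \<subseteq> Q"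
  shows "P = Q"
proof -
  note P = primeD[OF assms(1)] and Q = primeD[OF assms(2)]
  obtain L where L: "L \<in> fideals K" "L \<subseteq> oint K" "P = imul Q L"
    using to_contain_is_to_divide[OF P(1) Q(1) assms(3)] by blast
  have "\<not> L \<subseteq> P"
  proof
    assume "L \<subseteq> P"
    then have "L = imul Q L" using L(3) imul_integral_subset[OF fidealsD(1)[OF L(1)] Q(2)] by blast
    then have "imul L (oint K) = imul L Q"
      using imul_oint[OF fidealsD(1)[OF L(1)]] by (simp add: imul_commute)
    then have "oint K = Q" using imul_cancel[OF L(1) oint_fideal Q(1)] by blast
    then show False using Q(3) oint_closed(2) by blast
  qed
  then show ?thesis using prime_contains_imul[OF assms(1) Q(2) L(2)] L(3) assms(3) by blast
qed

abbreviation iprod :: "complex set list \<Rightarrow> complex set" where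
  "iprod Ps \<equiv> foldr imul Ps (oint K)"

lemma iprod_fideal: "set Ps \<subseteq> fideals K \<Longrightarrow> iprod Ps \<in> fideals K"
  by (induction Ps) (auto intro: oint_fideal imul_fideal)

lemma iprod_append: "set Ps \<subseteq> fideals K \<Longrightarrow> set Qs \<subseteq> fideals K \<Longrightarrow> iprod (Ps @ Qs) = imul (iprod Ps) (iprod Qs)"
  by (induction Ps) (auto simp: imul_assoc imul_oint_left iprod_fideal)

lemma primes_fideals: "prime_ideals K \<subseteq> fideals K"
  using primeD(1) by blast

lemma iprod_integral: "set Ps \<subseteq> prime_ideals K \<Longrightarrow> iprod Ps \<subseteq> oint K"
proof (induction Ps)
  case (Cons P Ps)
  then have "imul P (iprod Ps) \<subseteq> iprod Ps"
    using iprod_fideal[of Ps] primes_fideals by (intro imul_integral_subset fidealsD(1) primeD(2)) auto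
  then show ?case using Cons by auto
qed auto

text \<open>Induction on the finite number of ideals above \<open>I\<close>: splitting off a prime
  factor leaves a strictly larger ideal.\<close>

lemma ex_prime_factorization:
  assumes "I \<in> fideals K" "I \<subseteq> oint K"
  shows "\<exists>Ps. set Ps \<subseteq> prime_ideals K \<and> iprod Ps = I"
  using assms
proof (induction "card {J. omodule K J \<and> J \<subseteq> oint K \<and> I \<subseteq> J}" arbitrary: I rule: less_induct)
  case less
  show ?case
  proof (cases "1 \<in> I")
    case True
    then have "I = oint K" using less.prems oint_ideal_eqI[OF fidealsD(1)] by blast
    then show ?thesis by (intro exI[of _ "[]"]) auto
  next
    case False
    then obtain P where P: "P \<in> prime_ideals K" "I \<subseteq> P" using proper_in_prime less.prems by blast
    then obtain L where L: "L \<in> fideals K" "L \<subseteq> oint K" "I = imul P L"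
      using to_contain_is_to_divide[OF less.prems(1) primeD(1)[OF P(1)] P(2)] by blast
    have IL: "I \<subseteq> L" using imul_integral_subset[OF fidealsD(1)[OF L(1)] primeD(2)[OF P(1)]] L(3) by simp
    have "I \<noteq> L"
    proof
      assume "I = L"
      then have "imul L (oint K) = imul L P"
        using L(3) imul_oint[OF fidealsD(1)[OF L(1)]] by (simp add: imul_commute)
      then have "oint K = P" using imul_cancel[OF L(1) oint_fideal primeD(1)[OF P(1)]] by blast
      then show False using primeD(3)[OF P(1)] oint_closed(2) by blast
    qed
    then have "{J. omodule K J \<and> J \<subseteq> oint K \<and> L \<subseteq> J} \<subset> {J. omodule K J \<and> J \<subseteq> oint K \<and> I \<subseteq> J}"
      using IL less.prems fidealsD(1) by blast
    then have "card {J. omodule K J \<and> J \<subseteq> oint K \<and> L \<subseteq> J} < card {J. omodule K J \<and> J \<subseteq> oint K \<and> I \<subseteq> J}"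
      using finite_over_ideals[OF less.prems] by (rule psubset_card_mono[rotated])
    then obtain Ps where "set Ps \<subseteq> prime_ideals K" "iprod Ps = L" using less.hyps L by blast
    then show ?thesis using P L by (intro exI[of _ "P # Ps"]) auto
  qed
qed

lemma prime_contains_iprod:
  assumes "P \<in> prime_ideals K" "set Ps \<subseteq> prime_ideals K" "iprod Ps \<subseteq> P"
  shows "P \<in> set Ps"
  using assms(2,3)
proof (induction Ps)
  case Nil then show ?case using primeD(3)[OF assms(1)] oint_closed(2) by auto
next
  case (Cons Q Ps)
  then have "Q \<subseteq> P \<or> iprod Ps \<subseteq> P"
    using prime_contains_imul[OF assms(1), of Q "iprod Ps"] iprod_integral primeD(2) by auto
  then show ?case using Cons prime_subset_eq[of Q P] assms(1) by auto
qed

lemma iprod_mem_subset: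
  assumes "set Ps \<subseteq> prime_ideals K" "P \<in> set Ps" shows "iprod Ps \<subseteq> P"
  using assms
proof (induction Ps)
  case (Cons Q Ps)
  note Q = primeD[of Q]
  show ?case
  proof (cases "P = Q")
    case True
    then show ?thesis using imul_integral_subset[of P "iprod Ps"] Cons.prems primeD(4)[of P] iprod_integral[of Ps]
      by (simp add: imul_commute)
  next
    case False
    then have "iprod Ps \<subseteq> P" using Cons by auto
    moreover have "imul Q (iprod Ps) \<subseteq> iprod Ps"
      using Cons.prems iprod_fideal[of Ps] primes_fideals by (intro imul_integral_subset fidealsD(1) Q(2)) auto
    ultimately show ?thesis by simp
  qed
qed simp

lemma iprod_remove1:
  "set Ps \<subseteq> fideals K \<Longrightarrow> P \<in> set Ps \<Longrightarrow> iprod Ps = imul P (iprod (remove1 P Ps))"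
proof (induction Ps)
  case (Cons Q Ps)
  show ?case
  proof (cases "P = Q")
    case False
    then have "iprod Ps = imul P (iprod (remove1 P Ps))" using Cons by auto
    then show ?thesis using False by (simp add: imul_assoc[symmetric] imul_commute)
  qed simp
qed simp

lemma prime_factorization_unique:
  "set Ps \<subseteq> prime_ideals K \<Longrightarrow> set Qs \<subseteq> prime_ideals K \<Longrightarrow> iprod Ps = iprod Qs \<Longrightarrow> mset Ps = mset Qs"
proof (induction Ps arbitrary: Qs)
  case Nil
  show ?case
  proof (cases Qs)
    case (Cons Q Qs')
    then have "oint K \<subseteq> Q" using iprod_mem_subset[of Qs Q] Nil by auto
    then show ?thesis using primeD(3)[of Q] Nil Cons oint_closed(2) by auto
  qed simp
next
  case (Cons P Ps)
  have P: "P \<in> prime_ideals K" using Cons.prems by simp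
  then have mem: "P \<in> set Qs" using prime_contains_iprod[OF P Cons.prems(2)] iprod_mem_subset[OF Cons.prems(1), of P] Cons.prems(3) by auto
  have sub: "set (remove1 P Qs) \<subseteq> prime_ideals K" using Cons.prems(2) set_remove1_subset by fastforce
  have "imul P (iprod Ps) = imul P (iprod (remove1 P Qs))"
    using Cons.prems(3) iprod_remove1[OF _ mem] Cons.prems(2) primes_fideals by auto
  then have "iprod Ps = iprod (remove1 P Qs)"
    by (rule imul_cancel[OF primeD(1)[OF P] iprod_fideal iprod_fideal, rotated 2])
      (use Cons.prems(1) sub primes_fideals in auto)
  then have "mset Ps = mset (remove1 P Qs)" using Cons sub by auto
  then show ?case using mem by simp
qed

text \<open>The choice of the list does not matter by \<open>prime_factorization_unique\<close>; the
  value has no meaning when \<open>I\<close> is not a product of primes.\<close>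

definition val :: "complex set \<Rightarrow> complex set \<Rightarrow> nat" where
  "val P I = count_list (SOME Ps. set Ps \<subseteq> prime_ideals K \<and> iprod Ps = I) P"

lemma val_eq:
  assumes "set Ps \<subseteq> prime_ideals K" "iprod Ps = I"
  shows "val P I = count_list Ps P"
proof -
  let ?Qs = "SOME Ps. set Ps \<subseteq> prime_ideals K \<and> iprod Ps = I"
  have "set ?Qs \<subseteq> prime_ideals K \<and> iprod ?Qs = I"
    by (rule someI[of _ Ps]) (use assms in auto)
  then have "mset ?Qs = mset Ps" using prime_factorization_unique assms by blast
  then show ?thesis unfolding val_def by (metis count_mset)
qed

lemma val_oint: "val P (oint K) = 0"
  using val_eq[of "[]"] by simp

lemma val_imul:
  assumes "I \<in> fideals K" "I \<subseteq> oint K" "J \<in> fideals K" "J \<subseteq> oint K"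
  shows "val P (imul I J) = val P I + val P J"
proof -
  obtain Ps Qs where PQ: "set Ps \<subseteq> prime_ideals K" "iprod Ps = I" "set Qs \<subseteq> prime_ideals K" "iprod Qs = J"
    using ex_prime_factorization assms by metis
  have "iprod (Ps @ Qs) = imul I J"
    using iprod_append[of Ps Qs] PQ primes_fideals by auto
  then show ?thesis using val_eq[of "Ps @ Qs"] val_eq[OF PQ(1,2)] val_eq[OF PQ(3,4)] PQ by auto
qed

lemma val_prime: "P \<in> prime_ideals K \<Longrightarrow> Q \<in> prime_ideals K \<Longrightarrow> val P Q = (if P = Q then 1 else 0)"
  using val_eq[of "[Q]" Q P] imul_oint[OF fidealsD(1)[OF primeD(1)]] by simp

lemma val_pos_iff:
  assumes "P \<in> prime_ideals K" "I \<in> fideals K" "I \<subseteq> oint K"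
  shows "val P I > 0 \<longleftrightarrow> I \<subseteq> P"
proof -
  obtain Ps where Ps: "set Ps \<subseteq> prime_ideals K" "iprod Ps = I" using ex_prime_factorization assms by metis
  show ?thesis
    using val_eq[OF Ps, of P] prime_contains_iprod[OF assms(1) Ps(1)] iprod_mem_subset[OF Ps(1), of P] Ps(2)
    by (metis count_list_0_iff neq0_conv)
qed

end

section \<open>Kummer theory without roots of unity\<close>

context complex_subfield
begin

definition poly_over :: "complex poly \<Rightarrow> bool" where
  "poly_over p \<longleftrightarrow> (\<forall>i. Polynomial.coeff p i \<in> K)"

lemma poly_over_diff: "poly_over p \<Longrightarrow> poly_over q \<Longrightarrow> poly_over (p - q)"
  by (auto simp: poly_over_def intro: mems)

lemma poly_over_mult: "poly_over p \<Longrightarrow> poly_over q \<Longrightarrow> poly_over (p * q)"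
  by (auto simp: poly_over_def coeff_mult intro: mems)

lemma poly_over_monom: "c \<in> K \<Longrightarrow> poly_over (Polynomial.monom c n)"
  by (auto simp: poly_over_def intro: mems)

lemma poly_over_1: "poly_over 1"
  by (auto simp: poly_over_def coeff_1 intro: mems)

text \<open>Long division, one leading term at a time. By minimality of \<open>f\<close> a nonzero
  remainder never has smaller degree than \<open>f\<close>, so the division ends at zero.\<close>

lemma minimal_degree_dvd:
  assumes f: "poly_over f" "lead_coeff f = 1" "poly f y = 0"
    and min: "\<And>p. poly_over p \<Longrightarrow> p \<noteq> 0 \<Longrightarrow> poly p y = 0 \<Longrightarrow> Polynomial.degree f \<le> Polynomial.degree p"
    and p: "poly_over p" "poly p y = 0"
  shows "f dvd p"
  using p
proof (induction "Polynomial.degree p" arbitrary: p rule: less_induct)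
  case less
  show ?case
  proof (cases "p = 0")
    case False
    have le: "Polynomial.degree f \<le> Polynomial.degree p" using min less.prems False by blast
    define g where "g = Polynomial.monom (lead_coeff p) (Polynomial.degree p - Polynomial.degree f) * f"
    have f0: "f \<noteq> 0" using f(2) by auto
    have lp: "lead_coeff p \<noteq> 0" using False by simp
    have g0: "Polynomial.monom (lead_coeff p) (Polynomial.degree p - Polynomial.degree f) \<noteq> 0"
      using lp by (simp add: monom_eq_0_iff)
    have dg: "Polynomial.degree g = Polynomial.degree p"
      unfolding g_def using degree_mult_eq[OF g0 f0] degree_monom_eq[OF lp] le by simp
    have lg: "lead_coeff g = lead_coeff p"
      unfolding g_def lead_coeff_mult by (simp add: f(2) degree_monom_eq[OF lp])
    have pg: "poly_over g"
      unfolding g_def using less.prems(1) by (intro poly_over_mult poly_over_monom f(1)) (auto simp: poly_over_def)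
    have "p - g = 0 \<or> Polynomial.degree (p - g) < Polynomial.degree p"
      using dg lg by (metis coeff_diff degree_diff_le_max diff_self eq_zero_or_degree_less max.idem)
    moreover have "poly (p - g) y = 0" using less.prems f(3) by (simp add: g_def)
    ultimately have "f dvd p - g"
      using less.hyps[of "p - g"] poly_over_diff[OF less.prems(1) pg] by auto
    moreover have "f dvd g" by (simp add: g_def)
    ultimately show ?thesis by (metis diff_add_cancel dvd_add)
  qed simp
qed

lemma ex_minimal_polynomial:
  assumes "poly_over p" "p \<noteq> 0" "poly p y = 0"
  obtains f where "poly_over f" "lead_coeff f = 1" "poly f y = 0"
    "\<And>q. poly_over q \<Longrightarrow> q \<noteq> 0 \<Longrightarrow> poly q y = 0 \<Longrightarrow> Polynomial.degree f \<le> Polynomial.degree q"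
proof -
  define Q where "Q = (\<lambda>n. \<exists>q. poly_over q \<and> q \<noteq> 0 \<and> poly q y = 0 \<and> Polynomial.degree q = n)"
  have "Q (LEAST n. Q n)" by (rule LeastI_ex) (use assms Q_def in blast)
  then obtain q where q: "poly_over q" "q \<noteq> 0" "poly q y = 0" "Polynomial.degree q = (LEAST n. Q n)"
    unfolding Q_def by blast
  show ?thesis
  proof (rule that[of "Polynomial.smult (inverse (lead_coeff q)) q"])
    show "poly_over (Polynomial.smult (inverse (lead_coeff q)) q)"
      using q(1) by (auto simp: poly_over_def intro: mems)
    fix r assume r: "poly_over r" "r \<noteq> 0" "poly r y = 0"
    then have "Q (Polynomial.degree r)" unfolding Q_def by blast
    then show "Polynomial.degree (Polynomial.smult (inverse (lead_coeff q)) q) \<le> Polynomial.degree r"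
      using q(2,4) by (simp add: Least_le)
  next
    show "lead_coeff (Polynomial.smult (inverse (lead_coeff q)) q) = 1"
      using q(2) by (simp add: leading_coeff_0_iff)
    show "poly (Polynomial.smult (inverse (lead_coeff q)) q) y = 0" using q(3) by simp
  qed
qed

end

lemma complex_poly_linear_factors:
  fixes f :: "complex poly"
  assumes "lead_coeff f = 1"
  obtains as where "f = (\<Prod>a\<leftarrow>as. [:- a, 1:])" "length as = Polynomial.degree f"
proof -
  obtain as where "Polynomial.smult (lead_coeff f) (\<Prod>a\<leftarrow>as. [:- a, 1:]) = f" "length as = Polynomial.degree f"
    using fundamental_theorem_algebra_factorized[of f] by blast
  then show ?thesis using that[of as] assms by simp
qed

context complex_subfield
begin

text \<open>With \<open>a * r + b * l = 1\<close>, possibly with negative exponents,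
  \<open>x = (x ^ r) ^ a * (x ^ b) ^ l = (c ^ a * x ^ b) ^ l\<close>.\<close>

lemma ex_power_root:
  assumes x: "x \<in> K" and c: "c \<in> K" "c ^ l = x ^ r" and "Rings.coprime r l" "x \<noteq> 0"
  shows "\<exists>z\<in>K. x = z ^ l"
proof -
  obtain a b :: int where ab: "a * int r + b * int l = 1"
    using assms(4) by (metis bezout_int coprime_iff_gcd_eq_1 coprime_int_iff)
  have "c \<noteq> 0 \<or> l = 0" using c(2) assms(5) by (cases l) auto
  show ?thesis
  proof (cases "c = 0")
    case True
    then have "l = 0" using c(2) assms(5) by (cases l) auto
    then have "r = 1" using assms(4) by simp
    then show ?thesis using c(2) \<open>l = 0\<close> by (intro bexI[of _ 1]) (auto intro: mems)
  next
    case False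
    have "(c powi a * x powi b) ^ l = (c powi a) ^ l * (x powi b) ^ l" by (rule power_mult_distrib)
    also have "\<dots> = (c ^ l) powi a * x powi (b * int l)"
      by (simp only: power_int_power power_int_power' mult.commute)
    also have "\<dots> = x powi (a * int r) * x powi (b * int l)"
      by (simp only: c(2) power_int_power power_int_power' mult.commute)
    also have "\<dots> = x powi 1" using assms(5) ab by (simp flip: power_int_add)
    finally have "x = (c powi a * x powi b) ^ l" by simp
    moreover have "c powi a * x powi b \<in> K" using c x by (intro mems) auto
    ultimately show ?thesis by blast
  qed
qed

text \<open>The minimal polynomial of \<open>y\<close> divides \<open>X ^ l - x\<close>, so its
  constant term \<open>c\<close> is, up to sign, a product of \<open>r\<close> of the
  \<open>l\<close>-th roots of \<open>x\<close>. Then \<open>c ^ l\<close> is \<open>x ^ r\<close>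
  up to sign, and since \<open>0 < r < l\<close> makes \<open>r\<close> coprime to \<open>l\<close>,
  \<open>x\<close> would be an \<open>l\<close>-th power by \<open>ex_power_root\<close>.\<close>

lemma root_degree:
  assumes l: "prime l" and x: "x \<in> K" "\<not> (\<exists>z\<in>K. x = z ^ l)" and y: "y ^ l = x"
    and p: "poly_over p" "p \<noteq> 0" "poly p y = 0"
  shows "l \<le> Polynomial.degree p"
proof (rule ccontr)
  assume less: "\<not> l \<le> Polynomial.degree p"
  obtain f where f: "poly_over f" "lead_coeff f = 1" "poly f y = 0"
    "\<And>q. poly_over q \<Longrightarrow> q \<noteq> 0 \<Longrightarrow> poly q y = 0 \<Longrightarrow> Polynomial.degree f \<le> Polynomial.degree q"
    using ex_minimal_polynomial[OF p] by blast
  define r where "r = Polynomial.degree f"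
  have rl: "r < l" using f(4)[OF p] less by (simp add: r_def)
  have "r \<noteq> 0"
  proof
    assume "r = 0"
    then obtain a where "f = [:a:]" using degree_eq_zeroE unfolding r_def by blast
    then show False using f(2,3) by auto
  qed
  have l0: "l > 0" using l prime_gt_0_nat by blast
  let ?g = "Polynomial.monom 1 l - Polynomial.monom x 0 :: complex poly"
  have dvd: "f dvd ?g"
    using l0 x y by (intro minimal_degree_dvd[OF f]) (auto intro!: poly_over_diff poly_over_monom mems simp: poly_monom)
  obtain as where as: "f = (\<Prod>a\<leftarrow>as. [:- a, 1:])" "length as = r"
    using complex_poly_linear_factors[OF f(2)] unfolding r_def by blast
  have roots: "a ^ l = x" if "a \<in> set as" for a
  proof -
    have "poly f a = 0" using that by (auto simp: as(1) poly_prod_list prod_list_zero_iff)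
    then have "poly ?g a = 0" using dvd by (elim dvdE) (simp only: poly_mult mult_zero_left)
    then show ?thesis by (simp add: poly_monom)
  qed
  define c where "c = poly f 0"
  have "c = prod_list (map uminus as)" unfolding c_def as(1) by (induction as) auto
  also have "\<dots> ^ l = (prod_list (map (\<lambda>a. (- 1) ^ l * x) as))"
    using roots
  proof (induction as)
    case (Cons a as)
    have "(- a) ^ l = (- 1) ^ l * x" using Cons.prems[of a] power_minus[of a l] by simp
    moreover have "prod_list (map uminus as) ^ l = (\<Prod>a\<leftarrow>as. (- 1) ^ l * x)"
      using Cons by simp
    ultimately show ?case by (simp only: list.map prod_list.Cons power_mult_distrib)
  qed simp
  also have "\<dots> = ((- 1) ^ l * x) ^ r" using as(2) by (simp add: map_replicate_const)
  finally have "c ^ l = ((- 1) ^ l * x) ^ r" .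
  \<comment> \<open>Attaching the sign \<open>(- 1) ^ r\<close> to \<open>c\<close> makes all signs
    cancel, for \<open>l = 2\<close> as well as for odd \<open>l\<close>.\<close>
  then have "((- 1) ^ r * c) ^ l = (((- 1) ^ r) ^ l * ((- 1) ^ l) ^ r) * x ^ r"
    by (simp only: power_mult_distrib mult.assoc)
  also have "((- 1) ^ r) ^ l * ((- 1) ^ l) ^ r = (1 :: complex)"
    by (simp add: power_mult[symmetric] mult.commute[of l r] power_mult_distrib[symmetric])
  finally have "((- 1) ^ r * c) ^ l = x ^ r" by simp
  moreover have "(- 1) ^ r * c \<in> K"
    using f(1) unfolding c_def poly_over_def by (auto simp: poly_0_coeff_0 intro!: mems)
  moreover have "Rings.coprime r l"
    using l rl \<open>r \<noteq> 0\<close> by (metis coprime_commute dvd_imp_le gcd_nat.strict_iff_not linorder_not_le neq0_conv prime_imp_coprime)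
  moreover have "x \<noteq> 0" using x(2) zero_mem l0 by (metis power_0_left not_gr_zero)
  ultimately show False using ex_power_root[of x "(- 1) ^ r * c" l r] x by blast
qed

end

section \<open>The complex numbers as a ring record, and the degree of a radical extension\<close>

definition complex_ring :: "complex ring" where
  "complex_ring = \<lparr>carrier = UNIV, mult = (*), one = 1, zero = 0, add = (+)\<rparr>"

lemma complex_ring_simps [simp]:
  "carrier complex_ring = UNIV" "x \<otimes>\<^bsub>complex_ring\<^esub> y = x * y" "x \<oplus>\<^bsub>complex_ring\<^esub> y = x + y"
  "\<one>\<^bsub>complex_ring\<^esub> = 1" "\<zero>\<^bsub>complex_ring\<^esub> = 0"
  by (auto simp: complex_ring_def)

lemma complex_field: "field complex_ring"
proof (rule cring.cring_fieldI)
  show cr: "cring complex_ring"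
  proof (intro cringI abelian_groupI comm_monoidI)
    show "\<exists>y\<in>carrier complex_ring. y \<oplus>\<^bsub>complex_ring\<^esub> x = \<zero>\<^bsub>complex_ring\<^esub>" for x
      by (auto intro: exI[of _ "- x"])
  qed (auto simp: algebra_simps)
  have "x \<in> Units complex_ring" if "x \<noteq> 0" for x
    unfolding Units_def using that by (auto intro!: exI[of _ "inverse x"])
  moreover have "0 \<notin> Units complex_ring" unfolding Units_def by auto
  ultimately show "Units complex_ring = carrier complex_ring - {\<zero>\<^bsub>complex_ring\<^esub>}" by auto
qed

interpretation complex_ring: domain complex_ring
  using complex_field by (simp add: field_def)

lemma complex_ring_pow [simp]: "x [^]\<^bsub>complex_ring\<^esub> (n::nat) = x ^ n"
  by (induction n) (simp_all add: mult.commute)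

lemma complex_ring_minus [simp]: "\<ominus>\<^bsub>complex_ring\<^esub> x = - x"
  by (rule complex_ring.minus_equality) auto

lemma complex_ring_inv [simp]: "x \<noteq> 0 \<Longrightarrow> inv\<^bsub>complex_ring\<^esub> x = inverse x"
  by (rule complex_ring.comm_inv_char) auto

lemma subfield_complex_iff: "subfield K complex_ring \<longleftrightarrow> complex_subfield K"
proof
  assume K: "subfield K complex_ring"
  note E = subringE[OF subfieldE(1)[OF K]]
  show "complex_subfield K"
  proof
    show "1 \<in> K" using E(3) by simp
    show "x * y \<in> K" if "x \<in> K" "y \<in> K" for x y using E(6) that by simp
    show "x - y \<in> K" if "x \<in> K" "y \<in> K" for x y using E(7)[OF that(1) E(5)[OF that(2)]] by simp
    show "inverse x \<in> K" if "x \<in> K" for x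
    proof (cases "x = 0")
      case False
      then show ?thesis using complex_ring.subfield_m_inv(1)[OF K, of x] that by simp
    qed (use that in auto)
  qed
next
  assume "complex_subfield K"
  then interpret complex_subfield K .
  show "subfield K complex_ring"
  proof (rule field.subfieldI'[OF complex_field])
    show "subring K complex_ring"
      by (rule complex_ring.subringI) (auto intro: mems)
  qed (auto intro: mems)
qed

lemma complex_ring_eval: "complex_ring.eval p z = poly (Poly (rev p)) z"
proof (induction p)
  case (Cons a p)
  then show ?case by (simp add: Poly_append poly_monom mult.commute)
qed simp

context complex_subfield
begin

lemma poly_over_Poly: "set p \<subseteq> K \<Longrightarrow> poly_over (Poly p)"
  unfolding poly_over_def by (auto simp: nth_default_def intro: mems)

lemma ex_list_of_poly_over:
  assumes "poly_over p" "Polynomial.degree p < n"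
  shows "\<exists>ks. set ks \<subseteq> K \<and> length ks = n \<and> Poly (rev ks) = p"
proof -
  let ?ks = "map (Polynomial.coeff p) [0..<n]"
  have "Poly ?ks = p"
    by (rule poly_eqI) (use assms(2) in \<open>auto simp: nth_default_def coeff_eq_0\<close>)
  then show ?thesis using assms(1)
    by (intro exI[of _ "rev ?ks"]) (auto simp: poly_over_def)
qed

lemma subfield_K: "subfield K complex_ring"
  using subfield_complex_iff complex_subfield_axioms by blast

text \<open>The minimal polynomial of \<open>y\<close> has degree exactly \<open>l\<close>: at most
  because of \<open>X ^ l - x\<close>, at least by \<open>root_degree\<close>. The field is then
  described twice, by polynomials in \<open>y\<close> of degree below \<open>l\<close> and as the
  smallest field containing \<open>K\<close> and \<open>y\<close>.\<close>

lemma root_extension: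
  assumes l: "prime l" and x: "x \<in> K" "\<not> (\<exists>z\<in>K. x = z ^ l)" and y: "y ^ l = x"
  obtains E where "complex_subfield E" "K \<subseteq> E" "y \<in> E" "complex_ring.dimension l K E"
    "\<And>w. w \<in> E \<longleftrightarrow> (\<exists>g. poly_over g \<and> Polynomial.degree g < l \<and> poly g y = w)"
    "\<And>A. complex_subfield A \<Longrightarrow> K \<subseteq> A \<Longrightarrow> y \<in> A \<Longrightarrow> E \<subseteq> A"
proof -
  have l0: "l > 0" using l prime_gt_0_nat by blast
  note K = subfield_K
  \<comment> \<open>The polynomial \<open>X ^ l - x\<close> as a list with the leading coefficient
    first.\<close>
  let ?p = "1 # replicate (l - 1) 0 @ [- x]"
  have p_poly: "polynomial\<^bsub>complex_ring\<^esub> K ?p"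
    unfolding polynomial_def using x(1) by (auto intro: mems)
  then have pc: "?p \<in> carrier (K[X]\<^bsub>complex_ring\<^esub>)" by (simp add: univ_poly_carrier)
  have "Poly (rev ?p) = Polynomial.monom 1 l - [:x:]"
    by (rule poly_eqI) (use l0 in \<open>auto simp: nth_default_def nth_Cons coeff_pCons nth_append split: nat.splits\<close>)
  then have ev: "complex_ring.eval ?p y = \<zero>\<^bsub>complex_ring\<^esub>"
    unfolding complex_ring_eval by (simp add: poly_monom y)
  have alg: "(complex_ring.algebraic over K) y"
    by (rule complex_ring.algebraicI[OF pc _ ev]) simp
  note I = complex_ring.IrrE[OF K _ alg]
  let ?I = "complex_ring.Irr K y"
  have I_poly: "polynomial\<^bsub>complex_ring\<^esub> K ?I" using I(1) by (simp add: univ_poly_carrier)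
  have I_ne: "?I \<noteq> []" using complex_ring.pirreducibleE(1)[OF subfieldE(1)[OF K] I(1,2)] by simp
  have I_set: "set ?I \<subseteq> K" using complex_ring.polynomial_incl[OF I_poly] .
  have len: "length ?I \<le> l + 1"
  proof -
    have "?I pdivides\<^bsub>complex_ring\<^esub> ?p"
      using complex_ring.Irr_minimal[OF K _ alg pc ev] by simp
    then have "length ?I - 1 \<le> length ?p - 1"
      using complex_ring.pdivides_imp_degree_le[OF subfieldE(1)[OF K] I(1) pc] by simp
    then show ?thesis using l0 by simp
  qed
  have "Poly (rev ?I) \<noteq> 0"
  proof -
    have "Polynomial.coeff (Poly (rev ?I)) (length ?I - 1) = hd ?I"
      using I_ne by (simp add: nth_default_def rev_nth hd_conv_nth)
    also have "hd ?I = 1" using I(3) by simp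
    finally show ?thesis by (metis coeff_0 zero_neq_one)
  qed
  moreover have "poly (Poly (rev ?I)) y = 0" using I(4) unfolding complex_ring_eval by simp
  ultimately have "l \<le> Polynomial.degree (Poly (rev ?I))"
    using root_degree[OF l x y poly_over_Poly] I_set by auto
  also have "\<dots> \<le> length ?I - 1"
    using I_ne by (intro degree_le) (auto simp: coeff_Poly_eq nth_default_def)
  finally have dI: "length ?I - 1 = l" using len by simp
  define E where "E = complex_ring.simple_extension K y"
  have indep: "complex_ring.independent K (complex_ring.exp_base y l)"
    using complex_ring.exp_base_independent[OF K _ alg] dI by simp
  have span: "complex_ring.Span K (complex_ring.exp_base y l) = E"
    using complex_ring.Span_exp_base[OF K _ alg] dI by (simp add: E_def)
  have len_eb: "length (complex_ring.exp_base y l) = l" by (simp add: complex_ring.exp_base_def)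
  have E_iff: "w \<in> E \<longleftrightarrow> (\<exists>g. poly_over g \<and> Polynomial.degree g < l \<and> poly g y = w)" for w
  proof -
    have "w \<in> E \<longleftrightarrow> (\<exists>Ks. set Ks \<subseteq> K \<and> length Ks = l \<and> w = complex_ring.eval Ks y)"
      unfolding span[symmetric]
      using complex_ring.Span_mem_iff_length_version[OF K, of "complex_ring.exp_base y l" w] len_eb
        complex_ring.combine_eq_eval[of _ y]
      by (metis complex_ring_simps(1) subset_UNIV)
    also have "\<dots> \<longleftrightarrow> (\<exists>g. poly_over g \<and> Polynomial.degree g < l \<and> poly g y = w)"
    proof
      assume "\<exists>Ks. set Ks \<subseteq> K \<and> length Ks = l \<and> w = complex_ring.eval Ks y"
      then obtain Ks where Ks: "set Ks \<subseteq> K" "length Ks = l" "w = complex_ring.eval Ks y" by blast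
      have "Polynomial.degree (Poly (rev Ks)) < l"
        using Ks(2) l0 degree_Poly[of "rev Ks"]
        by (metis coeff_Poly_eq leading_coeff_0_iff length_rev linorder_not_le nth_default_beyond degree_0)
      then show "\<exists>g. poly_over g \<and> Polynomial.degree g < l \<and> poly g y = w"
        using Ks poly_over_Poly[of "rev Ks"] by (intro exI[of _ "Poly (rev Ks)"]) (simp add: complex_ring_eval)
    next
      assume "\<exists>g. poly_over g \<and> Polynomial.degree g < l \<and> poly g y = w"
      then show "\<exists>Ks. set Ks \<subseteq> K \<and> length Ks = l \<and> w = complex_ring.eval Ks y"
        unfolding complex_ring_eval using ex_list_of_poly_over by metis
    qed
    finally show ?thesis .
  qed
  show ?thesis
  proof (rule that[of E])
    show "complex_subfield E"
      unfolding subfield_complex_iff[symmetric] E_def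
      using complex_ring.simple_extension_is_subfield[OF K, of y] alg by simp
    show "K \<subseteq> E" unfolding E_def by (rule complex_ring.simple_extension_incl) auto
    show "y \<in> E" unfolding E_def by (rule complex_ring.simple_extension_mem[OF subfieldE(1)[OF K]]) simp
    show "complex_ring.dimension l K E"
      using complex_ring.dimension_independent[OF indep] span len_eb by simp
    show "E \<subseteq> A" if "complex_subfield A" "K \<subseteq> A" "y \<in> A" for A
      unfolding E_def using that subfield_complex_iff
      by (intro complex_ring.simple_extension_subring_incl subfieldE(1)) auto
  qed (rule E_iff)
qed

end

section \<open>Conjugates of a radical, and elements that become powers in a radical
  extension\<close>

context complex_subfield
begin

lemma poly_over_power: "poly_over p \<Longrightarrow> poly_over (p ^ n)"
  by (induction n) (auto intro: poly_over_mult poly_over_1)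

lemma poly_over_pcompose: "poly_over p \<Longrightarrow> poly_over q \<Longrightarrow> poly_over (pcompose p q)"
proof (induction p)
  case (pCons a p)
  have "a \<in> K" using pCons.prems(1) unfolding poly_over_def by (metis coeff_pCons_0)
  moreover have "poly_over p" using pCons.prems(1) unfolding poly_over_def by (metis coeff_pCons_Suc)
  ultimately have "poly_over [:a:]" "poly_over (q * pcompose p q)"
    using pCons by (auto simp: poly_over_def[of "[:a:]"] coeff_pCons split: nat.splits intro: mems poly_over_mult)
  then show ?case unfolding pcompose_pCons poly_over_def by (auto intro: mems)
qed (auto simp: poly_over_def intro: mems)

text \<open>By \<open>root_degree\<close>, \<open>X ^ l - x\<close> is the minimal polynomial of
  \<open>y\<close>, so every relation of \<open>y\<close> over \<open>K\<close> also holds for the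
  other roots. This plays the part of the automorphisms of a splitting field.\<close>

lemma conjugate_root:
  assumes l: "prime l" and x: "x \<in> K" "\<not> (\<exists>z\<in>K. x = z ^ l)" and y: "y ^ l = x" "y' ^ l = x"
    and p: "poly_over p" "poly p y = 0"
  shows "poly p y' = 0"
proof -
  let ?f = "Polynomial.monom 1 l - [:x:] :: complex poly"
  have l0: "l > 0" using l prime_gt_0_nat by blast
  have f: "poly_over ?f"
    using x by (intro poly_over_diff poly_over_monom) (auto simp: poly_over_def coeff_pCons intro: mems split: nat.splits)
  have deg: "Polynomial.degree ?f = l"
    unfolding diff_conv_add_uminus using l0 by (subst degree_add_eq_left) (auto simp: degree_monom_eq)
  have "?f dvd p"
  proof (rule minimal_degree_dvd[OF f])
    show "lead_coeff ?f = 1" using l0 unfolding deg by (cases l) (auto simp: coeff_pCons)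
    show "poly ?f y = 0" using y by (simp add: poly_monom)
    show "Polynomial.degree ?f \<le> Polynomial.degree q" if "poly_over q" "q \<noteq> 0" "poly q y = 0" for q
      unfolding deg using root_degree[OF l x y(1)] that by blast
  qed (use p in auto)
  then obtain q where "p = ?f * q" by (elim dvdE)
  then have "poly p y' = (y' ^ l - x) * poly q y'" by (simp add: poly_monom)
  then show ?thesis using y(2) by simp
qed

text \<open>Put \<open>v = g(y) / y ^ i\<close>. Since \<open>v ^ l = z\<close> is not an
  \<open>l\<close>-th power in \<open>K\<close>, the field \<open>K(v)\<close> has degree
  \<open>l\<close> and equals \<open>K(y)\<close>. So the conjugates of \<open>v\<close>, obtained
  by replacing \<open>y\<close> by its conjugates, are distinct and hence all the
  \<open>l\<close>-th roots of \<open>z\<close>; their sum is 0. On the other hand that sum is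
  \<open>l\<close> times the coefficient of index \<open>i\<close>, because
  \<open>y ^ k / y ^ i\<close> has trace 0 for \<open>k \<noteq> i\<close>.\<close>

lemma power_coefficient_zero:
  assumes l: "prime l" and x: "x \<in> K" "\<not> (\<exists>z\<in>K. x = z ^ l)" and y: "y ^ l = x"
    and g: "poly_over g" "Polynomial.degree g < l" and i: "i < l"
    and z: "(poly g y / y ^ i) ^ l = z" "z \<in> K" "\<not> (\<exists>u\<in>K. z = u ^ l)"
  shows "Polynomial.coeff g i = 0"
proof -
  have l0: "l > 0" and l1: "l > 1" using l prime_gt_0_nat prime_gt_1_nat by blast+
  have z0: "z \<noteq> 0" using z(3) zero_mem l0 by (metis power_0_left not_gr_zero)
  have x0: "x \<noteq> 0" using x(2) zero_mem l0 by (metis power_0_left not_gr_zero)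
  have y0: "y \<noteq> 0" using y x0 l0 by (metis power_0_left not_gr_zero)
  obtain E where E: "complex_subfield E" "K \<subseteq> E" "y \<in> E" "complex_ring.dimension l K E"
    "\<And>w. w \<in> E \<longleftrightarrow> (\<exists>g. poly_over g \<and> Polynomial.degree g < l \<and> poly g y = w)"
    using root_extension[OF l x y] by metis
  interpret E: complex_subfield E by (rule E(1))
  define v where "v = poly g y / y ^ i"
  have vE: "v \<in> E" unfolding v_def using E(3,5) g by (intro E.mems) auto
  obtain g' where g': "poly_over g'" "poly g' y = v" using E(5) vE by blast
  obtain E' where E': "complex_subfield E'" "K \<subseteq> E'" "v \<in> E'" "complex_ring.dimension l K E'"
    "\<And>w. w \<in> E' \<longleftrightarrow> (\<exists>g. poly_over g \<and> Polynomial.degree g < l \<and> poly g v = w)"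
    "\<And>A. complex_subfield A \<Longrightarrow> K \<subseteq> A \<Longrightarrow> v \<in> A \<Longrightarrow> E' \<subseteq> A"
    using root_extension[OF l z(2,3) z(1)[folded v_def]] by metis
  have "E' = E"
  proof -
    \<comment> \<open>A basis of \<open>K(v)\<close> is an independent family of length
      \<open>l\<close> in \<open>K(y)\<close>, whose dimension is also \<open>l\<close>, so it spans
      \<open>K(y)\<close>.\<close>
    obtain Us where Us: "complex_ring.independent K Us" "length Us = l" "complex_ring.Span K Us = E'"
      using complex_ring.exists_base[OF subfield_K E'(4)] by blast
    have "set Us \<subseteq> E'" using complex_ring.Span_base_incl[OF subfield_K, of Us] Us(3) by simp
    then have "set Us \<subseteq> E" using E'(6)[OF E(1,2) vE] by blast
    then show ?thesis
      using complex_ring.independent_length_eq_dimension[OF subfield_K E(4) Us(1)] Us by simp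
  qed
  \<comment> \<open>\<open>h\<close> recovers \<open>y\<close> from \<open>v\<close>, and therefore
    each conjugate of \<open>y\<close> from the matching conjugate of \<open>v\<close>; this is what
    makes the latter distinct.\<close>
  then obtain h where h: "poly_over h" "poly h v = y" using E'(5) E(3) by blast
  define \<zeta> where "\<zeta> j = cis (2 * pi * real j / real l)" for j
  have zeta_l: "\<zeta> j ^ l = 1" for j using l0 by (simp add: \<zeta>_def DeMoivre cis_multiple_2pi)
  have zeta_pow: "\<zeta> j = \<zeta> 1 ^ j" for j by (simp add: \<zeta>_def DeMoivre mult.commute)
  have zeta_bij: "bij_betw \<zeta> {..<l} {z. z ^ l = 1}"
    using bij_betw_roots_unity[OF l0] unfolding \<zeta>_def by simp
  define Y where "Y j = \<zeta> j * y" for j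
  have Y: "Y j ^ l = x" for j by (simp add: Y_def power_mult_distrib zeta_l y)
  have Y0: "Y j \<noteq> 0" for j using Y[of j] x0 l0 by (metis power_0_left not_gr_zero)
  define V where "V j = poly g' (Y j)" for j
  have h_V: "poly h (V j) = Y j" for j
  proof -
    have "poly (pcompose h g' - [:0, 1:]) (Y j) = 0"
    proof (rule conjugate_root[OF l x y Y])
      show "poly_over (pcompose h g' - [:0, 1:])"
        using h(1) g'(1) by (intro poly_over_diff poly_over_pcompose)
          (auto simp: poly_over_def coeff_pCons intro: mems split: nat.splits)
    qed (simp add: poly_pcompose g' h)
    then show ?thesis by (simp add: poly_pcompose V_def)
  qed
  have V_l: "V j ^ l = z" for j
  proof -
    have "poly (g' ^ l - [:z:]) (Y j) = 0"
    proof (rule conjugate_root[OF l x y Y])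
      show "poly_over (g' ^ l - [:z:])"
        using g'(1) z(2) by (intro poly_over_diff poly_over_power)
          (auto simp: poly_over_def coeff_pCons intro: mems split: nat.splits)
    qed (simp add: g' z(1)[folded v_def])
    then show ?thesis by (simp add: V_def)
  qed
  have V_eq: "V j * Y j ^ i = poly g (Y j)" for j
  proof -
    have "poly (g' * Polynomial.monom 1 i - g) (Y j) = 0"
    proof (rule conjugate_root[OF l x y Y])
      show "poly_over (g' * Polynomial.monom 1 i - g)"
        using g'(1) g(1) by (intro poly_over_diff poly_over_mult poly_over_monom) (auto intro: mems)
    qed (use y0 in \<open>simp add: g' v_def poly_monom\<close>)
    then show ?thesis by (simp add: V_def poly_monom)
  qed
  have inj: "inj_on V {..<l}"
  proof (rule inj_onI)
    fix j k assume jk: "j \<in> {..<l}" "k \<in> {..<l}" "V j = V k"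
    then have "Y j = Y k" using h_V by metis
    then have "\<zeta> j = \<zeta> k" using y0 by (simp add: Y_def)
    then show "j = k" using bij_betw_imp_inj_on[OF zeta_bij] jk(1,2) by (auto dest: inj_onD)
  qed
  have "V ` {..<l} = {w. w ^ l = z}"
  proof (rule card_subset_eq)
    show "finite {w. w ^ l = z}" using l0 by auto
    show "card (V ` {..<l}) = card {w. w ^ l = z}"
      using card_image[OF inj] card_nth_roots[OF z0 l0] by simp
  qed (use V_l in auto)
  then have "(\<Sum>j<l. V j) = (\<Sum>{w. w ^ l = z})"
    using sum.reindex[OF inj, of "\<lambda>w. w"] by simp
  also have "\<dots> = 0" using sum_nth_roots[OF l1] by blast
  finally have "(\<Sum>j<l. V j) = 0" .
  moreover have "(\<Sum>j<l. V j) = of_nat l * Polynomial.coeff g i"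
  proof -
    \<comment> \<open>Orthogonality of roots of unity: for \<open>k \<noteq> i\<close> the sum is a
      constant times the geometric sum of an \<open>l\<close>-th root of unity other than 1.\<close>
    have inner: "(\<Sum>j<l. Y j ^ k / Y j ^ i) = (if k = i then of_nat l else 0)" if k: "k < l" for k
    proof (cases "k = i")
      case True then show ?thesis using Y0 by simp
    next
      case False
      define q where "q = \<zeta> k / \<zeta> i"
      have zi: "\<zeta> i \<noteq> 0" by (simp add: \<zeta>_def)
      have "\<zeta> k \<noteq> \<zeta> i" using bij_betw_imp_inj_on[OF zeta_bij] k i False by (auto dest: inj_onD)
      then have q1: "q \<noteq> 1" using zi by (simp add: q_def)
      have ql: "q ^ l = 1" using zeta_l by (simp add: q_def power_divide)
      have "Y j ^ k / Y j ^ i = (y ^ k / y ^ i) * q ^ j" for j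
      proof -
        have "\<zeta> j ^ k = \<zeta> k ^ j" for k by (metis zeta_pow power_mult mult.commute)
        then show ?thesis by (simp add: Y_def q_def power_mult_distrib power_divide mult.commute)
      qed
      then have "(\<Sum>j<l. Y j ^ k / Y j ^ i) = (y ^ k / y ^ i) * (\<Sum>j<l. q ^ j)"
        by (simp add: sum_distrib_left)
      also have "(\<Sum>j<l. q ^ j) = 0" using geometric_sum[OF q1, of l] ql by simp
      finally show ?thesis using False by simp
    qed
    have "V j = (\<Sum>k<l. Polynomial.coeff g k * (Y j ^ k / Y j ^ i))" for j
    proof -
      have "V j = poly g (Y j) / Y j ^ i" using V_eq[of j] Y0[of j] by (simp add: field_simps)
      also have "poly g (Y j) = (\<Sum>k\<le>Polynomial.degree g. Polynomial.coeff g k * Y j ^ k)" by (rule poly_altdef)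
      also have "\<dots> = (\<Sum>k<l. Polynomial.coeff g k * Y j ^ k)"
        using g(2) by (intro sum.mono_neutral_left) (auto simp: coeff_eq_0)
      finally show ?thesis by (simp add: sum_divide_distrib)
    qed
    then have "(\<Sum>j<l. V j) = (\<Sum>j<l. \<Sum>k<l. Polynomial.coeff g k * (Y j ^ k / Y j ^ i))" by simp
    also have "\<dots> = (\<Sum>k<l. Polynomial.coeff g k * (\<Sum>j<l. Y j ^ k / Y j ^ i))"
      by (subst sum.swap) (simp add: sum_distrib_left)
    also have "\<dots> = (\<Sum>k<l. if k = i then of_nat l * Polynomial.coeff g k else 0)"
      by (intro sum.cong) (use inner in auto)
    also have "\<dots> = of_nat l * Polynomial.coeff g i" using i by simp
    finally show ?thesis .
  qed
  ultimately show ?thesis using l0 by simp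
qed

text \<open>If the power had none of these forms, then \<open>(poly g y / y ^ i) ^ l\<close> would
  not be an \<open>l\<close>-th power in \<open>K\<close> for any \<open>i < l\<close>, and
  \<open>power_coefficient_zero\<close> would annihilate every coefficient of
  \<open>g\<close>.\<close>

lemma power_in_root_extension:
  assumes l: "prime l" and x: "x \<in> K" "\<not> (\<exists>z\<in>K. x = z ^ l)" and y: "y ^ l = x"
    and w: "poly_over g" "Polynomial.degree g < l" "(poly g y) ^ l \<in> K" "poly g y \<noteq> 0"
  shows "\<exists>i<l. \<exists>u\<in>K. (poly g y) ^ l = x ^ i * u ^ l"
proof (rule ccontr)
  assume not: "\<not> ?thesis"
  have x0: "x \<noteq> 0" using x(2) zero_mem prime_gt_0_nat[OF l] by (metis power_0_left not_gr_zero)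
  have "Polynomial.coeff g i = 0" if i: "i < l" for i
  proof (rule power_coefficient_zero[OF l x y w(1,2) i])
    show "(poly g y / y ^ i) ^ l = (poly g y) ^ l / x ^ i"
      using y by (simp add: power_divide flip: power_mult) (simp add: power_mult mult.commute[of i])
    show "(poly g y) ^ l / x ^ i \<in> K" by (rule divide_mem[OF w(3) power_mem[OF x(1)]])
    show "\<not> (\<exists>u\<in>K. (poly g y) ^ l / x ^ i = u ^ l)"
      using not i x0 by (metis mult.commute nonzero_eq_divide_eq power_not_zero)
  qed
  then have "g = 0" using w(2) by (metis leading_coeff_0_iff)
  then show False using w(4) by simp
qed

end

text \<open>
  Without roots of unity in \<open>F\<close>: if \<open>y ^ l = x\<close> is not an \<open>l\<close>-th power in \<open>F\<close>, then \<open>F(y)\<close> has degree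
  \<open>l\<close> over \<open>F\<close>, and the elements of \<open>F\<close> which become \<open>l\<close>-th powers in \<open>F(y)\<close> are those of the form
  \<open>x ^ k * u ^ l\<close>. So passing from \<open>F\<close> to \<open>F(y)\<close> merges at most \<open>l\<close> classes at a time.
\<close>

lemma kummer_bound:
  assumes l: "prime l" and E: "complex_subfield E"
  shows "complex_subfield F \<Longrightarrow> F \<subseteq> E \<Longrightarrow> complex_ring.dimension n F E \<Longrightarrow>
    finite R \<Longrightarrow> R \<subseteq> F - {0} \<Longrightarrow> (\<And>r. r \<in> R \<Longrightarrow> \<exists>w\<in>E. r = w ^ l) \<Longrightarrow>
    (\<And>r s u. r \<in> R \<Longrightarrow> s \<in> R \<Longrightarrow> u \<in> F \<Longrightarrow> r = s * u ^ l \<Longrightarrow> r = s) \<Longrightarrow>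
    card R \<le> l ^ multiplicity l n"
proof (induction n arbitrary: F R rule: less_induct)
  case (less n)
  interpret F: complex_subfield F by (rule less.prems(1))
  interpret E: complex_subfield E by (rule E)
  have l0: "l > 0" and l1: "l > 1" using l prime_gt_0_nat prime_gt_1_nat by blast+
  show ?case
  proof (cases "\<forall>r\<in>R. \<exists>u\<in>F. r = u ^ l")
    case True
    have "r = s" if rs: "r \<in> R" "s \<in> R" for r s
    proof -
      obtain u v where uv: "u \<in> F" "r = u ^ l" "v \<in> F" "s = v ^ l" using True rs by meson
      have "v \<noteq> 0" using rs uv less.prems(5) l0 by auto
      then have "r = s * (u / v) ^ l" using uv by (simp add: power_divide)
      then show ?thesis using less.prems(7)[OF rs, of "u / v"] uv by (blast intro: F.mems)
    qed
    then have "card R \<le> 1" using card_le_Suc0_iff_eq[OF less.prems(4)] by auto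
    also have "1 \<le> l ^ multiplicity l n" using l0 by simp
    finally show ?thesis .
  next
    case False
    then obtain x where x: "x \<in> R" "x \<in> F" "\<not> (\<exists>u\<in>F. x = u ^ l)" using less.prems(5) by blast
    obtain y where y: "y \<in> E" "y ^ l = x" using less.prems(6)[OF x(1)] by metis
    obtain F1 where F1: "complex_subfield F1" "F \<subseteq> F1" "y \<in> F1" "complex_ring.dimension l F F1"
      "\<And>w. w \<in> F1 \<longleftrightarrow> (\<exists>g. F.poly_over g \<and> Polynomial.degree g < l \<and> poly g y = w)"
      "\<And>A. complex_subfield A \<Longrightarrow> F \<subseteq> A \<Longrightarrow> y \<in> A \<Longrightarrow> F1 \<subseteq> A"
      using F.root_extension[OF l x(2,3) y(2)] by metis
    interpret F1: complex_subfield F1 by (rule F1(1))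
    have F1E: "F1 \<subseteq> E" using F1(6)[OF E less.prems(2) y(1)] .
    have sF: "subfield F complex_ring" and sF1: "subfield F1 complex_ring" and sE: "subfield E complex_ring"
      using F.subfield_K F1.subfield_K E.subfield_K by auto
    obtain Us where Us: "complex_ring.independent F Us" "length Us = n" "complex_ring.Span F Us = E"
      using complex_ring.exists_base[OF sF less.prems(3)] by blast
    have UsE: "set Us \<subseteq> E" using complex_ring.Span_base_incl[OF sF, of Us] Us(3) by simp
    have "complex_ring.Span F1 Us = E"
    proof (rule antisym)
      have "subalgebra F1 E complex_ring"
      proof (rule subalgebra.intro)
        show "subgroup E (add_monoid complex_ring)"
          using subring.axioms(1)[OF subfieldE(1)[OF sE]] .
        show "subalgebra_axioms F1 E complex_ring"
          using F1E E.mult_mem by (auto simp: subalgebra_axioms_def)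
      qed
      then show "complex_ring.Span F1 Us \<subseteq> E" using complex_ring.subalgebra_Span_incl[OF sF1 _ UsE] by blast
      show "E \<subseteq> complex_ring.Span F1 Us"
      proof
        fix e assume "e \<in> E"
        then obtain Ks where "set Ks \<subseteq> F" "length Ks = length Us" "e = complex_ring.combine Ks Us"
          using complex_ring.Span_mem_iff_length_version[OF sF, of Us e] Us(3) by auto
        then show "e \<in> complex_ring.Span F1 Us"
          using complex_ring.Span_mem_iff_length_version[OF sF1, of Us e] F1(2) by auto
      qed
    qed
    then have "complex_ring.finite_dimension F1 E"
      using complex_ring.Span_finite_dimension[OF sF1, of Us] by simp
    then obtain m where m: "complex_ring.dimension m F1 E" by (auto simp: complex_ring.finite_dimension_def)
    have nm: "n = l * m"
      using complex_ring.telescopic_base[OF sF sF1 F1(4) m] less.prems(3) complex_ring.dimension_is_inj[OF sF] by blast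
    have "m \<noteq> 0"
    proof
      assume "m = 0"
      then have "E = {0}" using complex_ring.dimension_zero[OF sF1] m by simp
      then show False using E.one_mem by simp
    qed
    then have mn: "m < n" using nm l1 by simp
    define eq where "eq = (\<lambda>r s. \<exists>u\<in>F1. r = s * u ^ l)"
    \<comment> \<open>One member of \<open>R\<close> from each class modulo \<open>l\<close>-th
      powers of \<open>F1\<close>. These representatives are inequivalent over \<open>F1\<close>, so
      the induction hypothesis bounds their number, the degree of \<open>E\<close> over
      \<open>F1\<close> being the smaller \<open>m\<close>.\<close>
    define \<rho> where "\<rho> r = (SOME s. s \<in> R \<and> eq r s)" for r
    have rho: "\<rho> r \<in> R" "eq r (\<rho> r)" if "r \<in> R" for r
    proof -
      have "r \<in> R \<and> eq r r" using that F1.one_mem by (auto simp: eq_def intro!: bexI[of _ 1])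
      then have "\<rho> r \<in> R \<and> eq r (\<rho> r)" unfolding \<rho>_def by (rule someI)
      then show "\<rho> r \<in> R" "eq r (\<rho> r)" by auto
    qed
    have eq_trans: "eq r t" if "eq r s" "eq s t" for r s t
    proof -
      obtain u v where "u \<in> F1" "v \<in> F1" "r = s * u ^ l" "s = t * v ^ l"
        using \<open>eq r s\<close> \<open>eq s t\<close> unfolding eq_def by blast
      then have "r = t * (v * u) ^ l" "v * u \<in> F1" by (auto simp: power_mult_distrib intro: F1.mems)
      then show ?thesis unfolding eq_def by blast
    qed
    have eq_sym: "eq s r" if "eq r s" "r \<in> R" for r s
    proof -
      obtain u where u: "u \<in> F1" "r = s * u ^ l" using \<open>eq r s\<close> unfolding eq_def by blast
      have "u \<noteq> 0" using u \<open>r \<in> R\<close> less.prems(5) l0 by auto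
      then have "s = r * (inverse u) ^ l" using u by (simp add: power_inverse)
      then show ?thesis unfolding eq_def using F1.inverse_mem[OF u(1)] by blast
    qed
    have card1: "card (\<rho> ` R) \<le> l ^ multiplicity l m"
    proof (rule less.IH[OF mn F1(1) F1E m])
      show "finite (\<rho> ` R)" using less.prems(4) by simp
      have rhoR: "\<rho> ` R \<subseteq> R" by (intro image_subsetI rho(1))
      have "F - {0} \<subseteq> F1 - {0}" using F1(2) by (rule Diff_mono[OF _ order_refl])
      then show "\<rho> ` R \<subseteq> F1 - {0}" using rhoR less.prems(5) by (meson order_trans)
      show "\<exists>w\<in>E. r = w ^ l" if "r \<in> \<rho> ` R" for r
        by (rule less.prems(6)[OF subsetD[OF rhoR that]])
      fix r s u assume rs: "r \<in> \<rho> ` R" "s \<in> \<rho> ` R" "u \<in> F1" "r = s * u ^ l"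
      obtain a where a: "a \<in> R" "r = \<rho> a" using rs(1) by (elim imageE)
      obtain c where c: "c \<in> R" "s = \<rho> c" using rs(2) by (elim imageE)
      note ac = a(1) c(1) a(2) c(2)
      have "eq (\<rho> a) (\<rho> c)" using rs(4) unfolding eq_def ac by (rule bexI[OF _ rs(3)])
      then have "eq a (\<rho> c)" using eq_trans rho(2)[OF ac(1)] by blast
      then have "eq a c" using eq_trans eq_sym[OF rho(2)[OF ac(2)] ac(2)] by blast
      moreover have "eq c a" using \<open>eq a c\<close> ac(1) by (rule eq_sym)
      \<comment> \<open>The choice in \<open>\<rho> r\<close> depends on \<open>r\<close> only
        through the predicate \<open>eq r\<close>, so equivalent elements receive the same
        representative.\<close>
      ultimately have "eq a t \<longleftrightarrow> eq c t" for t using eq_trans by blast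
      then have "eq a = eq c" by (rule ext)
      then show "r = s" unfolding ac \<rho>_def by simp
    qed
    have "\<forall>r\<in>R. \<exists>i. i < l \<and> (\<exists>u\<in>F. r = \<rho> r * (x ^ i * u ^ l))"
    proof
      fix r assume r: "r \<in> R"
      obtain w where w: "w \<in> F1" "r = \<rho> r * w ^ l" using rho(2)[OF r] unfolding eq_def by blast
      have rF: "r \<in> F" "r \<noteq> 0" "\<rho> r \<in> F" "\<rho> r \<noteq> 0" using r rho(1)[OF r] less.prems(5) by auto
      have wl: "w ^ l = r / \<rho> r" using w(2) rF by (simp add: field_simps)
      obtain g where g: "F.poly_over g" "Polynomial.degree g < l" "poly g y = w" using F1(5) w(1) by blast
      have "w ^ l \<in> F" unfolding wl using rF by (intro F.mems)
      moreover have "w \<noteq> 0"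
      proof
        assume "w = 0"
        then have "r = 0" using w(2) l0 by (simp add: power_0_left)
        then show False using rF(2) by simp
      qed
      ultimately obtain i u where "i < l" "u \<in> F" "w ^ l = x ^ i * u ^ l"
        using F.power_in_root_extension[OF l x(2,3) y(2) g(1,2)] g(3) by blast
      then show "\<exists>i. i < l \<and> (\<exists>u\<in>F. r = \<rho> r * (x ^ i * u ^ l))" using w(2) by metis
    qed
    then obtain \<iota> where \<iota>: "\<And>r. r \<in> R \<Longrightarrow> \<iota> r < l" "\<And>r. r \<in> R \<Longrightarrow> \<exists>u\<in>F. r = \<rho> r * (x ^ \<iota> r * u ^ l)"
      by metis
    \<comment> \<open>Two members of \<open>R\<close> with the same representative and the same
      exponent of \<open>x\<close> differ by an \<open>l\<close>-th power of \<open>F\<close>, so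
      they coincide.\<close>
    have "inj_on (\<lambda>r. (\<rho> r, \<iota> r)) R"
    proof (rule inj_onI)
      fix r s assume rs: "r \<in> R" "s \<in> R" "(\<rho> r, \<iota> r) = (\<rho> s, \<iota> s)"
      obtain u where u: "u \<in> F" "r = \<rho> r * (x ^ \<iota> r * u ^ l)" using \<iota>(2)[OF rs(1)] by blast
      obtain v where v: "v \<in> F" "s = \<rho> s * (x ^ \<iota> s * v ^ l)" using \<iota>(2)[OF rs(2)] by blast
      have "v \<noteq> 0"
      proof
        assume "v = 0"
        then have "s = 0" using v(2) l0 by (simp add: power_0_left)
        then show False using rs(2) less.prems(5) by blast
      qed
      have "s * (u / v) ^ l = (\<rho> s * (x ^ \<iota> s * v ^ l)) * (u / v) ^ l" using v(2) by simp
      also have "\<dots> = \<rho> r * (x ^ \<iota> r * u ^ l)"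
        using rs(3) \<open>v \<noteq> 0\<close> by (simp add: power_divide)
      also have "\<dots> = r" using u(2) by simp
      finally have "r = s * (u / v) ^ l" by simp
      then show "r = s" using less.prems(7)[OF rs(1,2), of "u / v"] u(1) v(1) F.divide_mem by blast
    qed
    then have "card R \<le> card (\<rho> ` R \<times> {..<l})"
      by (rule card_inj_on_le) (use \<iota>(1) less.prems(4) in auto)
    also have "\<dots> = card (\<rho> ` R) * l" by (simp add: card_cartesian_product)
    also have "\<dots> \<le> l ^ multiplicity l m * l" using card1 by simp
    also have "\<dots> = l ^ multiplicity l n"
      using prime_elem_multiplicity_mult_distrib[of l l m] l \<open>m \<noteq> 0\<close> l0 multiplicity_same_power[of l 1]
      by (simp add: nm prime_imp_prime_elem)
    finally show ?thesis .
  qed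
qed

section \<open>Units modulo powers\<close>

text \<open>
  Takes the place of Dirichlet's unit theorem, of which only the finiteness of the units modulo
  \<open>l\<close>-th powers is needed. It is applied to the logarithms of the conjugates.
\<close>

lemma bounded_representatives:
  fixes A :: "complex set" and L :: "'i \<Rightarrow> complex \<Rightarrow> real"
  assumes "finite I" "l > 0" "1 \<in> A" "\<And>x y. x \<in> A \<Longrightarrow> y \<in> A \<Longrightarrow> x * y \<in> A" "\<And>x. x \<in> A \<Longrightarrow> inverse x \<in> A"
    and "0 \<notin> A" "\<And>i x y. i \<in> I \<Longrightarrow> x \<in> A \<Longrightarrow> y \<in> A \<Longrightarrow> L i (x * y) = L i x + L i y"
  shows "\<exists>B. \<forall>x\<in>A. \<exists>z\<in>A. \<forall>i\<in>I. \<bar>L i (x * z ^ l)\<bar> \<le> B"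
  using assms(1,7)
proof (induction I arbitrary: L)
  case empty then show ?case using assms(3) by auto
next
  case (insert j I)
  have pow: "z ^ k \<in> A" if "z \<in> A" for z k using that by (induction k) (auto intro: assms)
  have powi: "z powi k \<in> A" if "z \<in> A" for z k using that pow assms(5) by (auto simp: power_int_def)
  have L1: "L i 1 = 0" if "i \<in> insert j I" for i using insert.prems[OF that assms(3) assms(3)] by simp
  have Lpow: "L i (z ^ k) = of_nat k * L i z" if "i \<in> insert j I" "z \<in> A" for i z k
    using that pow by (induction k) (auto simp: L1 insert.prems algebra_simps)
  have Linv: "L i (inverse z) = - L i z" if "i \<in> insert j I" "z \<in> A" for i z
  proof -
    have "z \<noteq> 0" using that assms(6) by auto
    then have "L i z + L i (inverse z) = 0" using insert.prems[OF that(1,2) assms(5)[OF that(2)]] L1[OF that(1)] by simp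
    then show ?thesis by simp
  qed
  have Lpowi: "L i (z powi k) = of_int k * L i z" if "i \<in> insert j I" "z \<in> A" for i z k
    using that Lpow[of i z] Lpow[of i "inverse z"] Linv assms(5) by (auto simp: power_int_def)
  show ?case
  proof (cases "\<forall>a\<in>A. L j a = 0")
    case True
    obtain B where B: "\<forall>x\<in>A. \<exists>z\<in>A. \<forall>i\<in>I. \<bar>L i (x * z ^ l)\<bar> \<le> B"
      using insert.IH insert.prems by (metis insertCI)
    have "\<forall>x\<in>A. \<exists>z\<in>A. \<forall>i\<in>insert j I. \<bar>L i (x * z ^ l)\<bar> \<le> max B 0"
    proof
      fix x assume x: "x \<in> A"
      then obtain z where z: "z \<in> A" "\<forall>i\<in>I. \<bar>L i (x * z ^ l)\<bar> \<le> B" using B by blast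
      moreover have "L j (x * z ^ l) = 0" using True x z pow assms(4) by blast
      ultimately show "\<exists>z\<in>A. \<forall>i\<in>insert j I. \<bar>L i (x * z ^ l)\<bar> \<le> max B 0"
        by (intro bexI[of _ z]) auto
    qed
    then show ?thesis by blast
  next
    case False
    then obtain a where a: "a \<in> A" "L j a \<noteq> 0" by blast
    \<comment> \<open>Subtracting this multiple of \<open>L j\<close> makes \<open>L' i\<close>
      vanish at \<open>a\<close>, so a later correction by powers of \<open>a\<close>, which is
      meant to bound \<open>L j\<close>, leaves \<open>L' i\<close> unchanged.\<close>
    define L' where "L' i x = L i x - L i a / L j a * L j x" for i x
    have "\<exists>B. \<forall>x\<in>A. \<exists>z\<in>A. \<forall>i\<in>I. \<bar>L' i (x * z ^ l)\<bar> \<le> B"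
      by (rule insert.IH) (simp add: L'_def insert.prems algebra_simps add_divide_distrib)
    then obtain B where B: "\<forall>x\<in>A. \<exists>z\<in>A. \<forall>i\<in>I. \<bar>L' i (x * z ^ l)\<bar> \<le> B" by blast
    define C where "C = real l * \<bar>L j a\<bar>"
    define M where "M = (\<Sum>i\<in>I. \<bar>L i a / L j a\<bar>)"
    have M: "\<bar>L i a / L j a\<bar> \<le> M" if "i \<in> I" for i
      unfolding M_def using insert.hyps(1) that by (intro member_le_sum) auto
    have M0: "M \<ge> 0" unfolding M_def by (intro sum_nonneg) auto
    have C0: "C \<ge> 0" by (simp add: C_def)
    have "\<forall>x\<in>A. \<exists>z\<in>A. \<forall>i\<in>insert j I. \<bar>L i (x * z ^ l)\<bar> \<le> \<bar>B\<bar> + M * C + C"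
    proof
      fix x assume x: "x \<in> A"
      then obtain z where z: "z \<in> A" "\<forall>i\<in>I. \<bar>L' i (x * z ^ l)\<bar> \<le> B" using B by blast
      define y where "y = x * z ^ l"
      have y: "y \<in> A" unfolding y_def using x z pow assms(4) by blast
      define c where "c = real l * L j a"
      have c: "c \<noteq> 0" "\<bar>c\<bar> = C" using a(2) assms(2) by (auto simp: c_def C_def abs_mult)
      \<comment> \<open>The factor \<open>(a powi k) ^ l\<close> moves \<open>L j\<close> by a
        multiple of \<open>c\<close>; the floor brings it down to absolute value at most
        \<open>C\<close>.\<close>
      define k where "k = - \<lfloor>L j y / c\<rfloor>"
      define z' where "z' = z * a powi k"
      have z': "z' \<in> A" unfolding z'_def using z(1) powi[OF a(1)] assms(4) by blast
      have eq: "x * z' ^ l = y * (a powi k) ^ l"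
        by (simp add: z'_def y_def power_mult_distrib mult.assoc)
      have Li: "L i (x * z' ^ l) = L i y + of_nat l * (of_int k * L i a)" if "i \<in> insert j I" for i
        unfolding eq using that y pow powi[OF a(1)] a(1) by (simp add: insert.prems Lpow Lpowi)
      have "L j (x * z' ^ l) = c * (L j y / c - of_int \<lfloor>L j y / c\<rfloor>)"
        using c(1) by (simp add: Li k_def c_def algebra_simps)
      then have "\<bar>L j (x * z' ^ l)\<bar> = C * \<bar>L j y / c - of_int \<lfloor>L j y / c\<rfloor>\<bar>"
        using c(2) by (simp add: abs_mult)
      also have "\<dots> \<le> C * 1"
        using C0 floor_correct[of "L j y / c"] by (intro mult_left_mono) linarith+
      finally have Lj: "\<bar>L j (x * z' ^ l)\<bar> \<le> C" by simp
      have "\<bar>L i (x * z' ^ l)\<bar> \<le> \<bar>B\<bar> + M * C" if i: "i \<in> I" for i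
      proof -
        have "L i (x * z' ^ l) = L' i y + L i a / L j a * L j (x * z' ^ l)"
          using i a(2) by (simp add: Li L'_def field_simps)
        then have "\<bar>L i (x * z' ^ l)\<bar> \<le> \<bar>L' i y\<bar> + \<bar>L i a / L j a\<bar> * \<bar>L j (x * z' ^ l)\<bar>"
          by (metis abs_mult abs_triangle_ineq)
        also have "\<dots> \<le> \<bar>B\<bar> + M * C"
          using z(2) i M[OF i] M0 Lj unfolding y_def[symmetric] by (intro add_mono mult_mono) force+
        finally show ?thesis .
      qed
      then show "\<exists>z\<in>A. \<forall>i\<in>insert j I. \<bar>L i (x * z ^ l)\<bar> \<le> \<bar>B\<bar> + M * C + C"
        using z' Lj M0 C0 by (intro bexI[OF _ z'] ballI) (force simp: intro: order_trans)
    qed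
    then show ?thesis by blast
  qed
qed

definition units :: "complex set \<Rightarrow> complex set" where
  "units K = {u \<in> oint K. u \<noteq> 0 \<and> inverse u \<in> oint K}"

definition power_equiv :: "nat \<Rightarrow> complex set \<Rightarrow> (complex \<times> complex) set" where
  "power_equiv l A = {(x, y). x \<in> A \<and> y \<in> A \<and> (\<exists>z\<in>A. x = y * z ^ l)}"

lemma (in complex_subfield) hom_on_simps:
  assumes "hom_on K \<tau>"
  shows "x \<in> K \<Longrightarrow> y \<in> K \<Longrightarrow> \<tau> (x + y) = \<tau> x + \<tau> y" "x \<in> K \<Longrightarrow> y \<in> K \<Longrightarrow> \<tau> (x * y) = \<tau> x * \<tau> y"
    "\<tau> 1 = 1" "\<tau> 0 = 0" "x \<in> K \<Longrightarrow> \<tau> (- x) = - \<tau> x" "x \<in> K \<Longrightarrow> y \<in> K \<Longrightarrow> \<tau> (x - y) = \<tau> x - \<tau> y"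
    "x \<in> K \<Longrightarrow> x \<noteq> 0 \<Longrightarrow> \<tau> x \<noteq> 0" "x \<in> K \<Longrightarrow> \<tau> (x ^ n) = \<tau> x ^ n" "\<tau> (of_int k) = of_int k"
    "x \<in> K \<Longrightarrow> \<tau> (inverse x) = inverse (\<tau> x)" "\<tau> (of_rat q) = of_rat q"
proof -
  show add: "\<tau> (x + y) = \<tau> x + \<tau> y" if "x \<in> K" "y \<in> K" for x y using that assms by (simp add: hom_on_def)
  show mult: "\<tau> (x * y) = \<tau> x * \<tau> y" if "x \<in> K" "y \<in> K" for x y using that assms by (simp add: hom_on_def)
  show one: "\<tau> 1 = 1" using assms by (simp add: hom_on_def)
  show zero: "\<tau> 0 = 0" using add[OF zero_mem zero_mem] by simp
  show minus: "\<tau> (- x) = - \<tau> x" if "x \<in> K" for x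
    using add[OF that minus_mem[OF that]] zero by (simp add: eq_neg_iff_add_eq_0 add.commute)
  show diff: "\<tau> (x - y) = \<tau> x - \<tau> y" if "x \<in> K" "y \<in> K" for x y
    using add[OF that(1) minus_mem[OF that(2)]] minus[OF that(2)] by simp
  show nz: "\<tau> x \<noteq> 0" if "x \<in> K" "x \<noteq> 0" for x
    using mult[OF that(1) inverse_mem[OF that(1)]] that(2) one by auto
  show "\<tau> (x ^ n) = \<tau> x ^ n" if "x \<in> K" for x n
    using that by (induction n) (auto simp: one mult power_mem)
  have nat: "\<tau> (of_nat n) = of_nat n" for n by (induction n) (auto simp: zero one add of_nat_mem one_mem)
  show int: "\<tau> (of_int k) = of_int k" for k
    by (cases k rule: int_diff_cases) (simp add: diff nat of_nat_mem)
  show inv: "\<tau> (inverse x) = inverse (\<tau> x)" if "x \<in> K" for x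
  proof (cases "x = 0")
    case False
    then have "\<tau> x * \<tau> (inverse x) = 1" using mult[OF that inverse_mem[OF that]] one by simp
    then show ?thesis by (metis inverse_unique)
  qed (simp add: zero)
  show "\<tau> (of_rat q) = of_rat q"
  proof (cases q)
    case (Fract a b)
    then have "of_rat q = (of_int a * inverse (of_int b) :: complex)"
      by (simp add: of_rat_rat divide_inverse)
    then show ?thesis by (simp only: mult of_int_mem inverse_mem int inv)
  qed
qed

lemma (in complex_subfield) hom_on_poly:
  assumes "hom_on K \<tau>" "x \<in> K" "\<forall>i. Polynomial.coeff p i \<in> \<rat>"
  shows "\<tau> (poly p x) = poly p (\<tau> x)"
  using assms(3)
proof (induction p)
  case 0 then show ?case by (simp add: hom_on_simps[OF assms(1)])
next
  case (pCons a p)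
  have a: "a \<in> \<rat>" using pCons.prems by (metis coeff_pCons_0)
  have p: "\<forall>i. Polynomial.coeff p i \<in> \<rat>" using pCons.prems by (metis coeff_pCons_Suc)
  have "poly p x \<in> K" unfolding poly_altdef using p assms(2) Rats_mem by (intro mems) auto
  moreover have "\<tau> a = a" using a hom_on_simps(11)[OF assms(1)] by (auto elim: Rats_cases)
  ultimately show ?case using pCons.IH[OF p] assms(2) Rats_mem[OF a] by (simp add: hom_on_simps[OF assms(1)] mems)
qed

text \<open>A further linear factor turns each coefficient into an old one minus \<open>a\<close>
  times an old one, which multiplies the bound by at most \<open>1 + B \<le> 2 * B\<close>.\<close>

lemma coeff_linear_factors:
  fixes as :: "complex list"
  assumes "\<And>a. a \<in> set as \<Longrightarrow> algebraic_int a" "\<And>a. a \<in> set as \<Longrightarrow> norm a \<le> B" "B \<ge> 1"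
  shows "algebraic_int (Polynomial.coeff (\<Prod>a\<leftarrow>as. [:- a, 1:]) i) \<and>
    norm (Polynomial.coeff (\<Prod>a\<leftarrow>as. [:- a, 1:]) i) \<le> (2 * B) ^ length as"
  using assms(1,2)
proof (induction as arbitrary: i)
  case Nil then show ?case by (simp add: coeff_1)
next
  case (Cons a as)
  let ?p = "\<Prod>a\<leftarrow>as. [:- a, 1:]"
  have IH: "algebraic_int (Polynomial.coeff ?p i)" "norm (Polynomial.coeff ?p i) \<le> (2 * B) ^ length as" for i
    using Cons by auto
  have eq: "Polynomial.coeff ([:- a, 1:] * ?p) i = (case i of 0 \<Rightarrow> 0 | Suc j \<Rightarrow> Polynomial.coeff ?p j) - a * Polynomial.coeff ?p i"
    by (cases i) (auto simp: coeff_pCons)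
  have "algebraic_int (Polynomial.coeff ([:- a, 1:] * ?p) i)"
    unfolding eq using IH(1) Cons.prems(1)[of a]
    by (intro algebraic_int_diff algebraic_int_add_mult(2)) (auto split: nat.splits)
  moreover have "norm (Polynomial.coeff ([:- a, 1:] * ?p) i) \<le> (2 * B) ^ length (a # as)"
  proof -
    have "norm (Polynomial.coeff ([:- a, 1:] * ?p) i) \<le>
        norm (case i of 0 \<Rightarrow> 0 | Suc j \<Rightarrow> Polynomial.coeff ?p j) + norm (a * Polynomial.coeff ?p i)"
      unfolding eq by (rule norm_triangle_ineq4)
    also have "\<dots> \<le> (2 * B) ^ length as + B * (2 * B) ^ length as"
    proof (rule add_mono)
      show "norm (case i of 0 \<Rightarrow> 0 | Suc j \<Rightarrow> Polynomial.coeff ?p j) \<le> (2 * B) ^ length as"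
        using IH(2) assms(3) by (auto split: nat.splits)
      show "norm (a * Polynomial.coeff ?p i) \<le> B * (2 * B) ^ length as"
        unfolding norm_mult using IH(2) Cons.prems(2)[of a] assms(3) by (intro mult_mono) auto
    qed
    also have "\<dots> \<le> B * (2 * B) ^ length as + B * (2 * B) ^ length as"
      using assms(3) mult_right_mono[OF assms(3), of "(2 * B) ^ length as"] by simp
    also have "\<dots> = (2 * B) ^ length (a # as)" by (simp add: mult.assoc)
    finally show ?thesis .
  qed
  ultimately show ?case by simp
qed

section \<open>Embeddings, and finiteness of the units modulo powers\<close>

context complex_number_field
begin

text \<open>\<open>hom_on\<close> says nothing about values outside \<open>K\<close>; the
  restriction identifies functions that agree on \<open>K\<close> and makes the set finite.\<close>

definition embeddings :: "(complex \<Rightarrow> complex) set" where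
  "embeddings = (\<lambda>\<tau>. restrict \<tau> K) ` {\<tau>. hom_on K \<tau>}"

text \<open>An embedding is determined by its values on a finite spanning set, and the value at each
  \<open>v\<close> is a root of a fixed rational polynomial that vanishes at
  \<open>v\<close>.\<close>

lemma finite_embeddings: "finite embeddings"
proof -
  obtain B where B: "finite B" "B \<subseteq> K" "K \<subseteq> qvs.span B"
  proof -
    obtain d b c where "number_field_basis K d b c" using ex_number_field_basis by blast
    then interpret number_field_basis K d b c .
    have "K \<subseteq> qvs.span (b ` {..<d})"
    proof
      fix x assume "x \<in> K"
      then show "x \<in> qvs.span (b ` {..<d})"
        by (subst expansion) (auto intro!: qvs.span_sum qvs.span_scale intro: qvs.span_base)
    qed
    then show ?thesis using that[of "b ` {..<d}"] b_mem by auto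
  qed
  have "\<forall>x\<in>K. \<exists>f. lead_coeff f = 1 \<and> (\<forall>i. Polynomial.coeff f i \<in> \<rat>) \<and> poly f x = 0"
    using conjugates by blast
  then obtain f where f: "\<And>x. x \<in> K \<Longrightarrow> lead_coeff (f x) = 1"
    "\<And>x i. x \<in> K \<Longrightarrow> Polynomial.coeff (f x) i \<in> \<rat>" "\<And>x. x \<in> K \<Longrightarrow> poly (f x) x = 0" by metis
  have "inj_on (\<lambda>\<sigma>. restrict \<sigma> B) embeddings"
  proof (rule inj_onI)
    fix \<sigma> \<sigma>' assume s: "\<sigma> \<in> embeddings" "\<sigma>' \<in> embeddings" "restrict \<sigma> B = restrict \<sigma>' B"
    obtain \<tau> \<tau>' where t: "hom_on K \<tau>" "\<sigma> = restrict \<tau> K" "hom_on K \<tau>'" "\<sigma>' = restrict \<tau>' K"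
      using s unfolding embeddings_def by blast
    have eqB: "\<tau> v = \<tau>' v" if "v \<in> B" for v
      using fun_cong[OF s(3), of v] that B(2) t(2,4) by auto
    have "x \<in> K \<and> \<tau> x = \<tau>' x" if "x \<in> qvs.span B" for x
      using that
    proof (induction rule: qvs.span_induct_alt)
      case base then show ?case by (simp add: hom_on_simps[OF t(1)] hom_on_simps[OF t(3)] zero_mem)
    next
      case (step q v y)
      then have "v \<in> K" using B(2) by auto
      then show ?case using step eqB[of v]
        by (simp add: hom_on_simps[OF t(1)] hom_on_simps[OF t(3)] mems)
    qed
    then show "\<sigma> = \<sigma>'" unfolding t using B(3) by (intro restrict_ext) auto
  qed
  moreover have "(\<lambda>\<sigma>. restrict \<sigma> B) ` embeddings \<subseteq> (\<Pi>\<^sub>E v\<in>B. {z. poly (f v) z = 0})"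
  proof clarify
    fix \<sigma> assume "\<sigma> \<in> embeddings"
    then obtain \<tau> where t: "hom_on K \<tau>" "\<sigma> = restrict \<tau> K" unfolding embeddings_def by blast
    have "poly (f v) (\<tau> v) = 0" if "v \<in> K" for v
      using hom_on_poly[OF t(1) that, of "f v"] f(2,3)[OF that] hom_on_simps(4)[OF t(1)] by simp
    then show "restrict \<sigma> B \<in> (\<Pi>\<^sub>E v\<in>B. {z. poly (f v) z = 0})"
      unfolding t(2) restrict_PiE_iff using B(2) by auto
  qed
  moreover have "finite (\<Pi>\<^sub>E v\<in>B. {z. poly (f v) z = 0})"
  proof (rule finite_PiE[OF B(1)])
    fix v assume "v \<in> B"
    then have "f v \<noteq> 0" using f(1)[of v] B(2) by auto
    then show "finite {z. poly (f v) z = 0}" by (rule poly_roots_finite)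
  qed
  ultimately show ?thesis using finite_subset finite_imageD by blast
qed

lemma embeddings_hom: "\<sigma> \<in> embeddings \<Longrightarrow> hom_on K \<sigma>"
  unfolding embeddings_def by (auto simp: hom_on_def mems)

text \<open>All roots of the polynomial \<open>f\<close> attached to \<open>x\<close> are conjugates
  of \<open>x\<close>, hence bounded algebraic integers. So the coefficients of \<open>f\<close> are
  bounded algebraic integers; being rational, they are integers, and only finitely many polynomials
  of degree at most \<open>D\<close> remain.\<close>

lemma finite_bounded_integers: "finite {x \<in> oint K. \<forall>\<sigma>\<in>embeddings. norm (\<sigma> x) \<le> B}"
proof -
  obtain D where D: "\<And>x. x \<in> K \<Longrightarrow> \<exists>f. lead_coeff f = 1 \<and> Polynomial.degree f \<le> D \<and>
      (\<forall>i. Polynomial.coeff f i \<in> \<rat>) \<and> poly f x = 0 \<and>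
      (\<forall>z. poly f z = 0 \<longrightarrow> (\<exists>\<tau>. hom_on K \<tau> \<and> \<tau> x = z))"
    using conjugates_bounded by blast
  define B' where "B' = max B 1"
  define N where "N = \<lceil>(2 * B') ^ D\<rceil>"
  define polys where "polys = {p :: int poly. Polynomial.degree p \<le> D \<and> (\<forall>i. \<bar>Polynomial.coeff p i\<bar> \<le> N)}"
  have "finite polys"
  proof (rule finite_imageD)
    show "inj_on (\<lambda>p. map (Polynomial.coeff p) [0..<Suc D]) polys"
    proof (rule inj_onI)
      fix p q assume pq: "p \<in> polys" "q \<in> polys"
        "map (Polynomial.coeff p) [0..<Suc D] = map (Polynomial.coeff q) [0..<Suc D]"
      show "p = q"
      proof (rule poly_eqI)
        fix i show "Polynomial.coeff p i = Polynomial.coeff q i"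
        proof (cases "i \<le> D")
          case True
          then show ?thesis using arg_cong[OF pq(3), of "\<lambda>xs. xs ! i"] by (simp del: upt_Suc)
        next
          case False
          then show ?thesis using pq(1,2) by (simp add: polys_def coeff_eq_0)
        qed
      qed
    qed
    have "(\<lambda>p. map (Polynomial.coeff p) [0..<Suc D]) ` polys \<subseteq> {xs. set xs \<subseteq> {- N..N} \<and> length xs = Suc D}"
      by (auto simp: polys_def abs_le_iff simp del: upt_Suc) (metis minus_le_iff)+
    then show "finite ((\<lambda>p. map (Polynomial.coeff p) [0..<Suc D]) ` polys)"
      by (rule finite_subset) (intro finite_lists_length_eq finite_atLeastAtMost_int)
  qed
  have sub: "{x \<in> oint K. \<forall>\<sigma>\<in>embeddings. norm (\<sigma> x) \<le> B} \<subseteq>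
     (\<Union>p\<in>polys - {0}. {x. poly (map_poly of_int p) x = 0})"
  proof clarify
    fix x assume x: "x \<in> oint K" "\<forall>\<sigma>\<in>embeddings. norm (\<sigma> x) \<le> B"
    have xK: "x \<in> K" using x oint_mem by blast
    obtain f where f: "lead_coeff f = 1" "Polynomial.degree f \<le> D" "\<forall>i. Polynomial.coeff f i \<in> \<rat>" "poly f x = 0"
      "\<And>z. poly f z = 0 \<Longrightarrow> \<exists>\<tau>. hom_on K \<tau> \<and> \<tau> x = z" using D[OF xK] by blast
    obtain as where as: "f = (\<Prod>a\<leftarrow>as. [:- a, 1:])" "length as = Polynomial.degree f"
      using complex_poly_linear_factors[OF f(1)] by blast
    have root: "algebraic_int a \<and> norm a \<le> B'" if "a \<in> set as" for a
    proof -
      have "poly f a = 0" using that by (auto simp: as(1) poly_prod_list prod_list_zero_iff)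
      then obtain \<tau> where t: "hom_on K \<tau>" "\<tau> x = a" using f(5) by blast
      have "restrict \<tau> K \<in> embeddings" using t(1) unfolding embeddings_def by blast
      then have "norm a \<le> B" using x(2) t(2) xK by force
      moreover have "algebraic_int a"
      proof -
        obtain p where p: "lead_coeff p = 1" "\<forall>i. Polynomial.coeff p i \<in> \<int>" "poly p x = 0"
          using x(1) unfolding oint_def algebraic_int.simps by blast
        have "poly p a = 0"
          using hom_on_poly[OF t(1) xK, of p] p(2,3) t(2) hom_on_simps(4)[OF t(1)] Ints_subset_Rats by auto
        then show ?thesis using p by (intro algebraic_int.intros)
      qed
      ultimately show ?thesis by (simp add: B'_def)
    qed
    have co: "algebraic_int (Polynomial.coeff f i) \<and> norm (Polynomial.coeff f i) \<le> (2 * B') ^ length as" for i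
      unfolding as(1) by (rule coeff_linear_factors) (use root in \<open>auto simp: B'_def\<close>)
    then have "\<forall>i. \<exists>k. Polynomial.coeff f i = of_int k"
      using rational_algebraic_int_is_int f(3) Ints_cases by metis
    then obtain k where k: "\<And>i. Polynomial.coeff f i = of_int (k i)" by metis
    define p where "p = Poly (map k [0..<Suc D])"
    have cp: "Polynomial.coeff p i = k i" for i
    proof (cases "i \<le> D")
      case False
      then have "Polynomial.coeff f i = 0" using f(2) by (simp add: coeff_eq_0)
      then show ?thesis using k[of i] False by (simp add: p_def nth_default_def)
    qed (simp add: p_def nth_default_def nth_append del: upt_Suc)
    have fp: "f = map_poly of_int p" by (rule poly_eqI) (simp add: coeff_map_poly cp k)
    have "p \<in> polys"
      unfolding polys_def
    proof (intro CollectI conjI allI)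
      show "Polynomial.degree p \<le> D" using f(2) unfolding fp by (simp add: degree_map_poly)
      fix i
      have "real_of_int \<bar>k i\<bar> \<le> (2 * B') ^ length as" using co[of i] by (simp add: k)
      also have "\<dots> \<le> (2 * B') ^ D" using as(2) f(2) by (intro power_increasing) (auto simp: B'_def)
      finally show "\<bar>Polynomial.coeff p i\<bar> \<le> N" unfolding cp N_def by linarith
    qed
    moreover have "p \<noteq> 0" using f(1) fp by auto
    ultimately show "x \<in> (\<Union>p\<in>polys - {0}. {x. poly (map_poly of_int p) x = 0})" using f(4) fp by blast
  qed
  show ?thesis
  proof (rule finite_subset[OF sub], rule finite_UN_I)
    show "finite (polys - {0})" using \<open>finite polys\<close> by simp
    fix p :: "int poly" assume "p \<in> polys - {0}"
    then have "map_poly of_int p \<noteq> (0 :: complex poly)" by (simp add: map_poly_eq_0_iff)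
    then show "finite {x :: complex. poly (map_poly of_int p) x = 0}" by (rule poly_roots_finite)
  qed
qed

lemma units_closed:
  "1 \<in> units K" "x \<in> units K \<Longrightarrow> y \<in> units K \<Longrightarrow> x * y \<in> units K" "x \<in> units K \<Longrightarrow> inverse x \<in> units K"
  "0 \<notin> units K" "x \<in> units K \<Longrightarrow> x ^ n \<in> units K"
proof -
  show *: "1 \<in> units K" "\<And>x y. x \<in> units K \<Longrightarrow> y \<in> units K \<Longrightarrow> x * y \<in> units K"
    "\<And>x. x \<in> units K \<Longrightarrow> inverse x \<in> units K" "0 \<notin> units K"
    unfolding units_def by (auto intro: oint_closed)
  show "x \<in> units K \<Longrightarrow> x ^ n \<in> units K" by (induction n) (auto intro: *)
qed

text \<open>The logarithms of the absolute values of the conjugates are additive on units. So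
  \<open>bounded_representatives\<close> moves every unit, by an \<open>l\<close>-th power, into a
  set of integers with bounded conjugates, which is finite.\<close>

lemma finite_units_mod_powers:
  assumes "l > 0"
  shows "\<exists>W. finite W \<and> W \<subseteq> units K \<and> (\<forall>u\<in>units K. \<exists>w\<in>W. \<exists>z\<in>units K. u = w * z ^ l)"
proof -
  define L where "L \<sigma> x = ln (norm (\<sigma> x))" for \<sigma> :: "complex \<Rightarrow> complex" and x
  have uK: "u \<in> K" "u \<noteq> 0" "u \<in> oint K" if "u \<in> units K" for u using that oint_mem unfolding units_def by auto
  have "\<exists>B. \<forall>x\<in>units K. \<exists>z\<in>units K. \<forall>i\<in>embeddings. \<bar>L i (x * z ^ l)\<bar> \<le> B"
  proof (rule bounded_representatives[OF finite_embeddings assms units_closed(1,2,3,4)])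
    fix \<sigma> x y assume s: "\<sigma> \<in> embeddings" and xy: "x \<in> units K" "y \<in> units K"
    have "\<sigma> (x * y) = \<sigma> x * \<sigma> y" "\<sigma> x \<noteq> 0" "\<sigma> y \<noteq> 0"
      using hom_on_simps(2,7)[OF embeddings_hom[OF s]] uK[OF xy(1)] uK[OF xy(2)] by blast+
    then show "L \<sigma> (x * y) = L \<sigma> x + L \<sigma> y"
      unfolding L_def by (simp add: norm_mult ln_mult)
  qed
  then obtain B where B: "\<And>x. x \<in> units K \<Longrightarrow> \<exists>z\<in>units K. \<forall>i\<in>embeddings. \<bar>L i (x * z ^ l)\<bar> \<le> B" by blast
  define W where "W = {w \<in> units K. \<forall>\<sigma>\<in>embeddings. norm (\<sigma> w) \<le> exp B}"
  have "finite W"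
    by (rule finite_subset[OF _ finite_bounded_integers[of "exp B"]]) (auto simp: W_def units_def)
  moreover have "\<exists>w\<in>W. \<exists>z\<in>units K. u = w * z ^ l" if u: "u \<in> units K" for u
  proof -
    obtain z where z: "z \<in> units K" "\<forall>i\<in>embeddings. \<bar>L i (u * z ^ l)\<bar> \<le> B" using B[OF u] by blast
    define w where "w = u * z ^ l"
    have w: "w \<in> units K" unfolding w_def using u z(1) units_closed by blast
    have "norm (\<sigma> w) \<le> exp B" if s: "\<sigma> \<in> embeddings" for \<sigma>
    proof -
      have "ln (norm (\<sigma> w)) \<le> B" using z(2) s unfolding L_def w_def by (meson abs_le_D1)
      moreover have "norm (\<sigma> w) > 0" using hom_on_simps(7)[OF embeddings_hom[OF s]] uK[OF w] by simp
      ultimately show ?thesis by (metis exp_le_cancel_iff exp_ln)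
    qed
    then have "w \<in> W" using w by (simp add: W_def)
    moreover have "u = w * inverse z ^ l" using uK[OF z(1)] by (simp add: w_def power_inverse)
    ultimately show ?thesis using units_closed(3)[OF z(1)] by blast
  qed
  ultimately show ?thesis by (intro exI[of _ W]) (auto simp: W_def)
qed

end

section \<open>Extension of ideals and ramification\<close>

context complex_number_field
begin

lemma iprod_cong_mset:
  "set Ps \<subseteq> fideals K \<Longrightarrow> mset Ps = mset Qs \<Longrightarrow> iprod Ps = iprod Qs"
proof (induction Ps arbitrary: Qs)
  case (Cons P Ps)
  have mem: "P \<in> set Qs" using Cons.prems(2) by (metis list.set_intros(1) set_mset_mset)
  have "mset Ps = mset (remove1 P Qs)" using Cons.prems(2) by (metis add_mset_remove_trivial mset.simps(2) mset_remove1)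
  then have "iprod Ps = iprod (remove1 P Qs)" using Cons by auto
  moreover have "set Qs \<subseteq> fideals K" using Cons.prems by (metis set_mset_mset)
  ultimately show ?case using iprod_remove1[of Qs P] mem by simp
qed simp

lemma ipow_iprod:
  "set Ps \<subseteq> fideals K \<Longrightarrow> ipow (iprod Ps) n = iprod (concat (replicate n Ps))"
proof (induction n)
  case (Suc n)
  have "set (concat (replicate n Ps)) \<subseteq> fideals K" using Suc.prems by auto
  then show ?case using Suc iprod_append[of Ps "concat (replicate n Ps)"] by simp
qed simp

text \<open>Dividing all multiplicities of the prime factorization by \<open>l\<close> gives the
  factorization of the root.\<close>

lemma ex_ideal_root:
  assumes I: "I \<in> fideals K" "I \<subseteq> oint K" and l: "l > 0" and dvd: "\<And>P. P \<in> prime_ideals K \<Longrightarrow> l dvd val P I"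
  shows "\<exists>B\<in>fideals K. B \<subseteq> oint K \<and> ipow B l = I"
proof -
  obtain Ps where Ps: "set Ps \<subseteq> prime_ideals K" "iprod Ps = I" using ex_prime_factorization[OF I] by blast
  define N where "N = Abs_multiset (\<lambda>P. count (mset Ps) P div l)"
  have cN: "count N P = count (mset Ps) P div l" for P
  proof -
    have "finite {P. 0 < count (mset Ps) P div l}"
      by (rule finite_subset[of _ "set Ps"]) (auto simp: count_mset intro: ccontr dest: count_notin)
    then show ?thesis unfolding N_def by (simp add: Abs_multiset_inverse)
  qed
  obtain Qs where Qs: "mset Qs = N" using ex_mset by blast
  have cdvd: "l dvd count (mset Ps) P" for P
  proof (cases "P \<in> set Ps")
    case True
    then show ?thesis using dvd[of P] val_eq[OF Ps, of P] Ps(1) by (auto simp: count_mset)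
  next
    case False
    then have "count (mset Ps) P = 0" unfolding count_eq_zero_iff by (simp only: set_mset_mset not_False_eq_True)
    then show ?thesis by (simp only: dvd_0_right)
  qed
  have "mset (concat (replicate l Qs)) = mset Ps"
  proof (rule multiset_eqI)
    fix P
    have "count (mset (concat (replicate k Qs))) P = k * count N P" for k
      by (induction k) (auto simp: Qs)
    then show "count (mset (concat (replicate l Qs))) P = count (mset Ps) P"
      using cdvd[of P] by (simp add: cN)
  qed
  moreover have sub: "set Qs \<subseteq> prime_ideals K"
  proof
    fix Q assume "Q \<in> set Qs"
    then have "Q \<in># N" using Qs by (metis set_mset_mset)
    then have "count (mset Ps) Q > 0" using cN[of Q] by (metis count_greater_zero_iff div_0 gr0I)
    then show "Q \<in> prime_ideals K" using Ps(1) by auto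
  qed
  ultimately have "ipow (iprod Qs) l = I"
  proof -
    assume m: "mset (concat (replicate l Qs)) = mset Ps" and "set Qs \<subseteq> prime_ideals K"
    then have Q: "set Qs \<subseteq> fideals K" using primes_fideals by blast
    then have "set (concat (replicate l Qs)) \<subseteq> fideals K" by auto
    then show ?thesis using ipow_iprod[OF Q] iprod_cong_mset[OF _ m] Ps(2) by simp
  qed
  moreover have "iprod Qs \<in> fideals K" using sub primes_fideals by (intro iprod_fideal) auto
  ultimately show ?thesis using iprod_integral[OF sub] by blast
qed

lemma ipow_subset_prime:
  assumes P: "P \<in> prime_ideals K" and I: "I \<in> fideals K" "I \<subseteq> oint K"
  shows "ipow I k \<subseteq> oint K" "ipow I k \<subseteq> P \<Longrightarrow> I \<subseteq> P"
proof -
  show *: "ipow I k \<subseteq> oint K" for k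
  proof (induction k)
    case (Suc k)
    have "imul I (ipow I k) \<subseteq> imul (oint K) (oint K)" by (rule imul_mono[OF I(2) Suc])
    then show ?case using imul_oint[OF omodule_oint] by simp
  qed simp
  show "ipow I k \<subseteq> P \<Longrightarrow> I \<subseteq> P"
  proof (induction k)
    case 0 then show ?case using primeD(3)[OF P] oint_closed(2) by auto
  next
    case (Suc k)
    then show ?case using prime_contains_imul[OF P I(2) *[of k]] by auto
  qed
qed

end

locale number_field_extension = F: complex_number_field F + K: complex_number_field K for F K +
  assumes sub: "F \<subseteq> K"
begin

lemma oint_sub: "oint F \<subseteq> oint K" using sub by (auto simp: oint_def)

definition ext :: "complex set \<Rightarrow> complex set" where
  "ext I = imul I (oint K)"

lemma oint_oint: "imul (oint K) (oint K) = oint K"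
  using K.imul_oint[OF K.omodule_oint] .

lemma ext_imul: "ext (imul I J) = imul (ext I) (ext J)"
proof -
  have "imul (ext I) (ext J) = imul (imul I J) (imul (oint K) (oint K))"
    unfolding ext_def by (metis imul_assoc imul_commute)
  then show ?thesis by (simp add: oint_oint ext_def)
qed

lemma ext_smul: "ext (smul x I) = smul x (ext I)"
  unfolding ext_def by (rule smul_imul)

lemma ext_oint: "ext (oint F) = oint K"
proof (rule antisym)
  show "ext (oint F) \<subseteq> oint K"
    unfolding ext_def using imul_mono[OF oint_sub order_refl] oint_oint by blast
  show "oint K \<subseteq> ext (oint F)"
    unfolding ext_def using imul.prod[OF F.oint_closed(2)] by force
qed

lemma subset_ext: "I \<subseteq> ext I"
  unfolding ext_def using imul.prod[OF _ K.oint_closed(2)] by force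

lemma ext_least: "I \<subseteq> J \<Longrightarrow> omodule K J \<Longrightarrow> ext I \<subseteq> J"
  unfolding ext_def
proof (rule imul_least)
  fix i j assume "I \<subseteq> J" "omodule K J" "i \<in> I" "j \<in> oint K"
  then show "i * j \<in> J" using K.omoduleD(3)[of J j i] by (auto simp: mult.commute)
qed (auto intro: K.omoduleD)

lemma ext_integral: "I \<subseteq> oint F \<Longrightarrow> ext I \<subseteq> oint K"
  using oint_sub by (intro ext_least K.omodule_oint) auto

lemma ext_omodule: "0 \<in> I \<Longrightarrow> omodule K (ext I)"
  unfolding omodule_def
proof (intro conjI ballI)
  assume "0 \<in> I"
  then show "0 \<in> ext I" using subset_ext by blast
next
  fix a x assume a: "a \<in> oint K" and "x \<in> ext I"
  from this(2) show "a * x \<in> ext I"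
    unfolding ext_def
  proof induction
    case (prod i j)
    then show ?case using imul.prod[of i I "a * j" "oint K"] K.oint_closed(6)[OF a] by (simp add: mult.left_commute)
  qed (auto simp: distrib_left intro: imul.sum)
qed (auto simp: ext_def intro: imul.sum)

lemma ext_integral_fideal:
  assumes "I \<in> fideals F" "I \<subseteq> oint F"
  shows "ext I \<in> fideals K"
proof -
  obtain x where "x \<in> I" "x \<noteq> 0" using F.fidealsD(3)[OF assms(1)] by blast
  then show ?thesis
    using K.integral_fideal[OF ext_omodule ext_integral[OF assms(2)]] subset_ext
      F.omoduleD(1)[OF F.fidealsD(1)[OF assms(1)]] by blast
qed

text \<open>The contraction is nonzero because a nonzero ideal of integers contains a positive
  rational integer.\<close>

lemma contraction_prime:
  assumes P: "P \<in> prime_ideals K"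
  shows "P \<inter> oint F \<in> prime_ideals F"
proof -
  note D = K.primeD[OF P]
  obtain x where x: "x \<in> P" "x \<noteq> 0" using K.fidealsD(3)[OF D(1)] by blast
  obtain m :: int where m: "m > 0" "of_int m \<in> P" using K.nonzero_int_in_ideal[OF D(4,2) x] by blast
  have mod: "omodule F (P \<inter> oint F)"
    unfolding omodule_def
  proof (intro conjI ballI)
    show "0 \<in> P \<inter> oint F" using K.omoduleD(1)[OF D(4)] F.oint_closed(1) by blast
    show "x + y \<in> P \<inter> oint F" if "x \<in> P \<inter> oint F" "y \<in> P \<inter> oint F" for x y
      using that K.omoduleD(2)[OF D(4)] F.oint_closed(3) by simp
    show "a * x \<in> P \<inter> oint F" if "a \<in> oint F" "x \<in> P \<inter> oint F" for a x
      using that K.omoduleD(3)[OF D(4) subsetD[OF oint_sub]] F.oint_closed(6) by simp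
  qed
  have "P \<inter> oint F \<in> fideals F"
    using F.integral_fideal[OF mod, of "of_int m"] m F.oint_closed(7) by auto
  then show ?thesis
    unfolding prime_ideals_def using D(3,5) oint_sub by blast
qed

text \<open>A prime contained in the contraction of \<open>P\<close> equals it, since no nonzero
  prime lies strictly inside another.\<close>

lemma ext_subset_iff:
  assumes P: "P \<in> prime_ideals K" and p: "p \<in> prime_ideals F"
  shows "ext p \<subseteq> P \<longleftrightarrow> P \<inter> oint F = p"
proof
  assume "ext p \<subseteq> P"
  then have "p \<subseteq> P \<inter> oint F" using subset_ext F.primeD(2)[OF p] by blast
  then show "P \<inter> oint F = p" using F.prime_subset_eq[OF p contraction_prime[OF P]] by blast
next
  assume "P \<inter> oint F = p"
  then show "ext p \<subseteq> P" using K.primeD(4)[OF P] by (intro ext_least) auto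
qed

text \<open>Only the factor \<open>P \<inter> oint F\<close> of \<open>I\<close> contributes, as all
  other primes extend to ideals that \<open>P\<close> does not contain. When \<open>I\<close> is
  itself an extended prime, this is the multiplicativity of ramification indices.\<close>

lemma val_ext:
  assumes P: "P \<in> prime_ideals K" and I: "I \<in> fideals F" "I \<subseteq> oint F"
  shows "K.val P (ext I) = K.val P (ext (P \<inter> oint F)) * F.val (P \<inter> oint F) I"
proof -
  let ?p = "P \<inter> oint F"
  have step: "K.val P (ext q) = (if q = ?p then K.val P (ext ?p) else 0)" if q: "q \<in> prime_ideals F" for q
  proof (cases "q = ?p")
    case False
    then have "\<not> ext q \<subseteq> P" using ext_subset_iff[OF P q] by auto
    then show ?thesis
      using K.val_pos_iff[OF P ext_integral_fideal[OF F.primeD(1)[OF q] F.primeD(2)[OF q]] ext_integral[OF F.primeD(2)[OF q]]] False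
      by simp
  qed auto
  have "K.val P (ext (F.iprod Ps)) = K.val P (ext ?p) * count_list Ps ?p" if "set Ps \<subseteq> prime_ideals F" for Ps
    using that
  proof (induction Ps)
    case Nil then show ?case by (simp add: ext_oint K.val_oint)
  next
    case (Cons q Ps)
    then have q: "q \<in> prime_ideals F" and Ps: "set Ps \<subseteq> prime_ideals F" by auto
    have "K.val P (ext (F.iprod (q # Ps))) = K.val P (ext q) + K.val P (ext (F.iprod Ps))"
      using q F.iprod_fideal[of Ps] F.iprod_integral[OF Ps] Ps F.primes_fideals F.primeD(1,2)[OF q]
      by (simp add: ext_imul) (intro K.val_imul ext_integral_fideal ext_integral; auto)
    then show ?case using Cons.IH[OF Ps] step[OF q] by simp
  qed
  moreover obtain Ps where "set Ps \<subseteq> prime_ideals F" "F.iprod Ps = I" using F.ex_prime_factorization[OF I] by blast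
  ultimately show ?thesis using F.val_eq by metis
qed

lemma ext_ipow: "ext (F.ipow I n) = K.ipow (ext I) n"
  by (induction n) (simp_all add: ext_oint ext_imul)

end

text \<open>Artin's form of being Galois, in accordance with \<open>galois_extension\<close>: what
  all automorphisms over \<open>F\<close> fix lies in \<open>F\<close>.\<close>

locale galois_number_field_extension = number_field_extension +
  assumes fixed: "\<And>x. x \<in> K \<Longrightarrow>
    (\<And>g. hom_on K g \<Longrightarrow> g ` K = K \<Longrightarrow> (\<forall>a\<in>F. g a = a) \<Longrightarrow> g x = x) \<Longrightarrow> x \<in> F"
begin

definition gal :: "(complex \<Rightarrow> complex) set" where
  "gal = {g \<in> K.embeddings. g ` K = K \<and> (\<forall>a\<in>F. g a = a)}"

lemma finite_gal: "finite gal"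
  unfolding gal_def using K.finite_embeddings by simp

lemma galD:
  assumes "g \<in> gal"
  shows "hom_on K g" "g ` K = K" "\<And>a. a \<in> F \<Longrightarrow> g a = a" "inj_on g K"
proof -
  show h: "hom_on K g" "g ` K = K" "\<And>a. a \<in> F \<Longrightarrow> g a = a"
    using assms K.embeddings_hom unfolding gal_def by auto
  show "inj_on g K"
  proof (rule inj_onI)
    fix x y assume xy: "x \<in> K" "y \<in> K" "g x = g y"
    then have "g (x - y) = 0" using K.hom_on_simps(6)[OF h(1)] by simp
    then show "x = y" using K.hom_on_simps(7)[OF h(1) K.diff_mem[OF xy(1,2)]] by auto
  qed
qed

lemma restrict_gal: "hom_on K g \<Longrightarrow> g ` K = K \<Longrightarrow> (\<forall>a\<in>F. g a = a) \<Longrightarrow> restrict g K \<in> gal"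
  unfolding gal_def K.embeddings_def using sub by (auto simp: subset_iff)

lemma gal_comp:
  assumes "g \<in> gal" "h \<in> gal"
  shows "restrict (g \<circ> h) K \<in> gal"
proof (rule restrict_gal)
  note g = galD[OF assms(1)] and h = galD[OF assms(2)]
  have hK: "h x \<in> K" if "x \<in> K" for x using h(2) that by blast
  show "hom_on K (g \<circ> h)"
    using K.hom_on_simps(1-3)[OF g(1)] K.hom_on_simps(1-3)[OF h(1)] hK unfolding hom_on_def by simp
  show "(g \<circ> h) ` K = K" using g(2) h(2) by (simp only: image_comp[symmetric])
  show "\<forall>a\<in>F. (g \<circ> h) a = a" using g(3) h(3) by simp
qed

text \<open>The norm of \<open>x\<close> relative to \<open>F\<close>. Composition with an
  automorphism permutes the factors, so the product is fixed.\<close>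

lemma gal_norm_mem:
  assumes x: "x \<in> K"
  shows "(\<Prod>g\<in>gal. g x) \<in> F"
proof (rule fixed)
  have gx: "g x \<in> K" if "g \<in> gal" for g using galD(2)[OF that] x by blast
  then show "(\<Prod>g\<in>gal. g x) \<in> K" by (intro K.mems)
  fix h assume h: "hom_on K h" "h ` K = K" "\<forall>a\<in>F. h a = a"
  define h' where "h' = restrict h K"
  have h': "h' \<in> gal" unfolding h'_def using restrict_gal h by blast
  have hprod: "h (\<Prod>g\<in>A. g x) = (\<Prod>g\<in>A. h (g x))" if "finite A" "A \<subseteq> gal" for A
    using that
  proof (induction A)
    case (insert g A)
    have "(\<Prod>g\<in>A. g x) \<in> K" using insert.prems gx by (intro K.mems) auto
    then show ?case using insert gx K.hom_on_simps(2)[OF h(1)] by simp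
  qed (simp add: K.hom_on_simps(3)[OF h(1)])
  define c where "c g = restrict (h' \<circ> g) K" for g
  have inj: "inj_on c gal"
  proof (rule inj_onI)
    fix g1 g2 assume g: "g1 \<in> gal" "g2 \<in> gal" "c g1 = c g2"
    show "g1 = g2"
    proof
      fix y show "g1 y = g2 y"
      proof (cases "y \<in> K")
        case True
        then have "h' (g1 y) = h' (g2 y)" using fun_cong[OF g(3), of y] by (simp add: c_def)
        then show ?thesis using galD(4)[OF h'] galD(2)[OF g(1)] galD(2)[OF g(2)] True by (blast dest: inj_onD)
      next
        case False
        then show ?thesis using g(1,2) unfolding gal_def K.embeddings_def by auto
      qed
    qed
  qed
  have "c ` gal = gal"
    by (rule endo_inj_surj[OF finite_gal _ inj]) (use gal_comp[OF h'] in \<open>auto simp: c_def\<close>)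
  then have "(\<Prod>g\<in>gal. g x) = (\<Prod>g\<in>gal. c g x)"
    using prod.reindex[OF inj, of "\<lambda>g. g x"] by simp
  also have "\<dots> = (\<Prod>g\<in>gal. h (g x))"
    using x gx by (intro prod.cong) (auto simp: c_def h'_def)
  finally show "h (\<Prod>g\<in>gal. g x) = (\<Prod>g\<in>gal. g x)" using hprod[OF finite_gal order_refl] by simp
qed

lemma id_gal: "restrict (\<lambda>x. x) K \<in> gal"
  by (rule restrict_gal) (auto simp: hom_on_def)

lemma gal_imul: 
  assumes "g \<in> gal" "A \<subseteq> K" "B \<subseteq> K"
  shows "g ` imul A B = imul (g ` A) (g ` B)"
proof (rule antisym)
  note g = galD[OF assms(1)]
  have AB: "imul A B \<subseteq> K" using assms(2,3) by (intro imul_least) (auto intro: K.mems)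
  show "g ` imul A B \<subseteq> imul (g ` A) (g ` B)"
  proof clarify
    fix x assume "x \<in> imul A B"
    then show "g x \<in> imul (g ` A) (g ` B)"
    proof induction
      case (prod i j)
      then have "g (i * j) = g i * g j" using K.hom_on_simps(2)[OF g(1)] subsetD[OF assms(2)] subsetD[OF assms(3)] by simp
      then show ?case using imul.prod[OF imageI[OF prod(1)] imageI[OF prod(2)], of g g] by simp
    next
      case (sum x y)
      then have "g (x + y) = g x + g y" using K.hom_on_simps(1)[OF g(1)] subsetD[OF AB] by simp
      then show ?case using imul.sum[OF sum.IH] by simp
    qed
  qed
  show "imul (g ` A) (g ` B) \<subseteq> g ` imul A B"
  proof (rule imul_least)
    fix i j assume "i \<in> g ` A" "j \<in> g ` B"
    then obtain a b where ab: "a \<in> A" "b \<in> B" "i = g a" "j = g b" by blast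
    then have "i * j = g (a * b)" using K.hom_on_simps(2)[OF g(1)] subsetD[OF assms(2)] subsetD[OF assms(3)] by simp
    then show "i * j \<in> g ` imul A B" using imul.prod[OF ab(1,2)] by blast
  next
    fix x y assume "x \<in> g ` imul A B" "y \<in> g ` imul A B"
    then obtain a b where ab: "a \<in> imul A B" "b \<in> imul A B" "x = g a" "y = g b" by blast
    then have "x + y = g (a + b)" using K.hom_on_simps(1)[OF g(1)] subsetD[OF AB] by simp
    then show "x + y \<in> g ` imul A B" using imul.sum[OF ab(1,2)] by blast
  qed
qed

lemma gal_oint:
  assumes "g \<in> gal"
  shows "g ` oint K = oint K"
proof -
  note g = galD[OF assms]
  have iff: "algebraic_int (g x) \<longleftrightarrow> algebraic_int x" if x: "x \<in> K" for x
  proof -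
    have "poly p (g x) = 0 \<longleftrightarrow> poly p x = 0" if p: "\<forall>i. Polynomial.coeff p i \<in> \<int>" for p
    proof -
      have rat: "\<forall>i. Polynomial.coeff p i \<in> \<rat>" using p Ints_subset_Rats by auto
      have "poly p x \<in> K" unfolding poly_altdef using rat x K.Rats_mem by (intro K.mems) auto
      then show ?thesis
        using K.hom_on_poly[OF g(1) x rat] K.hom_on_simps(4,7)[OF g(1)] by metis
    qed
    then show ?thesis unfolding algebraic_int.simps by blast
  qed
  show ?thesis
  proof (rule antisym)
    show "g ` oint K \<subseteq> oint K" using iff g(2) by (auto simp: oint_def)
    show "oint K \<subseteq> g ` oint K"
    proof
      fix y assume y: "y \<in> oint K"
      then obtain x where x: "x \<in> K" "y = g x" using g(2) by (auto simp: oint_def)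
      then show "y \<in> g ` oint K" using y iff by (auto simp: oint_def)
    qed
  qed
qed

lemma gal_prime:
  assumes g: "g \<in> gal" and P: "P \<in> prime_ideals K"
  shows "g ` P \<in> prime_ideals K"
proof -
  note G = galD[OF g] and D = K.primeD[OF P]
  have PK: "P \<subseteq> K" using D(2) K.oint_mem by blast
  have mem: "g x \<in> g ` P \<longleftrightarrow> x \<in> P" if "x \<in> K" for x
    using G(4) PK that by (auto dest: inj_onD)
  have sub: "g ` P \<subseteq> oint K" using gal_oint[OF g] D(2) by blast
  have mod: "omodule K (g ` P)"
    unfolding omodule_def
  proof (intro conjI ballI)
    show "0 \<in> g ` P" using K.omoduleD(1)[OF D(4)] K.hom_on_simps(4)[OF G(1)] by (metis imageI)
    fix x y assume "x \<in> g ` P" "y \<in> g ` P"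
    then obtain a b where "a \<in> P" "b \<in> P" "x = g a" "y = g b" by blast
    then show "x + y \<in> g ` P"
      using K.hom_on_simps(1)[OF G(1), of a b] PK K.omoduleD(2)[OF D(4)] by (metis imageI subsetD)
  next
    fix a x assume a: "a \<in> oint K" and x: "x \<in> g ` P"
    obtain a' where a': "a' \<in> oint K" "a = g a'" using a gal_oint[OF g] by blast
    obtain x' where x': "x' \<in> P" "x = g x'" using x by blast
    have "a * x = g (a' * x')" using K.hom_on_simps(2)[OF G(1)] a' x' PK K.oint_mem by auto
    then show "a * x \<in> g ` P" using K.omoduleD(3)[OF D(4) a'(1) x'(1)] by blast
  qed
  obtain z where z: "z \<in> P" "z \<noteq> 0" using K.fidealsD(3)[OF D(1)] by blast
  have "g z \<in> g ` P" "g z \<noteq> 0" using z PK K.hom_on_simps(7)[OF G(1)] by auto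
  then have fi: "g ` P \<in> fideals K" by (rule K.integral_fideal[OF mod sub])
  have one: "1 \<notin> g ` P" using mem[OF K.one_mem] D(3) K.hom_on_simps(3)[OF G(1)] by simp
  have "x \<in> g ` P \<or> y \<in> g ` P" if xy: "x \<in> oint K" "y \<in> oint K" "x * y \<in> g ` P" for x y
  proof -
    have "x \<in> g ` oint K" "y \<in> g ` oint K" using xy gal_oint[OF g] by simp_all
    then obtain a b where ab: "a \<in> oint K" "b \<in> oint K" "x = g a" "y = g b" by (elim imageE)
    then have "g (a * b) \<in> g ` P" using xy(3) K.hom_on_simps(2)[OF G(1)] K.oint_mem by auto
    then have "a * b \<in> P" using mem ab K.oint_mem K.mult_mem by blast
    then show ?thesis using D(5) ab by blast
  qed
  then show ?thesis unfolding prime_ideals_def using fi sub one by blast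
qed

lemma gal_ipow:
  assumes "g \<in> gal" "P \<in> fideals K"
  shows "g ` K.ipow P n = K.ipow (g ` P) n"
proof (induction n)
  case (Suc n)
  then show ?case
    using gal_imul[OF assms(1) K.fidealsD(2)[OF assms(2)] K.fidealsD(2)[OF K.ipow_fideal[OF assms(2)]]] by simp
qed (simp add: gal_oint[OF assms(1)])

text \<open>
  Some power of \<open>Q\<close> is generated by some \<open>a\<close>; the norm of \<open>a\<close> lies in \<open>Q\<close> and in \<open>F\<close>, hence in \<open>P\<close>, so
  \<open>P\<close> contains a conjugate of \<open>a\<close>.
\<close>

lemma gal_transitive:
  assumes P: "P \<in> prime_ideals K" and Q: "Q \<in> prime_ideals K" and eq: "P \<inter> oint F = Q \<inter> oint F"
  shows "\<exists>g\<in>gal. g ` Q = P"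
proof -
  note DP = K.primeD[OF P] and DQ = K.primeD[OF Q]
  obtain k a where k: "k > 0" "a \<in> K - {0}" "K.ipow Q k = smul a (oint K)"
    using K.ex_principal_power[OF DQ(1)] by blast
  have aQk: "a \<in> K.ipow Q k" unfolding k(3) using K.oint_closed(2) by force
  obtain j where j: "k = Suc j" using k(1) by (cases k) auto
  have aO: "a \<in> oint K" using K.ipow_subset_prime(1)[OF Q DQ(1,2)] aQk by blast
  have "K.ipow Q k \<subseteq> Q"
  proof -
    have "imul (K.ipow Q j) Q \<subseteq> Q"
      by (rule K.imul_integral_subset[OF DQ(4) K.ipow_subset_prime(1)[OF Q DQ(1,2)]])
    then show ?thesis by (simp add: j imul_commute)
  qed
  then have aQ: "a \<in> Q" using aQk by blast
  let ?N = "\<Prod>g\<in>gal. g a"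
  have gO: "g a \<in> oint K" if "g \<in> gal" for g using gal_oint[OF that] aO by blast
  have prodO: "(\<Prod>g\<in>A. g a) \<in> oint K" if "A \<subseteq> gal" for A
    using that
  proof (induction A rule: infinite_finite_induct)
    case (insert g A) then show ?case using gO K.oint_closed(6) by simp
  qed (auto intro: K.oint_closed)
  have NF: "?N \<in> oint F" using gal_norm_mem[of a] prodO[OF order_refl] k(2) by (auto simp: oint_def)
  \<comment> \<open>The identity contributes the factor \<open>a\<close>, which puts the norm into
    \<open>Q\<close>.\<close>
  have "?N = a * (\<Prod>g\<in>gal - {restrict (\<lambda>x. x) K}. g a)"
    using prod.remove[OF finite_gal id_gal, of "\<lambda>g. g a"] k(2) by simp
  then have "?N \<in> Q" using K.omoduleD(3)[OF DQ(4) prodO[of "gal - {restrict (\<lambda>x. x) K}"] aQ] by (simp add: mult.commute)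
  then have "?N \<in> P" using NF eq by blast
  have "\<exists>g\<in>A. g a \<in> P" if "finite A" "A \<subseteq> gal" "(\<Prod>g\<in>A. g a) \<in> P" for A
    using that
  proof (induction A)
    case empty then show ?case using DP(3) by simp
  next
    case (insert g A)
    then show ?case using DP(5)[OF gO[of g] prodO[of A]] by auto
  qed
  then obtain g where g: "g \<in> gal" "g a \<in> P" using finite_gal \<open>?N \<in> P\<close> by blast
  have "K.ipow (g ` Q) k = g ` smul a (oint K)" using gal_ipow[OF g(1) DQ(1)] k(3) by metis
  also have "\<dots> \<subseteq> P"
  proof clarify
    fix x assume x: "x \<in> oint K"
    have "g (a * x) = g x * g a"
      using K.hom_on_simps(2)[OF galD(1)[OF g(1)], of a x] k(2) x K.oint_mem by (simp add: mult.commute)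
    then show "g (a * x) \<in> P" using K.omoduleD(3)[OF DP(4) _ g(2)] gal_oint[OF g(1)] x by (metis imageI)
  qed
  finally have "g ` Q \<subseteq> P"
    using K.ipow_subset_prime(2)[OF P] K.primeD(1,2)[OF gal_prime[OF g(1) Q]] by blast
  then show ?thesis using K.prime_subset_eq[OF gal_prime[OF g(1) Q] P] g(1) by blast
qed

text \<open>An automorphism over \<open>F\<close> maps \<open>ext I\<close> to itself and its
  factorization into primes to another one; uniqueness then compares the exponents.\<close>

lemma gal_val:
  assumes g: "g \<in> gal" and I: "I \<in> fideals F" "I \<subseteq> oint F"
    and P: "P \<in> prime_ideals K"
  shows "K.val (g ` P) (ext I) = K.val P (ext I)"
proof -
  obtain Ps where Ps: "set Ps \<subseteq> prime_ideals K" "K.iprod Ps = ext I"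
    using K.ex_prime_factorization[OF ext_integral_fideal[OF I] ext_integral[OF I(2)]] by blast
  have gi: "K.iprod (map ((`) g) Qs) = g ` K.iprod Qs" if "set Qs \<subseteq> prime_ideals K" for Qs
    using that
  proof (induction Qs)
    case (Cons Q Qs)
    have "Q \<subseteq> K" "K.iprod Qs \<subseteq> K"
      using Cons.prems K.primeD(2)[of Q] K.iprod_integral[of Qs] K.oint_mem by auto
    then show ?case using Cons gal_imul[OF g] by simp
  qed (simp add: gal_oint[OF g])
  have "g ` ext I = ext I"
  proof -
    have "I \<subseteq> F" using F.fidealsD(2)[OF I(1)] .
    then have "g ` I = I" "I \<subseteq> K" using galD(3)[OF g] sub by (force simp: image_iff)+
    moreover have "oint K \<subseteq> K" using K.oint_mem by blast
    ultimately show ?thesis unfolding ext_def using gal_imul[OF g, of I "oint K"] gal_oint[OF g] by simp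
  qed
  then have "K.iprod (map ((`) g) Ps) = ext I" using gi[OF Ps(1)] Ps(2) by simp
  moreover have "set (map ((`) g) Ps) \<subseteq> prime_ideals K" using gal_prime[OF g] Ps(1) by auto
  ultimately have "K.val (g ` P) (ext I) = count_list (map ((`) g) Ps) (g ` P)" by (rule K.val_eq[rotated])
  also have "\<dots> = count_list Ps P"
  proof -
    have "g ` Q = g ` P \<longleftrightarrow> Q = P" if "Q \<in> prime_ideals K" for Q
      using inj_on_image_eq_iff[OF galD(4)[OF g], of Q P] K.fidealsD(2)[OF K.primeD(1)] P that by blast
    then show ?thesis using Ps(1) by (induction Ps) auto
  qed
  also have "\<dots> = K.val P (ext I)" using K.val_eq[OF Ps] by simp
  finally show ?thesis .
qed

text \<open>By transitivity all primes above \<open>p\<close> have the same exponent in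
  \<open>ext p\<close>, so divisibility by \<open>l\<close> at \<open>P\<close> spreads to all of
  them. At the remaining primes the exponent is 0.\<close>

lemma ramified_power:
  assumes l: "l > 0" and p: "p \<in> prime_ideals F" and P: "P \<in> prime_ideals K" "P \<inter> oint F = p" and dvd: "l dvd K.val P (ext p)"
  shows "\<exists>B\<in>fideals K. B \<subseteq> oint K \<and> K.ipow B l = ext p"
proof (rule K.ex_ideal_root[OF _ _ l])
  note D = F.primeD[OF p]
  show fi: "ext p \<in> fideals K" "ext p \<subseteq> oint K" using ext_integral_fideal D ext_integral by blast+
  fix Q assume Q: "Q \<in> prime_ideals K"
  show "l dvd K.val Q (ext p)"
  proof (cases "Q \<inter> oint F = p")
    case True
    then obtain g where "g \<in> gal" "g ` P = Q" using gal_transitive[OF Q P(1)] P(2) by auto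
    then show ?thesis using gal_val[OF _ D(1,2) P(1)] dvd by metis
  next
    case False
    then show ?thesis using K.val_pos_iff[OF Q fi] ext_subset_iff[OF Q p] by simp
  qed
qed

end

section \<open>Counting classes and units modulo powers\<close>

lemma ex_transversal:
  assumes "equiv A r" "finite (A // r)"
  obtains W where "W \<subseteq> A" "finite W" "card W = card (A // r)" "\<And>x. x \<in> A \<Longrightarrow> \<exists>w\<in>W. (x, w) \<in> r"
    "\<And>v w. v \<in> W \<Longrightarrow> w \<in> W \<Longrightarrow> (v, w) \<in> r \<Longrightarrow> v = w"
proof -
  define f where "f C = (SOME x. x \<in> C)" for C :: "'a set"
  have f: "f C \<in> C" if "C \<in> A // r" for C
    unfolding f_def using in_quotient_imp_non_empty[OF assms(1) that] by (simp add: some_in_eq)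
  have inj: "inj_on f (A // r)"
  proof (rule inj_onI)
    fix C D assume CD: "C \<in> A // r" "D \<in> A // r" "f C = f D"
    have "(f C, f D) \<in> r"
      using CD f[OF CD(1)] in_quotient_imp_subset[OF assms(1) CD(1)] equivE[OF assms(1)]
      by (metis refl_onD subsetD)
    then show "C = D" using quotient_eqI[OF assms(1) CD(1,2) f[OF CD(1)] f[OF CD(2)]] by blast
  qed
  show ?thesis
  proof (rule that[of "f ` (A // r)"])
    show "f ` (A // r) \<subseteq> A" using f in_quotient_imp_subset[OF assms(1)] by blast
    show "finite (f ` (A // r))" using assms(2) by simp
    show "card (f ` (A // r)) = card (A // r)" by (rule card_image[OF inj])
    show "\<exists>w\<in>f ` (A // r). (x, w) \<in> r" if "x \<in> A" for x
    proof -
      have C: "r `` {x} \<in> A // r" using that by (rule quotientI)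
      then have "f (r `` {x}) \<in> r `` {x}" by (rule f)
      then show ?thesis using C by blast
    qed
    fix v w assume vw: "v \<in> f ` (A // r)" "w \<in> f ` (A // r)" "(v, w) \<in> r"
    then obtain C D where CD: "C \<in> A // r" "D \<in> A // r" "v = f C" "w = f D" by blast
    then show "v = w" using quotient_eqI[OF assms(1) CD(1,2) f[OF CD(1)] f[OF CD(2)]] vw(3) by simp
  qed
qed

lemma finite_quotient_cover:
  assumes "equiv A r" "finite W" "\<And>x. x \<in> A \<Longrightarrow> \<exists>w\<in>W. (x, w) \<in> r"
  shows "finite (A // r)"
proof (rule finite_subset)
  show "A // r \<subseteq> (\<lambda>w. r `` {w}) ` W"
  proof
    fix C assume "C \<in> A // r"
    then obtain x where x: "x \<in> A" "C = r `` {x}" by (auto elim: quotientE)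
    then obtain w where "w \<in> W" "(x, w) \<in> r" using assms(3) by blast
    then show "C \<in> (\<lambda>w. r `` {w}) ` W" using equiv_class_eq[OF assms(1)] x(2) by blast
  qed
qed (use assms(2) in simp)

lemma card_le_fibres:
  assumes "finite S" "f ` S \<subseteq> Y" "finite Y" "\<And>y. y \<in> Y \<Longrightarrow> card {s \<in> S. f s = y} \<le> m"
  shows "card S \<le> card Y * m"
proof -
  have "S = (\<Union>y\<in>Y. {s \<in> S. f s = y})" using assms(2) by blast
  then have "card S \<le> (\<Sum>y\<in>Y. card {s \<in> S. f s = y})"
    using card_UN_le[OF assms(3), of "\<lambda>y. {s \<in> S. f s = y}"] by metis
  also have "\<dots> \<le> (\<Sum>y\<in>Y. m)" by (rule sum_mono) (rule assms(4))
  finally show ?thesis by simp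
qed

section \<open>Exponents of elements, T-units, and classes killed by a power\<close>

context complex_number_field
begin

lemma smul_oint_fideal: "x \<in> K \<Longrightarrow> x \<noteq> 0 \<Longrightarrow> smul x (oint K) \<in> fideals K"
  by (rule smul_fideal[OF oint_fideal])

lemma smul_as_imul: "I \<in> fideals K \<Longrightarrow> smul x I = imul (smul x (oint K)) I"
  by (simp add: smul_imul imul_oint_left)

lemma unit_smul:
  assumes "u \<in> units K" shows "smul u (oint K) = oint K"
proof (rule antisym)
  have u: "u \<in> oint K" "u \<noteq> 0" "inverse u \<in> oint K" using assms by (auto simp: units_def)
  show "smul u (oint K) \<subseteq> oint K" using u oint_closed(6) by blast
  show "oint K \<subseteq> smul u (oint K)"
  proof
    fix x assume "x \<in> oint K"
    then have "inverse u * x \<in> oint K" using u oint_closed(6) by blast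
    then show "x \<in> smul u (oint K)" using u(2) by (intro image_eqI[of _ _ "inverse u * x"]) auto
  qed
qed

lemma unit_if_smul:
  assumes "u \<in> K" "u \<noteq> 0" "smul u (oint K) = oint K" shows "u \<in> units K"
proof -
  have "u \<in> oint K" using assms(3) oint_closed(2) by force
  moreover have "smul (inverse u) (oint K) = oint K" using smul_inverse[OF assms(2)] assms(3) by metis
  then have "inverse u \<in> oint K" using oint_closed(2) by force
  ultimately show ?thesis using assms(2) by (simp add: units_def)
qed

lemma ex_fraction:
  assumes "x \<in> K" "x \<noteq> 0"
  shows "\<exists>As Bs. set As \<subseteq> prime_ideals K \<and> set Bs \<subseteq> prime_ideals K \<and> smul x (iprod Bs) = iprod As"
proof -
  obtain d where d: "d \<in> oint K" "d \<noteq> 0" "d * x \<in> oint K" using ex_denominator[OF assms(1)] by blast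
  have int: "smul e (oint K) \<subseteq> oint K" if "e \<in> oint K" for e using oint_closed(6) that by blast
  obtain Bs where Bs: "set Bs \<subseteq> prime_ideals K" "iprod Bs = smul d (oint K)"
    using ex_prime_factorization[OF smul_oint_fideal[OF oint_mem[OF d(1)] d(2)] int[OF d(1)]] by blast
  obtain As where As: "set As \<subseteq> prime_ideals K" "iprod As = smul (d * x) (oint K)"
    using ex_prime_factorization[OF smul_oint_fideal[OF oint_mem[OF d(3)]] int[OF d(3)]] d(2) assms(2) by auto
  have "smul x (iprod Bs) = iprod As" unfolding As(2) Bs(2) smul_smul by (simp add: mult.commute)
  then show ?thesis using As(1) Bs(1) by blast
qed

text \<open>The exponent of \<open>p\<close> in the fractional ideal generated by \<open>x\<close>; junk for \<open>x = 0\<close>.\<close>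

definition vx :: "complex set \<Rightarrow> complex \<Rightarrow> int" where
  "vx p x = (THE n. \<exists>As Bs. set As \<subseteq> prime_ideals K \<and> set Bs \<subseteq> prime_ideals K \<and>
     smul x (iprod Bs) = iprod As \<and> n = int (count_list As p) - int (count_list Bs p))"

lemma vx_eq:
  assumes "set As \<subseteq> prime_ideals K" "set Bs \<subseteq> prime_ideals K" "smul x (iprod Bs) = iprod As"
  shows "vx p x = int (count_list As p) - int (count_list Bs p)"
  unfolding vx_def
proof (rule the_equality)
  fix n assume "\<exists>As Bs. set As \<subseteq> prime_ideals K \<and> set Bs \<subseteq> prime_ideals K \<and>
     smul x (iprod Bs) = iprod As \<and> n = int (count_list As p) - int (count_list Bs p)"
  then obtain As' Bs' where B: "set As' \<subseteq> prime_ideals K" "set Bs' \<subseteq> prime_ideals K"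
    "smul x (iprod Bs') = iprod As'" and n: "n = int (count_list As' p) - int (count_list Bs' p)" by blast
  note fid = subset_trans[OF _ primes_fideals]
  have "iprod (As @ Bs') = smul x (imul (iprod Bs) (iprod Bs'))"
    using iprod_append[OF fid[OF assms(1)] fid[OF B(2)]] assms(3) smul_imul[of x "iprod Bs" "iprod Bs'"] by simp
  also have "\<dots> = iprod (As' @ Bs)"
    using iprod_append[OF fid[OF B(1)] fid[OF assms(2)]] B(3) smul_imul[of x "iprod Bs'" "iprod Bs"]
    by (simp add: imul_commute)
  finally have "mset (As @ Bs') = mset (As' @ Bs)"
    by (rule prime_factorization_unique[rotated 2]) (use assms(1,2) B(1,2) in simp_all)
  then have "count (mset (As @ Bs')) p = count (mset (As' @ Bs)) p" by simp
  then have "count_list As p + count_list Bs' p = count_list As' p + count_list Bs p"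
    by (simp add: count_mset)
  then show "n = int (count_list As p) - int (count_list Bs p)" using n by simp
qed (use assms in blast)

lemma vx_mult:
  assumes "x \<in> K" "x \<noteq> 0" "y \<in> K" "y \<noteq> 0"
  shows "vx p (x * y) = vx p x + vx p y"
proof -
  obtain A B where AB: "set A \<subseteq> prime_ideals K" "set B \<subseteq> prime_ideals K" "smul x (iprod B) = iprod A"
    using ex_fraction assms by blast
  obtain C D where CD: "set C \<subseteq> prime_ideals K" "set D \<subseteq> prime_ideals K" "smul y (iprod D) = iprod C"
    using ex_fraction assms by blast
  note fid = subset_trans[OF _ primes_fideals]
  have "iprod (A @ C) = imul (smul x (iprod B)) (smul y (iprod D))"
    using iprod_append[OF fid[OF AB(1)] fid[OF CD(1)]] AB(3) CD(3) by simp
  also have "\<dots> = smul x (smul y (imul (iprod D) (iprod B)))"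
    unfolding smul_imul imul_commute[of "iprod B"] by (rule refl)
  also have "\<dots> = smul (x * y) (iprod (B @ D))"
    unfolding smul_smul using iprod_append[OF fid[OF AB(2)] fid[OF CD(2)]] by (simp add: imul_commute)
  finally have "smul (x * y) (iprod (B @ D)) = iprod (A @ C)" by simp
  then have "vx p (x * y) = int (count_list (A @ C) p) - int (count_list (B @ D) p)"
    using AB CD by (intro vx_eq) auto
  then show ?thesis using vx_eq[OF AB, of p] vx_eq[OF CD, of p] by simp
qed

lemma vx_one: "vx p 1 = 0"
  using vx_eq[of "[]" "[]" 1 p] by simp

lemma vx_power: "x \<in> K \<Longrightarrow> x \<noteq> 0 \<Longrightarrow> vx p (x ^ n) = int n * vx p x"
  by (induction n) (auto simp: vx_one vx_mult power_mem algebra_simps)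

lemma vx_inverse: "x \<in> K \<Longrightarrow> x \<noteq> 0 \<Longrightarrow> vx p (inverse x) = - vx p x"
  using vx_mult[of x "inverse x" p] inverse_mem[of x] by (simp add: vx_one)

lemma vx_powi: "x \<in> K \<Longrightarrow> x \<noteq> 0 \<Longrightarrow> vx p (x powi k) = k * vx p x"
  by (auto simp: power_int_def vx_power vx_inverse inverse_mem)

lemma vx_unit: "u \<in> units K \<Longrightarrow> vx p u = 0"
  using vx_eq[of "[]" "[]" u p] unit_smul by simp

definition T_units :: "complex set set \<Rightarrow> complex set" where
  "T_units T = {x \<in> K - {0}. \<forall>p\<in>prime_ideals K - T. vx p x = 0}"

text \<open>Primes outside \<open>T\<close> occur equally often in numerator and denominator, and
  the ideals that they form can be cancelled.\<close>

lemma T_units_fraction: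
  assumes "x \<in> T_units T"
  shows "\<exists>As Bs. set As \<subseteq> T \<inter> prime_ideals K \<and> set Bs \<subseteq> T \<inter> prime_ideals K \<and> smul x (iprod Bs) = iprod As"
proof -
  have x: "x \<in> K" "x \<noteq> 0" and v: "\<And>p. p \<in> prime_ideals K \<Longrightarrow> p \<notin> T \<Longrightarrow> vx p x = 0"
    using assms by (auto simp: T_units_def)
  obtain A B where AB: "set A \<subseteq> prime_ideals K" "set B \<subseteq> prime_ideals K" "smul x (iprod B) = iprod A"
    using ex_fraction x by blast
  define f where "f = filter (\<lambda>p. p \<in> T)"
  define g where "g = filter (\<lambda>p. p \<notin> T)"
  have fid: "set (f L) \<subseteq> fideals K" "set (g L) \<subseteq> fideals K" if "set L \<subseteq> prime_ideals K" for L
    using that primes_fideals by (auto simp: f_def g_def)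
  have split: "iprod L = imul (iprod (f L)) (iprod (g L))" if "set L \<subseteq> prime_ideals K" for L
  proof -
    have "mset L = mset (f L @ g L)" unfolding f_def g_def by (simp add: mset_filter)
    then have "iprod L = iprod (f L @ g L)" using that primes_fideals by (intro iprod_cong_mset) auto
    then show ?thesis using iprod_append[OF fid[OF that]] by simp
  qed
  have "mset (g A) = mset (g B)"
  proof (rule multiset_eqI)
    fix p
    have "count_list A p = count_list B p" if "p \<notin> T"
    proof (cases "p \<in> prime_ideals K")
      case True
      then show ?thesis using v[OF True that] vx_eq[OF AB, of p] by simp
    next
      case False
      then have "p \<notin> set A" "p \<notin> set B" using AB by auto
      then show ?thesis by (simp add: count_list_0_iff)
    qed
    then show "count (mset (g A)) p = count (mset (g B)) p"
      by (simp add: g_def mset_filter count_mset)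
  qed
  then have eqg: "iprod (g A) = iprod (g B)" using fid(2)[OF AB(1)] by (intro iprod_cong_mset)
  have "imul (iprod (g A)) (smul x (iprod (f B))) = smul x (iprod B)"
    unfolding split[OF AB(2)] eqg by (simp add: imul_commute[of "iprod (g B)"] smul_imul)
  also have "\<dots> = imul (iprod (g A)) (iprod (f A))"
    unfolding AB(3) by (subst split[OF AB(1)]) (rule imul_commute)
  finally have "smul x (iprod (f B)) = iprod (f A)"
    by (rule imul_cancel[rotated 3]) (use fid AB x in \<open>auto intro!: iprod_fideal smul_fideal\<close>)
  moreover have "set (f A) \<subseteq> T \<inter> prime_ideals K" "set (f B) \<subseteq> T \<inter> prime_ideals K"
    using AB by (auto simp: f_def)
  ultimately show ?thesis by blast
qed

lemma T_units_empty: "T_units {} = units K"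
proof
  show "T_units {} \<subseteq> units K"
  proof
    fix x assume x: "x \<in> T_units {}"
    then obtain A B where "set A \<subseteq> {}" "set B \<subseteq> {}" "smul x (iprod B) = iprod A"
      using T_units_fraction[OF x] by blast
    then show "x \<in> units K" using x by (intro unit_if_smul) (auto simp: T_units_def)
  qed
  show "units K \<subseteq> T_units {}"
    using vx_unit oint_mem by (auto simp: T_units_def units_def)
qed

lemma T_units_closed:
  "x \<in> T_units T \<Longrightarrow> y \<in> T_units T \<Longrightarrow> x * y \<in> T_units T" "x \<in> T_units T \<Longrightarrow> x powi k \<in> T_units T"
  by (auto simp: T_units_def vx_mult vx_powi mems)

lemma T_units_root: "z \<in> K \<Longrightarrow> l > 0 \<Longrightarrow> z ^ l \<in> T_units T \<Longrightarrow> z \<in> T_units T"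
  using zero_power[of l] by (cases "z = 0") (auto simp: T_units_def vx_power)

text \<open>Some power of \<open>p\<close> is generated by an element, which has exponent 0 away
  from \<open>p\<close>, so positive exponents at \<open>p\<close> do occur. Division with remainder
  shows that the least positive one divides all others; it may exceed 1 when \<open>p\<close> is not
  principal.\<close>

lemma ex_T_unit_uniformizer:
  assumes p: "p \<in> prime_ideals K" "p \<notin> T"
  obtains \<delta> m where "\<delta> \<in> T_units (insert p T)" "vx p \<delta> = m" "m > 0"
    "\<And>z. z \<in> T_units (insert p T) \<Longrightarrow> m dvd vx p z"
proof -
  obtain k a where k: "k > 0" "a \<in> K - {0}" "ipow p k = smul a (oint K)"
    using ex_principal_power[OF primeD(1)[OF p(1)]] by blast
  have "ipow p k = iprod (replicate k p)" by (induction k) auto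
  then have "vx q a = int (count_list (replicate k p) q)" for q
    using vx_eq[of "replicate k p" "[]" a q] k(3) p(1) by (auto simp: set_replicate_conv_if)
  moreover have "count_list (replicate k p) q = (if q = p then k else 0)" for q
    by (induction k) auto
  ultimately have va: "vx q a = (if q = p then int k else 0)" for q by simp
  define P where "P = (\<lambda>n::nat. n > 0 \<and> (\<exists>z\<in>T_units (insert p T). vx p z = int n))"
  have "a \<in> T_units (insert p T)" using k va by (auto simp: T_units_def)
  then have "P k" unfolding P_def using k(1) va[of p] by auto
  define m where "m = (LEAST n. P n)"
  have "P m" unfolding m_def using \<open>P k\<close> by (rule LeastI)
  then obtain \<delta> where d: "m > 0" "\<delta> \<in> T_units (insert p T)" "vx p \<delta> = int m" by (auto simp: P_def)
  show ?thesis
  proof (rule that[OF d(2,3)])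
    show "int m > 0" using d(1) by simp
    fix z assume z: "z \<in> T_units (insert p T)"
    define q where "q = vx p z div int m"
    have zd: "z * \<delta> powi (- q) \<in> T_units (insert p T)" using z d(2) by (intro T_units_closed)
    have "vx p (z * \<delta> powi (- q)) = vx p z - q * int m"
      using z d(2,3) by (auto simp: T_units_def vx_mult vx_powi mems)
    also have "\<dots> = vx p z mod int m" unfolding q_def by (simp add: minus_div_mult_eq_mod)
    finally have v: "vx p (z * \<delta> powi (- q)) = vx p z mod int m" .
    have "vx p z mod int m = 0"
    proof (rule ccontr)
      assume "vx p z mod int m \<noteq> 0"
      then have pos: "vx p z mod int m > 0" using d(1) by (metis of_nat_0_less_iff pos_mod_sign order_le_less)
      then have "P (nat (vx p z mod int m))" using v zd unfolding P_def by auto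
      then have "m \<le> nat (vx p z mod int m)" unfolding m_def by (rule Least_le)
      moreover have "vx p z mod int m < int m" using d(1) by simp
      ultimately show False using pos by linarith
    qed
    then show "int m dvd vx p z" by auto
  qed
qed

text \<open>
  For each prime of \<open>T\<close>, the powers below \<open>l\<close> of a \<open>T\<close>-unit whose exponent at that prime is positive
  and minimal multiply the number of classes by \<open>l\<close>.
\<close>

lemma ex_inequivalent_T_units:
  assumes l: "l > 0" and T: "finite T" "T \<subseteq> prime_ideals K"
    and W: "finite W" "W \<subseteq> units K" "\<And>v w z. v \<in> W \<Longrightarrow> w \<in> W \<Longrightarrow> z \<in> K \<Longrightarrow> v = w * z ^ l \<Longrightarrow> v = w"
  shows "\<exists>S. finite S \<and> S \<subseteq> T_units T \<and> card S = l ^ card T * card W \<and>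
    (\<forall>r\<in>S. \<forall>s\<in>S. \<forall>z\<in>K. r = s * z ^ l \<longrightarrow> r = s)"
  using T
proof (induction T)
  case empty
  then show ?case using W by (intro exI[of _ W]) (auto simp: T_units_empty)
next
  case (insert p T)
  then obtain S where S: "finite S" "S \<subseteq> T_units T" "card S = l ^ card T * card W"
    "\<And>r s z. r \<in> S \<Longrightarrow> s \<in> S \<Longrightarrow> z \<in> K \<Longrightarrow> r = s * z ^ l \<Longrightarrow> r = s" by auto
  have p: "p \<in> prime_ideals K" using insert.prems by blast
  obtain \<delta> m where d: "\<delta> \<in> T_units (insert p T)" "vx p \<delta> = m" "m > 0"
    "\<And>z. z \<in> T_units (insert p T) \<Longrightarrow> m dvd vx p z"
    using ex_T_unit_uniformizer[OF p insert.hyps(2)] by metis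
  have dK: "\<delta> \<in> K" "\<delta> \<noteq> 0" using d(1) by (auto simp: T_units_def)
  have SK: "s \<in> K" "s \<noteq> 0" "vx p s = 0" if "s \<in> S" for s
    using S(2) that p insert.hyps(2) by (auto simp: T_units_def)
  have sub: "T_units T \<subseteq> T_units (insert p T)" by (auto simp: T_units_def)
  have ineq: "i = j \<and> r = s"
    if rs: "r \<in> S" "s \<in> S" "i < l" "j < l" "z \<in> K" "r * \<delta> ^ i = s * \<delta> ^ j * z ^ l" for r s i j z
  proof -
    have z0: "z \<noteq> 0"
    proof
      assume "z = 0"
      then have "r * \<delta> ^ i = 0" using rs(6) l by (simp add: power_0_left)
      then show False using SK(2)[OF rs(1)] dK by simp
    qed
    have zl: "z ^ l = (r * \<delta> powi (int i)) * (s powi (- 1) * \<delta> powi (- int j))"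
      using rs(6) SK(2)[OF rs(2)] dK(2) by (simp add: power_int_minus field_simps)
    \<comment> \<open>Exponents of \<open>z ^ l\<close> are \<open>l\<close> times those of
      \<open>z\<close>, so \<open>z\<close> is again a unit away from \<open>T\<close> and
      \<open>p\<close>, and its exponent at \<open>p\<close> is a multiple of
      \<open>m\<close>.\<close>
    have "z ^ l \<in> T_units (insert p T)"
      unfolding zl using rs(1,2) S(2) sub d(1) by (intro T_units_closed) auto
    then have zT: "z \<in> T_units (insert p T)" using T_units_root[OF rs(5) l] by blast
    obtain t where t: "vx p z = m * t" using d(4)[OF zT] by blast
    have "vx p (r * \<delta> ^ i) = int i * m"
      using SK[OF rs(1)] dK d(2) by (simp add: vx_mult vx_power power_mem)
    moreover have "vx p (s * \<delta> ^ j * z ^ l) = int j * m + int l * (m * t)"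
      using SK[OF rs(2)] dK d(2) z0 rs(5) t by (simp add: vx_mult vx_power power_mem mult_mem)
    ultimately have "int i * m = int j * m + int l * (m * t)" using rs(6) by simp
    then have "m * (int i - int j) = m * (int l * t)" by (simp add: algebra_simps)
    then have "int i - int j = int l * t" using d(3) by simp
    then have "int i mod int l = int j mod int l" by (metis mod_eq_dvd_iff dvd_triv_left)
    then have ij: "i = j" using rs(3,4) by simp
    then have "r = s * z ^ l" using rs(6) dK(2) by simp
    then show ?thesis using S(4)[OF rs(1,2,5)] ij by simp
  qed
  have inj: "inj_on (\<lambda>(s, i). s * \<delta> ^ i) (S \<times> {..<l})"
  proof (rule inj_onI)
    fix x y assume xy: "x \<in> S \<times> {..<l}" "y \<in> S \<times> {..<l}"
      "(\<lambda>(s, i). s * \<delta> ^ i) x = (\<lambda>(s, i). s * \<delta> ^ i) y"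
    obtain r i s j where rs: "x = (r, i)" "y = (s, j)" by (metis surj_pair)
    then have "i = j \<and> r = s" using xy one_mem by (intro ineq[of r s i j 1]) auto
    then show "x = y" using rs by simp
  qed
  show ?case
  proof (rule exI[of _ "(\<lambda>(s, i). s * \<delta> ^ i) ` (S \<times> {..<l})"], intro conjI ballI impI)
    show "finite ((\<lambda>(s, i). s * \<delta> ^ i) ` (S \<times> {..<l}))" using S(1) by simp
    show "(\<lambda>(s, i). s * \<delta> ^ i) ` (S \<times> {..<l}) \<subseteq> T_units (insert p T)"
    proof clarify
      fix s i assume "s \<in> S"
      then show "s * \<delta> ^ i \<in> T_units (insert p T)"
        using S(2) sub T_units_closed(1) T_units_closed(2)[OF d(1), of "int i"] by auto
    qed
    show "card ((\<lambda>(s, i). s * \<delta> ^ i) ` (S \<times> {..<l})) = l ^ card (insert p T) * card W"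
      using card_image[OF inj] S(3) insert.hyps by (simp add: card_cartesian_product)
    fix u v z assume "u \<in> (\<lambda>(s, i). s * \<delta> ^ i) ` (S \<times> {..<l})" "v \<in> (\<lambda>(s, i). s * \<delta> ^ i) ` (S \<times> {..<l})"
      and z: "z \<in> K" "u = v * z ^ l"
    then obtain r i s j where "r \<in> S" "i < l" "u = r * \<delta> ^ i" "s \<in> S" "j < l" "v = s * \<delta> ^ j" by auto
    then show "u = v" using ineq[of r s i j z] z by simp
  qed
qed

lemma power_equiv_units: "equiv (units K) (power_equiv l (units K))"
proof (rule equivI)
  show "power_equiv l (units K) \<subseteq> units K \<times> units K" by (auto simp: power_equiv_def)
  show "refl_on (units K) (power_equiv l (units K))"
    using units_closed(1) by (auto simp: refl_on_def power_equiv_def intro!: bexI[of _ 1])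
  show "sym (power_equiv l (units K))"
  proof (rule symI)
    fix x y assume "(x, y) \<in> power_equiv l (units K)"
    then obtain z where z: "x \<in> units K" "y \<in> units K" "z \<in> units K" "x = y * z ^ l" by (auto simp: power_equiv_def)
    then have "z \<noteq> 0" using units_closed(4) by auto
    then have "y = x * inverse z ^ l" using z(4) by (simp add: power_inverse)
    then show "(y, x) \<in> power_equiv l (units K)" using z units_closed(3) by (auto simp: power_equiv_def)
  qed
  show "trans (power_equiv l (units K))"
  proof (rule transI)
    fix x y w assume "(x, y) \<in> power_equiv l (units K)" "(y, w) \<in> power_equiv l (units K)"
    then obtain z z' where z: "x \<in> units K" "y \<in> units K" "w \<in> units K" "z \<in> units K" "x = y * z ^ l"
      "z' \<in> units K" "y = w * z' ^ l" by (auto simp: power_equiv_def)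
    then have "x = w * (z' * z) ^ l" "z' * z \<in> units K" using units_closed(2) by (auto simp: power_mult_distrib)
    then show "(x, w) \<in> power_equiv l (units K)" using z by (auto simp: power_equiv_def)
  qed
qed

lemma finite_units_quotient: "l > 0 \<Longrightarrow> finite (units K // power_equiv l (units K))"
proof -
  assume "l > 0"
  then obtain W where W: "finite W" "W \<subseteq> units K" "\<forall>u\<in>units K. \<exists>w\<in>W. \<exists>z\<in>units K. u = w * z ^ l"
    using finite_units_mod_powers by meson
  show ?thesis
  proof (rule finite_quotient_cover[OF power_equiv_units W(1)])
    fix u assume u: "u \<in> units K"
    then obtain w z where "w \<in> W" "z \<in> units K" "u = w * z ^ l" using W(3) by meson
    then show "\<exists>w\<in>W. (u, w) \<in> power_equiv l (units K)"
      using u W(2) unfolding power_equiv_def by blast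
  qed
qed

text \<open>A set of ideals and not of classes. It is a union of classes of
  \<open>class_equiv\<close>, and its quotient is the \<open>l\<close>-torsion of the class
  group.\<close>

definition class_torsion :: "nat \<Rightarrow> complex set set" where
  "class_torsion l = {J \<in> fideals K. \<exists>x\<in>K - {0}. ipow J l = smul x (oint K)}"

definition class_equiv :: "(complex set \<times> complex set) set" where
  "class_equiv = {(I, J). I \<in> fideals K \<and> J \<in> fideals K \<and> (\<exists>x\<in>K - {0}. I = smul x J)}"

lemma class_equiv_equiv: "equiv (fideals K) class_equiv"
proof (rule equivI)
  show "class_equiv \<subseteq> fideals K \<times> fideals K" by (auto simp: class_equiv_def)
  show "refl_on (fideals K) class_equiv"
    using one_mem by (auto simp: refl_on_def class_equiv_def intro!: bexI[of _ 1])
  show "sym class_equiv"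
  proof (rule symI)
    fix I J assume "(I, J) \<in> class_equiv"
    then obtain x where x: "I \<in> fideals K" "J \<in> fideals K" "x \<in> K" "x \<noteq> 0" "I = smul x J" by (auto simp: class_equiv_def)
    then have "J = smul (inverse x) I" using smul_inverse[of x J I] by simp
    moreover have "inverse x \<in> K - {0}" using x(3,4) inverse_mem by simp
    ultimately show "(J, I) \<in> class_equiv" using x(1,2) unfolding class_equiv_def by blast
  qed
  show "trans class_equiv"
  proof (rule transI)
    fix I J L assume "(I, J) \<in> class_equiv" "(J, L) \<in> class_equiv"
    then obtain x y where x: "I \<in> fideals K" "J \<in> fideals K" "L \<in> fideals K" "x \<in> K" "x \<noteq> 0" "I = smul x J"
      "y \<in> K" "y \<noteq> 0" "J = smul y L" by (auto simp: class_equiv_def)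
    then have "I = smul (x * y) L" "x * y \<in> K - {0}" using mult_mem by (auto simp: smul_smul)
    then show "(I, L) \<in> class_equiv" using x unfolding class_equiv_def by blast
  qed
qed

lemma finite_class_torsion_quotient: "finite (class_torsion l // class_equiv)"
proof -
  obtain C where C: "finite C" "C \<subseteq> fideals K" "\<forall>I\<in>fideals K. \<exists>x\<in>K - {0}. \<exists>J\<in>C. I = smul x J"
    using finite_class_representatives by blast
  have "finite (fideals K // class_equiv)"
    by (rule finite_quotient_cover[OF class_equiv_equiv C(1)]) (use C(2,3) in \<open>fastforce simp: class_equiv_def\<close>)
  moreover have "class_torsion l // class_equiv \<subseteq> fideals K // class_equiv"
    unfolding quotient_def class_torsion_def by blast
  ultimately show ?thesis by (rule finite_subset[rotated])
qed

lemma class_torsion_quotient_eqD: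
  assumes "I \<in> fideals K" "J \<in> fideals K" "class_equiv `` {I} = class_equiv `` {J}"
  shows "\<exists>x\<in>K - {0}. I = smul x J"
  using eq_equiv_class[OF assms(3) class_equiv_equiv assms(2)] by (auto simp: class_equiv_def)

lemma smul_ipow: "I \<in> fideals K \<Longrightarrow> ipow (smul x I) n = smul (x ^ n) (ipow I n)"
proof (induction n)
  case (Suc n)
  have "ipow (smul x I) (Suc n) = imul (smul x I) (smul (x ^ n) (ipow I n))" using Suc by simp
  also have "\<dots> = smul x (smul (x ^ n) (imul (ipow I n) I))"
    unfolding smul_imul imul_commute[of I] by (rule refl)
  also have "\<dots> = smul (x ^ Suc n) (ipow I (Suc n))" by (simp add: smul_smul imul_commute)
  finally show ?case .
qed simp

end

section \<open>Comparison of T-units and units across an extension\<close>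

context number_field_extension
begin

text \<open>Numerator and denominator of \<open>s\<close> are products of primes of
  \<open>T\<close>, which become \<open>l\<close>-th powers in \<open>K\<close>. The quotient of the
  two roots is a root of the ideal generated by \<open>s\<close>.\<close>

lemma T_unit_ideal_root:
  assumes T: "\<And>p. p \<in> T \<Longrightarrow> \<exists>B\<in>fideals K. K.ipow B l = ext p" and s: "s \<in> F.T_units T"
  shows "\<exists>J\<in>fideals K. K.ipow J l = smul s (oint K)"
proof -
  obtain A B where AB: "set A \<subseteq> T \<inter> prime_ideals F" "set B \<subseteq> T \<inter> prime_ideals F" "smul s (F.iprod B) = F.iprod A"
    using F.T_units_fraction[OF s] by blast
  have root: "\<exists>J\<in>fideals K. K.ipow J l = ext (F.iprod L)" if "set L \<subseteq> T \<inter> prime_ideals F" for L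
    using that
  proof (induction L)
    case Nil
    have "K.ipow (oint K) l = oint K" by (induction l) (simp_all add: oint_oint)
    then show ?case using K.oint_fideal by (auto simp: ext_oint)
  next
    case (Cons q L)
    obtain J1 where J1: "J1 \<in> fideals K" "K.ipow J1 l = ext (F.iprod L)" using Cons by auto
    obtain J2 where J2: "J2 \<in> fideals K" "K.ipow J2 l = ext q" using T[of q] Cons.prems by auto
    have "K.ipow (imul J2 J1) n = imul (K.ipow J2 n) (K.ipow J1 n)" for n
      using K.ideals.pow_mult_distrib[of J2 J1 n] J1(1) J2(1)
      by (simp add: K.ideals_pow[symmetric] K.ideals_simps imul_commute)
    from this[of l] have "K.ipow (imul J2 J1) l = ext (F.iprod (q # L))"
      using J1(2) J2(2) by (simp add: ext_imul)
    then show ?case using K.imul_fideal[OF J2(1) J1(1)] by blast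
  qed
  obtain J1 where J1: "J1 \<in> fideals K" "K.ipow J1 l = ext (F.iprod A)" using root[OF AB(1)] by blast
  obtain J2 where J2: "J2 \<in> fideals K" "K.ipow J2 l = ext (F.iprod B)" using root[OF AB(2)] by blast
  obtain J3 where J3: "J3 \<in> fideals K" "imul J3 J2 = oint K" using K.ex_inverse_ideal[OF J2(1)] by blast
  have dist: "K.ipow (imul J J') n = imul (K.ipow J n) (K.ipow J' n)" if "J \<in> fideals K" "J' \<in> fideals K" for J J' n
    using K.ideals.pow_mult_distrib[of J J' n] that
    by (simp add: K.ideals_pow[symmetric] K.ideals_simps imul_commute)
  have one: "imul (K.ipow J3 l) (K.ipow J2 l) = oint K"
  proof -
    have "K.ipow (oint K) n = oint K" for n by (induction n) (simp_all add: oint_oint)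
    then show ?thesis using dist[OF J3(1) J2(1), of l] J3(2) by simp
  qed
  have "K.ipow (imul J1 J3) l = imul (smul s (K.ipow J2 l)) (K.ipow J3 l)"
    unfolding dist[OF J1(1) J3(1)] J1(2) J2(2) AB(3)[symmetric] ext_smul ..
  also have "\<dots> = smul s (oint K)" unfolding smul_imul using one by (simp add: imul_commute)
  finally show ?thesis using K.imul_fideal[OF J1(1) J3(1)] by blast
qed

lemma selmer_bound:
  assumes l: "prime l" and T: "\<And>p. p \<in> T \<Longrightarrow> \<exists>B\<in>fideals K. K.ipow B l = ext p"
    and S: "finite S" "S \<subseteq> F.T_units T" "\<And>r s z. r \<in> S \<Longrightarrow> s \<in> S \<Longrightarrow> z \<in> F \<Longrightarrow> r = s * z ^ l \<Longrightarrow> r = s"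
    and dim: "complex_ring.dimension n F K"
  shows "card S \<le> card (K.class_torsion l // K.class_equiv) * card (units K // power_equiv l (units K)) *
    l ^ multiplicity l n"
proof -
  have l0: "l > 0" using l prime_gt_0_nat by blast
  have SF: "s \<in> F" "s \<noteq> 0" "s \<in> K" if "s \<in> S" for s using S(2) that sub by (auto simp: F.T_units_def)
  obtain W where W: "W \<subseteq> units K" "finite W" "card W = card (units K // power_equiv l (units K))"
    "\<And>x. x \<in> units K \<Longrightarrow> \<exists>w\<in>W. (x, w) \<in> power_equiv l (units K)"
    using ex_transversal[OF K.power_equiv_units K.finite_units_quotient[OF l0]] by metis
  have "\<forall>s\<in>S. \<exists>J\<in>fideals K. K.ipow J l = smul s (oint K)"
    using T_unit_ideal_root[OF T] S(2) by blast
  then obtain J where J: "\<And>s. s \<in> S \<Longrightarrow> J s \<in> fideals K" "\<And>s. s \<in> S \<Longrightarrow> K.ipow (J s) l = smul s (oint K)" by metis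
  define C where "C s = K.class_equiv `` {J s}" for s
  \<comment> \<open>A reference element of \<open>S\<close> for each ideal class that occurs.
    Comparing \<open>J s\<close> with the ideal of the reference element of the same class gives a
    principal quotient.\<close>
  define base where "base c = (SOME s. s \<in> S \<and> C s = c)" for c
  have base: "base (C s) \<in> S" "C (base (C s)) = C s" if "s \<in> S" for s
  proof -
    have "base (C s) \<in> S \<and> C (base (C s)) = C s" unfolding base_def by (rule someI[of _ s]) (use that in simp)
    then show "base (C s) \<in> S" "C (base (C s)) = C s" by auto
  qed
  have "\<exists>w\<in>W. \<exists>y\<in>K. s = base (C s) * w * y ^ l" if s: "s \<in> S" for s
  proof -
    let ?t = "base (C s)"
    note t = base[OF s]
    obtain y where y: "y \<in> K - {0}" "J s = smul y (J ?t)"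
      using K.class_torsion_quotient_eqD[OF J(1)[OF s] J(1)[OF t(1)]] t(2) unfolding C_def by metis
    have "smul s (oint K) = smul (y ^ l) (smul ?t (oint K))"
      using J(2)[OF s] J(2)[OF t(1)] K.smul_ipow[OF J(1)[OF t(1)], of y l] y(2) by simp
    then have eq: "smul s (oint K) = smul (y ^ l * ?t) (oint K)" by (simp only: smul_smul)
    \<comment> \<open>After division by the reference element and an \<open>l\<close>-th power,
      \<open>s\<close> generates the unit ideal.\<close>
    define u where "u = s / (y ^ l * ?t)"
    have nz: "y ^ l * ?t \<noteq> 0" using y(1) SF(2)[OF t(1)] by simp
    have "u = inverse (y ^ l * ?t) * s" by (simp only: u_def divide_inverse mult.commute)
    then have "smul u (oint K) = smul (inverse (y ^ l * ?t)) (smul s (oint K))"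
      by (simp only: smul_smul)
    also have "\<dots> = smul (inverse (y ^ l * ?t) * (y ^ l * ?t)) (oint K)" unfolding eq smul_smul ..
    also have "inverse (y ^ l * ?t) * (y ^ l * ?t) = 1" using nz by (rule left_inverse)
    also have "smul 1 (oint K) = oint K" by simp
    finally have "u \<in> units K"
      using y(1) SF[OF s] SF[OF t(1)] by (intro K.unit_if_smul) (auto simp: u_def intro: K.mems)
    then obtain w where w: "w \<in> W" "(u, w) \<in> power_equiv l (units K)" using W(4) by blast
    then obtain z where z: "z \<in> units K" "u = w * z ^ l" by (auto simp: power_equiv_def)
    have "s = u * (y ^ l * ?t)" using nz by (simp add: u_def)
    then have "s = ?t * w * (y * z) ^ l" unfolding z(2) power_mult_distrib by (simp only: mult_ac)
    moreover have "y * z \<in> K" using y(1) z(1) K.oint_mem by (auto simp: units_def intro: K.mems)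
    ultimately show ?thesis using w(1) by blast
  qed
  then obtain w where w: "\<And>s. s \<in> S \<Longrightarrow> w s \<in> W" "\<And>s. s \<in> S \<Longrightarrow> \<exists>y\<in>K. s = base (C s) * w s * y ^ l" by metis
  have "card S \<le> card ((K.class_torsion l // K.class_equiv) \<times> W) * l ^ multiplicity l n"
  proof (rule card_le_fibres[OF S(1), of "\<lambda>s. (C s, w s)"])
    show "(\<lambda>s. (C s, w s)) ` S \<subseteq> (K.class_torsion l // K.class_equiv) \<times> W"
    proof (rule image_subsetI)
      fix s assume s: "s \<in> S"
      have "J s \<in> K.class_torsion l" unfolding K.class_torsion_def using J[OF s] SF[OF s] by blast
      then show "(C s, w s) \<in> (K.class_torsion l // K.class_equiv) \<times> W"
        using w(1)[OF s] by (auto simp: C_def intro: quotientI)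
    qed
    show "finite ((K.class_torsion l // K.class_equiv) \<times> W)"
      using K.finite_class_torsion_quotient W(2) by simp
    fix cw
    let ?R = "{s \<in> S. (C s, w s) = cw}"
    show "card ?R \<le> l ^ multiplicity l n"
    proof (cases "?R = {}")
      case True then show ?thesis by (simp only: card.empty)
    next
      case False
      then obtain r where r: "r \<in> S" "(C r, w r) = cw" by blast
      \<comment> \<open>All quotients \<open>s / r\<close> within one fibre are \<open>l\<close>-th
        powers in \<open>K\<close>, so dividing by the fixed member \<open>r\<close> brings the
        fibre into the form that \<open>kummer_bound\<close> counts.\<close>
      have inj: "inj_on (\<lambda>s. s / r) ?R" using SF(2)[OF r(1)] by (auto simp: inj_on_def)
      have "card ((\<lambda>s. s / r) ` ?R) \<le> l ^ multiplicity l n"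
      proof (rule kummer_bound[OF l K.complex_subfield_axioms F.complex_subfield_axioms sub dim])
        show "finite ((\<lambda>s. s / r) ` ?R)" using S(1) by simp
        show "(\<lambda>s. s / r) ` ?R \<subseteq> F - {0}" using SF r(1) by (auto intro: F.mems)
        show "\<exists>y\<in>K. x = y ^ l" if "x \<in> (\<lambda>s. s / r) ` ?R" for x
        proof -
          obtain s where s: "s \<in> S" "(C s, w s) = cw" "x = s / r" using \<open>x \<in> (\<lambda>s. s / r) ` ?R\<close> by blast
          obtain y where y: "y \<in> K" "s = base (C s) * w s * y ^ l" using w(2)[OF s(1)] by blast
          obtain v where v: "v \<in> K" "r = base (C r) * w r * v ^ l" using w(2)[OF r(1)] by blast
          have eq: "C s = C r" "w s = w r" using s(2) r(2) by auto
          define e where "e = base (C r) * w r"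
          have "s = e * y ^ l" "r = e * v ^ l" using y(2) v(2) eq by (simp_all add: e_def)
          moreover have "e \<noteq> 0" using SF(2)[OF r(1)] calculation by auto
          ultimately have "x = (y / v) ^ l" using s(3) by (simp add: power_divide)
          then show ?thesis using y(1) v(1) K.divide_mem by blast
        qed
        fix x y u assume "x \<in> (\<lambda>s. s / r) ` ?R" "y \<in> (\<lambda>s. s / r) ` ?R" and u: "u \<in> F" "x = y * u ^ l"
        then obtain s t where st: "s \<in> S" "x = s / r" "t \<in> S" "y = t / r" by blast
        have "s = t * u ^ l" using u(2) st SF(2)[OF r(1)] by (simp add: field_simps)
        then show "x = y" using S(3)[OF st(1,3) u(1)] st by simp
      qed
      then show ?thesis using card_image[OF inj] by simp
    qed
  qed
  then show ?thesis using W(3) by (simp add: card_cartesian_product)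
qed

text \<open>Inequivalence holds even for factors \<open>z\<close> from the whole field: here
  \<open>z ^ l\<close> is a quotient of units, and an element whose \<open>l\<close>-th power is a
  unit is a unit.\<close>

lemma units_transversal:
  assumes l: "l > 0"
  obtains W where "W \<subseteq> units F" "finite W" "card W = card (units F // power_equiv l (units F))"
    "\<And>v w z. v \<in> W \<Longrightarrow> w \<in> W \<Longrightarrow> z \<in> F \<Longrightarrow> v = w * z ^ l \<Longrightarrow> v = w"
proof -
  obtain W where W: "W \<subseteq> units F" "finite W" "card W = card (units F // power_equiv l (units F))"
    "\<And>v w. v \<in> W \<Longrightarrow> w \<in> W \<Longrightarrow> (v, w) \<in> power_equiv l (units F) \<Longrightarrow> v = w"
    using ex_transversal[OF F.power_equiv_units F.finite_units_quotient[OF l]] by metis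
  show ?thesis
  proof (rule that[OF W(1-3)])
    fix v w z assume a: "v \<in> W" "w \<in> W" "z \<in> F" "v = w * z ^ l"
    have vw: "v \<in> units F" "w \<in> units F" using a W(1) by auto
    then have "w \<noteq> 0" using F.units_closed(4) by auto
    then have "z ^ l = v * inverse w" using a(4) by simp
    then have "z ^ l \<in> F.T_units {}" using vw F.units_closed F.T_units_empty by simp
    then have "z \<in> units F" using F.T_units_root[OF a(3) l] F.T_units_empty by blast
    then show "v = w" using W(4)[OF a(1,2)] a(4) vw by (auto simp: power_equiv_def)
  qed
qed

lemma ramified_selmer_bound:
  assumes l: "prime l" and T: "finite T" "T \<subseteq> prime_ideals F" "\<And>p. p \<in> T \<Longrightarrow> \<exists>B\<in>fideals K. K.ipow B l = ext p"
    and dim: "complex_ring.dimension n F K"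
  shows "l ^ card T * card (units F // power_equiv l (units F)) \<le>
    card (K.class_torsion l // K.class_equiv) * card (units K // power_equiv l (units K)) * l ^ multiplicity l n"
proof -
  have l0: "l > 0" using l prime_gt_0_nat by blast
  obtain W where W: "W \<subseteq> units F" "finite W" "card W = card (units F // power_equiv l (units F))"
    "\<And>v w z. v \<in> W \<Longrightarrow> w \<in> W \<Longrightarrow> z \<in> F \<Longrightarrow> v = w * z ^ l \<Longrightarrow> v = w"
    using units_transversal[OF l0] by metis
  have "\<exists>S. finite S \<and> S \<subseteq> F.T_units T \<and> card S = l ^ card T * card W \<and>
    (\<forall>r\<in>S. \<forall>s\<in>S. \<forall>z\<in>F. r = s * z ^ l \<longrightarrow> r = s)"
    by (rule F.ex_inequivalent_T_units[OF l0 T(1,2) W(2,1,4)])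
  then obtain S where S: "finite S" "S \<subseteq> F.T_units T" "card S = l ^ card T * card W"
    "\<forall>r\<in>S. \<forall>s\<in>S. \<forall>z\<in>F. r = s * z ^ l \<longrightarrow> r = s" by (elim exE conjE)
  have "card S \<le> card (K.class_torsion l // K.class_equiv) * card (units K // power_equiv l (units K)) *
    l ^ multiplicity l n"
    by (rule selmer_bound[OF l T(3) S(1,2) _ dim]) (use S(4) in blast)+
  then show ?thesis using S(3) W(3) by simp
qed

text \<open>A unit of \<open>F\<close> is a unit of \<open>K\<close> outright, so no ideal class
  enters; the fibres of its class modulo \<open>l\<close>-th powers of units of \<open>K\<close> are
  bounded by \<open>kummer_bound\<close>.\<close>

lemma units_bound:
  assumes l: "prime l" and dim: "complex_ring.dimension n F K"
  shows "card (units F // power_equiv l (units F)) \<le> card (units K // power_equiv l (units K)) * l ^ multiplicity l n"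
proof -
  have l0: "l > 0" using l prime_gt_0_nat by blast
  obtain V where V: "V \<subseteq> units F" "finite V" "card V = card (units F // power_equiv l (units F))"
    "\<And>v w z. v \<in> V \<Longrightarrow> w \<in> V \<Longrightarrow> z \<in> F \<Longrightarrow> v = w * z ^ l \<Longrightarrow> v = w"
    using units_transversal[OF l0] by metis
  obtain W where W: "W \<subseteq> units K" "finite W" "card W = card (units K // power_equiv l (units K))"
    "\<And>x. x \<in> units K \<Longrightarrow> \<exists>w\<in>W. (x, w) \<in> power_equiv l (units K)"
    using ex_transversal[OF K.power_equiv_units K.finite_units_quotient[OF l0]] by metis
  have VF: "v \<in> F" "v \<noteq> 0" "v \<in> units K" if "v \<in> V" for v
    using V(1) that oint_sub F.oint_mem by (auto simp: units_def)
  have "\<forall>v\<in>V. \<exists>w\<in>W. \<exists>z\<in>K. v = w * z ^ l"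
  proof
    fix v assume "v \<in> V"
    then obtain w where w: "w \<in> W" "(v, w) \<in> power_equiv l (units K)" using W(4) VF by blast
    then show "\<exists>w\<in>W. \<exists>z\<in>K. v = w * z ^ l"
      using K.oint_mem unfolding power_equiv_def units_def by blast
  qed
  then obtain w where w: "\<And>v. v \<in> V \<Longrightarrow> w v \<in> W" "\<And>v. v \<in> V \<Longrightarrow> \<exists>z\<in>K. v = w v * z ^ l" by metis
  have "card V \<le> card W * l ^ multiplicity l n"
  proof (rule card_le_fibres[OF V(2), of w])
    fix c
    let ?R = "{s \<in> V. w s = c}"
    show "card ?R \<le> l ^ multiplicity l n"
    proof (cases "?R = {}")
      case True then show ?thesis by (simp only: card.empty)
    next
      case False
      then obtain r where r: "r \<in> V" "w r = c" by blast
      have inj: "inj_on (\<lambda>s. s / r) ?R" using VF(2)[OF r(1)] by (auto simp: inj_on_def)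
      have "card ((\<lambda>s. s / r) ` ?R) \<le> l ^ multiplicity l n"
      proof (rule kummer_bound[OF l K.complex_subfield_axioms F.complex_subfield_axioms sub dim])
        show "finite ((\<lambda>s. s / r) ` ?R)" using V(2) by simp
        show "(\<lambda>s. s / r) ` ?R \<subseteq> F - {0}" using VF r(1) by (auto intro: F.mems)
        show "\<exists>y\<in>K. x = y ^ l" if "x \<in> (\<lambda>s. s / r) ` ?R" for x
        proof -
          obtain s where s: "s \<in> V" "w s = c" "x = s / r" using \<open>x \<in> (\<lambda>s. s / r) ` ?R\<close> by blast
          obtain y where y: "y \<in> K" "s = c * y ^ l" using w(2)[OF s(1)] s(2) by blast
          obtain v where v: "v \<in> K" "r = c * v ^ l" using w(2)[OF r(1)] r(2) by blast
          have "c \<noteq> 0" using VF(2)[OF r(1)] v(2) by auto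
          then have "x = (y / v) ^ l" using s(3) y(2) v(2) by (simp add: power_divide)
          then show ?thesis using y(1) v(1) K.divide_mem by blast
        qed
        fix x y u assume "x \<in> (\<lambda>s. s / r) ` ?R" "y \<in> (\<lambda>s. s / r) ` ?R" and u: "u \<in> F" "x = y * u ^ l"
        then obtain s t where st: "s \<in> V" "x = s / r" "t \<in> V" "y = t / r" by blast
        have "s = t * u ^ l" using u(2) st VF(2)[OF r(1)] by (simp add: field_simps)
        then show "x = y" using V(4)[OF st(1,3) u(1)] st by simp
      qed
      then show ?thesis using card_image[OF inj] by simp
    qed
  qed (use w(1) W(2) in auto)
  then show ?thesis using V(3) W(3) by simp
qed

end

text \<open>A family that spans \<open>E\<close> over \<open>F\<close> also spans it over
  \<open>M\<close>, and \<open>M\<close> is a subspace of \<open>E\<close>, so both steps are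
  finite. The positivity of the degrees serves the additivity of
  \<open>multiplicity\<close>.\<close>

lemma dimension_tower:
  assumes "complex_subfield F" "complex_subfield M" "complex_subfield E" "F \<subseteq> M" "M \<subseteq> E"
    and dim: "complex_ring.dimension n F E"
  obtains a c where "complex_ring.dimension a F M" "complex_ring.dimension c M E" "n = a * c" "a > 0" "c > 0"
proof -
  have sF: "subfield F complex_ring" and sM: "subfield M complex_ring" and sE: "subfield E complex_ring"
    using assms(1-3) subfield_complex_iff by auto
  have subalg: "subalgebra A B complex_ring"
    if "subfield A complex_ring" "subfield B complex_ring" "A \<subseteq> B" for A B
  proof (rule subalgebra.intro)
    show "subgroup B (add_monoid complex_ring)"
      using subring.axioms(1)[OF subfieldE(1)[OF that(2)]] .
    show "subalgebra_axioms A B complex_ring"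
      using that subringE(6)[OF subfieldE(1)[OF that(2)]] by (auto simp: subalgebra_axioms_def)
  qed
  obtain Us where Us: "complex_ring.independent F Us" "length Us = n" "complex_ring.Span F Us = E"
    using complex_ring.exists_base[OF sF dim] by blast
  have UsE: "set Us \<subseteq> E" using complex_ring.Span_base_incl[OF sF, of Us] Us(3) by simp
  have "complex_ring.Span M Us = E"
  proof (rule antisym)
    show "complex_ring.Span M Us \<subseteq> E"
      using complex_ring.subalgebra_Span_incl[OF sM subalg[OF sM sE assms(5)] UsE] .
    show "E \<subseteq> complex_ring.Span M Us"
    proof
      fix e assume "e \<in> E"
      then obtain Ks where "set Ks \<subseteq> F" "length Ks = length Us" "e = complex_ring.combine Ks Us"
        using complex_ring.Span_mem_iff_length_version[OF sF, of Us e] Us(3) by auto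
      then show "e \<in> complex_ring.Span M Us"
        using complex_ring.Span_mem_iff_length_version[OF sM, of Us e] assms(4) by auto
    qed
  qed
  then have "complex_ring.finite_dimension M E"
    using complex_ring.Span_finite_dimension[OF sM, of Us] by simp
  then obtain c where c: "complex_ring.dimension c M E" by (auto simp: complex_ring.finite_dimension_def)
  have "complex_ring.finite_dimension F M"
    using complex_ring.subalbegra_incl_imp_finite_dimension[OF sF complex_ring.finite_dimensionI[OF dim]
        subalg[OF sF sM assms(4)] assms(5)] .
  then obtain a where a: "complex_ring.dimension a F M" by (auto simp: complex_ring.finite_dimension_def)
  have n: "n = a * c"
    using complex_ring.telescopic_base[OF sF sM a c] dim complex_ring.dimension_is_inj[OF sF] by blast
  have pos: "m > 0" if "subfield A complex_ring" "complex_ring.dimension m A B" "1 \<in> B" for m A B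
  proof (rule ccontr)
    assume "\<not> m > 0"
    then have "B = {0}" using complex_ring.dimension_zero[OF that(1)] that(2) by simp
    then show False using that(3) by simp
  qed
  have "a > 0" "c > 0"
    using pos[OF sF a] pos[OF sM c] assms(2,3) complex_subfield.one_mem by blast+
  then show ?thesis using that[OF a c n] by blast
qed

section \<open>Towers of Galois extensions\<close>

locale galois_tower =
  fixes n :: nat and F :: "nat \<Rightarrow> complex set"
  assumes number_fields: "i \<le> n \<Longrightarrow> complex_number_field (F i)"
    and step: "i < n \<Longrightarrow> galois_number_field_extension (F i) (F (Suc i))"
    and n_pos: "n > 0"
begin

lemma mono: "i \<le> j \<Longrightarrow> j \<le> n \<Longrightarrow> F i \<subseteq> F j"
proof (induction j)
  case (Suc j)
  show ?case
  proof (cases "i = Suc j")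
    case False
    then have "F i \<subseteq> F j" using Suc by simp
    also have "F j \<subseteq> F (Suc j)"
      using step[of j] Suc.prems unfolding galois_number_field_extension_def number_field_extension_def
        number_field_extension_axioms_def by simp
    finally show ?thesis .
  qed simp
qed simp

lemma extension: "i \<le> j \<Longrightarrow> j \<le> n \<Longrightarrow> number_field_extension (F i) (F j)"
  unfolding number_field_extension_def number_field_extension_axioms_def using mono number_fields by auto

text \<open>The ramification index between \<open>F i\<close> and \<open>F j\<close> at the primes
  that lie below a prime \<open>P\<close> of the top field.\<close>

definition ram :: "nat \<Rightarrow> nat \<Rightarrow> complex set \<Rightarrow> nat" where
  "ram i j P = complex_number_field.val (F j) (P \<inter> oint (F j))
     (number_field_extension.ext (F j) (P \<inter> oint (F i)))"

lemma oint_mono: "i \<le> j \<Longrightarrow> j \<le> n \<Longrightarrow> oint (F i) \<subseteq> oint (F j)"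
  using mono by (auto simp: oint_def)

lemma contraction: "i \<le> n \<Longrightarrow> P \<in> prime_ideals (F n) \<Longrightarrow> P \<inter> oint (F i) \<in> prime_ideals (F i)"
  using number_field_extension.contraction_prime[OF extension[OF _ order_refl]] .

lemma ext_ext:
  assumes "i \<le> j" "j \<le> n"
  shows "number_field_extension.ext (F n) (number_field_extension.ext (F j) I) = number_field_extension.ext (F n) I"
proof -
  interpret jn: number_field_extension "F j" "F n" by (rule extension) (use assms in auto)
  interpret ij: number_field_extension "F i" "F j" by (rule extension[OF assms])
  have "imul (oint (F j)) (oint (F n)) = oint (F n)" using jn.ext_oint unfolding jn.ext_def .
  then show ?thesis unfolding jn.ext_def ij.ext_def imul_assoc by simp
qed

lemma ram_mult:
  assumes "i \<le> j" "j \<le> n" "P \<in> prime_ideals (F n)"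
  shows "ram i n P = ram j n P * ram i j P"
proof -
  interpret jn: number_field_extension "F j" "F n" by (rule extension) (use assms in auto)
  interpret ij: number_field_extension "F i" "F j" by (rule extension[OF assms(1,2)])
  have p: "P \<inter> oint (F i) \<in> prime_ideals (F i)" using contraction assms by simp
  have P: "P \<inter> oint (F n) = P" using jn.K.primeD(2)[OF assms(3)] by blast
  have fi: "ij.ext (P \<inter> oint (F i)) \<in> fideals (F j)" "ij.ext (P \<inter> oint (F i)) \<subseteq> oint (F j)"
    using ij.ext_integral_fideal ij.ext_integral ij.F.primeD(1)[OF p] ij.F.primeD(2)[OF p] by blast+
  show ?thesis
    using jn.val_ext[OF assms(3) fi] ext_ext[OF assms(1,2)]
    unfolding ram_def P by simp
qed

lemma ram_self: "P \<in> prime_ideals (F n) \<Longrightarrow> ram n n P = 1"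
proof -
  assume P: "P \<in> prime_ideals (F n)"
  interpret nn: number_field_extension "F n" "F n" by (rule extension) auto
  have "P \<inter> oint (F n) = P" using nn.F.primeD(2)[OF P] by blast
  then show "ram n n P = 1"
    unfolding ram_def nn.ext_def using nn.F.imul_oint[OF nn.F.primeD(4)[OF P]] nn.F.val_prime[OF P P] by simp
qed

text \<open>If \<open>l\<close> divided no single step, its divisibility of \<open>ram i n P\<close>
  would pass from each \<open>i\<close> to the next, up to \<open>ram n n P\<close>, which is
  1.\<close>

lemma ex_ramified_step:
  assumes "prime l" "P \<in> prime_ideals (F n)" "l dvd ram 0 n P"
  shows "\<exists>i<n. l dvd ram i (Suc i) P"
proof (rule ccontr)
  assume not: "\<not> ?thesis"
  have "l dvd ram i n P" if "i \<le> n" for i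
    using that
  proof (induction i)
    case (Suc i)
    then have "l dvd ram (Suc i) n P * ram i (Suc i) P"
      using ram_mult[of i "Suc i" P] assms(2) by simp
    then show ?case using not Suc.prems assms(1) by (simp add: prime_dvd_mult_iff)
  qed (rule assms(3))
  then have "l dvd 1" using ram_self[OF assms(2)] by (metis order_refl)
  then show False using assms(1) by simp
qed

theorem tower_bound:
  assumes l: "prime l" and T: "finite T"
    "\<And>p. p \<in> T \<Longrightarrow> \<exists>P\<in>prime_ideals (F n). P \<inter> oint (F 0) = p \<and>
      l dvd complex_number_field.val (F n) P (number_field_extension.ext (F n) p)"
    and dim: "complex_ring.dimension m (F 0) (F n)"
  shows "\<exists>k. card T \<le> n * k \<and>
    l ^ k * card (units (F 0) // power_equiv l (units (F 0))) \<le>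
      card (complex_number_field.class_torsion (F n) l // complex_number_field.class_equiv (F n)) *
      card (units (F n) // power_equiv l (units (F n))) * l ^ multiplicity l m"
proof -
  have l0: "l > 0" using l prime_gt_0_nat by blast
  obtain P where P: "\<And>p. p \<in> T \<Longrightarrow> P p \<in> prime_ideals (F n)" "\<And>p. p \<in> T \<Longrightarrow> P p \<inter> oint (F 0) = p"
    "\<And>p. p \<in> T \<Longrightarrow> l dvd complex_number_field.val (F n) (P p) (number_field_extension.ext (F n) p)"
    using T(2) by metis
  interpret N: complex_number_field "F n" by (rule number_fields) simp
  have "\<exists>i<n. l dvd ram i (Suc i) (P p)" if p: "p \<in> T" for p
  proof (rule ex_ramified_step[OF l P(1)[OF p]])
    have "P p \<inter> oint (F n) = P p" using N.primeD(2)[OF P(1)[OF p]] by blast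
    then show "l dvd ram 0 n (P p)" unfolding ram_def using P(2,3)[OF p] by simp
  qed
  then obtain \<iota> where \<iota>: "\<And>p. p \<in> T \<Longrightarrow> \<iota> p < n" "\<And>p. p \<in> T \<Longrightarrow> l dvd ram (\<iota> p) (Suc (\<iota> p)) (P p)" by metis
  obtain i where i: "i < n" "card T \<le> n * card {p \<in> T. \<iota> p = i}"
  proof -
    have "\<exists>i<n. card T \<le> n * card {p \<in> T. \<iota> p = i}"
    proof (rule ccontr)
      assume a: "\<not> ?thesis"
      have "T = (\<Union>i<n. {p \<in> T. \<iota> p = i})" using \<iota>(1) by blast
      then have "card T \<le> (\<Sum>i<n. card {p \<in> T. \<iota> p = i})"
        using card_UN_le[of "{..<n}" "\<lambda>i. {p \<in> T. \<iota> p = i}"] by simp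
      then have "n * card T \<le> (\<Sum>i<n. n * card {p \<in> T. \<iota> p = i})" by (simp flip: sum_distrib_left)
      also have "\<dots> < (\<Sum>i<n. card T)" using a n_pos by (intro sum_strict_mono) force+
      finally show False by simp
    qed
    then show ?thesis using that by blast
  qed
  define S where "S = {p \<in> T. \<iota> p = i}"
  define T' where "T' = (\<lambda>p. P p \<inter> oint (F i)) ` S"
  have sub0: "oint (F 0) \<subseteq> oint (F i)" using oint_mono i by simp
  \<comment> \<open>Contracting further down to \<open>F 0\<close> recovers \<open>p\<close>, so
    distinct \<open>p\<close> give distinct primes of \<open>F i\<close> although the primes
    \<open>P p\<close> were chosen arbitrarily.\<close>
  have inj: "inj_on (\<lambda>p. P p \<inter> oint (F i)) S"
  proof (rule inj_onI)
    fix p q assume pq: "p \<in> S" "q \<in> S" "P p \<inter> oint (F i) = P q \<inter> oint (F i)"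
    then have "P p \<inter> oint (F 0) = P q \<inter> oint (F 0)" using sub0 by blast
    then show "p = q" using P(2) pq(1,2) by (simp add: S_def)
  qed
  have cardT': "card T' = card S" unfolding T'_def by (rule card_image[OF inj])
  interpret st: galois_number_field_extension "F i" "F (Suc i)" by (rule step[OF i(1)])
  interpret iN: number_field_extension "F i" "F n" by (rule extension) (use i in auto)
  interpret sN: number_field_extension "F (Suc i)" "F n" by (rule extension) (use i in auto)
  interpret zi: number_field_extension "F 0" "F i" by (rule extension) (use i in auto)
  have T'p: "T' \<subseteq> prime_ideals (F i)"
    unfolding T'_def using contraction[of i] P(1) i(1) by (auto simp: S_def)
  have root: "\<exists>B\<in>fideals (F n). N.ipow B l = iN.ext p'" if p': "p' \<in> T'" for p'
  proof -
    obtain p where p: "p \<in> S" "p' = P p \<inter> oint (F i)" using p' unfolding T'_def by blast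
    then have pT: "p \<in> T" "\<iota> p = i" by (auto simp: S_def)
    define P1 where "P1 = P p \<inter> oint (F (Suc i))"
    have P1: "P1 \<in> prime_ideals (F (Suc i))" unfolding P1_def using contraction[of "Suc i"] P(1)[OF pT(1)] i(1) by simp
    have P1p: "P1 \<inter> oint (F i) = p'" unfolding P1_def p(2) using oint_mono[of i "Suc i"] i(1) by auto
    have "l dvd st.K.val P1 (st.ext p')"
      using \<iota>(2)[OF pT(1)] unfolding ram_def pT(2) P1_def p(2) .
    then obtain B where B: "B \<in> fideals (F (Suc i))" "B \<subseteq> oint (F (Suc i))" "st.K.ipow B l = st.ext p'"
      using st.ramified_power[OF l0 subsetD[OF T'p p'] P1 P1p] by blast
    have "N.ipow (sN.ext B) l = sN.ext (st.ext p')" using sN.ext_ipow[of B l] B(3) by simp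
    also have "\<dots> = iN.ext p'" using ext_ext[of i "Suc i" p'] i(1) by simp
    finally show ?thesis using sN.ext_integral_fideal[OF B(1,2)] by blast
  qed
  obtain a c where ac: "complex_ring.dimension a (F 0) (F i)" "complex_ring.dimension c (F i) (F n)" "m = a * c" "a > 0" "c > 0"
  proof -
    have cs: "complex_subfield (F j)" if "j \<le> n" for j
      using number_fields[OF that] by (rule complex_number_field.axioms(1))
    show ?thesis
      by (rule dimension_tower[OF cs[OF le0] cs[OF less_imp_le[OF i(1)]] cs[OF order_refl] zi.sub iN.sub dim])
        (rule that)
  qed
  have fin: "finite T'" unfolding T'_def S_def using T(1) by simp
  \<comment> \<open>The losses below and above \<open>F i\<close> add up to the exponent of
    \<open>l\<close> in the whole degree.\<close>
  have e: "multiplicity l m = multiplicity l a + multiplicity l c"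
    unfolding ac(3) using ac(4,5) l by (intro prime_elem_multiplicity_mult_distrib) (auto simp: prime_imp_prime_elem)
  have b1: "l ^ card T' * card (units (F i) // power_equiv l (units (F i))) \<le>
    card (N.class_torsion l // N.class_equiv) * card (units (F n) // power_equiv l (units (F n))) * l ^ multiplicity l c"
    by (rule iN.ramified_selmer_bound[OF l fin T'p root ac(2)])
  have b2: "card (units (F 0) // power_equiv l (units (F 0))) \<le>
    card (units (F i) // power_equiv l (units (F i))) * l ^ multiplicity l a"
    by (rule zi.units_bound[OF l ac(1)])
  have "l ^ card T' * card (units (F 0) // power_equiv l (units (F 0))) \<le>
    (l ^ card T' * card (units (F i) // power_equiv l (units (F i)))) * l ^ multiplicity l a"
    using mult_left_mono[OF b2, of "l ^ card T'"] by (simp add: mult.assoc)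
  also have "\<dots> \<le> (card (N.class_torsion l // N.class_equiv) * card (units (F n) // power_equiv l (units (F n))) *
    l ^ multiplicity l c) * l ^ multiplicity l a"
    by (rule mult_right_mono[OF b1]) simp
  also have "\<dots> = card (N.class_torsion l // N.class_equiv) * card (units (F n) // power_equiv l (units (F n))) *
    l ^ multiplicity l m" unfolding e by (simp add: power_add mult_ac)
  finally show ?thesis using i(2) cardT' S_def by (intro exI[of _ "card T'"]) simp
qed

end

section \<open>Embedding a number field into the complex numbers\<close>

lemma (in field) hom_complex_simps:
  assumes "subfield E R" "\<sigma> \<in> Ring.ring_hom (R\<lparr>carrier := E\<rparr>) complex_ring"
  shows "x \<in> E \<Longrightarrow> y \<in> E \<Longrightarrow> \<sigma> (x \<oplus> y) = \<sigma> x + \<sigma> y" "x \<in> E \<Longrightarrow> y \<in> E \<Longrightarrow> \<sigma> (x \<otimes> y) = \<sigma> x * \<sigma> y"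
    "\<sigma> \<one> = 1" "\<sigma> \<zero> = 0" "x \<in> E \<Longrightarrow> \<sigma> (\<ominus> x) = - \<sigma> x" "x \<in> E \<Longrightarrow> x \<noteq> \<zero> \<Longrightarrow> \<sigma> x \<noteq> 0"
    "x \<in> E \<Longrightarrow> x \<noteq> \<zero> \<Longrightarrow> \<sigma> (inv x) = inverse (\<sigma> x)" "inj_on \<sigma> E"
proof -
  note S = subringE[OF subfieldE(1)[OF assms(1)]]
  note h = assms(2)[unfolded Ring.ring_hom_def, simplified]
  show add: "\<sigma> (x \<oplus> y) = \<sigma> x + \<sigma> y" if "x \<in> E" "y \<in> E" for x y using h that by simp
  show mult: "\<sigma> (x \<otimes> y) = \<sigma> x * \<sigma> y" if "x \<in> E" "y \<in> E" for x y using h that by simp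
  show one: "\<sigma> \<one> = 1" using h by simp
  show zero: "\<sigma> \<zero> = 0" using add[OF S(2) S(2)] by simp
  show minus: "\<sigma> (\<ominus> x) = - \<sigma> x" if "x \<in> E" for x
  proof -
    have "\<sigma> (x \<oplus> \<ominus> x) = \<sigma> x + \<sigma> (\<ominus> x)" using add[OF that S(5)[OF that]] .
    moreover have "x \<oplus> \<ominus> x = \<zero>" using S(1) that r_neg by blast
    ultimately show ?thesis using zero by (simp add: eq_neg_iff_add_eq_0 add.commute)
  qed
  have inv: "inv x \<in> E" "x \<otimes> inv x = \<one>" if "x \<in> E" "x \<noteq> \<zero>" for x
    using subfield_m_inv[OF assms(1), of x] that by auto
  have prod: "\<sigma> x * \<sigma> (inv x) = 1" if "x \<in> E" "x \<noteq> \<zero>" for x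
    using mult[OF that(1) inv(1)[OF that]] inv(2)[OF that] one by simp
  show nz: "\<sigma> x \<noteq> 0" if "x \<in> E" "x \<noteq> \<zero>" for x using prod[OF that] by auto
  show "\<sigma> (inv x) = inverse (\<sigma> x)" if "x \<in> E" "x \<noteq> \<zero>" for x
    using prod[OF that] by (metis inverse_unique)
  show "inj_on \<sigma> E"
  proof (rule inj_onI)
    fix x y assume xy: "x \<in> E" "y \<in> E" "\<sigma> x = \<sigma> y"
    have c: "x \<in> carrier R" "y \<in> carrier R" using xy S(1) by auto
    have "\<sigma> (x \<oplus> \<ominus> y) = 0" using add[OF xy(1) S(5)[OF xy(2)]] minus[OF xy(2)] xy(3) by simp
    then have "x \<oplus> \<ominus> y = \<zero>" using nz[OF S(7)[OF xy(1) S(5)[OF xy(2)]]] by blast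
    then show "x = y" using c by (metis a_inv_closed minus_equality minus_minus)
  qed
qed

text \<open>The list starts with the leading coefficient, \<open>Poly\<close> with the constant one;
  hence the reversal.\<close>

definition map_to_poly :: "('a \<Rightarrow> complex) \<Rightarrow> 'a list \<Rightarrow> complex poly" where
  "map_to_poly \<sigma> p = Poly (rev (map \<sigma> p))"

lemma (in field) coeff_map_to_poly:
  assumes "\<sigma> \<zero> = 0"
  shows "Polynomial.coeff (map_to_poly \<sigma> p) i = \<sigma> (coeff p i)"
proof (cases "i < length p")
  case True
  then show ?thesis
    by (simp add: map_to_poly_def nth_default_def rev_nth rev_map coeff_nth Suc_diff_Suc)
next
  case False
  then show ?thesis using assms by (simp add: map_to_poly_def nth_default_def coeff_length)
qed

lemma (in field) coeff_mem:
  assumes "set p \<subseteq> E" "\<zero> \<in> E"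
  shows "coeff p i \<in> E"
proof (cases "i < length p")
  case True
  then show ?thesis using coeff_nth[OF True] assms(1) nth_mem[of "length p - 1 - i" p] by auto
next
  case False
  then show ?thesis using coeff_length[of p i] assms(2) by simp
qed

lemma (in field) map_to_poly_hom:
  assumes E: "subfield E R" and s: "\<sigma> \<in> Ring.ring_hom (R\<lparr>carrier := E\<rparr>) complex_ring"
    and p: "set p \<subseteq> E" "set q \<subseteq> E"
  shows "map_to_poly \<sigma> (poly_add p q) = map_to_poly \<sigma> p + map_to_poly \<sigma> q"
    "map_to_poly \<sigma> (poly_mult p q) = map_to_poly \<sigma> p * map_to_poly \<sigma> q"
proof -
  note S = subringE[OF subfieldE(1)[OF E]]
  note h = hom_complex_simps[OF E s]
  have pc: "set p \<subseteq> carrier R" "set q \<subseteq> carrier R" using p S(1) by auto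
  have c: "coeff p i \<in> E" "coeff q i \<in> E" for i
    using coeff_mem[OF p(1) S(2)] coeff_mem[OF p(2) S(2)] by blast+
  show "map_to_poly \<sigma> (poly_add p q) = map_to_poly \<sigma> p + map_to_poly \<sigma> q"
    by (rule poly_eqI) (simp only: coeff_map_to_poly[of \<sigma>, OF h(4)] poly_add_coeff[OF pc] coeff_add h(1)[OF c(1) c(2)])
  have fs: "\<sigma> (\<Oplus>k\<in>A. f k) = (\<Sum>k\<in>A. \<sigma> (f k)) \<and> (\<Oplus>k\<in>A. f k) \<in> E" if "finite A" "\<And>k. k \<in> A \<Longrightarrow> f k \<in> E" for A :: "nat set" and f
    using that
  proof (induction A)
    case (insert k A)
    then have "(\<Oplus>k\<in>insert k A. f k) = f k \<oplus> (\<Oplus>k\<in>A. f k)"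
      using S(1) by (intro finsum_insert) auto
    then show ?case using insert h(1) S(7) by simp
  qed (simp add: h(4) S(2))
  show "map_to_poly \<sigma> (poly_mult p q) = map_to_poly \<sigma> p * map_to_poly \<sigma> q"
  proof (rule poly_eqI)
    fix i
    have "\<sigma> (\<Oplus>k\<in>{..i}. coeff p k \<otimes> coeff q (i - k)) = (\<Sum>k\<in>{..i}. \<sigma> (coeff p k \<otimes> coeff q (i - k)))"
      using fs[of "{..i}" "\<lambda>k. coeff p k \<otimes> coeff q (i - k)"] c S(6) by simp
    then show "Polynomial.coeff (map_to_poly \<sigma> (poly_mult p q)) i = Polynomial.coeff (map_to_poly \<sigma> p * map_to_poly \<sigma> q) i"
      by (simp add: coeff_map_to_poly[of \<sigma>, OF h(4)] poly_mult_coeff[OF pc] coeff_mult h(2) c del: poly_mult.simps)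
  qed
qed

lemma (in field) poly_map_to_poly:
  assumes "\<sigma> \<in> Ring.ring_hom R complex_ring" "set p \<subseteq> carrier R" "a \<in> carrier R"
  shows "eval p a \<in> carrier R \<and> poly (map_to_poly \<sigma> p) (\<sigma> a) = \<sigma> (eval p a)"
proof -
  have s: "\<sigma> \<in> Ring.ring_hom (R\<lparr>carrier := carrier R\<rparr>) complex_ring" using assms(1) by simp
  note h = hom_complex_simps[OF carrier_is_subfield s]
  have pow: "\<sigma> (a [^] k) = \<sigma> a ^ k" for k :: nat
    using assms(3) by (induction k) (simp_all add: h mult.commute)
  show ?thesis using assms(2)
  proof (induction p)
    case (Cons u p)
    then show ?case using assms(3) by (simp add: map_to_poly_def Poly_append poly_monom h pow mult.commute)
  qed (simp add: map_to_poly_def h(4))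
qed

lemma (in ring) finite_dimension_mono:
  assumes A: "subfield A R" and B: "subfield B R" and "A \<subseteq> B" "finite_dimension A (carrier R)"
  shows "finite_dimension B (carrier R)"
proof -
  obtain n where "dimension n A (carrier R)" using assms(4) by (auto simp: finite_dimension_def)
  then obtain Us where Us: "set Us \<subseteq> carrier R" "Span A Us = carrier R" using exists_base[OF A] by blast
  have "Span B Us = carrier R"
  proof (rule antisym)
    show "Span B Us \<subseteq> carrier R"
      using Span_in_carrier[OF subringE(1)[OF subfieldE(1)[OF B]] Us(1)] by blast
    show "carrier R \<subseteq> Span B Us"
    proof
      fix x assume "x \<in> carrier R"
      then obtain Ks where "set Ks \<subseteq> A" "length Ks = length Us" "x = combine Ks Us"
        using Span_mem_iff_length_version[OF A Us(1), of x] Us(2) by auto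
      then show "x \<in> Span B Us"
        using Span_mem_iff_length_version[OF B Us(1), of x] assms(3) by auto
    qed
  qed
  then show ?thesis using Span_finite_dimension[OF B Us(1)] by simp
qed

text \<open>The value at \<open>eval q a\<close> is the image of \<open>q\<close> under
  \<open>\<sigma>\<close>, evaluated at \<open>z\<close>. It does not depend on \<open>q\<close>,
  because the polynomials over \<open>E\<close> that vanish at \<open>a\<close> are the multiples of
  \<open>Irr E a\<close>, and the image of that polynomial vanishes at \<open>z\<close>.\<close>

lemma (in field) extend_hom_simple:
  assumes E: "subfield E R" and s: "\<sigma> \<in> Ring.ring_hom (R\<lparr>carrier := E\<rparr>) complex_ring"
    and a: "a \<in> carrier R" "(algebraic over E) a" and z: "poly (map_to_poly \<sigma> (Irr E a)) z = 0"
  shows "\<exists>\<tau>\<in>Ring.ring_hom (R\<lparr>carrier := simple_extension E a\<rparr>) complex_ring. (\<forall>e\<in>E. \<tau> e = \<sigma> e) \<and> \<tau> a = z"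
proof -
  note S = subringE[OF subfieldE(1)[OF E]]
  note h = hom_complex_simps[OF E s]
  interpret ev: ring_hom_ring "E[X]" R "\<lambda>p. eval p a" by (rule eval_ring_hom[OF subfieldE(1)[OF E] a(1)])
  define t where "t q = poly (map_to_poly \<sigma> q) z" for q
  have setE: "set q \<subseteq> E" if "q \<in> carrier (E[X])" for q
    using that polynomial_incl univ_poly_carrier by blast
  have t_add: "t (p \<oplus>\<^bsub>E[X]\<^esub> q) = t p + t q" and t_mult: "t (p \<otimes>\<^bsub>E[X]\<^esub> q) = t p * t q"
    if "p \<in> carrier (E[X])" "q \<in> carrier (E[X])" for p q
    unfolding t_def univ_poly_add univ_poly_mult using map_to_poly_hom[OF E s setE setE] that by simp_all
  have t_ker: "t d = 0" if d: "d \<in> carrier (E[X])" "eval d a = \<zero>" for d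
  proof -
    have "d \<in> PIdl\<^bsub>E[X]\<^esub> (Irr E a)"
      using Irr_generates_ker[OF E a] d unfolding a_kernel_def' by auto
    then obtain r where "r \<in> carrier (E[X])" "d = r \<otimes>\<^bsub>E[X]\<^esub> Irr E a" unfolding cgenideal_def by auto
    then show ?thesis using t_mult IrrE(1)[OF E a] z by (simp add: t_def)
  qed
  have t_cong: "t p = t q" if pq: "p \<in> carrier (E[X])" "q \<in> carrier (E[X])" "eval p a = eval q a" for p q
  proof -
    let ?d = "p \<ominus>\<^bsub>E[X]\<^esub> q"
    have d: "?d \<in> carrier (E[X])" using pq by simp
    have "eval ?d a = eval p a \<ominus> eval q a"
      unfolding a_minus_def using pq(1,2) ev.hom_add[of p "\<ominus>\<^bsub>E[X]\<^esub> q"] ev.hom_a_inv[of q] by simp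
    also have "\<dots> = \<zero>" using pq(3) ev.hom_closed[OF pq(2)] by (simp add: r_right_minus_eq)
    finally have "t ?d = 0" using t_ker[OF d] by simp
    moreover have "p = ?d \<oplus>\<^bsub>E[X]\<^esub> q" using pq(1,2) by (simp add: a_minus_def ev.R.a_assoc ev.R.l_neg)
    ultimately show ?thesis using t_add[OF d pq(2)] by simp
  qed
  have img: "simple_extension E a = (\<lambda>p. eval p a) ` carrier (E[X])"
    by (rule simple_extension_as_eval_img[OF S(1) a(1)])
  define \<tau> where "\<tau> x = t (SOME q. q \<in> carrier (E[X]) \<and> eval q a = x)" for x
  have tau: "\<tau> (eval q a) = t q" if "q \<in> carrier (E[X])" for q
  proof -
    have "(SOME p. p \<in> carrier (E[X]) \<and> eval p a = eval q a) \<in> carrier (E[X]) \<and>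
      eval (SOME p. p \<in> carrier (E[X]) \<and> eval p a = eval q a) a = eval q a"
      by (rule someI[of _ q]) (use that in simp)
    then show ?thesis unfolding \<tau>_def using t_cong that by blast
  qed
  \<comment> \<open>The zero polynomial is the empty list, so a constant needs a case
    distinction.\<close>
  have t_const: "t (if e = \<zero> then [] else [e]) = \<sigma> e" if "e \<in> E" for e
    using h(4) by (simp add: t_def map_to_poly_def)
  have const_mem: "(if e = \<zero> then [] else [e]) \<in> carrier (E[X])" if "e \<in> E" for e
    using that by (auto simp: univ_poly_carrier[symmetric] polynomial_def)
  have const_eval: "eval (if e = \<zero> then [] else [e]) a = e" if "e \<in> E" for e
    using that S(1) a(1) by auto
  have tau_E: "\<tau> e = \<sigma> e" if "e \<in> E" for e
    using tau[OF const_mem[OF that]] const_eval[OF that] t_const[OF that] by simp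
  have X: "[\<one>, \<zero>] \<in> carrier (E[X])"
    using S(2,3) by (auto simp: univ_poly_carrier[symmetric] polynomial_def)
  have "eval [\<one>, \<zero>] a = a" using a(1) by simp
  moreover have "t [\<one>, \<zero>] = z" using h(3,4) by (simp add: t_def map_to_poly_def)
  ultimately have tau_a: "\<tau> a = z" using tau[OF X] by simp
  have "\<tau> \<in> Ring.ring_hom (R\<lparr>carrier := simple_extension E a\<rparr>) complex_ring"
  proof (rule ring_hom_memI)
    show "\<tau> \<one>\<^bsub>R\<lparr>carrier := simple_extension E a\<rparr>\<^esub> = \<one>\<^bsub>complex_ring\<^esub>" using tau_E[OF S(3)] h(3) by simp
    fix x y assume "x \<in> carrier (R\<lparr>carrier := simple_extension E a\<rparr>)" "y \<in> carrier (R\<lparr>carrier := simple_extension E a\<rparr>)"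
    then have "x \<in> (\<lambda>p. eval p a) ` carrier (E[X])" "y \<in> (\<lambda>p. eval p a) ` carrier (E[X])"
      using img by simp_all
    then obtain p q where pq: "p \<in> carrier (E[X])" "x = eval p a" "q \<in> carrier (E[X])" "y = eval q a"
      by (elim imageE)
    have "\<tau> (x \<otimes> y) = t (p \<otimes>\<^bsub>E[X]\<^esub> q)" using tau[of "p \<otimes>\<^bsub>E[X]\<^esub> q"] pq by simp
    then show "\<tau> (x \<otimes>\<^bsub>R\<lparr>carrier := simple_extension E a\<rparr>\<^esub> y) = \<tau> x \<otimes>\<^bsub>complex_ring\<^esub> \<tau> y"
      using t_mult pq tau by simp
    have "\<tau> (x \<oplus> y) = t (p \<oplus>\<^bsub>E[X]\<^esub> q)" using tau[of "p \<oplus>\<^bsub>E[X]\<^esub> q"] pq by simp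
    then show "\<tau> (x \<oplus>\<^bsub>R\<lparr>carrier := simple_extension E a\<rparr>\<^esub> y) = \<tau> x \<oplus>\<^bsub>complex_ring\<^esub> \<tau> y"
      using t_add pq tau by simp
  qed auto
  then show ?thesis using tau_E tau_a by blast
qed

lemma (in field) ex_root_map_to_poly:
  assumes E: "subfield E R" and s: "\<sigma> \<in> Ring.ring_hom (R\<lparr>carrier := E\<rparr>) complex_ring"
    and a: "a \<in> carrier R" "(algebraic over E) a"
  shows "\<exists>z. poly (map_to_poly \<sigma> (Irr E a)) z = 0"
proof -
  note I = IrrE[OF E a]
  have len: "length (Irr E a) \<ge> 2"
    using pirreducible_degree[OF E I(1,2)] by simp
  have "Polynomial.coeff (map_to_poly \<sigma> (Irr E a)) (length (Irr E a) - 1) = 1"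
  proof -
    have "Irr E a \<noteq> []" using len by auto
    then have "coeff (Irr E a) (length (Irr E a) - 1) = \<one>" using I(3) lead_coeff_simp by metis
    then show ?thesis using hom_complex_simps(3,4)[OF E s] by (simp add: coeff_map_to_poly)
  qed
  then have "Polynomial.degree (map_to_poly \<sigma> (Irr E a)) \<noteq> 0"
    using len le_degree[of "map_to_poly \<sigma> (Irr E a)" "length (Irr E a) - 1"] by simp
  then show ?thesis using fundamental_theorem_of_algebra_alt by (metis constant_degree fundamental_theorem_of_algebra)
qed

lemma (in field) extend_hom_list:
  assumes "subfield E R" "\<sigma> \<in> Ring.ring_hom (R\<lparr>carrier := E\<rparr>) complex_ring"
    and "set Us \<subseteq> carrier R" "\<And>a. a \<in> set Us \<Longrightarrow> (algebraic over E) a"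
  shows "\<exists>E' \<tau>. subfield E' R \<and> E \<subseteq> E' \<and> set Us \<subseteq> E' \<and>
    \<tau> \<in> Ring.ring_hom (R\<lparr>carrier := E'\<rparr>) complex_ring \<and> (\<forall>e\<in>E. \<tau> e = \<sigma> e)"
  using assms
proof (induction Us arbitrary: E \<sigma>)
  case Nil then show ?case by auto
next
  case (Cons u Us)
  have u: "u \<in> carrier R" "(algebraic over E) u" using Cons.prems by auto
  obtain z where "poly (map_to_poly \<sigma> (Irr E u)) z = 0" using ex_root_map_to_poly[OF Cons.prems(1,2) u] by blast
  then obtain \<tau> where t: "\<tau> \<in> Ring.ring_hom (R\<lparr>carrier := simple_extension E u\<rparr>) complex_ring" "\<forall>e\<in>E. \<tau> e = \<sigma> e"
    using extend_hom_simple[OF Cons.prems(1,2) u] by blast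
  let ?E1 = "simple_extension E u"
  have E1: "subfield ?E1 R" using simple_extension_is_subfield[OF Cons.prems(1) u(1)] u(2) by simp
  have sub: "E \<subseteq> ?E1" "u \<in> ?E1"
    using simple_extension_incl[OF subringE(1)[OF subfieldE(1)[OF Cons.prems(1)]] u(1)]
      simple_extension_mem[OF subfieldE(1)[OF Cons.prems(1)] u(1)] by auto
  have "\<exists>E' \<tau>'. subfield E' R \<and> ?E1 \<subseteq> E' \<and> set Us \<subseteq> E' \<and>
    \<tau>' \<in> Ring.ring_hom (R\<lparr>carrier := E'\<rparr>) complex_ring \<and> (\<forall>e\<in>?E1. \<tau>' e = \<tau> e)"
  proof (rule Cons.IH[OF E1 t(1)])
    show "set Us \<subseteq> carrier R" using Cons.prems(3) by simp
    show "(algebraic over ?E1) a" if "a \<in> set Us" for a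
      using algebraic_mono[OF sub(1)] Cons.prems(4)[of a] that by simp
  qed
  then obtain E' \<tau>' where "subfield E' R" "?E1 \<subseteq> E'" "set Us \<subseteq> E'"
    "\<tau>' \<in> Ring.ring_hom (R\<lparr>carrier := E'\<rparr>) complex_ring" "\<forall>e\<in>?E1. \<tau>' e = \<tau> e" by blast
  then show ?case using sub t(2) by (intro exI[of _ E'] exI[of _ \<tau>']) auto
qed

text \<open>A finite family spanning everything over \<open>E0\<close> is adjoined one element at a
  time; the field reached contains its span.\<close>

lemma (in field) extend_hom_carrier:
  assumes E: "subfield E R" "\<sigma> \<in> Ring.ring_hom (R\<lparr>carrier := E\<rparr>) complex_ring"
    and fin: "finite_dimension E0 (carrier R)" "subfield E0 R" "E0 \<subseteq> E"
  shows "\<exists>\<tau>\<in>Ring.ring_hom R complex_ring. \<forall>e\<in>E. \<tau> e = \<sigma> e"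
proof -
  obtain n where "dimension n E0 (carrier R)" using fin(1) by (auto simp: finite_dimension_def)
  then obtain Us where Us: "set Us \<subseteq> carrier R" "Span E0 Us = carrier R"
    using exists_base[OF fin(2)] by blast
  have alg: "(algebraic over E) a" if "a \<in> set Us" for a
    using algebraic_mono[OF fin(3)] finite_dimension_imp_algebraic[OF fin(2) carrier_is_subring fin(1)] Us(1) that by blast
  obtain E' \<tau> where E': "subfield E' R" "E \<subseteq> E'" "set Us \<subseteq> E'"
    "\<tau> \<in> Ring.ring_hom (R\<lparr>carrier := E'\<rparr>) complex_ring" "\<forall>e\<in>E. \<tau> e = \<sigma> e"
    using extend_hom_list[OF E Us(1) alg] by blast
  have "Span E0 Us \<subseteq> E'"
  proof -
    have "subalgebra E0 E' R"
    proof (rule subalgebra.intro)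
      show "subgroup E' (add_monoid R)" using subring.axioms(1)[OF subfieldE(1)[OF E'(1)]] .
      show "subalgebra_axioms E0 E' R"
        using fin(3) E'(2) subringE(6)[OF subfieldE(1)[OF E'(1)]] by (auto simp: subalgebra_axioms_def)
    qed
    then show ?thesis using subalgebra_Span_incl[OF fin(2) _ E'(3)] by blast
  qed
  then have "E' = carrier R" using Us(2) subringE(1)[OF subfieldE(1)[OF E'(1)]] by blast
  then show ?thesis using E'(4,5) by auto
qed

section \<open>The prime field made explicit, and the embedding of the whole field\<close>

context number_field
begin

abbreviation int_embed :: "int \<Rightarrow> 'a" where "int_embed k \<equiv> add_pow K k \<one>"

lemma int_embed_simps:
  "int_embed k \<in> carrier K" "int_embed (j + k) = int_embed j \<oplus> int_embed k" "int_embed 1 = \<one>" "int_embed 0 = \<zero>"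
  "int_embed (j * k) = int_embed j \<otimes> int_embed k" "int_embed (- k) = \<ominus> int_embed k" "int_embed k = \<zero> \<longleftrightarrow> k = 0"
proof -
  show c: "int_embed k \<in> carrier K" for k by (rule add.int_pow_closed) simp
  show "int_embed (j + k) = int_embed j \<oplus> int_embed k" by (rule add.int_pow_mult) simp
  show "int_embed 1 = \<one>" by (rule add.int_pow_1) simp
  show z: "int_embed 0 = \<zero>" by (simp add: add_pow_def int_pow_def)
  show m: "int_embed (- k) = \<ominus> int_embed k" for k using add.int_pow_neg[of \<one> k] by simp
  have "int_embed j \<otimes> int_embed k = [j] \<cdot> (\<one> \<otimes> int_embed k)" by (rule add_pow_ldistr_int[OF one_closed c])
  also have "\<dots> = int_embed (k * j)" using c add.int_pow_pow[of \<one> j k] by simp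
  finally show "int_embed (j * k) = int_embed j \<otimes> int_embed k" by (simp add: mult.commute)
  have pos: "int_embed k \<noteq> \<zero>" if "k > 0" for k
    using char_zero[of "nat k"] that add_pow_int_ge[of k K \<one>] by simp
  show "int_embed k = \<zero> \<longleftrightarrow> k = 0"
  proof
    assume a: "int_embed k = \<zero>"
    show "k = 0"
    proof (rule ccontr)
      assume "k \<noteq> 0"
      then consider "k > 0" | "- k > 0" by linarith
      then show False using pos[of k] pos[of "- k"] a m[of k] by cases auto
    qed
  qed (simp add: z)
qed

text \<open>The fractions of integers inside \<open>K\<close>. They contain the prime field
  \<open>generate_field K {}\<close>, and the numerators and denominators give
  \<open>rat_hom\<close> a direct definition.\<close>

definition rationals :: "'a set" where
  "rationals = {x \<in> carrier K. \<exists>m n. n \<noteq> 0 \<and> int_embed n \<otimes> x = int_embed m}"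

lemma rationalsI: "x \<in> carrier K \<Longrightarrow> n \<noteq> 0 \<Longrightarrow> int_embed n \<otimes> x = int_embed m \<Longrightarrow> x \<in> rationals"
  unfolding rationals_def by blast

lemma rationals_ops:
  assumes "x \<in> carrier K" "y \<in> carrier K" "int_embed n \<otimes> x = int_embed m" "int_embed n' \<otimes> y = int_embed m'"
  shows "int_embed (n * n') \<otimes> (x \<oplus> y) = int_embed (m * n' + m' * n)"
    "int_embed (n * n') \<otimes> (x \<otimes> y) = int_embed (m * m')"
    "int_embed n \<otimes> (\<ominus> x) = int_embed (- m)"
proof -
  note c = int_embed_simps(1) assms(1,2)
  have "int_embed (n * n') \<otimes> (x \<oplus> y) = int_embed n' \<otimes> (int_embed n \<otimes> x) \<oplus> int_embed n \<otimes> (int_embed n' \<otimes> y)"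
    unfolding int_embed_simps(5) using c by (simp add: r_distr l_distr m_ac)
  also have "\<dots> = int_embed (m * n' + m' * n)"
    unfolding assms(3,4) int_embed_simps(2,5) using c by (simp add: m_comm)
  finally show "int_embed (n * n') \<otimes> (x \<oplus> y) = int_embed (m * n' + m' * n)" .
  have "int_embed (n * n') \<otimes> (x \<otimes> y) = (int_embed n \<otimes> x) \<otimes> (int_embed n' \<otimes> y)"
    unfolding int_embed_simps(5) using c by (simp add: m_ac)
  then show "int_embed (n * n') \<otimes> (x \<otimes> y) = int_embed (m * m')" unfolding assms(3,4) int_embed_simps(5) .
  show "int_embed n \<otimes> (\<ominus> x) = int_embed (- m)"
    unfolding int_embed_simps(6) assms(3)[symmetric] using c by (simp add: r_minus)
qed

lemma rationals_subfield: "subfield rationals K"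
proof (rule subfieldI')
  have ex: "\<exists>m n. n \<noteq> 0 \<and> int_embed n \<otimes> x = int_embed m" "x \<in> carrier K" if "x \<in> rationals" for x
    using that by (auto simp: rationals_def)
  show "subring rationals K"
  proof (rule subringI)
    show "rationals \<subseteq> carrier K" by (auto simp: rationals_def)
    show "\<one> \<in> rationals" by (rule rationalsI[of _ 1 1]) (auto simp: int_embed_simps)
    show "\<ominus> h \<in> rationals" if h: "h \<in> rationals" for h
    proof -
      obtain m n where "n \<noteq> 0" "int_embed n \<otimes> h = int_embed m" using ex[OF h] by blast
      then show ?thesis using rationals_ops(3)[OF ex(2)[OF h] ex(2)[OF h]] ex(2)[OF h] by (intro rationalsI) auto
    qed
    fix x y assume xy: "x \<in> rationals" "y \<in> rationals"
    obtain m n where m: "n \<noteq> 0" "int_embed n \<otimes> x = int_embed m" using ex[OF xy(1)] by blast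
    obtain m' n' where m': "n' \<noteq> 0" "int_embed n' \<otimes> y = int_embed m'" using ex[OF xy(2)] by blast
    note o = rationals_ops[OF ex(2)[OF xy(1)] ex(2)[OF xy(2)] m(2) m'(2)]
    show "x \<otimes> y \<in> rationals" by (rule rationalsI[OF _ _ o(2)]) (use m m' ex(2) xy in auto)
    show "x \<oplus> y \<in> rationals" by (rule rationalsI[OF _ _ o(1)]) (use m m' ex(2) xy in auto)
  qed
  show "inv k \<in> rationals" if k: "k \<in> rationals - {\<zero>}" for k
  proof -
    obtain m n where m: "n \<noteq> 0" "int_embed n \<otimes> k = int_embed m" "k \<in> carrier K" "k \<noteq> \<zero>" using ex k by blast
    have ki: "inv k \<in> carrier K" "k \<otimes> inv k = \<one>" using m(3,4) field_Units by auto
    have "int_embed m \<otimes> inv k = int_embed n \<otimes> (k \<otimes> inv k)"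
      unfolding m(2)[symmetric] by (rule m_assoc[OF int_embed_simps(1) m(3) ki(1)])
    also have "\<dots> = int_embed n" using ki(2) int_embed_simps(1) by simp
    finally have eq: "int_embed m \<otimes> inv k = int_embed n" .
    have "m \<noteq> 0"
    proof
      assume "m = 0"
      then have "int_embed n \<otimes> k = \<zero>" using m(2) int_embed_simps(4) by simp
      then show False using integral[OF _ int_embed_simps(1) m(3)] m(1,4) int_embed_simps(7) by blast
    qed
    then show ?thesis using rationalsI[OF ki(1) _ eq] by blast
  qed
qed

lemma prime_field_rationals: "generate_field K {} \<subseteq> rationals"
  by (rule generate_field_min_subfield1) (use rationals_subfield in auto)

definition rat_hom :: "'a \<Rightarrow> complex" where
  "rat_hom x = (THE q. \<exists>m n. n \<noteq> 0 \<and> int_embed n \<otimes> x = int_embed m \<and> q = of_int m / of_int n)"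

lemma rat_hom_eq:
  assumes "x \<in> carrier K" "n \<noteq> 0" "int_embed n \<otimes> x = int_embed m"
  shows "rat_hom x = of_int m / of_int n"
  unfolding rat_hom_def
proof (rule the_equality)
  fix q :: complex assume "\<exists>m n. n \<noteq> 0 \<and> int_embed n \<otimes> x = int_embed m \<and> q = of_int m / of_int n"
  then obtain m' n' where q: "n' \<noteq> 0" "int_embed n' \<otimes> x = int_embed m'" "q = of_int m' / of_int n'" by blast
  have "int_embed (n * m') = int_embed n \<otimes> (int_embed n' \<otimes> x)" using q(2) by (simp only: int_embed_simps(5))
  also have "\<dots> = int_embed n' \<otimes> (int_embed n \<otimes> x)" using assms(1) int_embed_simps(1) by (simp add: m_lcomm)
  also have "\<dots> = int_embed (n' * m)" using assms(3) by (simp only: int_embed_simps(5))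
  finally have "int_embed (n * m' + - (n' * m)) = \<zero>"
    unfolding int_embed_simps(2,6) using int_embed_simps(1) by (simp add: r_neg)
  then have "n * m' = n' * m" using int_embed_simps(7)[of "n * m' + - (n' * m)"] by simp
  then have "(of_int n * of_int m' :: complex) = of_int n' * of_int m" by (metis of_int_mult)
  then show "q = of_int m / of_int n" using q(1,3) assms(2) by (simp add: frac_eq_eq mult.commute)
qed (use assms in blast)

lemma rat_hom_hom: "rat_hom \<in> Ring.ring_hom (K\<lparr>carrier := rationals\<rparr>) complex_ring"
proof (rule ring_hom_memI)
  show "rat_hom \<one>\<^bsub>K\<lparr>carrier := rationals\<rparr>\<^esub> = \<one>\<^bsub>complex_ring\<^esub>"
    using rat_hom_eq[of \<one> 1 1] by (simp add: int_embed_simps)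
  fix x y assume "x \<in> carrier (K\<lparr>carrier := rationals\<rparr>)" "y \<in> carrier (K\<lparr>carrier := rationals\<rparr>)"
  then have "x \<in> rationals" "y \<in> rationals" by simp_all
  obtain m n where x: "x \<in> carrier K" "n \<noteq> 0" "int_embed n \<otimes> x = int_embed m"
    using \<open>x \<in> rationals\<close> unfolding rationals_def by blast
  obtain m' n' where y: "y \<in> carrier K" "n' \<noteq> 0" "int_embed n' \<otimes> y = int_embed m'"
    using \<open>y \<in> rationals\<close> unfolding rationals_def by blast
  note xy = x y
  note o = rationals_ops[OF xy(1,4,3,6)]
  have "rat_hom (x \<otimes> y) = of_int (m * m') / of_int (n * n')"
    by (rule rat_hom_eq[OF _ _ o(2)]) (use xy in auto)
  then show "rat_hom (x \<otimes>\<^bsub>K\<lparr>carrier := rationals\<rparr>\<^esub> y) = rat_hom x \<otimes>\<^bsub>complex_ring\<^esub> rat_hom y"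
    using rat_hom_eq[OF xy(1-3)] rat_hom_eq[OF xy(4-6)] by simp
  have "rat_hom (x \<oplus> y) = of_int (m * n' + m' * n) / of_int (n * n')"
    by (rule rat_hom_eq[OF _ _ o(1)]) (use xy in auto)
  then show "rat_hom (x \<oplus>\<^bsub>K\<lparr>carrier := rationals\<rparr>\<^esub> y) = rat_hom x \<oplus>\<^bsub>complex_ring\<^esub> rat_hom y"
    using rat_hom_eq[OF xy(1-3)] rat_hom_eq[OF xy(4-6)] xy(2,5) by (simp add: add_frac_eq)
qed auto

lemma rat_hom_Rats: "x \<in> rationals \<Longrightarrow> rat_hom x \<in> \<rat>"
proof -
  assume "x \<in> rationals"
  then obtain m n where "x \<in> carrier K" "n \<noteq> 0" "int_embed n \<otimes> x = int_embed m" by (auto simp: rationals_def)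
  then show ?thesis using rat_hom_eq by simp
qed

lemma finite_dim_rationals: "finite_dimension rationals (carrier K)"
  using finite_dimension_mono[OF generate_field_is_subfield rationals_subfield prime_field_rationals finite_over_rationals]
  by simp

lemma hom_on_rationals:
  assumes "\<sigma> \<in> Ring.ring_hom K complex_ring" "x \<in> rationals"
  shows "\<sigma> x = rat_hom x"
proof -
  have s: "\<sigma> \<in> Ring.ring_hom (K\<lparr>carrier := carrier K\<rparr>) complex_ring" using assms(1) by simp
  note h = hom_complex_simps[OF carrier_is_subfield s]
  obtain m n where mn: "x \<in> carrier K" "n \<noteq> 0" "int_embed n \<otimes> x = int_embed m" using assms(2) by (auto simp: rationals_def)
  have nat: "\<sigma> (int_embed (int k)) = of_nat k" for k
    by (induction k) (simp_all add: int_embed_simps h add.commute)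
  have int: "\<sigma> (int_embed k) = of_int k" for k
  proof (cases k rule: int_diff_cases)
    case (diff a b)
    have "int_embed k = int_embed (int a) \<oplus> \<ominus> int_embed (int b)"
      unfolding diff by (simp flip: int_embed_simps(6) int_embed_simps(2))
    then show ?thesis using nat h(1,5) int_embed_simps(1) diff by simp
  qed
  have "of_int n * \<sigma> x = of_int m"
    using h(2)[OF int_embed_simps(1) mn(1), of n] int mn(3) by simp
  moreover have "of_int n * rat_hom x = of_int m" unfolding rat_hom_eq[OF mn] using mn(2) by simp
  ultimately have "of_int n * \<sigma> x = of_int n * rat_hom x" by simp
  then show ?thesis using mn(2) by (metis mult_left_cancel of_int_eq_0_iff)
qed

text \<open>The polynomials required for the conjugates are minimal polynomials over
  \<open>rationals\<close>, of degree at most the dimension \<open>n\<close>. A root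
  \<open>z\<close> of the one that belongs to \<open>a\<close> gives an embedding of the simple
  extension with \<open>a\<close> sent to \<open>z\<close>; extended to \<open>K\<close> and
  composed with the inverse of \<open>\<sigma>\<close>, it is the desired map.\<close>

theorem ex_complex_embedding:
  "\<exists>\<sigma>\<in>Ring.ring_hom K complex_ring. complex_number_field (\<sigma> ` carrier K)"
proof -
  obtain \<sigma> where s: "\<sigma> \<in> Ring.ring_hom K complex_ring"
    using extend_hom_carrier[OF rationals_subfield rat_hom_hom finite_dim_rationals rationals_subfield order_refl] by blast
  have s': "\<sigma> \<in> Ring.ring_hom (K\<lparr>carrier := carrier K\<rparr>) complex_ring" using s by simp
  note h = hom_complex_simps[OF carrier_is_subfield s']
  obtain n where n: "dimension n rationals (carrier K)" using finite_dim_rationals by (auto simp: finite_dimension_def)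
  then obtain Us where Us: "set Us \<subseteq> carrier K" "Span rationals Us = carrier K" using exists_base[OF rationals_subfield] by blast
  have "complex_number_field (\<sigma> ` carrier K)"
  proof
    show "1 \<in> \<sigma> ` carrier K" using h(3) one_closed by (metis imageI)
    fix x y assume xy: "x \<in> \<sigma> ` carrier K"
    obtain a where a: "a \<in> carrier K" "x = \<sigma> a" using xy by blast
    show "inverse x \<in> \<sigma> ` carrier K"
    proof (cases "a = \<zero>")
      case True then show ?thesis using a h(4) by (metis imageI inverse_zero)
    next
      case False
      then have "inv a \<in> carrier K" using a field_Units by auto
      then show ?thesis using h(7)[OF a(1) False] a(2) by (metis imageI)
    qed
    assume "y \<in> \<sigma> ` carrier K"
    then obtain b where b: "b \<in> carrier K" "y = \<sigma> b" by blast
    show "x * y \<in> \<sigma> ` carrier K" using h(2)[OF a(1) b(1)] a b by (metis imageI m_closed)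
    have "x - y = \<sigma> (a \<oplus> \<ominus> b)" using h(1)[OF a(1) a_inv_closed[OF b(1)]] h(5)[OF b(1)] a b by simp
    then show "x - y \<in> \<sigma> ` carrier K" using a b by (metis imageI a_closed a_inv_closed)
  next
    show "\<exists>B. finite B \<and> \<sigma> ` carrier K \<subseteq> qvs.span B"
    proof (intro exI[of _ "\<sigma> ` set Us"] conjI)
      have comb: "combine Ks Vs \<in> carrier K \<and> \<sigma> (combine Ks Vs) \<in> qvs.span (\<sigma> ` set Us)"
        if "set Ks \<subseteq> rationals" "set Vs \<subseteq> set Us" for Ks Vs
        using that
      proof (induction Ks Vs rule: combine.induct)
        case (1 k Ks v Vs)
        have kv: "k \<in> carrier K" "v \<in> carrier K" using 1(2,3) Us(1) by (auto simp: rationals_def)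
        obtain q where q: "\<sigma> k = of_rat q" using hom_on_rationals[OF s] rat_hom_Rats 1(2) by (metis Rats_cases list.set_intros(1) subsetD)
        have IH: "combine Ks Vs \<in> carrier K" "\<sigma> (combine Ks Vs) \<in> qvs.span (\<sigma> ` set Us)" using 1 by auto
        have "\<sigma> (combine (k # Ks) (v # Vs)) = of_rat q * \<sigma> v + \<sigma> (combine Ks Vs)"
          using h(1)[OF m_closed[OF kv] IH(1)] h(2)[OF kv] q by simp
        also have "\<dots> \<in> qvs.span (\<sigma> ` set Us)"
          using IH(2) 1(3) by (intro qvs.span_add qvs.span_scale) (auto intro: qvs.span_base)
        finally show ?case using kv IH(1) by simp
      qed (auto simp: h(4) qvs.span_zero)
      show "\<sigma> ` carrier K \<subseteq> qvs.span (\<sigma> ` set Us)"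
      proof clarify
        fix x assume "x \<in> carrier K"
        then obtain Ks where "set Ks \<subseteq> rationals" "x = combine Ks Us"
          using Span_mem_iff_length_version[OF rationals_subfield Us(1), of x] Us(2) by auto
        then show "\<sigma> x \<in> qvs.span (\<sigma> ` set Us)" using comb by simp
      qed
    qed simp
    show "\<exists>D. \<forall>x\<in>\<sigma> ` carrier K. \<exists>f. lead_coeff f = 1 \<and> Polynomial.degree f \<le> D \<and>
      (\<forall>i. Polynomial.coeff f i \<in> \<rat>) \<and> poly f x = 0 \<and>
      (\<forall>z. poly f z = 0 \<longrightarrow> (\<exists>\<tau>. hom_on (\<sigma> ` carrier K) \<tau> \<and> \<tau> x = z))"
    proof (intro exI[of _ n] ballI)
      fix x assume "x \<in> \<sigma> ` carrier K"
      then obtain a where a: "a \<in> carrier K" "x = \<sigma> a" by blast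
      have alg: "(algebraic over rationals) a"
        using finite_dimension_imp_algebraic[OF rationals_subfield carrier_is_subring finite_dim_rationals a(1)] .
      note I = IrrE[OF rationals_subfield a(1) alg]
      let ?I = "Irr rationals a" and ?f = "map_to_poly rat_hom (Irr rationals a)"
      have I_set: "set ?I \<subseteq> rationals" using I(1) polynomial_incl univ_poly_carrier by blast
      have len: "length ?I \<ge> 2" using pirreducible_degree[OF rationals_subfield I(1,2)] by simp
      note rh = hom_complex_simps[OF rationals_subfield rat_hom_hom]
      have co: "Polynomial.coeff ?f i = rat_hom (coeff ?I i)" for i by (rule coeff_map_to_poly[of rat_hom, OF rh(4)])
      have deg_le: "Polynomial.degree ?f \<le> length ?I - 1"
        by (rule degree_le) (use coeff_length[of ?I] rh(4) in \<open>auto simp: co\<close>)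
      have top: "Polynomial.coeff ?f (length ?I - 1) = 1"
      proof -
        have "?I \<noteq> []" using len by auto
        then have "coeff ?I (length ?I - 1) = \<one>" using I(3) lead_coeff_simp by metis
        then show ?thesis using rh(3) by (simp add: co)
      qed
      have deg: "Polynomial.degree ?f = length ?I - 1"
        using deg_le le_degree[of ?f "length ?I - 1"] top by simp
      have "length ?I - 1 \<le> n"
      proof -
        have ind: "independent rationals (exp_base a (length ?I - 1))"
          using exp_base_independent[OF rationals_subfield a(1) alg] .
        show ?thesis using independent_length_le_dimension[OF rationals_subfield n ind exp_base_closed[OF a(1)]]
          by (simp add: exp_base_def)
      qed
      moreover have "\<forall>i. Polynomial.coeff ?f i \<in> \<rat>"
      proof
        fix i
        have "coeff ?I i \<in> rationals"
          by (rule coeff_mem[OF I_set subringE(2)[OF subfieldE(1)[OF rationals_subfield]]])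
        then show "Polynomial.coeff ?f i \<in> \<rat>" unfolding co by (rule rat_hom_Rats)
      qed
      moreover have "poly ?f x = 0"
      proof -
        have "?f = map_to_poly \<sigma> ?I"
          unfolding map_to_poly_def using hom_on_rationals[OF s] I_set by (intro arg_cong[of _ _ Poly] arg_cong[of _ _ rev] map_cong) auto
        moreover have "set ?I \<subseteq> carrier K" using I_set by (auto simp: rationals_def)
        ultimately show ?thesis using poly_map_to_poly[OF s _ a(1), of ?I] I(4) h(4) a(2) by simp
      qed
      moreover have "\<exists>\<tau>. hom_on (\<sigma> ` carrier K) \<tau> \<and> \<tau> x = z" if root: "poly ?f z = 0" for z
      proof -
        obtain \<tau>0 where t0: "\<tau>0 \<in> Ring.ring_hom (K\<lparr>carrier := simple_extension rationals a\<rparr>) complex_ring" "\<tau>0 a = z"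
          using extend_hom_simple[OF rationals_subfield rat_hom_hom a(1) alg root] by blast
        have sf: "subfield (simple_extension rationals a) K"
          using simple_extension_is_subfield[OF rationals_subfield a(1)] alg by simp
        have sub: "rationals \<subseteq> simple_extension rationals a" "a \<in> simple_extension rationals a"
          using simple_extension_incl[OF subringE(1)[OF subfieldE(1)[OF rationals_subfield]] a(1)]
            simple_extension_mem[OF subfieldE(1)[OF rationals_subfield] a(1)] by auto
        obtain \<tau> where t: "\<tau> \<in> Ring.ring_hom K complex_ring" "\<tau> a = z"
          using extend_hom_carrier[OF sf t0(1) finite_dim_rationals rationals_subfield sub(1)] t0(2) sub(2) by metis
        have t': "\<tau> \<in> Ring.ring_hom (K\<lparr>carrier := carrier K\<rparr>) complex_ring" using t(1) by simp
        note th = hom_complex_simps[OF carrier_is_subfield t']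
        define \<rho> where "\<rho> y = \<tau> (inv_into (carrier K) \<sigma> y)" for y
        have rho: "\<rho> (\<sigma> b) = \<tau> b" if "b \<in> carrier K" for b
          unfolding \<rho>_def using inv_into_f_f[OF h(8) that] by simp
        have "hom_on (\<sigma> ` carrier K) \<rho>"
          unfolding hom_on_def
        proof (intro conjI ballI)
          show "\<rho> 1 = 1" using rho[OF one_closed] h(3) th(3) by simp
          fix u v assume "u \<in> \<sigma> ` carrier K" "v \<in> \<sigma> ` carrier K"
          then obtain b c where bc: "b \<in> carrier K" "u = \<sigma> b" "c \<in> carrier K" "v = \<sigma> c" by blast
          show "\<rho> (u + v) = \<rho> u + \<rho> v" using rho[OF a_closed[OF bc(1,3)]] h(1) th(1) bc rho by simp
          show "\<rho> (u * v) = \<rho> u * \<rho> v" using rho[OF m_closed[OF bc(1,3)]] h(2) th(2) bc rho by simp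
        qed
        then show ?thesis using rho[OF a(1)] a(2) t(2) by blast
      qed
      ultimately show "\<exists>f. lead_coeff f = 1 \<and> Polynomial.degree f \<le> n \<and>
        (\<forall>i. Polynomial.coeff f i \<in> \<rat>) \<and> poly f x = 0 \<and>
        (\<forall>z. poly f z = 0 \<longrightarrow> (\<exists>\<tau>. hom_on (\<sigma> ` carrier K) \<tau> \<and> \<tau> x = z))"
        using deg top by (intro exI[of _ ?f]) auto
    qed
  qed
  then show ?thesis using s by blast
qed

end

section \<open>Computing the \<open>l\<close>-rank by counting\<close>

text \<open>Two functions that identify the same arguments have equally many values. Cosets in an
  abstract group can thus be counted as equivalence classes of complex objects.\<close>

lemma image_eq_iff_bij:
  assumes "\<And>x y. x \<in> A \<Longrightarrow> y \<in> A \<Longrightarrow> f x = f y \<longleftrightarrow> g x = g y"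
  shows "finite (f ` A) \<longleftrightarrow> finite (g ` A)" "card (f ` A) = card (g ` A)"
proof -
  have "bij_betw (\<lambda>y. g (inv_into A f y)) (f ` A) (g ` A)"
  proof (rule bij_betwI[where g = "\<lambda>y. f (inv_into A g y)"])
    show "(\<lambda>y. g (inv_into A f y)) \<in> f ` A \<rightarrow> g ` A" using inv_into_into[of _ f A] by auto
    show "(\<lambda>y. f (inv_into A g y)) \<in> g ` A \<rightarrow> f ` A" using inv_into_into[of _ g A] by auto
    show "f (inv_into A g (g (inv_into A f x))) = x" if x: "x \<in> f ` A" for x
    proof -
      let ?a = "inv_into A f x"
      have a: "?a \<in> A" "f ?a = x" using x by (auto intro: inv_into_into f_inv_into_f)
      have "inv_into A g (g ?a) \<in> A" "g (inv_into A g (g ?a)) = g ?a"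
        using a(1) by (auto intro: inv_into_into f_inv_into_f)
      then show ?thesis using assms[OF _ a(1)] a(2) by metis
    qed
    show "g (inv_into A f (f (inv_into A g x))) = x" if x: "x \<in> g ` A" for x
    proof -
      let ?a = "inv_into A g x"
      have a: "?a \<in> A" "g ?a = x" using x by (auto intro: inv_into_into f_inv_into_f)
      have "inv_into A f (f ?a) \<in> A" "f (inv_into A f (f ?a)) = f ?a"
        using a(1) by (auto intro: inv_into_into f_inv_into_f)
      then show ?thesis using assms[OF _ a(1)] a(2) by metis
    qed
  qed
  then show "finite (f ` A) \<longleftrightarrow> finite (g ` A)" "card (f ` A) = card (g ` A)"
    using bij_betw_finite bij_betw_same_card by blast+
qed

lemma (in group) rcos_eq_iff:
  assumes "subgroup H G" "x \<in> carrier G" "y \<in> carrier G"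
  shows "H #> x = H #> y \<longleftrightarrow> x \<otimes> inv y \<in> H"
proof
  assume "H #> x = H #> y"
  then have "x \<in> H #> y" using rcos_self[OF assms(2,1)] by simp
  then obtain h where h: "h \<in> H" "x = h \<otimes> y" unfolding r_coset_def by blast
  moreover have "h \<in> carrier G" using h(1) subgroup.subset[OF assms(1)] by blast
  ultimately show "x \<otimes> inv y \<in> H" using assms(3) by (simp add: m_assoc)
next
  assume a: "x \<otimes> inv y \<in> H"
  have "x = (x \<otimes> inv y) \<otimes> y" using assms(2,3) by (simp add: m_assoc)
  then have "x \<in> H #> y" using a unfolding r_coset_def by blast
  then show "H #> x = H #> y" using repr_independence[OF _ assms(3,1)] by simp
qed

lemma exponent_vectorspace:
  assumes V: "comm_group V" and l: "prime l" and exp: "\<And>v. v \<in> carrier V \<Longrightarrow> v [^]\<^bsub>V\<^esub> l = \<one>\<^bsub>V\<^esub>"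
  shows "vectorspace (residue_ring (int l)) (exponent_module V)"
proof -
  interpret V: comm_group V by fact
  interpret R: residues_prime l "residue_ring (int l)" using l by unfold_locales auto
  \<comment> \<open>Scalars are residues, reduced after every operation; this is harmless because
    exponents matter only modulo \<open>l\<close>.\<close>
  have red: "v [^]\<^bsub>V\<^esub> (k mod int l) = v [^]\<^bsub>V\<^esub> k" if v: "v \<in> carrier V" for v and k :: int
  proof -
    have "v [^]\<^bsub>V\<^esub> (int l * (k div int l)) = \<one>\<^bsub>V\<^esub>"
      using V.int_pow_pow[OF v, of "int l" "k div int l"] exp[OF v] V.int_pow_one by (simp add: int_pow_int)
    moreover have "v [^]\<^bsub>V\<^esub> (int l * (k div int l) + k mod int l) =
      v [^]\<^bsub>V\<^esub> (int l * (k div int l)) \<otimes>\<^bsub>V\<^esub> v [^]\<^bsub>V\<^esub> (k mod int l)"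
      by (rule V.int_pow_mult[OF v])
    ultimately show ?thesis using v by simp
  qed
  have "module (residue_ring (int l)) (exponent_module V)"
  proof (rule module_criteria)
    show "cring (residue_ring (int l))" by (rule R.is_cring)
    show "\<forall>v\<in>carrier (exponent_module V). \<exists>w\<in>carrier (exponent_module V).
        v \<oplus>\<^bsub>exponent_module V\<^esub> w = \<zero>\<^bsub>exponent_module V\<^esub>"
      unfolding exponent_module_def using V.r_inv V.inv_closed by auto
  qed (auto simp: exponent_module_def R.res_mult_eq R.res_add_eq R.res_one_eq red V.m_ac
      V.int_pow_pow V.int_pow_mult V.int_pow_distrib mult.commute)
  then show ?thesis unfolding vectorspace_def using R.is_field by simp
qed

section \<open>The rank as an exponent of a cardinality\<close>

context comm_group
begin

lemma power_subgroup_subgroup: "subgroup (power_subgroup l G) G"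
proof (rule subgroupI)
  show "power_subgroup l G \<subseteq> carrier G" "power_subgroup l G \<noteq> {}" by (auto simp: power_subgroup_def)
  fix a assume "a \<in> power_subgroup l G"
  then obtain x where x: "x \<in> carrier G" "a = x [^] l" by (auto simp: power_subgroup_def)
  have "inv a = (inv x) [^] l" using x by (simp add: nat_pow_inv)
  then show "inv a \<in> power_subgroup l G" using x unfolding power_subgroup_def by auto
  fix b assume "b \<in> power_subgroup l G"
  then obtain y where y: "y \<in> carrier G" "b = y [^] l" by (auto simp: power_subgroup_def)
  have "a \<otimes> b = (x \<otimes> y) [^] l" using x y by (simp add: nat_pow_distrib)
  then show "a \<otimes> b \<in> power_subgroup l G" using x y unfolding power_subgroup_def by auto
qed

text \<open>Coordinates in a basis identify the quotient with the functions from the basis to a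
  field of \<open>l\<close> elements.\<close>

lemma power_group_rank:
  assumes l: "prime l" and fin: "finite (carrier (G Mod power_subgroup l G))"
  shows "l ^ group_rank l G = card (carrier (G Mod power_subgroup l G))"
proof -
  let ?P = "power_subgroup l G" and ?V = "G Mod power_subgroup l G"
  interpret P: normal ?P G using subgroup_imp_normal[OF power_subgroup_subgroup] .
  interpret V: comm_group ?V using abelian_FactGroup[OF power_subgroup_subgroup] .
  have exp: "v [^]\<^bsub>?V\<^esub> l = \<one>\<^bsub>?V\<^esub>" if v: "v \<in> carrier ?V" for v
  proof -
    obtain x where x: "x \<in> carrier G" "v = ?P #> x" using v unfolding carrier_FactGroup by blast
    have "v [^]\<^bsub>?V\<^esub> l = ?P #> (x [^] l)" using P.FactGroup_pow[OF x(1), of l] x(2) by simp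
    moreover have "x [^] l \<in> ?P" using x(1) by (auto simp: power_subgroup_def)
    ultimately show ?thesis using P.rcos_const by simp
  qed
  let ?R = "residue_ring (int l)" and ?M = "exponent_module ?V"
  interpret M: vectorspace ?R ?M by (rule exponent_vectorspace[OF V.comm_group_axioms l exp])
  have cM: "carrier ?M = carrier ?V" by (simp add: exponent_module_def)
  have cR: "carrier ?R = {0..int l - 1}" by (simp add: residue_ring_def)
  have "M.gen_set (carrier ?M)" using M.in_own_span[of "carrier ?M"] M.span_is_subset2[of "carrier ?M"] by blast
  then have "M.fin_dim" unfolding M.fin_dim_def using fin cM by (intro exI[of _ "carrier ?M"]) simp
  then obtain B where B: "finite B" "M.basis B" using M.finite_basis_exists by blast
  have BC: "B \<subseteq> carrier ?M" using B(2) by (simp add: M.basis_def)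
  have crit: "\<exists>!a. a \<in> B \<rightarrow>\<^sub>E carrier ?R \<and> M.lincomb a B = v" if "v \<in> carrier ?M" for v
    using M.basis_criterion[OF B(1) BC] B(2) that by blast
  have closed: "M.lincomb a B \<in> carrier ?M" if "a \<in> B \<rightarrow>\<^sub>E carrier ?R" for a
    using that by (intro M.lincomb_closed BC) auto
  have "bij_betw (\<lambda>a. M.lincomb a B) (B \<rightarrow>\<^sub>E carrier ?R) (carrier ?M)"
  proof (rule bij_betw_imageI)
    show "inj_on (\<lambda>a. M.lincomb a B) (B \<rightarrow>\<^sub>E carrier ?R)"
    proof (rule inj_onI)
      fix a b assume ab: "a \<in> B \<rightarrow>\<^sub>E carrier ?R" "b \<in> B \<rightarrow>\<^sub>E carrier ?R" "M.lincomb a B = M.lincomb b B"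
      show "a = b" using crit[OF closed[OF ab(1)]] ab by metis
    qed
    show "(\<lambda>a. M.lincomb a B) ` (B \<rightarrow>\<^sub>E carrier ?R) = carrier ?M"
      using crit closed by (auto simp: image_iff) metis
  qed
  then have "card (carrier ?M) = card (B \<rightarrow>\<^sub>E carrier ?R)" by (rule bij_betw_same_card[symmetric])
  also have "\<dots> = l ^ card B" using B(1) by (simp add: card_PiE cR)
  also have "card B = group_rank l G" unfolding group_rank_def by (rule M.dim_basis[OF B, symmetric])
  finally show ?thesis using cM by simp
qed

text \<open>The \<open>l\<close>-th power map has the elements killed by \<open>l\<close> as kernel
  and the power subgroup as image; two applications of Lagrange's theorem compare the index of the
  image with the size of the kernel.\<close>

lemma card_Mod_power_subgroup_finite:
  assumes fin: "finite (carrier G)"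
  shows "card (carrier (G Mod power_subgroup l G)) = card {x \<in> carrier G. x [^] l = \<one>}"
proof -
  let ?T = "{x \<in> carrier G. x [^] l = \<one>}" and ?P = "power_subgroup l G"
  have T: "subgroup ?T G"
  proof (rule subgroupI)
    show "inv a \<in> ?T" if "a \<in> ?T" for a using that by (auto simp: nat_pow_inv)
    show "a \<otimes> b \<in> ?T" if "a \<in> ?T" "b \<in> ?T" for a b using that by (auto simp: nat_pow_distrib)
  qed (auto intro: exI[of _ \<one>])
  have "card ((\<lambda>x. ?T #> x) ` carrier G) = card ((\<lambda>x. x [^] l) ` carrier G)"
  proof (rule image_eq_iff_bij)
    fix x y assume xy: "x \<in> carrier G" "y \<in> carrier G"
    have "(x \<otimes> inv y) [^] l = x [^] l \<otimes> inv (y [^] l)" using xy by (simp add: nat_pow_distrib nat_pow_inv)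
    moreover have "x [^] l \<otimes> inv (y [^] l) = \<one> \<longleftrightarrow> x [^] l = y [^] l"
    proof
      assume "x [^] l \<otimes> inv (y [^] l) = \<one>"
      then show "x [^] l = y [^] l" using inv_equality[of "x [^] l" "inv (y [^] l)"] xy by simp
    qed (use xy in simp)
    ultimately have "x \<otimes> inv y \<in> ?T \<longleftrightarrow> x [^] l = y [^] l" using xy by simp
    then show "?T #> x = ?T #> y \<longleftrightarrow> x [^] l = y [^] l" using rcos_eq_iff[OF T xy] by simp
  qed
  then have "card (rcosets ?T) = card ?P"
    unfolding power_subgroup_def carrier_FactGroup[symmetric] by (simp add: FactGroup_def)
  moreover have "card ?T * card (rcosets ?T) = Coset.order G" "card ?P * card (rcosets ?P) = Coset.order G"
    using lagrange[OF T] lagrange[OF power_subgroup_subgroup] by (simp_all add: mult.commute)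
  moreover have "card ?P > 0"
    using fin by (auto simp: power_subgroup_def card_gt_0_iff)
  ultimately have "card ?P * card (rcosets ?P) = card ?P * card ?T" by (simp add: mult.commute)
  then have "card (rcosets ?P) = card ?T" using \<open>card ?P > 0\<close> by simp
  then show ?thesis by (simp add: FactGroup_def)
qed

end

section \<open>Number fields and their images in the complex numbers\<close>

lemma (in complex_number_field) complex_number_field_subset:
  assumes "complex_subfield F" "F \<subseteq> K"
  shows "complex_number_field F"
proof -
  interpret F: complex_subfield F by fact
  show ?thesis
  proof
    show "\<exists>B. finite B \<and> F \<subseteq> qvs.span B" using finite_dim assms(2) by blast
    obtain D where D: "\<forall>x\<in>K. \<exists>f. lead_coeff f = 1 \<and> Polynomial.degree f \<le> D \<and>
      (\<forall>i. Polynomial.coeff f i \<in> \<rat>) \<and> poly f x = 0 \<and>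
      (\<forall>z. poly f z = 0 \<longrightarrow> (\<exists>\<tau>. hom_on K \<tau> \<and> \<tau> x = z))" using conjugates_bounded by blast
    have mono: "hom_on K \<tau> \<Longrightarrow> hom_on F \<tau>" for \<tau> using assms(2) unfolding hom_on_def by blast
    show "\<exists>D. \<forall>x\<in>F. \<exists>f. lead_coeff f = 1 \<and> Polynomial.degree f \<le> D \<and>
      (\<forall>i. Polynomial.coeff f i \<in> \<rat>) \<and> poly f x = 0 \<and>
      (\<forall>z. poly f z = 0 \<longrightarrow> (\<exists>\<tau>. hom_on F \<tau> \<and> \<tau> x = z))"
    proof (intro exI[of _ D] ballI)
      fix x assume "x \<in> F"
      then obtain f where "lead_coeff f = 1" "Polynomial.degree f \<le> D" "\<forall>i. Polynomial.coeff f i \<in> \<rat>" "poly f x = 0"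
        "\<forall>z. poly f z = 0 \<longrightarrow> (\<exists>\<tau>. hom_on K \<tau> \<and> \<tau> x = z)" using bspec[OF D subsetD[OF assms(2)]] by blast
      then show "\<exists>f. lead_coeff f = 1 \<and> Polynomial.degree f \<le> D \<and>
        (\<forall>i. Polynomial.coeff f i \<in> \<rat>) \<and> poly f x = 0 \<and>
        (\<forall>z. poly f z = 0 \<longrightarrow> (\<exists>\<tau>. hom_on F \<tau> \<and> \<tau> x = z))"
        using mono by (intro exI[of _ f]) blast
    qed
  qed
qed

text \<open>Negatives are phrased as products with -1, which is the form in which a module over the
  ring of integers supplies them.\<close>

lemma (in ring) additive_subgroup_criterion:
  assumes "I \<subseteq> carrier R" "\<zero> \<in> I" "\<And>x y. x \<in> I \<Longrightarrow> y \<in> I \<Longrightarrow> x \<oplus> y \<in> I" "\<And>x. x \<in> I \<Longrightarrow> (\<ominus> \<one>) \<otimes> x \<in> I"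
  shows "additive_subgroup I R"
proof (rule additive_subgroup.intro, rule subgroup.intro)
  fix x assume x: "x \<in> I"
  then have "(\<ominus> \<one>) \<otimes> x = \<ominus> x" using assms(1) l_minus[of \<one> x] by auto
  then show "inv\<^bsub>add_monoid R\<^esub> x \<in> I" using assms(4)[OF x] by (simp add: a_inv_def)
qed (use assms in auto)

lemma comm_group_pullback:
  assumes "comm_group H" "inj_on \<phi> (carrier G)" "\<phi> ` carrier G = carrier H"
    "\<And>x y. x \<in> carrier G \<Longrightarrow> y \<in> carrier G \<Longrightarrow> x \<otimes>\<^bsub>G\<^esub> y \<in> carrier G \<and> \<phi> (x \<otimes>\<^bsub>G\<^esub> y) = \<phi> x \<otimes>\<^bsub>H\<^esub> \<phi> y"
    "\<one>\<^bsub>G\<^esub> \<in> carrier G" "\<phi> \<one>\<^bsub>G\<^esub> = \<one>\<^bsub>H\<^esub>"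
  shows "comm_group G"
proof -
  interpret H: comm_group H by fact
  have c: "\<phi> x \<in> carrier H" if "x \<in> carrier G" for x using assms(3) that by blast
  have eqI: "x = y" if "x \<in> carrier G" "y \<in> carrier G" "\<phi> x = \<phi> y" for x y
    using inj_onD[OF assms(2) that(3,1,2)] .
  show ?thesis
  proof (rule comm_groupI)
    show "x \<otimes>\<^bsub>G\<^esub> y = y \<otimes>\<^bsub>G\<^esub> x" if "x \<in> carrier G" "y \<in> carrier G" for x y
      using that by (intro eqI) (simp_all add: assms(4) c H.m_comm)
    show "x \<otimes>\<^bsub>G\<^esub> y \<otimes>\<^bsub>G\<^esub> z = x \<otimes>\<^bsub>G\<^esub> (y \<otimes>\<^bsub>G\<^esub> z)"
      if "x \<in> carrier G" "y \<in> carrier G" "z \<in> carrier G" for x y z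
      using that by (intro eqI) (simp_all add: assms(4) c H.m_assoc)
    show "\<one>\<^bsub>G\<^esub> \<otimes>\<^bsub>G\<^esub> x = x" if "x \<in> carrier G" for x
      using that assms(5) by (intro eqI) (simp_all add: assms(4,6) c)
    fix x assume x: "x \<in> carrier G"
    have "inv\<^bsub>H\<^esub> \<phi> x \<in> \<phi> ` carrier G" using c[OF x] assms(3) by simp
    then obtain y where y: "y \<in> carrier G" "inv\<^bsub>H\<^esub> \<phi> x = \<phi> y" by blast
    have "y \<otimes>\<^bsub>G\<^esub> x = \<one>\<^bsub>G\<^esub>"
      using x y assms(4)[OF y(1) x] assms(5,6) c[OF x] by (intro eqI) (simp_all flip: y(2))
    then show "\<exists>y\<in>carrier G. y \<otimes>\<^bsub>G\<^esub> x = \<one>\<^bsub>G\<^esub>" using y(1) by blast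
  qed (use assms(4,5) in auto)
qed

text \<open>The setting in which ideals, units and primes of \<open>L\<close> are carried to subsets
  of the complex numbers. It is used for the top field and, with the same \<open>\<sigma>\<close>,
  for the subfields of the tower.\<close>

locale embedded_field = field L for L (structure) +
  fixes \<sigma> :: "'a \<Rightarrow> complex"
  assumes hom: "\<sigma> \<in> Ring.ring_hom L complex_ring"
    and number_field_image: "complex_number_field (\<sigma> ` carrier L)"

sublocale embedded_field \<subseteq> C: complex_number_field "\<sigma> ` carrier L"
  by (rule number_field_image)

section \<open>Integers and units under the embedding\<close>

context embedded_field
begin

lemma hom_carrier: "\<sigma> \<in> Ring.ring_hom (L\<lparr>carrier := carrier L\<rparr>) complex_ring"
  using hom by simp

lemmas hom_simps = hom_complex_simps[OF carrier_is_subfield hom_carrier]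

abbreviation \<O> where "\<O> \<equiv> carrier (ring_of_integers L)"

lemma hom_int: "add_pow L (k::int) \<one> \<in> carrier L" "\<sigma> (add_pow L (k::int) \<one>) = of_int k"
proof -
  have nat: "\<sigma> (add_pow L n \<one>) = of_nat n" for n :: nat
    by (induction n) (simp_all add: hom_simps add.nat_pow_Suc add.commute)
  show "add_pow L k \<one> \<in> carrier L" by (rule add.int_pow_closed) simp
  show "\<sigma> (add_pow L k \<one>) = of_int k"
  proof (cases "k < 0")
    case True
    then show ?thesis using nat[of "nat (- k)"] by (simp add: add_pow_int_lt hom_simps)
  next
    case False
    then show ?thesis using nat[of "nat k"] by (simp add: add_pow_int_ge)
  qed
qed

text \<open>A monic polynomial is mapped coefficientwise; conversely an integral complex polynomial
  is lifted through the copies of the integers in \<open>L\<close>, and injectivity of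
  \<open>\<sigma>\<close> gives the root.\<close>

lemma integers_eq: "\<O> = {x \<in> carrier L. algebraic_int (\<sigma> x)}"
proof (intro antisym subsetI CollectI conjI)
  fix x assume "x \<in> \<O>"
  then have x: "x \<in> carrier L" and ex: "\<exists>p \<in> carrier (univ_poly L (rational_integers L)).
      p \<noteq> [] \<and> hd p = \<one> \<and> eval p x = \<zero>"
    by (simp_all add: ring_of_integers_def)
  show "x \<in> carrier L" by fact
  obtain p where p: "p \<in> carrier (univ_poly L (rational_integers L))" "p \<noteq> []" "hd p = \<one>" "eval p x = \<zero>"
    using ex by blast
  have set: "set p \<subseteq> rational_integers L"
    using p(1,2) unfolding univ_poly_carrier[symmetric] polynomial_def by blast
  then have set': "set p \<subseteq> carrier L" unfolding rational_integers_def using hom_int(1) by blast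
  let ?f = "map_to_poly \<sigma> p"
  have co: "Polynomial.coeff ?f i = \<sigma> (coeff p i)" for i by (rule coeff_map_to_poly[of \<sigma>, OF hom_simps(4)])
  have "Polynomial.degree ?f \<le> length p - 1"
    by (rule degree_le) (use coeff_length[of p] hom_simps(4) in \<open>auto simp: co\<close>)
  moreover have top: "Polynomial.coeff ?f (length p - 1) = 1"
    using lead_coeff_simp[OF p(2)] p(3) by (simp add: co hom_simps(3))
  ultimately have "Polynomial.degree ?f = length p - 1"
    using le_degree[of ?f "length p - 1"] by simp
  then have "lead_coeff ?f = 1" using top by simp
  moreover have "\<forall>i. Polynomial.coeff ?f i \<in> \<int>"
  proof
    fix i
    have "\<zero> \<in> rational_integers L"
      unfolding rational_integers_def by (rule range_eqI[of _ _ 0]) (simp add: add_pow_def int_pow_def)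
    then have "coeff p i \<in> rational_integers L" by (rule coeff_mem[OF set])
    then show "Polynomial.coeff ?f i \<in> \<int>" unfolding co rational_integers_def using hom_int(2) by auto
  qed
  moreover have "poly ?f (\<sigma> x) = 0" using poly_map_to_poly[OF hom set' x] p(4) hom_simps(4) by simp
  ultimately show "algebraic_int (\<sigma> x)" by (rule algebraic_int.intros)
next
  fix x assume "x \<in> {x \<in> carrier L. algebraic_int (\<sigma> x)}"
  then have x: "x \<in> carrier L" "algebraic_int (\<sigma> x)" by auto
  from x(2) obtain f where f: "lead_coeff f = 1" "\<forall>i. Polynomial.coeff f i \<in> \<int>" "poly f (\<sigma> x) = 0"
    by (auto elim: algebraic_int.cases)
  have "\<forall>i. \<exists>k. Polynomial.coeff f i = of_int k" using f(2) by (auto simp: Ints_def)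
  then obtain g where g: "\<And>i. Polynomial.coeff f i = of_int (g i)" by (auto dest: choice)
  define d where "d = Polynomial.degree f"
  define p where "p = map (\<lambda>i. add_pow L (g i :: int) \<one>) (rev [0..<Suc d])"
  have set: "set p \<subseteq> rational_integers L" by (auto simp: p_def rational_integers_def)
  have set': "set p \<subseteq> carrier L" using hom_int(1) by (auto simp: p_def)
  have "(of_int (g d) :: complex) = of_int 1" using f(1) g[of d] by (simp add: d_def)
  then have "g d = 1" by (simp only: of_int_eq_iff)
  then have hd: "p \<noteq> []" "hd p = \<one>" by (simp_all add: p_def)
  have p: "p \<in> carrier (univ_poly L (rational_integers L))"
    using set hd by (simp only: univ_poly_carrier[symmetric] polynomial_def) simp
  have "map_to_poly \<sigma> p = f"
  proof (rule poly_eqI)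
    fix i
    have "map \<sigma> p = map (Polynomial.coeff f) (rev [0..<Suc d])" by (simp add: p_def hom_int(2) g)
    then have "map_to_poly \<sigma> p = Poly (map (Polynomial.coeff f) [0..<Suc d])" by (simp add: map_to_poly_def rev_map)
    then show "Polynomial.coeff (map_to_poly \<sigma> p) i = Polynomial.coeff f i"
      by (simp add: nth_default_def d_def coeff_eq_0 nth_append del: upt_Suc)
  qed
  then have "\<sigma> (eval p x) = 0" "eval p x \<in> carrier L" using poly_map_to_poly[OF hom set' x(1)] f(3) by simp_all
  then have "eval p x = \<zero>" using hom_simps(6) by blast
  then show "x \<in> \<O>" unfolding ring_of_integers_def using x(1) p hd by auto
qed

lemma integers_subset: "\<O> \<subseteq> carrier L"
  unfolding integers_eq by blast

lemma image_integers: "\<sigma> ` \<O> = oint (\<sigma> ` carrier L)"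
  unfolding integers_eq oint_def by blast

lemma image_mem_iff: "I \<subseteq> carrier L \<Longrightarrow> x \<in> carrier L \<Longrightarrow> \<sigma> x \<in> \<sigma> ` I \<longleftrightarrow> x \<in> I"
  using inj_on_image_mem_iff[OF hom_simps(8)] by blast

lemma image_eq_iff: "I \<subseteq> carrier L \<Longrightarrow> J \<subseteq> carrier L \<Longrightarrow> \<sigma> ` I = \<sigma> ` J \<longleftrightarrow> I = J"
  using inj_on_image_eq_iff[OF hom_simps(8)] by blast

lemma integer_iff: "x \<in> carrier L \<Longrightarrow> \<sigma> x \<in> oint (\<sigma> ` carrier L) \<longleftrightarrow> x \<in> \<O>"
  unfolding image_integers[symmetric] by (rule image_mem_iff[OF integers_subset])

lemma preimage: "I \<subseteq> \<sigma> ` carrier L \<Longrightarrow> \<exists>J\<subseteq>carrier L. \<sigma> ` J = I"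
  by (metis subset_imageE)

lemma integers_closed:
  "\<one> \<in> \<O>" "\<zero> \<in> \<O>" "x \<in> \<O> \<Longrightarrow> y \<in> \<O> \<Longrightarrow> x \<oplus> y \<in> \<O>" "x \<in> \<O> \<Longrightarrow> y \<in> \<O> \<Longrightarrow> x \<otimes> y \<in> \<O>" "x \<in> \<O> \<Longrightarrow> \<ominus> x \<in> \<O>"
proof -
  have iff: "x \<in> \<O> \<longleftrightarrow> x \<in> carrier L \<and> \<sigma> x \<in> oint (\<sigma> ` carrier L)" for x
    using integer_iff integers_subset by blast
  show "\<one> \<in> \<O>" "\<zero> \<in> \<O>" unfolding iff using C.oint_closed(1,2) by (simp_all add: hom_simps)
  show "x \<in> \<O> \<Longrightarrow> y \<in> \<O> \<Longrightarrow> x \<oplus> y \<in> \<O>" unfolding iff using C.oint_closed(3) by (simp add: hom_simps)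
  show "x \<in> \<O> \<Longrightarrow> y \<in> \<O> \<Longrightarrow> x \<otimes> y \<in> \<O>" unfolding iff using C.oint_closed(6) by (simp add: hom_simps)
  show "x \<in> \<O> \<Longrightarrow> \<ominus> x \<in> \<O>" unfolding iff using C.oint_closed(5) by (simp add: hom_simps)
qed

lemma ring_of_integers_simps:
  "x \<otimes>\<^bsub>ring_of_integers L\<^esub> y = x \<otimes> y" "x \<oplus>\<^bsub>ring_of_integers L\<^esub> y = x \<oplus> y"
  "\<one>\<^bsub>ring_of_integers L\<^esub> = \<one>" "\<zero>\<^bsub>ring_of_integers L\<^esub> = \<zero>"
  by (simp_all add: ring_of_integers_def)

lemma ring_of_integers_domain: "domain (ring_of_integers L)"
proof -
  have "ring_of_integers L = L\<lparr>carrier := \<O>\<rparr>" by (simp add: ring_of_integers_def)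
  moreover have "subring \<O> L"
    by (rule subringI) (use integers_subset integers_closed in auto)
  ultimately show ?thesis using subring_is_domain by metis
qed

lemma units_iff: "x \<in> Units (ring_of_integers L) \<longleftrightarrow> x \<in> carrier L \<and> \<sigma> x \<in> units (\<sigma> ` carrier L)"
proof
  assume "x \<in> Units (ring_of_integers L)"
  then obtain y where y: "x \<in> \<O>" "y \<in> \<O>" "y \<otimes> x = \<one>"
    unfolding Units_def by (auto simp: ring_of_integers_simps)
  have c: "x \<in> carrier L" "y \<in> carrier L" using y integers_subset by auto
  have eq: "\<sigma> y * \<sigma> x = 1" using hom_simps(2)[OF c(2,1)] y(3) hom_simps(3) by simp
  then have "inverse (\<sigma> x) = \<sigma> y" "\<sigma> x \<noteq> 0" by (auto simp: inverse_unique mult.commute)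
  then show "x \<in> carrier L \<and> \<sigma> x \<in> units (\<sigma> ` carrier L)"
    unfolding units_def using c y integer_iff by auto
next
  assume x: "x \<in> carrier L \<and> \<sigma> x \<in> units (\<sigma> ` carrier L)"
  then have u: "\<sigma> x \<in> oint (\<sigma> ` carrier L)" "\<sigma> x \<noteq> 0" "inverse (\<sigma> x) \<in> oint (\<sigma> ` carrier L)"
    by (auto simp: units_def)
  then obtain y where y: "y \<in> \<O>" "inverse (\<sigma> x) = \<sigma> y" unfolding image_integers[symmetric] by blast
  have c: "y \<in> carrier L" using y integers_subset by auto
  have "\<sigma> (x \<otimes> y) = \<sigma> \<one>" using hom_simps(2)[of x y] hom_simps(3) x c u(2) by (simp flip: y(2))
  then have "x \<otimes> y = \<one>" using inj_onD[OF hom_simps(8)] x c by blast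
  then have "y \<otimes> x = \<one>" using m_comm[of x y] x c by simp
  then show "x \<in> Units (ring_of_integers L)"
    unfolding Units_def using \<open>x \<otimes> y = \<one>\<close> x y(1) u(1) integer_iff by (auto simp: ring_of_integers_simps)
qed

lemma units_rank:
  assumes l: "prime l"
  shows "l ^ group_rank l (units_of (ring_of_integers L)) =
    card (units (\<sigma> ` carrier L) // power_equiv l (units (\<sigma> ` carrier L)))"
proof -
  let ?U = "units_of (ring_of_integers L)" and ?V = "units (\<sigma> ` carrier L)"
  interpret R: domain "ring_of_integers L" by (rule ring_of_integers_domain)
  interpret U: comm_group ?U by (rule R.units_comm_group)
  have cU: "carrier ?U = Units (ring_of_integers L)" by (simp add: units_of_def)
  have UL: "x \<in> carrier ?U \<Longrightarrow> x \<in> carrier L" for x using units_iff cU by simp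
  have UV: "\<sigma> ` carrier ?U = ?V"
  proof (intro antisym subsetI)
    fix v assume v: "v \<in> ?V"
    then have "v \<in> \<sigma> ` carrier L" using C.oint_mem by (auto simp: units_def)
    then obtain x where "x \<in> carrier L" "v = \<sigma> x" by blast
    then show "v \<in> \<sigma> ` carrier ?U" using v units_iff cU by auto
  qed (use units_iff cU in auto)
  have mult: "\<sigma> (x \<otimes>\<^bsub>?U\<^esub> y) = \<sigma> x * \<sigma> y" if "x \<in> carrier ?U" "y \<in> carrier ?U" for x y
    using that UL by (simp add: units_of_def ring_of_integers_simps hom_simps)
  have one: "\<sigma> \<one>\<^bsub>?U\<^esub> = 1" by (simp add: units_of_def ring_of_integers_simps hom_simps)
  have pow: "\<sigma> (x [^]\<^bsub>?U\<^esub> k) = \<sigma> x ^ k" if "x \<in> carrier ?U" for x and k :: nat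
    using that by (induction k) (simp_all add: mult one mult.commute)
  have inj: "x = y" if "x \<in> carrier ?U" "y \<in> carrier ?U" "\<sigma> x = \<sigma> y" for x y
    using inj_onD[OF hom_simps(8) that(3)] UL that by blast
  let ?P = "power_subgroup l ?U"
  have P: "subgroup ?P ?U" by (rule U.power_subgroup_subgroup)
  have eq: "?P #>\<^bsub>?U\<^esub> x = ?P #>\<^bsub>?U\<^esub> y \<longleftrightarrow> power_equiv l ?V `` {\<sigma> x} = power_equiv l ?V `` {\<sigma> y}"
    if xy: "x \<in> carrier ?U" "y \<in> carrier ?U" for x y
  proof -
    have V: "\<sigma> x \<in> ?V" "\<sigma> y \<in> ?V" using UV xy by auto
    have "?P #>\<^bsub>?U\<^esub> x = ?P #>\<^bsub>?U\<^esub> y \<longleftrightarrow> (\<exists>z\<in>carrier ?U. x \<otimes>\<^bsub>?U\<^esub> inv\<^bsub>?U\<^esub> y = z [^]\<^bsub>?U\<^esub> l)"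
      by (simp only: U.rcos_eq_iff[OF P xy]) (auto simp: power_subgroup_def)
    also have "\<dots> \<longleftrightarrow> (\<exists>z\<in>carrier ?U. \<sigma> x = \<sigma> y * \<sigma> z ^ l)"
    proof (rule bex_cong[OF refl])
      fix z assume z: "z \<in> carrier ?U"
      have "x \<otimes>\<^bsub>?U\<^esub> inv\<^bsub>?U\<^esub> y = z [^]\<^bsub>?U\<^esub> l \<longleftrightarrow> x = z [^]\<^bsub>?U\<^esub> l \<otimes>\<^bsub>?U\<^esub> y"
        using U.inv_solve_right[of "z [^]\<^bsub>?U\<^esub> l" x y] xy z by auto
      also have "\<dots> \<longleftrightarrow> \<sigma> x = \<sigma> (z [^]\<^bsub>?U\<^esub> l \<otimes>\<^bsub>?U\<^esub> y)"
        using inj[of x "z [^]\<^bsub>?U\<^esub> l \<otimes>\<^bsub>?U\<^esub> y"] xy z by auto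
      also have "\<sigma> (z [^]\<^bsub>?U\<^esub> l \<otimes>\<^bsub>?U\<^esub> y) = \<sigma> y * \<sigma> z ^ l" using xy z by (simp add: mult pow)
      finally show "x \<otimes>\<^bsub>?U\<^esub> inv\<^bsub>?U\<^esub> y = z [^]\<^bsub>?U\<^esub> l \<longleftrightarrow> \<sigma> x = \<sigma> y * \<sigma> z ^ l" .
    qed
    also have "\<dots> \<longleftrightarrow> (\<exists>z\<in>?V. \<sigma> x = \<sigma> y * z ^ l)" unfolding UV[symmetric] by simp
    also have "\<dots> \<longleftrightarrow> (\<sigma> x, \<sigma> y) \<in> power_equiv l ?V" using V by (simp add: power_equiv_def)
    finally show ?thesis using eq_equiv_class_iff[OF C.power_equiv_units V] by simp
  qed
  have img: "?V // power_equiv l ?V = (\<lambda>x. power_equiv l ?V `` {\<sigma> x}) ` carrier ?U"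
    unfolding quotient_def UV[symmetric] by blast
  have "finite (?V // power_equiv l ?V)" using C.finite_units_quotient prime_gt_0_nat[OF l] by blast
  moreover have "finite (carrier (?U Mod ?P)) \<longleftrightarrow> finite (?V // power_equiv l ?V)"
    unfolding carrier_FactGroup img by (rule image_eq_iff_bij(1)) (rule eq)
  ultimately have fin: "finite (carrier (?U Mod ?P))" by simp
  have "card (carrier (?U Mod ?P)) = card (?V // power_equiv l ?V)"
    unfolding carrier_FactGroup img by (rule image_eq_iff_bij(2)) (rule eq)
  then show ?thesis using U.power_group_rank[OF l fin] by simp
qed

end

section \<open>Fractional ideals and the class group under the embedding\<close>

context embedded_field
begin

lemma image_ideal_prod:
  assumes "I \<subseteq> carrier L" "J \<subseteq> carrier L"
  shows "ideal_prod L I J \<subseteq> carrier L" "\<sigma> ` ideal_prod L I J = imul (\<sigma> ` I) (\<sigma> ` J)"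
proof -
  have *: "x \<in> carrier L \<and> \<sigma> x \<in> imul (\<sigma> ` I) (\<sigma> ` J)" if "x \<in> ideal_prod L I J" for x
    using that
  proof induction
    case (prod i j)
    then have "i \<in> carrier L" "j \<in> carrier L" using assms by auto
    then show ?case using prod imul.prod[of "\<sigma> i" "\<sigma> ` I" "\<sigma> j" "\<sigma> ` J"] by (simp add: hom_simps)
  qed (auto simp: hom_simps intro: imul.sum)
  show "ideal_prod L I J \<subseteq> carrier L" using * by blast
  have "z \<in> \<sigma> ` ideal_prod L I J" if "z \<in> imul (\<sigma> ` I) (\<sigma> ` J)" for z
    using that
  proof induction
    case (prod i j)
    then obtain x y where xy: "x \<in> I" "y \<in> J" "i = \<sigma> x" "j = \<sigma> y" by blast
    then have "x \<in> carrier L" "y \<in> carrier L" using assms by auto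
    then have "i * j = \<sigma> (x \<otimes> y)" using xy(3,4) by (simp add: hom_simps(2))
    then show ?case using ideal_prod.prod[OF xy(1,2)] by blast
  next
    case (sum u v)
    then obtain x y where xy: "x \<in> ideal_prod L I J" "y \<in> ideal_prod L I J" "u = \<sigma> x" "v = \<sigma> y" by blast
    then have "u + v = \<sigma> (x \<oplus> y)" using * hom_simps(1)[of x y] by auto
    then show ?case using ideal_prod.sum[OF xy(1,2)] by blast
  qed
  then show "\<sigma> ` ideal_prod L I J = imul (\<sigma> ` I) (\<sigma> ` J)" using * by blast
qed

lemma image_omodule:
  assumes I: "I \<subseteq> carrier L"
  shows "omodule (\<sigma> ` carrier L) (\<sigma> ` I) \<longleftrightarrow>
    \<zero> \<in> I \<and> (\<forall>x\<in>I. \<forall>y\<in>I. x \<oplus> y \<in> I) \<and> (\<forall>a\<in>\<O>. \<forall>x\<in>I. a \<otimes> x \<in> I)"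
proof -
  have "0 \<in> \<sigma> ` I \<longleftrightarrow> \<zero> \<in> I" using image_mem_iff[OF I zero_closed] hom_simps(4) by simp
  moreover have "\<sigma> x + \<sigma> y \<in> \<sigma> ` I \<longleftrightarrow> x \<oplus> y \<in> I" if "x \<in> I" "y \<in> I" for x y
  proof -
    have "x \<in> carrier L" "y \<in> carrier L" using I that by auto
    then show ?thesis using image_mem_iff[OF I, of "x \<oplus> y"] hom_simps(1) by simp
  qed
  moreover have "\<sigma> a * \<sigma> x \<in> \<sigma> ` I \<longleftrightarrow> a \<otimes> x \<in> I" if "a \<in> \<O>" "x \<in> I" for a x
  proof -
    have "x \<in> carrier L" "a \<in> carrier L" using I integers_subset that by auto
    then show ?thesis using image_mem_iff[OF I, of "a \<otimes> x"] hom_simps(2) by simp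
  qed
  ultimately show ?thesis unfolding omodule_def image_integers[symmetric] by simp
qed

lemma image_zero_iff: "I \<subseteq> carrier L \<Longrightarrow> \<sigma> ` I = {0} \<longleftrightarrow> I = {\<zero>}"
  using image_eq_iff[of I "{\<zero>}"] hom_simps(4) by simp

lemma fractional_ideal_iff:
  "I \<in> fractional_ideals L \<longleftrightarrow> I \<subseteq> carrier L \<and> \<sigma> ` I \<in> fideals (\<sigma> ` carrier L)"
proof (cases "I \<subseteq> carrier L")
  case True
  have "(\<exists>d\<in>\<O> - {\<zero>}. \<forall>x\<in>I. d \<otimes> x \<in> \<O>) \<longleftrightarrow>
    (\<exists>d\<in>oint (\<sigma> ` carrier L) - {0}. \<forall>x\<in>\<sigma> ` I. d * x \<in> oint (\<sigma> ` carrier L))" (is "?l \<longleftrightarrow> ?r")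
  proof -
    have "oint (\<sigma> ` carrier L) - {0} = \<sigma> ` (\<O> - {\<zero>})"
      unfolding image_integers[symmetric] using integers_subset hom_simps(4,6) by auto
    then have "?r \<longleftrightarrow> (\<exists>d\<in>\<O> - {\<zero>}. \<forall>x\<in>I. \<sigma> d * \<sigma> x \<in> oint (\<sigma> ` carrier L))" by simp
    also have "\<dots> \<longleftrightarrow> ?l"
    proof (intro bex_cong ball_cong refl)
      fix d x assume "d \<in> \<O> - {\<zero>}" "x \<in> I"
      then have "d \<in> carrier L" "x \<in> carrier L" using True integers_subset by auto
      then show "\<sigma> d * \<sigma> x \<in> oint (\<sigma> ` carrier L) \<longleftrightarrow> d \<otimes> x \<in> \<O>"
        using integer_iff[of "d \<otimes> x"] hom_simps(2) by simp
    qed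
    finally show ?thesis by blast
  qed
  moreover have "additive_subgroup I L \<and> (\<forall>a\<in>\<O>. \<forall>x\<in>I. a \<otimes> x \<in> I) \<longleftrightarrow> omodule (\<sigma> ` carrier L) (\<sigma> ` I)"
    unfolding image_omodule[OF True]
  proof (intro iffI conjI; (elim conjE)?)
    assume "additive_subgroup I L"
    then interpret additive_subgroup I L .
    show "\<zero> \<in> I" "\<forall>x\<in>I. \<forall>y\<in>I. x \<oplus> y \<in> I" using a_closed by auto
  next
    assume "\<zero> \<in> I" "\<forall>x\<in>I. \<forall>y\<in>I. x \<oplus> y \<in> I" "\<forall>a\<in>\<O>. \<forall>x\<in>I. a \<otimes> x \<in> I"
    then show "additive_subgroup I L"
      using integers_closed(5)[OF integers_closed(1)] by (intro additive_subgroup_criterion True) auto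
  qed
  moreover have "\<sigma> ` I \<subseteq> \<sigma> ` carrier L" using True by blast
  ultimately show ?thesis
    unfolding fractional_ideals_def fideals_def using image_zero_iff[OF True] True by auto
next
  case False
  then show ?thesis unfolding fractional_ideals_def using additive_subgroup.a_subset by blast
qed

lemma fractional_ideal_subset: "I \<in> fractional_ideals L \<Longrightarrow> I \<subseteq> carrier L"
  using fractional_ideal_iff by blast

lemma image_fractional_ideals: "(`) \<sigma> ` fractional_ideals L = fideals (\<sigma> ` carrier L)"
proof (intro antisym subsetI)
  fix J assume J: "J \<in> fideals (\<sigma> ` carrier L)"
  then obtain I where "I \<subseteq> carrier L" "\<sigma> ` I = J" using preimage[OF C.fidealsD(2)[OF J]] by blast
  then show "J \<in> (`) \<sigma> ` fractional_ideals L" using J fractional_ideal_iff by blast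
qed (use fractional_ideal_iff in blast)

lemma fractional_ideal_inj: "inj_on ((`) \<sigma>) (fractional_ideals L)"
  using image_eq_iff fractional_ideal_subset by (intro inj_onI) blast

lemma fractional_ideal_group_simps:
  "carrier (fractional_ideal_group L) = fractional_ideals L"
  "I \<otimes>\<^bsub>fractional_ideal_group L\<^esub> J = ideal_prod L I J"
  "\<one>\<^bsub>fractional_ideal_group L\<^esub> = \<O>"
  by (simp_all add: fractional_ideal_group_def)

lemma fractional_ideal_mult:
  assumes "I \<in> fractional_ideals L" "J \<in> fractional_ideals L"
  shows "ideal_prod L I J \<in> fractional_ideals L" "\<sigma> ` ideal_prod L I J = imul (\<sigma> ` I) (\<sigma> ` J)"
  using assms image_ideal_prod[of I J] C.imul_fideal unfolding fractional_ideal_iff by auto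

sublocale fractional_ideals: comm_group "fractional_ideal_group L"
proof (rule comm_group_pullback[OF C.ideals.comm_group_axioms, of "(`) \<sigma>"])
  show "\<one>\<^bsub>fractional_ideal_group L\<^esub> \<in> carrier (fractional_ideal_group L)"
    using integers_subset C.oint_fideal by (simp add: fractional_ideal_group_simps fractional_ideal_iff image_integers)
qed (use fractional_ideal_inj image_fractional_ideals fractional_ideal_mult in
    \<open>simp_all add: fractional_ideal_group_simps C.ideals_simps image_integers\<close>)

lemma fractional_ideal_pow:
  assumes "I \<in> fractional_ideals L"
  shows "\<sigma> ` (I [^]\<^bsub>fractional_ideal_group L\<^esub> n) = C.ipow (\<sigma> ` I) n"
proof (induction n)
  case (Suc n)
  have "I [^]\<^bsub>fractional_ideal_group L\<^esub> n \<in> fractional_ideals L"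
    using fractional_ideals.nat_pow_closed assms by (simp add: fractional_ideal_group_simps)
  then show ?case using Suc fractional_ideal_mult(2)[OF _ assms]
    by (simp add: fractional_ideals.nat_pow_Suc fractional_ideal_group_simps imul_commute)
qed (simp add: fractional_ideal_group_simps image_integers)

lemma principal_iff:
  assumes "I \<in> fractional_ideals L"
  shows "I \<in> principal_fractional_ideals L \<longleftrightarrow>
    (\<exists>z\<in>\<sigma> ` carrier L - {0}. \<sigma> ` I = smul z (oint (\<sigma> ` carrier L)))"
proof -
  have K: "\<sigma> ` carrier L - {0} = \<sigma> ` (carrier L - {\<zero>})" using hom_simps(4,6) by auto
  have img: "\<sigma> ` ((\<lambda>a. a \<otimes> x) ` \<O>) = smul (\<sigma> x) (oint (\<sigma> ` carrier L))" if "x \<in> carrier L" for x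
  proof -
    have "\<sigma> (a \<otimes> x) = \<sigma> x * \<sigma> a" if "a \<in> \<O>" for a
      using hom_simps(2)[of a x] integers_subset \<open>x \<in> carrier L\<close> that by auto
    then show ?thesis unfolding image_integers[symmetric] by (simp add: image_image)
  qed
  have sub: "(\<lambda>a. a \<otimes> x) ` \<O> \<subseteq> carrier L" if "x \<in> carrier L" for x
    using integers_subset that by auto
  have "I \<in> principal_fractional_ideals L \<longleftrightarrow> (\<exists>x\<in>carrier L - {\<zero>}. I = (\<lambda>a. a \<otimes> x) ` \<O>)"
    unfolding principal_fractional_ideals_def by blast
  also have "\<dots> \<longleftrightarrow> (\<exists>x\<in>carrier L - {\<zero>}. \<sigma> ` I = smul (\<sigma> x) (oint (\<sigma> ` carrier L)))"
    using image_eq_iff[OF fractional_ideal_subset[OF assms] sub] img by (intro bex_cong refl) auto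
  also have "\<dots> \<longleftrightarrow> (\<exists>z\<in>\<sigma> ` (carrier L - {\<zero>}). \<sigma> ` I = smul z (oint (\<sigma> ` carrier L)))" by simp
  finally show ?thesis unfolding K .
qed

lemma principal_subset: "principal_fractional_ideals L \<subseteq> fractional_ideals L"
proof
  fix I assume "I \<in> principal_fractional_ideals L"
  then obtain x where x: "x \<in> carrier L" "x \<noteq> \<zero>" "I = (\<lambda>a. a \<otimes> x) ` \<O>"
    unfolding principal_fractional_ideals_def by blast
  have "\<sigma> (a \<otimes> x) = \<sigma> x * \<sigma> a" if "a \<in> \<O>" for a
    using hom_simps(2)[of a x] integers_subset x(1) that by auto
  then have "\<sigma> ` I = smul (\<sigma> x) (oint (\<sigma> ` carrier L))"
    unfolding image_integers[symmetric] x(3) by (simp add: image_image)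
  moreover have "\<sigma> x \<in> \<sigma> ` carrier L" "\<sigma> x \<noteq> 0" using x(1,2) hom_simps(6) by auto
  ultimately have "\<sigma> ` I \<in> fideals (\<sigma> ` carrier L)" using C.smul_oint_fideal by metis
  moreover have "I \<subseteq> carrier L" using integers_subset x by auto
  ultimately show "I \<in> fractional_ideals L" using fractional_ideal_iff by blast
qed

text \<open>Multiplying by \<open>J\<close> and cancelling removes the inverse, so that the cosets
  of principal ideals become the classes of \<open>class_equiv\<close>.\<close>

lemma principal_quotient_iff:
  assumes I: "I \<in> fractional_ideals L" and J: "J \<in> fractional_ideals L"
  shows "I \<otimes>\<^bsub>fractional_ideal_group L\<^esub> inv\<^bsub>fractional_ideal_group L\<^esub> J \<in> principal_fractional_ideals L \<longleftrightarrow>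
    (\<exists>z\<in>\<sigma> ` carrier L - {0}. \<sigma> ` I = smul z (\<sigma> ` J))"
proof -
  let ?G = "fractional_ideal_group L" and ?O = "oint (\<sigma> ` carrier L)"
  have c: "I \<in> carrier ?G" "J \<in> carrier ?G" using I J by (simp_all add: fractional_ideal_group_simps)
  define Q where "Q = I \<otimes>\<^bsub>?G\<^esub> inv\<^bsub>?G\<^esub> J"
  have Q: "Q \<in> fractional_ideals L" using fractional_ideals.m_closed[OF c(1) fractional_ideals.inv_closed[OF c(2)]]
    by (simp add: Q_def fractional_ideal_group_simps)
  have "I = Q \<otimes>\<^bsub>?G\<^esub> J" unfolding Q_def using c by (simp add: fractional_ideals.m_assoc)
  then have I_eq: "\<sigma> ` I = imul (\<sigma> ` Q) (\<sigma> ` J)"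
    using fractional_ideal_mult(2)[OF Q J] by (simp add: fractional_ideal_group_simps)
  have f: "\<sigma> ` Q \<in> fideals (\<sigma> ` carrier L)" "\<sigma> ` J \<in> fideals (\<sigma> ` carrier L)" using Q J fractional_ideal_iff by auto
  have eq: "\<sigma> ` Q = smul z ?O \<longleftrightarrow> \<sigma> ` I = smul z (\<sigma> ` J)" if z: "z \<in> \<sigma> ` carrier L - {0}" for z
  proof -
    have s: "smul z ?O \<in> fideals (\<sigma> ` carrier L)" using C.smul_oint_fideal z by blast
    have "smul z (\<sigma> ` J) = imul (smul z ?O) (\<sigma> ` J)" by (rule C.smul_as_imul[OF f(2)])
    then show ?thesis unfolding I_eq
      using C.imul_cancel[OF f(2) f(1) s] by (metis imul_commute)
  qed
  show ?thesis unfolding Q_def[symmetric] principal_iff[OF Q]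
  proof (rule bex_cong[OF refl])
    fix z assume "z \<in> \<sigma> ` carrier L - {0}"
    then show "\<sigma> ` Q = smul z ?O \<longleftrightarrow> \<sigma> ` I = smul z (\<sigma> ` J)" by (rule eq)
  qed
qed

lemma principal_subgroup: "subgroup (principal_fractional_ideals L) (fractional_ideal_group L)"
proof (rule fractional_ideals.subgroupI)
  let ?G = "fractional_ideal_group L"
  note one = fractional_ideals.one_closed[unfolded fractional_ideal_group_simps]
  have P_iff: "I \<in> principal_fractional_ideals L \<longleftrightarrow> (\<exists>z\<in>\<sigma> ` carrier L - {0}. \<sigma> ` I = smul z (\<sigma> ` \<O>))"
    if "I \<in> fractional_ideals L" for I
    using principal_iff[OF that] by (simp only: image_integers)
  show "principal_fractional_ideals L \<subseteq> carrier ?G" using principal_subset by (simp add: fractional_ideal_group_simps)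
  show "principal_fractional_ideals L \<noteq> {}"
    unfolding principal_fractional_ideals_def using one_closed one_not_zero by blast
  fix I assume I: "I \<in> principal_fractional_ideals L"
  then have I': "I \<in> fractional_ideals L" using principal_subset by blast
  obtain z where z: "z \<in> \<sigma> ` carrier L - {0}" "\<sigma> ` I = smul z (\<sigma> ` \<O>)" using I P_iff[OF I'] by blast
  have "\<sigma> ` \<O> = smul (inverse z) (\<sigma> ` I)" using smul_inverse[of z "\<sigma> ` \<O>" "\<sigma> ` I"] z by simp
  then have "\<O> \<otimes>\<^bsub>?G\<^esub> inv\<^bsub>?G\<^esub> I \<in> principal_fractional_ideals L"
    unfolding principal_quotient_iff[OF one I'] using z(1) C.inverse_mem[of z] by (intro bexI[of _ "inverse z"]) auto
  moreover have "I \<in> carrier ?G" using I' by (simp add: fractional_ideal_group_simps(1))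
  ultimately show "inv\<^bsub>?G\<^esub> I \<in> principal_fractional_ideals L"
    using fractional_ideals.l_one[OF fractional_ideals.inv_closed] by (metis fractional_ideal_group_simps(3))
  fix J assume J: "J \<in> principal_fractional_ideals L"
  then have J': "J \<in> fractional_ideals L" using principal_subset by blast
  obtain w where w: "w \<in> \<sigma> ` carrier L - {0}" "\<sigma> ` J = smul w (\<sigma> ` \<O>)" using J P_iff[OF J'] by blast
  have oo: "imul (\<sigma> ` \<O>) (\<sigma> ` \<O>) = \<sigma> ` \<O>" unfolding image_integers using C.imul_oint[OF C.omodule_oint] .
  have "\<sigma> ` ideal_prod L I J = smul (z * w) (\<sigma> ` \<O>)"
  proof -
    have "\<sigma> ` ideal_prod L I J = smul z (imul (\<sigma> ` \<O>) (smul w (\<sigma> ` \<O>)))"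
      unfolding fractional_ideal_mult(2)[OF I' J'] z(2) w(2) by (rule smul_imul)
    also have "\<dots> = smul z (smul w (imul (\<sigma> ` \<O>) (\<sigma> ` \<O>)))"
      by (simp only: smul_imul[of w "\<sigma> ` \<O>" "\<sigma> ` \<O>"] imul_commute[of "\<sigma> ` \<O>" "smul w (\<sigma> ` \<O>)"])
    finally show ?thesis unfolding oo smul_smul .
  qed
  moreover have "z * w \<in> \<sigma> ` carrier L - {0}" using z w C.mult_mem by auto
  ultimately show "I \<otimes>\<^bsub>?G\<^esub> J \<in> principal_fractional_ideals L"
    unfolding fractional_ideal_group_simps P_iff[OF fractional_ideal_mult(1)[OF I' J']] by blast
qed

text \<open>The rank refers to the quotient by \<open>l\<close>-th powers, the counting argument to
  the \<open>l\<close>-torsion. Both have the same size because the class group is finite, and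
  torsion classes then correspond to classes of complex ideals.\<close>

lemma class_group_rank:
  assumes l: "prime l"
  shows "l ^ group_rank l (class_group L) = card (C.class_torsion l // C.class_equiv)"
proof -
  let ?G = "fractional_ideal_group L" and ?P = "principal_fractional_ideals L"
  interpret N: normal ?P ?G using fractional_ideals.subgroup_imp_normal[OF principal_subgroup] .
  interpret A: comm_group "class_group L"
    unfolding class_group_def using fractional_ideals.abelian_FactGroup[OF principal_subgroup] .
  have eq: "?P #>\<^bsub>?G\<^esub> I = ?P #>\<^bsub>?G\<^esub> J \<longleftrightarrow> C.class_equiv `` {\<sigma> ` I} = C.class_equiv `` {\<sigma> ` J}"
    if "I \<in> carrier ?G" "J \<in> carrier ?G" for I J
  proof -
    have IJ: "I \<in> fractional_ideals L" "J \<in> fractional_ideals L" using that by (simp_all add: fractional_ideal_group_simps)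
    have f: "\<sigma> ` I \<in> fideals (\<sigma> ` carrier L)" "\<sigma> ` J \<in> fideals (\<sigma> ` carrier L)" using IJ fractional_ideal_iff by auto
    have "(\<sigma> ` I, \<sigma> ` J) \<in> C.class_equiv \<longleftrightarrow> (\<exists>z\<in>\<sigma> ` carrier L - {0}. \<sigma> ` I = smul z (\<sigma> ` J))"
      using f by (simp add: C.class_equiv_def)
    then show ?thesis
      using fractional_ideals.rcos_eq_iff[OF principal_subgroup that] principal_quotient_iff[OF IJ]
        eq_equiv_class_iff[OF C.class_equiv_equiv f] by simp
  qed
  have fid: "fideals (\<sigma> ` carrier L) = (`) \<sigma> ` carrier ?G"
    using image_fractional_ideals by (simp add: fractional_ideal_group_simps)
  \<comment> \<open>Every ideal is 0-torsion, so this case is the finiteness of the whole class group.\<close>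
  have "C.class_torsion 0 = fideals (\<sigma> ` carrier L)"
    unfolding C.class_torsion_def using C.one_mem by (auto intro!: bexI[of _ 1])
  then have "finite (fideals (\<sigma> ` carrier L) // C.class_equiv)" using C.finite_class_torsion_quotient[of 0] by simp
  moreover have "fideals (\<sigma> ` carrier L) // C.class_equiv = (\<lambda>I. C.class_equiv `` {\<sigma> ` I}) ` carrier ?G"
    unfolding quotient_def fid by blast
  moreover have "finite ((\<lambda>I. ?P #>\<^bsub>?G\<^esub> I) ` carrier ?G) \<longleftrightarrow> finite ((\<lambda>I. C.class_equiv `` {\<sigma> ` I}) ` carrier ?G)"
    by (rule image_eq_iff_bij(1)) (rule eq)
  ultimately have fin: "finite (carrier (class_group L))"
    unfolding class_group_def carrier_FactGroup by simp
  define S where "S = {I \<in> carrier ?G. I [^]\<^bsub>?G\<^esub> l \<in> ?P}"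
  have tor: "{x \<in> carrier (class_group L). x [^]\<^bsub>class_group L\<^esub> l = \<one>\<^bsub>class_group L\<^esub>} = (\<lambda>I. ?P #>\<^bsub>?G\<^esub> I) ` S"
  proof -
    have "(?P #>\<^bsub>?G\<^esub> I) [^]\<^bsub>class_group L\<^esub> l = \<one>\<^bsub>class_group L\<^esub> \<longleftrightarrow> I [^]\<^bsub>?G\<^esub> l \<in> ?P" if I: "I \<in> carrier ?G" for I
    proof -
      have "(?P #>\<^bsub>?G\<^esub> I) [^]\<^bsub>class_group L\<^esub> l = ?P #>\<^bsub>?G\<^esub> (I [^]\<^bsub>?G\<^esub> l)"
        unfolding class_group_def using N.FactGroup_pow[OF I] by simp
      moreover have "?P #>\<^bsub>?G\<^esub> (I [^]\<^bsub>?G\<^esub> l) = ?P \<longleftrightarrow> I [^]\<^bsub>?G\<^esub> l \<in> ?P"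
        using fractional_ideals.coset_join1[of ?P "I [^]\<^bsub>?G\<^esub> l"] fractional_ideals.coset_join2[of "I [^]\<^bsub>?G\<^esub> l" ?P]
          principal_subgroup I subgroup.subset[OF principal_subgroup] by auto
      ultimately show ?thesis by (simp add: class_group_def)
    qed
    then show ?thesis unfolding S_def class_group_def carrier_FactGroup by auto
  qed
  have tor': "C.class_torsion l = (`) \<sigma> ` S"
  proof -
    have iff: "I [^]\<^bsub>?G\<^esub> l \<in> ?P \<longleftrightarrow> (\<exists>z\<in>\<sigma> ` carrier L - {0}. C.ipow (\<sigma> ` I) l = smul z (oint (\<sigma> ` carrier L)))"
      if "I \<in> carrier ?G" for I
      using principal_iff[of "I [^]\<^bsub>?G\<^esub> l"] fractional_ideals.nat_pow_closed[OF that, of l] fractional_ideal_pow[of I l] that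
      by (simp add: fractional_ideal_group_simps(1))
    show ?thesis unfolding C.class_torsion_def S_def fid using iff by blast
  qed
  have cls: "C.class_torsion l // C.class_equiv = (\<lambda>I. C.class_equiv `` {\<sigma> ` I}) ` S"
    unfolding quotient_def tor' by blast
  have "card ((\<lambda>I. ?P #>\<^bsub>?G\<^esub> I) ` S) = card ((\<lambda>I. C.class_equiv `` {\<sigma> ` I}) ` S)"
    by (rule image_eq_iff_bij(2)) (use eq in \<open>auto simp: S_def\<close>)
  moreover have "finite (carrier (class_group L Mod power_subgroup l (class_group L)))"
    unfolding carrier_FactGroup using fin by simp
  ultimately show ?thesis
    using A.power_group_rank[OF l] A.card_Mod_power_subgroup_finite[OF fin, of l] tor cls by simp
qed

end

lemma count_list_map_inj_on:
  assumes "inj_on f A" "set xs \<subseteq> A" "x \<in> A"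
  shows "count_list (map f xs) (f x) = count_list xs x"
  using assms(2)
proof (induction xs)
  case (Cons y xs)
  then have "f y = f x \<longleftrightarrow> y = x" using inj_on_eq_iff[OF assms(1)] assms(3) by simp
  then show ?case using Cons by simp
qed simp

section \<open>Primes, ramification indices and Galois extensions under the embedding\<close>

context embedded_field
begin

lemma nonzero_prime_iff:
  "P \<in> nonzero_primes (ring_of_integers L) \<longleftrightarrow> P \<subseteq> \<O> \<and> \<sigma> ` P \<in> prime_ideals (\<sigma> ` carrier L)"
proof
  interpret R: domain "ring_of_integers L" by (rule ring_of_integers_domain)
  assume "P \<in> nonzero_primes (ring_of_integers L)"
  then have P: "primeideal P (ring_of_integers L)" "P \<noteq> {\<zero>}"
    by (simp_all add: nonzero_primes_def ring_of_integers_simps)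
  interpret P: primeideal P "ring_of_integers L" by (rule P(1))
  have sub: "P \<subseteq> \<O>" by (rule P.a_subset)
  then have subL: "P \<subseteq> carrier L" using integers_subset by blast
  have zero: "\<zero> \<in> P" using P.zero_closed by (simp add: ring_of_integers_simps)
  have "omodule (\<sigma> ` carrier L) (\<sigma> ` P)"
    unfolding image_omodule[OF subL] using zero P.a_closed P.I_l_closed by (simp add: ring_of_integers_simps)
  moreover have img: "\<sigma> ` P \<subseteq> oint (\<sigma> ` carrier L)" unfolding image_integers[symmetric] using sub by blast
  moreover obtain x where "x \<in> P" "x \<noteq> \<zero>" using P(2) zero by blast
  ultimately have "\<sigma> ` P \<in> fideals (\<sigma> ` carrier L)"
    using C.integral_fideal[of "\<sigma> ` P" "\<sigma> x"] hom_simps(6)[of x] subL by blast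
  moreover have "1 \<notin> \<sigma> ` P"
  proof
    assume "1 \<in> \<sigma> ` P"
    then have "\<one> \<in> P" using image_mem_iff[OF subL one_closed] hom_simps(3) by simp
    then show False using P.one_imp_carrier P.I_notcarr by (simp add: ring_of_integers_simps)
  qed
  moreover have "x \<in> \<sigma> ` P \<or> y \<in> \<sigma> ` P"
    if xy: "x \<in> oint (\<sigma> ` carrier L)" "y \<in> oint (\<sigma> ` carrier L)" "x * y \<in> \<sigma> ` P" for x y
  proof -
    obtain a b where ab: "a \<in> \<O>" "x = \<sigma> a" "b \<in> \<O>" "y = \<sigma> b"
      using xy(1,2) unfolding image_integers[symmetric] by blast
    have c: "a \<in> carrier L" "b \<in> carrier L" using ab integers_subset by auto
    have "a \<otimes> b \<in> P" using xy(3) image_mem_iff[OF subL, of "a \<otimes> b"] hom_simps(2)[OF c] ab c by simp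
    then have "a \<in> P \<or> b \<in> P" using P.I_prime[OF ab(1,3)] by (simp add: ring_of_integers_simps)
    then show ?thesis using ab by blast
  qed
  ultimately have "\<sigma> ` P \<in> prime_ideals (\<sigma> ` carrier L)" using img unfolding prime_ideals_def by blast
  then show "P \<subseteq> \<O> \<and> \<sigma> ` P \<in> prime_ideals (\<sigma> ` carrier L)" using sub by blast
next
  interpret R: domain "ring_of_integers L" by (rule ring_of_integers_domain)
  assume "P \<subseteq> \<O> \<and> \<sigma> ` P \<in> prime_ideals (\<sigma> ` carrier L)"
  then have sub: "P \<subseteq> \<O>" and P: "\<sigma> ` P \<in> fideals (\<sigma> ` carrier L)" "1 \<notin> \<sigma> ` P"
    "\<And>x y. x \<in> oint (\<sigma> ` carrier L) \<Longrightarrow> y \<in> oint (\<sigma> ` carrier L) \<Longrightarrow> x * y \<in> \<sigma> ` P \<Longrightarrow> x \<in> \<sigma> ` P \<or> y \<in> \<sigma> ` P"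
    unfolding prime_ideals_def by blast+
  have subL: "P \<subseteq> carrier L" using sub integers_subset by blast
  have om: "\<zero> \<in> P" "\<And>x y. x \<in> P \<Longrightarrow> y \<in> P \<Longrightarrow> x \<oplus> y \<in> P" "\<And>a x. a \<in> \<O> \<Longrightarrow> x \<in> P \<Longrightarrow> a \<otimes> x \<in> P"
    using C.fidealsD(1)[OF P(1)] unfolding image_omodule[OF subL] by blast+
  have "primeideal P (ring_of_integers L)"
  proof (rule primeidealI2)
    show "additive_subgroup P (ring_of_integers L)"
    proof (rule R.additive_subgroup_criterion[OF sub])
      show "\<ominus>\<^bsub>ring_of_integers L\<^esub> \<one>\<^bsub>ring_of_integers L\<^esub> \<otimes>\<^bsub>ring_of_integers L\<^esub> x \<in> P" if "x \<in> P" for x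
        using om(3)[OF R.a_inv_closed[OF R.one_closed] that] by (simp only: ring_of_integers_simps)
    qed (use om in \<open>simp_all add: ring_of_integers_simps\<close>)
    show "cring (ring_of_integers L)" by (rule R.is_cring)
    fix a x assume ax: "a \<in> P" "x \<in> \<O>"
    show "x \<otimes>\<^bsub>ring_of_integers L\<^esub> a \<in> P" using om(3) ax by (simp add: ring_of_integers_simps)
    moreover have "a \<in> \<O>" using ax(1) sub by blast
    ultimately show "a \<otimes>\<^bsub>ring_of_integers L\<^esub> x \<in> P" using R.m_comm[OF _ ax(2)] by simp
  next
    show "\<O> \<noteq> P" using P(2) integers_closed(1) hom_simps(3) by force
    fix a b assume ab: "a \<in> \<O>" "b \<in> \<O>" "a \<otimes>\<^bsub>ring_of_integers L\<^esub> b \<in> P"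
    have c: "a \<in> carrier L" "b \<in> carrier L" using ab integers_subset by auto
    have "\<sigma> a * \<sigma> b \<in> \<sigma> ` P" using ab(3) hom_simps(2)[OF c] by (simp only: ring_of_integers_simps) (metis imageI)
    then have "\<sigma> a \<in> \<sigma> ` P \<or> \<sigma> b \<in> \<sigma> ` P" using P(3) integer_iff ab c by blast
    then show "a \<in> P \<or> b \<in> P" using image_mem_iff[OF subL] c by blast
  qed
  moreover have "P \<noteq> {\<zero>}" using C.fidealsD(3)[OF P(1)] hom_simps(4) by auto
  ultimately show "P \<in> nonzero_primes (ring_of_integers L)"
    by (simp add: nonzero_primes_def ring_of_integers_simps)
qed

lemma nonzero_primes_subset: "P \<in> nonzero_primes (ring_of_integers L) \<Longrightarrow> P \<subseteq> carrier L"
  using nonzero_prime_iff integers_subset by blast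

lemma ideal_prod_integers: "ideal_prod (ring_of_integers L) = ideal_prod L"
proof -
  have 1: "x \<in> ideal_prod L I J" if "x \<in> ideal_prod (ring_of_integers L) I J" for x I J
    using that by induction (auto simp: ring_of_integers_simps intro: ideal_prod.intros)
  have 2: "x \<in> ideal_prod (ring_of_integers L) I J" if "x \<in> ideal_prod L I J" for x I J
    using that
  proof induction
    case (prod i j)
    then show ?case using ideal_prod.prod[of i I j J "ring_of_integers L"] by (simp add: ring_of_integers_simps)
  next
    case (sum x y)
    then show ?case using ideal_prod.sum[of x "ring_of_integers L" I J y] by (simp add: ring_of_integers_simps)
  qed
  have "ideal_prod (ring_of_integers L) I J = ideal_prod L I J" for I J using 1 2 by blast
  then show ?thesis by (intro ext)
qed

lemma image_foldr_ideal_prod: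
  assumes "\<And>P. P \<in> set Ps \<Longrightarrow> P \<subseteq> carrier L"
  shows "foldr (ideal_prod (ring_of_integers L)) Ps \<O> \<subseteq> carrier L"
    "\<sigma> ` foldr (ideal_prod (ring_of_integers L)) Ps \<O> = C.iprod (map ((`) \<sigma>) Ps)"
proof -
  have "foldr (ideal_prod (ring_of_integers L)) Ps \<O> \<subseteq> carrier L \<and>
    \<sigma> ` foldr (ideal_prod (ring_of_integers L)) Ps \<O> = C.iprod (map ((`) \<sigma>) Ps)"
    using assms
  proof (induction Ps)
    case (Cons P Ps)
    then have "P \<subseteq> carrier L" "foldr (ideal_prod (ring_of_integers L)) Ps \<O> \<subseteq> carrier L"
      "\<sigma> ` foldr (ideal_prod (ring_of_integers L)) Ps \<O> = C.iprod (map ((`) \<sigma>) Ps)" by auto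
    then show ?case using image_ideal_prod[of P "foldr (ideal_prod (ring_of_integers L)) Ps \<O>"]
      by (simp add: ideal_prod_integers)
  qed (simp add: integers_subset image_integers)
  then show "foldr (ideal_prod (ring_of_integers L)) Ps \<O> \<subseteq> carrier L"
    "\<sigma> ` foldr (ideal_prod (ring_of_integers L)) Ps \<O> = C.iprod (map ((`) \<sigma>) Ps)" by blast+
qed

text \<open>The preimage of the complex product is an ideal that contains \<open>p\<close>, so
  minimality of the generated ideal gives one inclusion; conversely that ideal contains the products
  of elements of \<open>p\<close> with integers.\<close>

lemma image_genideal:
  assumes p: "p \<subseteq> \<O>" and om: "omodule (\<sigma> ` carrier L) (imul (\<sigma> ` p) (oint (\<sigma> ` carrier L)))"
  shows "genideal (ring_of_integers L) p \<subseteq> carrier L"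
    "\<sigma> ` genideal (ring_of_integers L) p = imul (\<sigma> ` p) (oint (\<sigma> ` carrier L))"
proof -
  interpret R: domain "ring_of_integers L" by (rule ring_of_integers_domain)
  let ?I = "genideal (ring_of_integers L) p"
  define J where "J = {x \<in> \<O>. \<sigma> x \<in> imul (\<sigma> ` p) (oint (\<sigma> ` carrier L))}"
  have JO: "J \<subseteq> \<O>" by (auto simp: J_def)
  have JL: "J \<subseteq> carrier L" using JO integers_subset by blast
  have pL: "p \<subseteq> carrier L" using p integers_subset by blast
  interpret I: ideal ?I "ring_of_integers L" by (rule R.genideal_ideal[OF p])
  have IL: "?I \<subseteq> carrier L" using I.a_subset integers_subset by blast
  then show "genideal (ring_of_integers L) p \<subseteq> carrier L" .
  have int: "imul (\<sigma> ` p) (oint (\<sigma> ` carrier L)) \<subseteq> oint (\<sigma> ` carrier L)"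
  proof (rule C.imul_integral_subset[OF C.omodule_oint])
    show "\<sigma> ` p \<subseteq> oint (\<sigma> ` carrier L)" unfolding image_integers[symmetric] using p by blast
  qed
  have J: "\<sigma> ` J = imul (\<sigma> ` p) (oint (\<sigma> ` carrier L))"
    using int unfolding J_def image_integers[symmetric] by blast
  have oJ: "\<zero> \<in> J" "\<And>x y. x \<in> J \<Longrightarrow> y \<in> J \<Longrightarrow> x \<oplus> y \<in> J" "\<And>a x. a \<in> \<O> \<Longrightarrow> x \<in> J \<Longrightarrow> a \<otimes> x \<in> J"
    using om unfolding J[symmetric] image_omodule[OF JL] by blast+
  have "ideal J (ring_of_integers L)"
  proof (rule idealI[OF R.ring_axioms])
    have "additive_subgroup J (ring_of_integers L)"
    proof (rule R.additive_subgroup_criterion)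
      show "\<ominus>\<^bsub>ring_of_integers L\<^esub> \<one>\<^bsub>ring_of_integers L\<^esub> \<otimes>\<^bsub>ring_of_integers L\<^esub> x \<in> J" if "x \<in> J" for x
        using oJ(3)[OF R.a_inv_closed[OF R.one_closed] that] by (simp only: ring_of_integers_simps)
      show "J \<subseteq> \<O>" by (rule JO)
      show "\<zero>\<^bsub>ring_of_integers L\<^esub> \<in> J" using oJ(1) by (simp only: ring_of_integers_simps)
      show "x \<oplus>\<^bsub>ring_of_integers L\<^esub> y \<in> J" if "x \<in> J" "y \<in> J" for x y
        using oJ(2)[OF that] by (simp only: ring_of_integers_simps)
    qed
    then show "subgroup J (add_monoid (ring_of_integers L))" by (rule additive_subgroup.a_subgroup)
    fix a x assume ax: "a \<in> J" "x \<in> \<O>"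
    show *: "x \<otimes>\<^bsub>ring_of_integers L\<^esub> a \<in> J" using oJ(3)[OF ax(2,1)] by (simp only: ring_of_integers_simps)
    have "a \<in> \<O>" using ax(1) JO by blast
    then show "a \<otimes>\<^bsub>ring_of_integers L\<^esub> x \<in> J" using * R.m_comm[OF _ ax(2), of a] by (simp only:)
  qed
  moreover have "p \<subseteq> J"
  proof
    fix x assume x: "x \<in> p"
    have "\<sigma> x * 1 \<in> imul (\<sigma> ` p) (oint (\<sigma> ` carrier L))" by (rule imul.prod) (use x C.oint_closed(2) in auto)
    then show "x \<in> J" using x p by (auto simp: J_def)
  qed
  ultimately have "?I \<subseteq> J" by (rule R.genideal_minimal)
  then have "\<sigma> ` ?I \<subseteq> imul (\<sigma> ` p) (oint (\<sigma> ` carrier L))" unfolding J[symmetric] by blast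
  moreover have "imul (\<sigma> ` p) (oint (\<sigma> ` carrier L)) \<subseteq> \<sigma> ` ?I"
  proof (rule imul_least)
    fix i j assume "i \<in> \<sigma> ` p" "j \<in> oint (\<sigma> ` carrier L)"
    then obtain a b where ab: "a \<in> p" "i = \<sigma> a" "b \<in> \<O>" "j = \<sigma> b" unfolding image_integers[symmetric] by blast
    then have "a \<in> ?I" using R.genideal_self[OF p] by blast
    then have "a \<otimes> b \<in> ?I" using I.I_r_closed[OF _ ab(3)] by (simp add: ring_of_integers_simps)
    moreover have "\<sigma> (a \<otimes> b) = i * j" using hom_simps(2)[of a b] ab pL integers_subset by auto
    ultimately show "i * j \<in> \<sigma> ` ?I" by (metis imageI)
  next
    fix x y assume "x \<in> \<sigma> ` ?I" "y \<in> \<sigma> ` ?I"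
    then obtain a b where ab: "a \<in> ?I" "x = \<sigma> a" "b \<in> ?I" "y = \<sigma> b" by blast
    then have "a \<oplus> b \<in> ?I" using I.a_closed by (simp add: ring_of_integers_simps)
    moreover have "\<sigma> (a \<oplus> b) = x + y" using hom_simps(1)[of a b] ab IL by auto
    ultimately show "x + y \<in> \<sigma> ` ?I" by (metis imageI)
  qed
  ultimately show "\<sigma> ` ?I = imul (\<sigma> ` p) (oint (\<sigma> ` carrier L))" by blast
qed

text \<open>Factorizations into nonzero primes correspond to those of the extended complex ideal,
  where existence and uniqueness are known; so the definite description denotes the common
  multiplicity.\<close>

lemma ramification_index_eq:
  assumes p: "p \<subseteq> \<O>" and I: "imul (\<sigma> ` p) (oint (\<sigma> ` carrier L)) \<in> fideals (\<sigma> ` carrier L)" and P: "P \<subseteq> carrier L"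
  shows "ramification_index L p P = C.val (\<sigma> ` P) (imul (\<sigma> ` p) (oint (\<sigma> ` carrier L)))"
proof -
  let ?I = "imul (\<sigma> ` p) (oint (\<sigma> ` carrier L))" and ?R = "ring_of_integers L"
  have int: "?I \<subseteq> oint (\<sigma> ` carrier L)"
  proof (rule C.imul_integral_subset[OF C.omodule_oint])
    show "\<sigma> ` p \<subseteq> oint (\<sigma> ` carrier L)" unfolding image_integers[symmetric] using p by blast
  qed
  note gen = image_genideal[OF p C.fidealsD(1)[OF I]]
  have char: "foldr (ideal_prod ?R) Ps \<O> = genideal ?R p \<longleftrightarrow> C.iprod (map ((`) \<sigma>) Ps) = ?I"
    if "set Ps \<subseteq> nonzero_primes ?R" for Ps
  proof -
    have sub: "Q \<subseteq> carrier L" if "Q \<in> set Ps" for Q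
      using that \<open>set Ps \<subseteq> nonzero_primes ?R\<close> nonzero_primes_subset by blast
    have f: "foldr (ideal_prod ?R) Ps \<O> \<subseteq> carrier L" "\<sigma> ` foldr (ideal_prod ?R) Ps \<O> = C.iprod (map ((`) \<sigma>) Ps)"
      by (rule image_foldr_ideal_prod, erule sub)+
    show ?thesis by (rule image_eq_iff[OF f(1) gen(1), unfolded f(2) gen(2), symmetric])
  qed
  have count: "count_list (map ((`) \<sigma>) Ps) (\<sigma> ` P) = count_list Ps P" if "set Ps \<subseteq> nonzero_primes ?R" for Ps
  proof (rule count_list_map_inj_on[of _ "Pow (carrier L)"])
    show "inj_on ((`) \<sigma>) (Pow (carrier L))" using image_eq_iff by (intro inj_onI) blast
    show "set Ps \<subseteq> Pow (carrier L)" using nonzero_primes_subset subsetD[OF that] by blast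
    show "P \<in> Pow (carrier L)" using P by simp
  qed
  have primes: "set (map ((`) \<sigma>) Ps) \<subseteq> prime_ideals (\<sigma> ` carrier L)" if "set Ps \<subseteq> nonzero_primes ?R" for Ps
    using that nonzero_prime_iff by auto
  obtain Qs where Qs: "set Qs \<subseteq> prime_ideals (\<sigma> ` carrier L)" "C.iprod Qs = ?I"
    using C.ex_prime_factorization[OF I int] by blast
  have "\<exists>Q'. Q' \<in> nonzero_primes ?R \<and> \<sigma> ` Q' = Q" if Q: "Q \<in> set Qs" for Q
  proof -
    have "Q \<in> prime_ideals (\<sigma> ` carrier L)" using Q Qs(1) by blast
    moreover from this have "Q \<subseteq> \<sigma> ` \<O>" unfolding image_integers prime_ideals_def by blast
    then obtain Q' where "Q' \<subseteq> \<O>" "\<sigma> ` Q' = Q" by (metis subset_imageE)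
    ultimately show ?thesis using nonzero_prime_iff by blast
  qed
  then obtain f where f: "\<And>Q. Q \<in> set Qs \<Longrightarrow> f Q \<in> nonzero_primes ?R" "\<And>Q. Q \<in> set Qs \<Longrightarrow> \<sigma> ` f Q = Q" by metis
  have map: "map ((`) \<sigma>) (map f Qs) = Qs" using f(2) by (simp add: map_idI)
  have set: "set (map f Qs) \<subseteq> nonzero_primes ?R" using f(1) by auto
  show ?thesis unfolding ramification_index_def
  proof (rule the_equality)
    have "foldr (ideal_prod ?R) (map f Qs) \<O> = genideal ?R p" unfolding char[OF set] map by (rule Qs(2))
    moreover have "C.val (\<sigma> ` P) ?I = count_list (map f Qs) P"
      using C.val_eq[OF Qs, of "\<sigma> ` P"] count[OF set] unfolding map by simp
    ultimately show "\<exists>Ps. set Ps \<subseteq> nonzero_primes ?R \<and> foldr (ideal_prod ?R) Ps \<O> = genideal ?R p \<and>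
      C.val (\<sigma> ` P) ?I = count_list Ps P" using set by blast
  next
    fix e assume "\<exists>Ps. set Ps \<subseteq> nonzero_primes ?R \<and> foldr (ideal_prod ?R) Ps \<O> = genideal ?R p \<and> e = count_list Ps P"
    then obtain Ps where Ps: "set Ps \<subseteq> nonzero_primes ?R" "foldr (ideal_prod ?R) Ps \<O> = genideal ?R p" "e = count_list Ps P" by blast
    then have "C.iprod (map ((`) \<sigma>) Ps) = ?I" using char by blast
    then show "e = C.val (\<sigma> ` P) ?I" using C.val_eq[OF primes[OF Ps(1)], of ?I "\<sigma> ` P"] count[OF Ps(1)] Ps(3) by simp
  qed
qed

lemma subfield_embedded:
  assumes E: "subfield E L"
  shows "embedded_field (L\<lparr>carrier := E\<rparr>) \<sigma>" "complex_number_field (\<sigma> ` E)"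
proof -
  note S = subringE[OF subfieldE(1)[OF E]]
  have "\<sigma> \<in> Ring.ring_hom (L\<lparr>carrier := E\<rparr>) complex_ring"
  proof (rule ring_hom_memI)
    fix x y assume "x \<in> carrier (L\<lparr>carrier := E\<rparr>)" "y \<in> carrier (L\<lparr>carrier := E\<rparr>)"
    then have "x \<in> carrier L" "y \<in> carrier L" using S(1) by auto
    then show "\<sigma> (x \<otimes>\<^bsub>L\<lparr>carrier := E\<rparr>\<^esub> y) = \<sigma> x \<otimes>\<^bsub>complex_ring\<^esub> \<sigma> y"
      "\<sigma> (x \<oplus>\<^bsub>L\<lparr>carrier := E\<rparr>\<^esub> y) = \<sigma> x \<oplus>\<^bsub>complex_ring\<^esub> \<sigma> y" by (simp_all add: hom_simps)
  qed (simp_all add: hom_simps)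
  note s = this
  note h = hom_complex_simps[OF E s]
  have "complex_subfield (\<sigma> ` E)"
  proof
    show "1 \<in> \<sigma> ` E" using S(3) h(3) by (metis imageI)
    fix x assume "x \<in> \<sigma> ` E"
    then obtain a where a: "a \<in> E" "x = \<sigma> a" by blast
    show "inverse x \<in> \<sigma> ` E"
    proof (cases "a = \<zero>")
      case True then show ?thesis using a h(4) by (metis imageI inverse_zero)
    next
      case False
      then have "inv a \<in> E" using subfield_m_inv(1)[OF E, of a] a by simp
      then show ?thesis using h(7)[OF a(1) False] a(2) by (metis imageI)
    qed
    fix y assume "y \<in> \<sigma> ` E"
    then obtain b where b: "b \<in> E" "y = \<sigma> b" by blast
    show "x * y \<in> \<sigma> ` E" using h(2)[OF a(1) b(1)] a b S(6) by (metis imageI)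
    have "x - y = \<sigma> (a \<oplus> \<ominus> b)" using h(1)[OF a(1) S(5)[OF b(1)]] h(5)[OF b(1)] a b by simp
    then show "x - y \<in> \<sigma> ` E" using a b S(5,7) by (metis imageI)
  qed
  then show nf: "complex_number_field (\<sigma> ` E)"
    using C.complex_number_field_subset S(1) by blast
  show "embedded_field (L\<lparr>carrier := E\<rparr>) \<sigma>"
    unfolding embedded_field_def embedded_field_axioms_def using subfield_iff(2)[OF E] s nf by simp
qed

text \<open>Conjugating the automorphisms of \<open>L\<close> by \<open>\<sigma>\<close> gives
  enough automorphisms of the image to cut out the image of \<open>E\<close>.\<close>

lemma galois_image:
  assumes gal: "galois_extension L E"
  shows "galois_number_field_extension (\<sigma> ` E) (\<sigma> ` carrier L)"
proof -
  have E: "subfield E L" and fix_E: "\<And>x. x \<in> carrier L \<Longrightarrow>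
      (\<And>s. s \<in> ring_iso L L \<Longrightarrow> (\<forall>a\<in>E. s a = a) \<Longrightarrow> s x = x) \<Longrightarrow> x \<in> E"
    using gal unfolding galois_extension_def by blast+
  note S = subringE[OF subfieldE(1)[OF E]]
  interpret E: complex_number_field "\<sigma> ` E" by (rule subfield_embedded(2)[OF E])
  show ?thesis
  proof
    show "\<sigma> ` E \<subseteq> \<sigma> ` carrier L" using S(1) by blast
    fix x assume x: "x \<in> \<sigma> ` carrier L" and
      fixed: "\<And>g. hom_on (\<sigma> ` carrier L) g \<Longrightarrow> g ` \<sigma> ` carrier L = \<sigma> ` carrier L \<Longrightarrow> \<forall>a\<in>\<sigma> ` E. g a = a \<Longrightarrow> g x = x"
    obtain a where a: "a \<in> carrier L" "x = \<sigma> a" using x by blast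
    have "a \<in> E"
    proof (rule fix_E[OF a(1)])
      fix s assume s: "s \<in> ring_iso L L" "\<forall>b\<in>E. s b = b"
      note si = ring_iso_memE[OF s(1)]
      define g where "g z = \<sigma> (s (inv_into (carrier L) \<sigma> z))" for z
      have g: "g (\<sigma> b) = \<sigma> (s b)" if "b \<in> carrier L" for b
        unfolding g_def using inv_into_f_f[OF hom_simps(8) that] by simp
      have "hom_on (\<sigma> ` carrier L) g"
        unfolding hom_on_def
      proof (intro conjI ballI)
        show "g 1 = 1" using g[OF one_closed] si(4) by (simp add: hom_simps)
        fix u v assume "u \<in> \<sigma> ` carrier L" "v \<in> \<sigma> ` carrier L"
        then obtain b c where bc: "b \<in> carrier L" "u = \<sigma> b" "c \<in> carrier L" "v = \<sigma> c" by blast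
        show "g (u + v) = g u + g v" using g[OF a_closed[OF bc(1,3)]] bc g si(1,3) by (simp add: hom_simps)
        show "g (u * v) = g u * g v" using g[OF m_closed[OF bc(1,3)]] bc g si(1,2) by (simp add: hom_simps)
      qed
      moreover have "g ` \<sigma> ` carrier L = \<sigma> ` carrier L"
      proof -
        have "g ` \<sigma> ` carrier L = \<sigma> ` s ` carrier L" using g by (simp add: image_image)
        also have "s ` carrier L = carrier L" using si(5) by (simp add: bij_betw_def)
        finally show ?thesis .
      qed
      moreover have "\<forall>b\<in>\<sigma> ` E. g b = b" using g s(2) S(1) by auto
      ultimately have "\<sigma> (s a) = \<sigma> a" using fixed[of g] g[OF a(1)] a(2) by simp
      then show "s a = a" using inj_onD[OF hom_simps(8)] si(1) a(1) by blast
    qed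
    then show "x \<in> \<sigma> ` E" using a(2) by blast
  qed
qed

lemma dimension_image:
  assumes E: "subfield E L" and dim: "dimension m E (carrier L)"
  shows "complex_ring.dimension m (\<sigma> ` E) (\<sigma> ` carrier L)"
proof -
  interpret H: ring_hom_ring L complex_ring \<sigma>
    by (rule ring_hom_ringI2[OF ring_axioms complex_ring.ring_axioms hom])
  show ?thesis by (rule H.inj_hom_dimension[OF E _ hom_simps(8) dim]) simp
qed

end

lemma (in embedded_field) ex_ramified_primes:
  assumes E: "subfield E L"
  obtains T where "finite T" "card T = ramified_count l L E"
    "\<And>p. p \<in> T \<Longrightarrow> \<exists>P\<in>prime_ideals (\<sigma> ` carrier L). P \<inter> oint (\<sigma> ` E) = p \<and>
      l dvd C.val P (number_field_extension.ext (\<sigma> ` carrier L) p)"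
proof -
  let ?M = "L\<lparr>carrier := E\<rparr>"
  interpret M: embedded_field ?M \<sigma> by (rule subfield_embedded(1)[OF E])
  have EL: "E \<subseteq> carrier L" using subringE(1)[OF subfieldE(1)[OF E]] .
  interpret X: number_field_extension "\<sigma> ` E" "\<sigma> ` carrier L"
    using M.C.complex_number_field_axioms C.complex_number_field_axioms EL
    by (simp add: number_field_extension_def number_field_extension_axioms_def image_mono)
  have ints: "\<sigma> ` M.\<O> = oint (\<sigma> ` E)" "M.\<O> \<subseteq> E" using M.image_integers M.integers_subset by simp_all
  define S where "S = {p \<in> nonzero_primes (ring_of_integers ?M).
       \<exists>P \<in> nonzero_primes (ring_of_integers L). P \<inter> M.\<O> = p \<and> l dvd ramification_index L p P}"
  have S_card: "ramified_count l L E = card S" unfolding ramified_count_def S_def ..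
  have S_sub: "p \<subseteq> carrier L" if "p \<in> S" for p
    using that M.nonzero_primes_subset[of p] EL unfolding S_def by auto
  have inj: "inj_on ((`) \<sigma>) S" using image_eq_iff S_sub by (intro inj_onI) blast
  have ram: "\<exists>P\<in>prime_ideals (\<sigma> ` carrier L). P \<inter> oint (\<sigma> ` E) = \<sigma> ` p \<and> l dvd C.val P (X.ext (\<sigma> ` p))"
    if p: "p \<in> S" for p
  proof -
    obtain P where P: "p \<in> nonzero_primes (ring_of_integers ?M)" "P \<in> nonzero_primes (ring_of_integers L)"
      "P \<inter> M.\<O> = p" "l dvd ramification_index L p P" using p unfolding S_def by blast
    have PL: "P \<subseteq> carrier L" using nonzero_primes_subset[OF P(2)] .
    have "p \<subseteq> M.\<O>" and prime: "\<sigma> ` p \<in> prime_ideals (\<sigma> ` E)" using P(1) M.nonzero_prime_iff by auto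
    have pr: "\<sigma> ` p \<in> fideals (\<sigma> ` E)" "\<sigma> ` p \<subseteq> oint (\<sigma> ` E)" using prime by (auto simp: prime_ideals_def)
    have "\<sigma> ` p \<subseteq> oint (\<sigma> ` carrier L)" using pr(2) X.oint_sub by blast
    then have "\<sigma> ` p \<subseteq> \<sigma> ` \<O>" by (simp add: image_integers)
    have p_int: "p \<subseteq> \<O>"
    proof
      fix x assume x: "x \<in> p"
      then have "x \<in> carrier L" using S_sub[OF p] by blast
      moreover have "\<sigma> x \<in> \<sigma> ` \<O>" using \<open>\<sigma> ` p \<subseteq> \<sigma> ` \<O>\<close> x by blast
      ultimately show "x \<in> \<O>" using image_mem_iff[OF integers_subset] by blast
    qed
    have fid: "imul (\<sigma> ` p) (oint (\<sigma> ` carrier L)) \<in> fideals (\<sigma> ` carrier L)"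
      using X.ext_integral_fideal[OF pr] unfolding X.ext_def .
    have "ramification_index L p P = C.val (\<sigma> ` P) (X.ext (\<sigma> ` p))"
      unfolding X.ext_def by (rule ramification_index_eq[OF p_int fid PL])
    moreover have "\<sigma> ` P \<inter> oint (\<sigma> ` E) = \<sigma> ` p"
      unfolding ints(1)[symmetric] P(3)[symmetric]
      using inj_on_image_Int[OF hom_simps(8) PL] ints(2) EL by blast
    moreover have "\<sigma> ` P \<in> prime_ideals (\<sigma> ` carrier L)" using P(2) nonzero_prime_iff by blast
    ultimately show ?thesis using P(4) by auto
  qed
  show thesis
  proof (cases "finite S")
    case True
    show thesis
    proof (rule that[of "(`) \<sigma> ` S"])
      show "card ((`) \<sigma> ` S) = ramified_count l L E" using card_image[OF inj] S_card by simp
    qed (use True ram in auto)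
  next
    \<comment> \<open>\<open>card\<close> of an infinite set is 0, so the count is 0 here and the
      empty set has the right size.\<close>
    case False
    show thesis by (rule that[of "{}"]) (use False S_card in auto)
  qed
qed

theorem corollary1p5:
  fixes l n :: nat
    and K :: "('a, 'b) ring_scheme"
    and F :: "nat \<Rightarrow> 'a set"
  assumes "prime l"
    and "n \<ge> 1"
    and "number_field K"
    and "F n = carrier K"
    and "\<And>i. i \<le> n \<Longrightarrow> subfield (F i) K"
    and "\<And>i. i < n \<Longrightarrow> F i \<subseteq> F (Suc i)"
    and "\<And>i. i < n \<Longrightarrow> galois_extension (K \<lparr> carrier := F (Suc i) \<rparr>) (F i)"
  shows "real (group_rank l (class_group K)) \<ge>
           real (ramified_count l K (F 0)) / real n
           - real (group_rank l (units_of (ring_of_integers K)))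
           + real (group_rank l (units_of (ring_of_integers (K \<lparr> carrier := F 0 \<rparr>))))
           - real (degree_exponent l K (F 0))"
proof -
  interpret K: number_field K by fact
  obtain \<sigma> where "\<sigma> \<in> Ring.ring_hom K complex_ring" "complex_number_field (\<sigma> ` carrier K)"
    using K.ex_complex_embedding by blast
  then interpret K: embedded_field K \<sigma>
    by (simp add: embedded_field_def embedded_field_axioms_def K.field_axioms)
  have F0: "subfield (F 0) K" using assms(5) by simp
  interpret F0: embedded_field "K\<lparr>carrier := F 0\<rparr>" \<sigma> by (rule K.subfield_embedded(1)[OF F0])
  interpret tower: galois_tower n "\<lambda>i. \<sigma> ` F i"
  proof (rule galois_tower.intro)
    show "complex_number_field (\<sigma> ` F i)" if "i \<le> n" for i
      by (rule K.subfield_embedded(2)[OF assms(5)[OF that]])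
    show "galois_number_field_extension (\<sigma> ` F i) (\<sigma> ` F (Suc i))" if i: "i < n" for i
    proof -
      interpret M: embedded_field "K\<lparr>carrier := F (Suc i)\<rparr>" \<sigma>
        by (rule K.subfield_embedded(1)[OF assms(5)]) (use i in simp)
      show ?thesis using M.galois_image[OF assms(7)[OF i]] by simp
    qed
    show "n > 0" using assms(2) by simp
  qed
  obtain T where T: "finite T" "card T = ramified_count l K (F 0)"
    "\<And>p. p \<in> T \<Longrightarrow> \<exists>P\<in>prime_ideals (\<sigma> ` carrier K). P \<inter> oint (\<sigma> ` F 0) = p \<and>
      l dvd K.C.val P (number_field_extension.ext (\<sigma> ` carrier K) p)"
    using K.ex_ramified_primes[OF F0, of l] by blast
  \<comment> \<open>\<open>F 0\<close> contains the prime field, so \<open>K\<close> has a finite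
    dimension \<open>m\<close> over it and \<open>degree_exponent\<close> is the multiplicity of
    \<open>l\<close> in \<open>m\<close>.\<close>
  have "generate_field K {} \<subseteq> F 0" by (rule K.generate_field_min_subfield1[OF _ F0]) auto
  then have "K.finite_dimension (F 0) (carrier K)"
    using K.finite_dimension_mono[OF K.generate_field_is_subfield F0 _ K.finite_over_rationals] by simp
  then obtain m where m: "K.dimension m (F 0) (carrier K)" by (auto simp: K.finite_dimension_def)
  have deg: "degree_exponent l K (F 0) = multiplicity l m"
    unfolding degree_exponent_def using K.dimI[OF F0 m] by (simp add: over_def)
  have "complex_ring.dimension m (\<sigma> ` F 0) (\<sigma> ` F n)" using K.dimension_image[OF F0 m] assms(4) by simp
  then obtain k where k: "card T \<le> n * k"
    "l ^ k * card (units (\<sigma> ` F 0) // power_equiv l (units (\<sigma> ` F 0))) \<le>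
      card (K.C.class_torsion l // K.C.class_equiv) *
      card (units (\<sigma> ` carrier K) // power_equiv l (units (\<sigma> ` carrier K))) * l ^ multiplicity l m"
    using tower.tower_bound[OF assms(1) T(1), of m] T(3) assms(4) by auto
  let ?c = "group_rank l (class_group K)" and ?u = "group_rank l (units_of (ring_of_integers K))"
    and ?v = "group_rank l (units_of (ring_of_integers (K\<lparr>carrier := F 0\<rparr>)))"
  \<comment> \<open>All cardinals in the bound are powers of \<open>l\<close>. The exponents are
    compared as natural numbers, with every term on the side where it is added; subtraction appears
    only in the real numbers.\<close>
  have "l ^ (k + ?v) \<le> l ^ (?c + ?u + multiplicity l m)"
    using k(2) K.class_group_rank[OF assms(1)] K.units_rank[OF assms(1)] F0.units_rank[OF assms(1)]
    by (simp add: power_add)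
  then have "k + ?v \<le> ?c + ?u + multiplicity l m"
    using prime_gt_1_nat[OF assms(1)] by (rule power_le_imp_le_exp[rotated])
  moreover have "real (ramified_count l K (F 0)) / real n \<le> real k"
  proof -
    have "real (card T) \<le> real n * real k" using k(1) by (metis of_nat_le_iff of_nat_mult)
    then show ?thesis using assms(2) T(2) by (simp add: divide_le_eq mult.commute)
  qed
  ultimately show ?thesis unfolding deg by linarith
qed

end
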